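(* Let $m_0\in\mathcal{P}(\mathbb{R}^{2d})$, let $(\psi,\phi)$ be $m_0$-admissible weights with associated weight $m$, and let $R>1$ be such that the set $$U_R^{\psi,\phi,m_0}=\left\{f\in M^2_m(\mathbb{R}^d):\ \|f\|_{\psi,\phi,m_0}\le R,\ \|f\|_{M^2_{m_0}(\mathbb{R}^d)}=1\right\}$$ is nonempty. Let $$\mathfrak{F}^{\psi,\phi,m_0}[f]=\|\psi f\|^2_{L^2(\mathbb{R}^d)}+\|\phi\widehat f\|^2_{L^2(\mathbb{R}^d)},\qquad f\in M^2_m(\mathbb{R}^d).$$ Then there exists $f_0\in U_R^{\psi,\phi,m_0}$ such that $$\mathfrak{F}^{\psi,\phi,m_0}[f_0]\le\mathfrak{F}^{\psi,\phi,m_0}[f]$$ for all $f\in\Omega:=\left\{f\in M^2_m(\mathbb{R}^d):\ \|f\|_{M^2_{m_0}(\mathbb{R}^d)}=1\right\}$.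
   Context: A weight on $\mathbb{R}^n$ is a positive continuous function. A weight $m$ is $v$-moderate if $m(x+y)\le Cm(x)v(y)$ for all $x,y$ and some $C>0$. $\mathcal{P}(\mathbb{R}^n)$ is the set of weights that are $v$-moderate for some polynomial weight $v$. $L^\infty_0(\mathbb{R}^n)$ is the set of $h\in L^\infty(\mathbb{R}^n)$ with $\lim_{R\to\infty}\operatorname{ess\,sup}_{|z|\ge R}|h(z)|=0$. Given $m_0\in\mathcal{P}(\mathbb{R}^{2d})$, a pair of continuous functions $\psi,\phi\in L^\infty_{loc}(\mathbb{R}^d)$ is called ($m_0$-)admissible weights if $m(x,\omega)=\sqrt{|m_0(x,\omega)|^2+|\psi(x)|^2+|\phi(\omega)|^2}$ satisfies $m\in\mathcal{P}(\mathbb{R}^{2d})$ and $m_0/m\in L^\infty_0(\mathbb{R}^{2d})$. The Fourier transform is $\widehat f(\omega)=\int f(x)e^{-2\pi ix\cdot\omega}dx$. Fix $g\in\mathcal{S}(\mathbb{R}^d)\setminus\{0\}$ and let $V_gf(x,\omega)=\int_{\mathbb{R}^d}f(t)\overline{g(t-x)}e^{-2\pi it\cdot\omega}dt$ (extended to $\mathcal S'$ by duality). For $\mu\in\mathcal{P}(\mathbb{R}^{2d})$, $M^2_\mu(\mathbb{R}^d)$ is the space of $f\in\mathcal{S}'(\mathbb{R}^d)$ with $\|f\|_{M^2_\mu}=\left(\int_{\mathbb{R}^{2d}}|\mu(z)V_gf(z)|^2dz\right)^{1/2}<\infty$. Finally $$\|f\|^2_{\psi,\phi,m_0}=\|f\|^2_{M^2_{m_0}}+\|\psi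 f\|^2_{L^2}+\|\phi\widehat f\|^2_{L^2},$$ which is a norm on $M^2_m(\mathbb{R}^d)$ equivalent to $\|\cdot\|_{M^2_m}$. *)

theory Defs
  imports "HOL-Analysis.Analysis" "HOL-Probability.Essential_Supremum"
begin

definition weight :: "('a::euclidean_space \<Rightarrow> real) \<Rightarrow> bool" where
  "weight m \<longleftrightarrow> continuous_on UNIV m \<and> (\<forall>x. 0 < m x)"

definition moderate :: "('a::euclidean_space \<Rightarrow> real) \<Rightarrow> ('a \<Rightarrow> real) \<Rightarrow> bool" where
  "moderate v m \<longleftrightarrow> (\<exists>C>0. \<forall>x y. m (x + y) \<le> C * m x * v y)"

definition poly_weight :: "real \<Rightarrow> 'a::euclidean_space \<Rightarrow> real" where
  "poly_weight s z = (1 + (norm z)\<^sup>2) powr (s / 2)"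

definition moderate_weights :: "('a::euclidean_space \<Rightarrow> real) set" where
  "moderate_weights = {m. weight m \<and> (\<exists>s\<ge>0. moderate (poly_weight s) m)}"

definition Linf_loc :: "('a::euclidean_space \<Rightarrow> complex) set" where
  "Linf_loc = {h \<in> borel_measurable borel.
     \<forall>K. compact K \<longrightarrow> (\<exists>B. AE x in lborel. x \<in> K \<longrightarrow> cmod (h x) \<le> B)}"

definition Linf :: "('a::euclidean_space \<Rightarrow> real) set" where
  "Linf = {h \<in> borel_measurable borel. esssup lborel (\<lambda>z. ereal \<bar>h z\<bar>) < \<infinity>}"

definition Linf0 :: "('a::euclidean_space \<Rightarrow> real) set" where
  "Linf0 = {h \<in> Linf.
     ((\<lambda>R::real. esssup (restrict_space lborel {z. R \<le> norm z}) (\<lambda>z. ereal \<bar>h z\<bar>)) \<longlongrightarrow> 0) at_top}"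

definition assoc_weight ::
  "('a::euclidean_space \<times> 'a \<Rightarrow> real) \<Rightarrow> ('a \<Rightarrow> complex) \<Rightarrow> ('a \<Rightarrow> complex) \<Rightarrow> 'a \<times> 'a \<Rightarrow> real" where
  "assoc_weight m0 \<psi> \<phi> = (\<lambda>(x, \<omega>). sqrt (\<bar>m0 (x, \<omega>)\<bar>\<^sup>2 + (cmod (\<psi> x))\<^sup>2 + (cmod (\<phi> \<omega>))\<^sup>2))"

definition admissible_weights ::
  "('a::euclidean_space \<times> 'a \<Rightarrow> real) \<Rightarrow> ('a \<Rightarrow> complex) \<Rightarrow> ('a \<Rightarrow> complex) \<Rightarrow> bool" where
  "admissible_weights m0 \<psi> \<phi> \<longleftrightarrow>
     continuous_on UNIV \<psi> \<and> continuous_on UNIV \<phi> \<and> \<psi> \<in> Linf_loc \<and> \<phi> \<in> Linf_loc \<and>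
     assoc_weight m0 \<psi> \<phi> \<in> moderate_weights \<and>
     (\<lambda>z. m0 z / assoc_weight m0 \<psi> \<phi> z) \<in> Linf0"

definition partial_deriv :: "'a::euclidean_space \<Rightarrow> ('a \<Rightarrow> complex) \<Rightarrow> 'a \<Rightarrow> complex" where
  "partial_deriv b f = (\<lambda>x. frechet_derivative f (at x) b)"

primrec iter_deriv :: "'a::euclidean_space list \<Rightarrow> ('a \<Rightarrow> complex) \<Rightarrow> 'a \<Rightarrow> complex" where
  "iter_deriv [] f = f"
| "iter_deriv (b # bs) f = partial_deriv b (iter_deriv bs f)"

text \<open>
  A function is of class \<open>C\<^sup>\<infinity>\<close> iff all its iterated partial derivatives exist and are
  differentiable; lists of basis vectors play the role of multi-indices.
\<close>

definition smooth :: "('a::euclidean_space \<Rightarrow> complex) \<Rightarrow> bool" where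
  "smooth f \<longleftrightarrow> (\<forall>bs. set bs \<subseteq> Basis \<longrightarrow> iter_deriv bs f differentiable_on UNIV)"

definition schwartz :: "('a::euclidean_space \<Rightarrow> complex) set" where
  "schwartz = {f. smooth f \<and>
     (\<forall>bs N. set bs \<subseteq> Basis \<longrightarrow> bounded (range (\<lambda>x. (1 + norm x) ^ N *\<^sub>R iter_deriv bs f x)))}"

definition schwartz_seminorm :: "nat \<Rightarrow> ('a::euclidean_space \<Rightarrow> complex) \<Rightarrow> real" where
  "schwartz_seminorm N f =
     (SUP (bs, x) \<in> {bs. set bs \<subseteq> Basis \<and> length bs \<le> N} \<times> UNIV.
        (1 + norm x) ^ N * cmod (iter_deriv bs f x))"

text \<open>
  The seminorms increase with \<open>N\<close>, so continuity of a linear functional is domination by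
  one of them. Functionals are extensional, hence determined by their values on \<^const>\<open>schwartz\<close>.
  The pairing is bilinear (no complex conjugation).
\<close>

definition tempered :: "(('a::euclidean_space \<Rightarrow> complex) \<Rightarrow> complex) set" where
  "tempered = {u \<in> extensional schwartz.
     (\<forall>\<eta>\<in>schwartz. \<forall>\<theta>\<in>schwartz. u (\<lambda>x. \<eta> x + \<theta> x) = u \<eta> + u \<theta>) \<and>
     (\<forall>c. \<forall>\<eta>\<in>schwartz. u (\<lambda>x. c * \<eta> x) = c * u \<eta>) \<and>
     (\<exists>C N. \<forall>\<eta>\<in>schwartz. cmod (u \<eta>) \<le> C * schwartz_seminorm N \<eta>)}"

definition fourier :: "('a::euclidean_space \<Rightarrow> complex) \<Rightarrow> 'a \<Rightarrow> complex" where
  "fourier f \<omega> = (LINT x|lborel. f x * cis (- 2 * pi * (x \<bullet> \<omega>)))"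

definition fourier_dist ::
  "(('a::euclidean_space \<Rightarrow> complex) \<Rightarrow> complex) \<Rightarrow> ('a \<Rightarrow> complex) \<Rightarrow> complex" where
  "fourier_dist u = restrict (\<lambda>\<eta>. u (fourier \<eta>)) schwartz"

text \<open>
  Agreement is required only on test functions (smooth of compact support), so no growth
  condition is imposed on \<open>F\<close>; by density this still determines the tempered \<open>u\<close>.
\<close>

definition is_function :: "(('a::euclidean_space \<Rightarrow> complex) \<Rightarrow> complex) \<Rightarrow> ('a \<Rightarrow> complex) \<Rightarrow> bool" where
  "is_function u F \<longleftrightarrow> F \<in> borel_measurable borel \<and>
     (\<forall>K. compact K \<longrightarrow> set_integrable lborel K F) \<and>
     (\<forall>\<eta>. smooth \<eta> \<and> compact (closure {x. \<eta> x \<noteq> 0}) \<longrightarrow> u \<eta> = (LINT x|lborel. F x * \<eta> x))"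

text \<open>Norms take values in \<^typ>\<open>ennreal\<close>, so that they are \<open>\<infinity>\<close> outside the respective space.\<close>

definition ennreal_sqrt :: "ennreal \<Rightarrow> ennreal" where
  "ennreal_sqrt a = (if a = \<infinity> then \<infinity> else ennreal (sqrt (enn2real a)))"

definition L2_norm :: "('a::euclidean_space \<Rightarrow> complex) \<Rightarrow> ennreal" where
  "L2_norm h = ennreal_sqrt (\<integral>\<^sup>+ x. ennreal ((cmod (h x))\<^sup>2) \<partial>lborel)"

text \<open>
  The product of a continuous function with a distribution, as a function: pointwise if the
  distribution is a function; moreover, the zero function times any distribution is zero.
  The second clause is needed: if \<open>\<psi> = 0\<close>, then \<open>M\<^sup>2\<^sub>m\<close> may contain distributions that are
  not functions. If \<open>\<psi>\<close> does not vanish identically, moderateness of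
  \<open>m(x,\<omega>) \<ge> |\<psi>(x)|\<close> forces every element of \<open>M\<^sup>2\<^sub>m\<close> to be a locally square-integrable function.
\<close>

definition is_product ::
  "('a::euclidean_space \<Rightarrow> complex) \<Rightarrow> (('a \<Rightarrow> complex) \<Rightarrow> complex) \<Rightarrow> ('a \<Rightarrow> complex) \<Rightarrow> bool" where
  "is_product \<psi> u h \<longleftrightarrow>
     (\<exists>F. is_function u F \<and> h = (\<lambda>x. \<psi> x * F x)) \<or> (\<psi> = (\<lambda>_. 0) \<and> h = (\<lambda>_. 0))"

text \<open>
  The product is unique almost everywhere, so the infimum merely selects the norm of the
  product, or \<open>\<infinity>\<close> if there is none.
\<close>

definition L2_norm_product ::
  "('a::euclidean_space \<Rightarrow> complex) \<Rightarrow> (('a \<Rightarrow> complex) \<Rightarrow> complex) \<Rightarrow> ennreal" where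
  "L2_norm_product \<psi> u = (INF h \<in> {h. is_product \<psi> u h}. L2_norm h)"

text \<open>
  For \<open>f\<close> a function, applying it to \<open>t \<mapsto> cnj (g (t - x)) e\<^sup>-\<^sup>2\<^sup>\<pi>\<^sup>i\<^sup>t\<^sup>\<omega>\<close> gives back the integral
  defining the short-time Fourier transform.
\<close>

definition stft ::
  "('a::euclidean_space \<Rightarrow> complex) \<Rightarrow> (('a \<Rightarrow> complex) \<Rightarrow> complex) \<Rightarrow> 'a \<times> 'a \<Rightarrow> complex" where
  "stft g f = (\<lambda>(x, \<omega>). f (\<lambda>t. cnj (g (t - x)) * cis (- 2 * pi * (t \<bullet> \<omega>))))"

definition M2_norm ::
  "('a::euclidean_space \<Rightarrow> complex) \<Rightarrow> ('a \<times> 'a \<Rightarrow> real) \<Rightarrow> (('a \<Rightarrow> complex) \<Rightarrow> complex) \<Rightarrow> ennreal" where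
  "M2_norm g \<mu> f = L2_norm (\<lambda>z. complex_of_real (\<mu> z) * stft g f z)"

definition M2 ::
  "('a::euclidean_space \<Rightarrow> complex) \<Rightarrow> ('a \<times> 'a \<Rightarrow> real) \<Rightarrow> (('a \<Rightarrow> complex) \<Rightarrow> complex) set" where
  "M2 g \<mu> = {f \<in> tempered. M2_norm g \<mu> f < \<infinity>}"

definition energy ::
  "('a::euclidean_space \<Rightarrow> complex) \<Rightarrow> ('a \<Rightarrow> complex) \<Rightarrow> (('a \<Rightarrow> complex) \<Rightarrow> complex) \<Rightarrow> ennreal" where
  "energy \<psi> \<phi> f = (L2_norm_product \<psi> f)\<^sup>2 + (L2_norm_product \<phi> (fourier_dist f))\<^sup>2"

definition weighted_norm ::
  "('a::euclidean_space \<Rightarrow> complex) \<Rightarrow> ('a \<Rightarrow> complex) \<Rightarrow> ('a \<Rightarrow> complex) \<Rightarrow> ('a \<times> 'a \<Rightarrow> real) \<Rightarrow>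
     (('a \<Rightarrow> complex) \<Rightarrow> complex) \<Rightarrow> ennreal" where
  "weighted_norm g \<psi> \<phi> m0 f = ennreal_sqrt ((M2_norm g m0 f)\<^sup>2 +
     (L2_norm_product \<psi> f)\<^sup>2 + (L2_norm_product \<phi> (fourier_dist f))\<^sup>2)"

definition unit_sphere ::
  "('a::euclidean_space \<Rightarrow> complex) \<Rightarrow> ('a \<Rightarrow> complex) \<Rightarrow> ('a \<Rightarrow> complex) \<Rightarrow> ('a \<times> 'a \<Rightarrow> real) \<Rightarrow>
     (('a \<Rightarrow> complex) \<Rightarrow> complex) set" where
  "unit_sphere g \<psi> \<phi> m0 = {f \<in> M2 g (assoc_weight m0 \<psi> \<phi>). M2_norm g m0 f = 1}"

definition bounded_sphere ::
  "('a::euclidean_space \<Rightarrow> complex) \<Rightarrow> real \<Rightarrow> ('a \<Rightarrow> complex) \<Rightarrow> ('a \<Rightarrow> complex) \<Rightarrow>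
     ('a \<times> 'a \<Rightarrow> real) \<Rightarrow> (('a \<Rightarrow> complex) \<Rightarrow> complex) set" where
  "bounded_sphere g R \<psi> \<phi> m0 = {f \<in> M2 g (assoc_weight m0 \<psi> \<phi>).
     weighted_norm g \<psi> \<phi> m0 f \<le> ennreal R \<and> M2_norm g m0 f = 1}"

end

theory Submission
  imports Defs "HOL-Probability.Probability" "HOL-Complex_Analysis.Great_Picard"
begin

text \<open>
  The energy is minimised on the sphere by the direct method. Three facts make it work.

  \<^item> The norm estimate: \<open>\<parallel>f\<parallel>\<^sup>2\<close> in \<open>M\<^sup>2\<^sub>m\<close> is at most a constant times the square of \<open>\<parallel>f\<parallel>\<^sub>\<psi>\<^sub>,\<^sub>\<phi>\<^sub>,\<^sub>m\<^sub>0\<close>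
    (\<open>norm_estimate\<close>, \<open>state_norm_estimate\<close>). Hence a minimising sequence is bounded in \<open>M\<^sup>2\<^sub>m\<close>.
  \<^item> Compactness: a bounded sequence in \<open>M\<^sup>2\<^sub>m\<close> has a subsequence whose short-time Fourier transforms
    converge pointwise (\<open>state_pointwise_compact\<close>) and then also in \<open>L\<^sup>2\<close> with weight \<open>m\<^sub>0\<close>, since \<open>m\<^sub>0\<close> is
    small relative to \<open>m\<close> at infinity (\<open>strong_convergence\<close>). So the constraint survives the limit.
  \<^item> The energy is a quadratic form. By the parallelogram law, near minimisers that are close in
    \<open>M\<^sup>2\<close> with weight \<open>m\<^sub>0\<close> differ by an element of small energy (\<open>near_minimisers_close\<close>). With the
    norm estimate, the minimising sequence is a Cauchy sequence in \<open>M\<^sup>2\<^sub>m\<close>, which is complete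
    (\<open>states_complete\<close>), and Fatou's lemma bounds the energy of its limit.

  The norm estimate rests on the Plancherel identity for a fixed position of the window: the integral
  of \<open>|V\<^sub>g f(x,\<omega>)|\<^sup>2\<close> over \<open>\<omega>\<close> is the integral of \<open>|f(t) g(t - x)|\<^sup>2\<close>, so that weighting by \<open>\<psi>(x)\<^sup>2\<close> compares
  \<open>\<psi>\<close> with its average over the window. If \<open>\<psi>\<close> is itself moderate, that comparison is immediate.
  Otherwise \<open>\<psi>\<close> still satisfies \<open>\<psi>(x)\<^sup>2 \<le> K (\<psi>(t)\<^sup>2 + 1) (1 + |x - t|)\<^sup>k\<close>, and \<open>\<phi>\<close> is bounded below, or
  both weights are bounded below at infinity; in these cases the \<open>L\<^sup>2\<close> norm is controlled as well
  (\<open>\<psi>_trichotomy\<close>).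

  Distributions enter through two facts. Each Schwartz function is a superposition of time-frequency
  shifts of the conjugated window (\<open>coefficient_synthesis\<close>), so that the transform determines the
  distribution, with a bound by its norm (\<open>stft_bound\<close>). And if the weight does not decay in frequency, that bound
  involves only a weighted \<open>L\<^sup>2\<close> norm of the test function, so by duality the function that represents
  the distribution lies in a weighted \<open>L\<^sup>2\<close> space (\<open>function_weighted_L2\<close>). The frequency side follows
  from the position side because the Fourier transform rotates the time-frequency plane
  (\<open>stft_fourier_dist\<close>).

  The calculus of Schwartz functions that this uses, up to Fourier inversion, the Plancherel identity
  and density of test functions, comes first.
\<close>

section \<open>Smooth functions\<close>

lemma differentiable_onD: "f differentiable_on UNIV \<Longrightarrow> f differentiable (at x)"
  by (simp add: differentiable_on_def)

lemma differentiable_onI: "(\<And>x. f differentiable (at x)) \<Longrightarrow> f differentiable_on UNIV"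
  by (simp add: differentiable_on_def)

lemma partial_deriv_eqI:
  assumes "\<And>x. (f has_derivative f' x) (at x)"
  shows "partial_deriv b f = (\<lambda>x. f' x b)"
  using frechet_derivative_at[OF assms] by (auto simp: partial_deriv_def fun_eq_iff)

lemma has_derivative_partial:
  fixes f :: "'a::euclidean_space \<Rightarrow> complex"
  assumes "f differentiable_on UNIV"
  shows "(f has_derivative frechet_derivative f (at x)) (at x)"
  using assms by (simp add: differentiable_onD frechet_derivative_works[symmetric])

lemma iter_deriv_append: "iter_deriv (bs @ cs) f = iter_deriv bs (iter_deriv cs f)"
  by (induction bs) auto

lemma smooth_differentiable: "smooth f \<Longrightarrow> f differentiable_on UNIV"
  unfolding smooth_def by (metis iter_deriv.simps(1) empty_subsetI list.set(1))

lemma smooth_iter_deriv: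
  assumes "smooth f" "set bs \<subseteq> Basis" shows "smooth (iter_deriv bs f)"
  unfolding smooth_def
proof (intro allI impI)
  fix cs :: "'a list" assume "set cs \<subseteq> Basis"
  then have "iter_deriv (cs @ bs) f differentiable_on UNIV"
    using assms by (auto simp: smooth_def)
  then show "iter_deriv cs (iter_deriv bs f) differentiable_on UNIV"
    by (simp add: iter_deriv_append)
qed

lemma smooth_partial: "smooth f \<Longrightarrow> b \<in> Basis \<Longrightarrow> smooth (partial_deriv b f)"
  using smooth_iter_deriv[of f "[b]"] by simp

lemma smooth_continuous_on: "smooth f \<Longrightarrow> continuous_on S f"
  using smooth_differentiable differentiable_imp_continuous_on continuous_on_subset by blast

lemma smooth_borel [measurable_dest]: "smooth f \<Longrightarrow> f \<in> borel_measurable borel"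
  using smooth_continuous_on borel_measurable_continuous_onI by blast

text \<open>Smoothness is the greatest property that implies differentiability and passes to partial derivatives.\<close>

lemma smooth_coinduct:
  assumes "f \<in> X"
    and diff: "\<And>h. h \<in> X \<Longrightarrow> h differentiable_on UNIV"
    and part: "\<And>h b. h \<in> X \<Longrightarrow> b \<in> Basis \<Longrightarrow> partial_deriv b h \<in> X"
  shows "smooth f"
proof -
  have "iter_deriv bs f \<in> X" if "set bs \<subseteq> Basis" for bs
    using that by (induction bs) (auto simp: assms)
  then show ?thesis by (auto simp: smooth_def diff)
qed

lemma partial_deriv_add:
  assumes "f differentiable_on UNIV" "g differentiable_on UNIV"
  shows "partial_deriv b (\<lambda>x. f x + g x) = (\<lambda>x. partial_deriv b f x + partial_deriv b g x)"
  using partial_deriv_eqI[OF has_derivative_add[OF has_derivative_partial has_derivative_partial], OF assms]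
  by (simp add: partial_deriv_def)

lemma partial_deriv_mult:
  assumes "f differentiable_on UNIV" "g differentiable_on UNIV"
  shows "partial_deriv b (\<lambda>x. f x * g x) = (\<lambda>x. partial_deriv b f x * g x + f x * partial_deriv b g x)"
  using partial_deriv_eqI[OF has_derivative_mult[OF has_derivative_partial has_derivative_partial], OF assms]
  by (simp add: partial_deriv_def add.commute)

lemma partial_deriv_const: "partial_deriv b (\<lambda>x. c) = (\<lambda>x. 0)"
  using partial_deriv_eqI[of "\<lambda>x. c" "\<lambda>x y. 0" b] by simp

lemma partial_deriv_cmult:
  assumes "f differentiable_on UNIV"
  shows "partial_deriv b (\<lambda>x. c * f x) = (\<lambda>x. c * partial_deriv b f x)"
  using partial_deriv_mult[of "\<lambda>x. c" f] assms by (simp add: partial_deriv_const)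

lemma partial_deriv_cnj:
  assumes "f differentiable_on UNIV"
  shows "partial_deriv b (\<lambda>x. cnj (f x)) = (\<lambda>x. cnj (partial_deriv b f x))"
  using partial_deriv_eqI[OF has_derivative_cnj[OF has_derivative_partial], OF assms]
  by (simp add: partial_deriv_def)

lemma partial_deriv_affine:
  fixes f :: "'a::euclidean_space \<Rightarrow> complex"
  assumes "f differentiable_on UNIV"
  shows "partial_deriv b (\<lambda>x. f (r *\<^sub>R x + a)) = (\<lambda>x. of_real r * partial_deriv b f (r *\<^sub>R x + a))"
proof -
  have "((\<lambda>x. f (r *\<^sub>R x + a)) has_derivative (\<lambda>h. frechet_derivative f (at (r *\<^sub>R x + a)) (r *\<^sub>R h))) (at x)" for x
    by (rule has_derivative_compose[OF _ has_derivative_partial[OF assms], of "\<lambda>x. r *\<^sub>R x + a" "\<lambda>h. r *\<^sub>R h"])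
      (auto intro!: derivative_eq_intros)
  moreover have "frechet_derivative f (at y) (r *\<^sub>R b) = r *\<^sub>R frechet_derivative f (at y) b" for y
    using has_derivative_partial[OF assms, of y] linear_cmul bounded_linear.linear has_derivative_bounded_linear by blast
  ultimately show ?thesis
    using partial_deriv_eqI[of "\<lambda>x. f (r *\<^sub>R x + a)"
        "\<lambda>x h. frechet_derivative f (at (r *\<^sub>R x + a)) (r *\<^sub>R h)" b]
    by (auto simp: partial_deriv_def scaleR_conv_of_real)
qed

lemma differentiable_on_affine:
  fixes f :: "'a::euclidean_space \<Rightarrow> complex"
  assumes "f differentiable_on UNIV"
  shows "(\<lambda>x. f (r *\<^sub>R x + a)) differentiable_on UNIV"
proof (rule differentiable_onI)
  fix x
  show "(\<lambda>x. f (r *\<^sub>R x + a)) differentiable (at x)"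
    by (rule differentiable_compose[of f "\<lambda>x. r *\<^sub>R x + a"])
      (auto intro!: derivative_intros differentiable_onD[OF assms])
qed

text \<open>
  The algebra generated by a set \<open>B\<close> of functions. By the product rule it is closed under partial
  derivatives as soon as the partial derivatives of its generators lie in it.
\<close>

inductive_set generated_algebra :: "('a::euclidean_space \<Rightarrow> complex) set \<Rightarrow> ('a \<Rightarrow> complex) set"
  for B where
  base: "f \<in> B \<Longrightarrow> f \<in> generated_algebra B"
| add: "f \<in> generated_algebra B \<Longrightarrow> h \<in> generated_algebra B \<Longrightarrow> (\<lambda>x. f x + h x) \<in> generated_algebra B"
| mult: "f \<in> generated_algebra B \<Longrightarrow> h \<in> generated_algebra B \<Longrightarrow> (\<lambda>x. f x * h x) \<in> generated_algebra B"

lemma smooth_generated_algebra: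
  assumes diff: "\<And>h. h \<in> B \<Longrightarrow> h differentiable_on UNIV"
    and part: "\<And>h b. h \<in> B \<Longrightarrow> b \<in> Basis \<Longrightarrow> partial_deriv b h \<in> generated_algebra B"
    and f: "f \<in> generated_algebra B"
  shows "smooth f"
proof -
  have d: "h differentiable_on UNIV" if "h \<in> generated_algebra B" for h
    using that by induction (auto intro: diff differentiable_on_add differentiable_on_mult)
  have "partial_deriv b h \<in> generated_algebra B" if "h \<in> generated_algebra B" "b \<in> Basis" for h b
    using that
  proof induction
    case (add f h)
    then show ?case by (simp add: partial_deriv_add d generated_algebra.add)
  next
    case (mult f h)
    then show ?case
      by (simp add: partial_deriv_mult d generated_algebra.add generated_algebra.mult)
  qed (auto intro: part)
  with d f show ?thesis by (intro smooth_coinduct[of f "generated_algebra B"]) auto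
qed

lemma smooth_algebra: "f \<in> generated_algebra (Collect smooth) \<Longrightarrow> smooth f"
  by (rule smooth_generated_algebra[of "Collect smooth"])
    (auto intro: smooth_differentiable smooth_partial generated_algebra.base)

lemma smooth_add: "smooth f \<Longrightarrow> smooth h \<Longrightarrow> smooth (\<lambda>x. f x + h x)"
  by (rule smooth_algebra) (auto intro: generated_algebra.intros)

lemma smooth_mult: "smooth f \<Longrightarrow> smooth h \<Longrightarrow> smooth (\<lambda>x. f x * h x)"
  by (rule smooth_algebra) (auto intro: generated_algebra.intros)

lemma smooth_const: "smooth (\<lambda>x. c)"
  by (rule smooth_coinduct[of _ "range (\<lambda>c x. c)"]) (auto simp: partial_deriv_const)

lemma smooth_cmult: "smooth f \<Longrightarrow> smooth (\<lambda>x. c * f x)"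
  using smooth_mult[OF smooth_const] .

lemma smooth_cnj: "smooth f \<Longrightarrow> smooth (\<lambda>x. cnj (f x))"
  by (rule smooth_coinduct[of _ "(\<lambda>f x. cnj (f x)) ` Collect smooth"])
    (auto simp: partial_deriv_cnj smooth_differentiable smooth_partial intro!: differentiable_onI
      differentiableI[OF has_derivative_cnj[OF has_derivative_partial[OF smooth_differentiable]]])

lemma smooth_affine: "smooth f \<Longrightarrow> smooth (\<lambda>x. f (r *\<^sub>R x + a))"
proof (rule smooth_coinduct[of _ "{\<lambda>x. c * f (r *\<^sub>R x + a) |f c. smooth f}"])
  assume "smooth f"
  then show "(\<lambda>x. f (r *\<^sub>R x + a)) \<in> {\<lambda>x. c * f (r *\<^sub>R x + a) |f c. smooth f}"
    by (auto intro!: exI[of _ f] exI[of _ 1])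
next
  fix h assume "h \<in> {\<lambda>x. c * f (r *\<^sub>R x + a) |f c. smooth f}"
  then obtain f c where h: "h = (\<lambda>x. c * f (r *\<^sub>R x + a))" and f: "smooth f" by auto
  note d = differentiable_on_affine[OF smooth_differentiable[OF f], of r a]
  then show "h differentiable_on UNIV" unfolding h by (auto intro: differentiable_on_mult)
  fix b :: 'a assume b: "b \<in> Basis"
  have "partial_deriv b h = (\<lambda>x. (c * of_real r) * partial_deriv b f (r *\<^sub>R x + a))"
    unfolding h using d smooth_differentiable[OF f] by (simp add: partial_deriv_cmult partial_deriv_affine mult.assoc)
  then show "partial_deriv b h \<in> {\<lambda>x. c * f (r *\<^sub>R x + a) |f c. smooth f}"
    using smooth_partial[OF f b] by auto
qed

lemma partial_deriv_linear:
  "partial_deriv b (\<lambda>x. complex_of_real (x \<bullet> a) + c) = (\<lambda>x. of_real (b \<bullet> a))"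
  by (rule partial_deriv_eqI) (auto intro!: derivative_eq_intros)

lemma smooth_linear: "smooth (\<lambda>x. complex_of_real (x \<bullet> a))"
proof (rule smooth_coinduct[of _ "{\<lambda>x. complex_of_real (x \<bullet> a) + c |a c. True}"])
  show "(\<lambda>x. complex_of_real (x \<bullet> a)) \<in> {\<lambda>x. complex_of_real (x \<bullet> a) + c |a c. True}"
    by (rule CollectI, rule exI[of _ a], rule exI[of _ 0]) simp
next
  fix h :: "'a \<Rightarrow> complex" assume "h \<in> {\<lambda>x. complex_of_real (x \<bullet> a) + c |a c. True}"
  then obtain a c where h: "h = (\<lambda>x. complex_of_real (x \<bullet> a) + c)" by auto
  show "h differentiable_on UNIV"
    unfolding h by (intro differentiable_onI differentiableI[where f'="\<lambda>h. of_real (h \<bullet> a)" for a])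
      (auto intro!: derivative_eq_intros)
  fix b :: 'a assume b: "b \<in> Basis"
  show "partial_deriv b h \<in> {\<lambda>x. complex_of_real (x \<bullet> a) + c |a c. True}"
    unfolding h partial_deriv_linear by (rule CollectI, rule exI[of _ 0], rule exI[of _ "of_real (b \<bullet> a)"]) simp
qed

text \<open>The character that occurs in the Fourier transform; a modulation multiplies by it.\<close>

definition modulation :: "'a::euclidean_space \<Rightarrow> 'a \<Rightarrow> complex" where
  "modulation \<omega> t = cis (- 2 * pi * (t \<bullet> \<omega>))"

lemma cmod_modulation [simp]: "cmod (modulation \<omega> t) = 1"
  by (simp add: modulation_def)

lemma cis_eq_exp: "cis x = exp (\<i> * of_real x)"
  by (simp add: cis_conv_exp)

lemma has_derivative_modulation:
  "(modulation \<omega> has_derivative (\<lambda>h. (- 2 * pi * \<i> * of_real (h \<bullet> \<omega>)) * modulation \<omega> t)) (at t)"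
proof -
  have "((\<lambda>t. \<i> * of_real (- 2 * pi * (t \<bullet> \<omega>))) has_derivative (\<lambda>h. \<i> * of_real (- 2 * pi * (h \<bullet> \<omega>)))) (at t)"
    by (intro derivative_intros)
  from has_derivative_compose[OF this has_field_derivative_imp_has_derivative[OF DERIV_exp]]
  have "((\<lambda>t. exp (\<i> * of_real (- 2 * pi * (t \<bullet> \<omega>)))) has_derivative
      (\<lambda>h. \<i> * of_real (- 2 * pi * (h \<bullet> \<omega>)) * exp (\<i> * of_real (- 2 * pi * (t \<bullet> \<omega>))))) (at t)"
    by (simp only: mult.commute mult.left_commute)
  then show ?thesis unfolding modulation_def cis_eq_exp by (simp add: mult_ac)
qed

lemma partial_deriv_modulation:
  "partial_deriv b (modulation \<omega>) = (\<lambda>t. (- 2 * pi * \<i> * of_real (b \<bullet> \<omega>)) * modulation \<omega> t)"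
  by (rule partial_deriv_eqI[OF has_derivative_modulation])

lemma differentiable_modulation: "modulation \<omega> differentiable_on UNIV"
  by (intro differentiable_onI differentiableI[OF has_derivative_modulation])

lemma iter_deriv_modulation:
  "iter_deriv bs (modulation \<omega>) = (\<lambda>t. (\<Prod>b\<leftarrow>bs. - 2 * pi * \<i> * of_real (b \<bullet> \<omega>)) * modulation \<omega> t)"
proof (induction bs)
  case (Cons b bs)
  show ?case
    unfolding iter_deriv.simps Cons.IH partial_deriv_cmult[OF differentiable_modulation] partial_deriv_modulation
    by (simp add: mult_ac)
qed simp

lemma smooth_modulation: "smooth (modulation \<omega>)"
  unfolding smooth_def iter_deriv_modulation
  by (auto intro!: differentiable_on_mult differentiable_modulation)

lemma iter_deriv_modulation_bound:
  assumes "set bs \<subseteq> Basis" "length bs \<le> N"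
  shows "cmod (iter_deriv bs (modulation \<omega>) t) \<le> (1 + 2 * pi * norm \<omega>) ^ N"
proof -
  have "cmod (\<Prod>b\<leftarrow>bs. - 2 * pi * \<i> * of_real (b \<bullet> \<omega>)) \<le> (1 + 2 * pi * norm \<omega>) ^ length bs"
    using assms(1)
  proof (induction bs)
    case (Cons b bs)
    have "\<bar>b \<bullet> \<omega>\<bar> \<le> norm \<omega>" using Cons.prems Cauchy_Schwarz_ineq2[of b \<omega>] by simp
    then have "2 * pi * \<bar>b \<bullet> \<omega>\<bar> \<le> 2 * pi * norm \<omega>" by (intro mult_left_mono) auto
    moreover have "cmod (- 2 * pi * \<i> * of_real (b \<bullet> \<omega>)) = 2 * pi * \<bar>b \<bullet> \<omega>\<bar>"
      by (simp add: norm_mult)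
    ultimately have "cmod (- 2 * pi * \<i> * of_real (b \<bullet> \<omega>)) \<le> 1 + 2 * pi * norm \<omega>"
      by linarith
    moreover have "cmod (\<Prod>b\<leftarrow>bs. - 2 * pi * \<i> * of_real (b \<bullet> \<omega>)) \<le> (1 + 2 * pi * norm \<omega>) ^ length bs"
      using Cons by auto
    ultimately show ?case
      using mult_mono[of "cmod (- 2 * pi * \<i> * of_real (b \<bullet> \<omega>))" _ "cmod (\<Prod>b\<leftarrow>bs. - 2 * pi * \<i> * of_real (b \<bullet> \<omega>))"]
      by (simp add: norm_mult)
  qed simp
  also have "\<dots> \<le> (1 + 2 * pi * norm \<omega>) ^ N"
    using assms by (intro power_increasing) auto
  finally show ?thesis unfolding iter_deriv_modulation by (simp add: norm_mult)
qed

lemma iter_deriv_add: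
  assumes "smooth f" "smooth h" "set bs \<subseteq> Basis"
  shows "iter_deriv bs (\<lambda>x. f x + h x) = (\<lambda>x. iter_deriv bs f x + iter_deriv bs h x)"
  using assms(3)
  by (induction bs) (simp_all add: partial_deriv_add smooth_differentiable smooth_iter_deriv assms)

lemma iter_deriv_cmult:
  assumes "smooth f" "set bs \<subseteq> Basis"
  shows "iter_deriv bs (\<lambda>x. c * f x) = (\<lambda>x. c * iter_deriv bs f x)"
  using assms(2)
  by (induction bs) (simp_all add: partial_deriv_cmult smooth_differentiable smooth_iter_deriv assms)

lemma iter_deriv_cnj:
  assumes "smooth f" "set bs \<subseteq> Basis"
  shows "iter_deriv bs (\<lambda>x. cnj (f x)) = (\<lambda>x. cnj (iter_deriv bs f x))"
  using assms(2)
  by (induction bs) (simp_all add: partial_deriv_cnj smooth_differentiable smooth_iter_deriv assms)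

lemma iter_deriv_affine:
  assumes "smooth f" "set bs \<subseteq> Basis"
  shows "iter_deriv bs (\<lambda>x. f (r *\<^sub>R x + a)) = (\<lambda>x. of_real r ^ length bs * iter_deriv bs f (r *\<^sub>R x + a))"
  using assms(2)
proof (induction bs)
  case (Cons b bs)
  then show ?case
    using differentiable_on_affine[OF smooth_differentiable[OF smooth_iter_deriv[OF assms(1)]], of bs r a]
      smooth_differentiable[OF smooth_iter_deriv[OF assms(1)], of bs]
    by (simp add: partial_deriv_cmult partial_deriv_affine mult_ac)
qed simp

lemma iter_deriv_const: "bs \<noteq> [] \<Longrightarrow> iter_deriv bs (\<lambda>x. c) = (\<lambda>x. 0)"
proof (induction bs)
  case (Cons b bs) then show ?case by (cases "bs = []") (auto simp: partial_deriv_const)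
qed simp

text \<open>A crude form of the Leibniz rule: every differentiation doubles the number of products.\<close>

lemma iter_deriv_mult_bound:
  assumes "smooth f" "smooth h" "set bs \<subseteq> Basis" "0 \<le> A" "0 \<le> B"
    and "\<And>cs. set cs \<subseteq> Basis \<Longrightarrow> length cs \<le> length bs \<Longrightarrow> cmod (iter_deriv cs f t) \<le> A"
    and "\<And>cs. set cs \<subseteq> Basis \<Longrightarrow> length cs \<le> length bs \<Longrightarrow> cmod (iter_deriv cs h t) \<le> B"
  shows "cmod (iter_deriv bs (\<lambda>x. f x * h x) t) \<le> 2 ^ length bs * A * B"
  using assms
proof (induction bs arbitrary: f h rule: rev_induct)
  case Nil
  then show ?case using Nil.prems(6,7)[of "[]"] by (simp add: norm_mult mult_mono)
next
  case (snoc b bs)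
  have b: "b \<in> Basis" and bs: "set bs \<subseteq> Basis" using snoc.prems by auto
  have s: "smooth (partial_deriv b f)" "smooth (partial_deriv b h)"
    using snoc.prems b by (auto intro: smooth_partial)
  have p: "cmod (iter_deriv cs (partial_deriv b f) t) \<le> A" "cmod (iter_deriv cs (partial_deriv b h) t) \<le> B"
    if "set cs \<subseteq> Basis" "length cs \<le> length bs" for cs
    using snoc.prems(6,7)[of "cs @ [b]"] that b by (auto simp: iter_deriv_append)
  have q: "cmod (iter_deriv cs f t) \<le> A" "cmod (iter_deriv cs h t) \<le> B"
    if "set cs \<subseteq> Basis" "length cs \<le> length bs" for cs
    using snoc.prems(6,7)[of cs] that by auto
  have "iter_deriv (bs @ [b]) (\<lambda>x. f x * h x) =
      (\<lambda>t. iter_deriv bs (\<lambda>x. partial_deriv b f x * h x) t + iter_deriv bs (\<lambda>x. f x * partial_deriv b h x) t)"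
    using snoc.prems(1,2) s bs
    by (simp add: iter_deriv_append partial_deriv_mult smooth_differentiable iter_deriv_add smooth_mult)
  moreover have "cmod (iter_deriv bs (\<lambda>x. partial_deriv b f x * h x) t) \<le> 2 ^ length bs * A * B"
    by (rule snoc.IH) (use snoc.prems s bs p q in auto)
  moreover have "cmod (iter_deriv bs (\<lambda>x. f x * partial_deriv b h x) t) \<le> 2 ^ length bs * A * B"
    by (rule snoc.IH) (use snoc.prems s bs p q in auto)
  ultimately show ?case
    by (simp add: norm_triangle_le)
qed

section \<open>Schwartz functions and their seminorms\<close>

lemma schwartz_smooth: "f \<in> schwartz \<Longrightarrow> smooth f"
  by (simp add: schwartz_def)

lemma schwartzI:
  assumes "smooth f"
    and "\<And>bs N. set bs \<subseteq> Basis \<Longrightarrow> \<exists>B. \<forall>x. (1 + norm x) ^ N * cmod (iter_deriv bs f x) \<le> B"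
  shows "f \<in> schwartz"
  unfolding schwartz_def
proof (intro CollectI conjI assms(1) allI impI)
  fix bs :: "'a list" and N :: nat assume "set bs \<subseteq> Basis"
  then obtain B where "\<forall>x. (1 + norm x) ^ N * cmod (iter_deriv bs f x) \<le> B" using assms(2) by blast
  then show "bounded (range (\<lambda>x. (1 + norm x) ^ N *\<^sub>R iter_deriv bs f x))"
    by (auto simp: bounded_iff)
qed

lemma schwartzD:
  assumes "f \<in> schwartz" "set bs \<subseteq> Basis"
  shows "\<exists>B. \<forall>x. (1 + norm x) ^ N * cmod (iter_deriv bs f x) \<le> B"
proof -
  have "bounded (range (\<lambda>x. (1 + norm x) ^ N *\<^sub>R iter_deriv bs f x))"
    using assms by (simp add: schwartz_def)
  then show ?thesis by (auto simp: bounded_iff)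
qed

lemma seminorm_bdd:
  fixes f :: "'a::euclidean_space \<Rightarrow> complex"
  assumes "f \<in> schwartz"
  shows "bdd_above ((\<lambda>(bs, x). (1 + norm x) ^ N * cmod (iter_deriv bs f x)) `
    ({bs. set bs \<subseteq> Basis \<and> length bs \<le> N} \<times> UNIV))"
proof -
  have "finite {bs :: 'a list. set bs \<subseteq> Basis \<and> length bs \<le> N}"
    by (rule finite_lists_length_le) simp
  moreover have "bdd_above (range (\<lambda>x. (1 + norm x) ^ N * cmod (iter_deriv bs f x)))"
    if "bs \<in> {bs :: 'a list. set bs \<subseteq> Basis \<and> length bs \<le> N}" for bs
    using schwartzD[OF assms, of bs N] that by (auto simp: bdd_above_def)
  ultimately have "bdd_above (\<Union>bs\<in>{bs. set bs \<subseteq> Basis \<and> length bs \<le> N}.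
      range (\<lambda>x. (1 + norm x) ^ N * cmod (iter_deriv bs f x)))"
    by (subst bdd_above_UN) auto
  then show ?thesis by (rule bdd_above_mono) auto
qed

lemma seminorm_ge:
  assumes "f \<in> schwartz" "set bs \<subseteq> Basis" "length bs \<le> N"
  shows "(1 + norm x) ^ N * cmod (iter_deriv bs f x) \<le> schwartz_seminorm N f"
  unfolding schwartz_seminorm_def
  using cSUP_upper[OF _ seminorm_bdd[OF assms(1), of N], of "(bs, x)"] assms by auto

lemma seminorm_le:
  assumes "\<And>bs x. set bs \<subseteq> Basis \<Longrightarrow> length bs \<le> N \<Longrightarrow> (1 + norm x) ^ N * cmod (iter_deriv bs f x) \<le> B"
  shows "schwartz_seminorm N f \<le> B"
  unfolding schwartz_seminorm_def
  by (rule cSUP_least) (use assms in \<open>auto intro!: exI[of _ "[]"]\<close>)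

lemma seminorm_nonneg: "f \<in> schwartz \<Longrightarrow> 0 \<le> schwartz_seminorm N f"
  using seminorm_ge[of f "[]" N 0] by (simp add: order_trans[OF norm_ge_zero])

lemma seminorm_mono:
  assumes "f \<in> schwartz" "N \<le> M"
  shows "schwartz_seminorm N f \<le> schwartz_seminorm M f"
proof (rule seminorm_le)
  fix bs :: "'a list" and x assume bs: "set bs \<subseteq> Basis" "length bs \<le> N"
  have "(1 + norm x) ^ N * cmod (iter_deriv bs f x) \<le> (1 + norm x) ^ M * cmod (iter_deriv bs f x)"
    using assms by (intro mult_right_mono power_increasing) auto
  also have "\<dots> \<le> schwartz_seminorm M f" using bs assms by (intro seminorm_ge) auto
  finally show "(1 + norm x) ^ N * cmod (iter_deriv bs f x) \<le> schwartz_seminorm M f" .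
qed

lemma schwartz_decay:
  assumes "f \<in> schwartz"
  shows "cmod (f x) \<le> schwartz_seminorm N f / (1 + norm x) ^ N"
proof -
  have "0 < (1 + norm x) ^ N" by (simp add: add_pos_nonneg)
  then show ?thesis using seminorm_ge[OF assms, of "[]" N x] by (simp add: field_simps)
qed

lemma schwartz_continuous_on: "f \<in> schwartz \<Longrightarrow> continuous_on S f"
  by (simp add: schwartz_smooth smooth_continuous_on)

lemma schwartz_borel [measurable_dest]: "f \<in> schwartz \<Longrightarrow> f \<in> borel_measurable borel"
  by (simp add: schwartz_smooth smooth_borel)

lemma schwartz_add:
  assumes "f \<in> schwartz" "h \<in> schwartz" shows "(\<lambda>x. f x + h x) \<in> schwartz"
proof (rule schwartzI)
  show "smooth (\<lambda>x. f x + h x)" using assms by (simp add: schwartz_smooth smooth_add)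
  fix bs :: "'a list" and N assume bs: "set bs \<subseteq> Basis"
  obtain A B where "\<forall>x. (1 + norm x) ^ N * cmod (iter_deriv bs f x) \<le> A"
     "\<forall>x. (1 + norm x) ^ N * cmod (iter_deriv bs h x) \<le> B"
    using assms bs schwartzD by metis
  then have "(1 + norm x) ^ N * cmod (iter_deriv bs (\<lambda>x. f x + h x) x) \<le> A + B" for x
    using norm_triangle_ineq[of "iter_deriv bs f x" "iter_deriv bs h x"] assms bs
      mult_left_mono[of "cmod (iter_deriv bs f x + iter_deriv bs h x)" "cmod (iter_deriv bs f x) + cmod (iter_deriv bs h x)" "(1 + norm x) ^ N"]
    by (simp add: iter_deriv_add schwartz_smooth distrib_left) (smt (verit))
  then show "\<exists>B. \<forall>x. (1 + norm x) ^ N * cmod (iter_deriv bs (\<lambda>x. f x + h x) x) \<le> B" by blast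
qed

text \<open>
  The workhorse for products: a factor whose derivatives grow at most like \<open>(1 + |t|)\<^sup>M\<close> costs
  \<open>M\<close> orders of the seminorm. It covers modulations, coordinates, cutoffs and translated windows.
\<close>

lemma seminorm_mult_pointwise:
  assumes "f \<in> schwartz" "smooth h" "set bs \<subseteq> Basis" "length bs \<le> N"
    and B: "\<And>cs t. set cs \<subseteq> Basis \<Longrightarrow> length cs \<le> N \<Longrightarrow> cmod (iter_deriv cs h t) \<le> B * (1 + norm t) ^ M"
  shows "(1 + norm x) ^ N * cmod (iter_deriv bs (\<lambda>t. f t * h t) x) \<le> 2 ^ N * B * schwartz_seminorm (N + M) f"
proof -
  let ?P = "schwartz_seminorm (N + M) f"
  have pos: "0 < 1 + norm x" by (simp add: add_pos_nonneg)
  have "0 \<le> B * (1 + norm x) ^ M" using B[of "[]" x] by (auto intro: order_trans[OF norm_ge_zero])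
  moreover have "0 < (1 + norm x) ^ M" using pos by simp
  ultimately have B0: "0 \<le> B" by (simp add: zero_le_mult_iff)
  have P0: "0 \<le> ?P" using assms(1) by (rule seminorm_nonneg)
  have "cmod (iter_deriv bs (\<lambda>t. f t * h t) x) \<le> 2 ^ length bs * (?P / (1 + norm x) ^ (N + M)) * (B * (1 + norm x) ^ M)"
  proof (rule iter_deriv_mult_bound)
    show "smooth f" using assms by (simp add: schwartz_smooth)
    fix cs :: "'a list" assume cs: "set cs \<subseteq> Basis" "length cs \<le> length bs"
    show "cmod (iter_deriv cs f x) \<le> ?P / (1 + norm x) ^ (N + M)"
      using seminorm_ge[OF assms(1) cs(1), of "N + M" x] cs assms pos by (simp add: field_simps)
    show "cmod (iter_deriv cs h x) \<le> B * (1 + norm x) ^ M" using B cs assms by auto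
  qed (use assms B0 P0 in auto)
  also have "\<dots> \<le> 2 ^ N * (?P / (1 + norm x) ^ (N + M)) * (B * (1 + norm x) ^ M)"
    using assms B0 P0 pos by (intro mult_right_mono) (auto intro!: power_increasing)
  also have "\<dots> = 2 ^ N * B * ?P / (1 + norm x) ^ N"
    using pos by (simp add: power_add field_simps)
  finally show ?thesis using pos by (simp add: field_simps)
qed

lemma seminorm_mult:
  assumes "f \<in> schwartz" "smooth h"
    and "\<And>cs t. set cs \<subseteq> Basis \<Longrightarrow> length cs \<le> N \<Longrightarrow> cmod (iter_deriv cs h t) \<le> B * (1 + norm t) ^ M"
  shows "schwartz_seminorm N (\<lambda>t. f t * h t) \<le> 2 ^ N * B * schwartz_seminorm (N + M) f"
  by (rule seminorm_le) (use seminorm_mult_pointwise[OF assms(1,2) _ _ assms(3)] in blast)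

lemma schwartz_mult_moderate:
  fixes h :: "'a::euclidean_space \<Rightarrow> complex"
  assumes "f \<in> schwartz" "smooth h"
    and "\<And>N. \<exists>B M. \<forall>cs t. set cs \<subseteq> Basis \<longrightarrow> length cs \<le> N \<longrightarrow> cmod (iter_deriv cs h t) \<le> B * (1 + norm t) ^ M"
  shows "(\<lambda>t. f t * h t) \<in> schwartz"
proof (rule schwartzI)
  show "smooth (\<lambda>x. f x * h x)" using assms by (simp add: schwartz_smooth smooth_mult)
  fix bs :: "'a list" and N assume bs: "set bs \<subseteq> Basis"
  let ?N = "max N (length bs)"
  obtain B M where BM: "\<And>cs t. set cs \<subseteq> Basis \<Longrightarrow> length cs \<le> ?N \<Longrightarrow> cmod (iter_deriv cs h t) \<le> B * (1 + norm t) ^ M"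
    using assms(3)[of ?N] by metis
  have "(1 + norm x) ^ N * cmod (iter_deriv bs (\<lambda>x. f x * h x) x)
     \<le> 2 ^ ?N * B * schwartz_seminorm (?N + M) f" for x
  proof -
    have "(1 + norm x) ^ N * cmod (iter_deriv bs (\<lambda>x. f x * h x) x)
      \<le> (1 + norm x) ^ ?N * cmod (iter_deriv bs (\<lambda>x. f x * h x) x)"
      by (intro mult_right_mono power_increasing) auto
    also have "\<dots> \<le> 2 ^ ?N * B * schwartz_seminorm (?N + M) f"
      by (rule seminorm_mult_pointwise[OF assms(1,2) bs _ BM]) auto
    finally show ?thesis .
  qed
  then show "\<exists>B. \<forall>x. (1 + norm x) ^ N * cmod (iter_deriv bs (\<lambda>x. f x * h x) x) \<le> B" by blast
qed

lemma schwartz_cmult: "f \<in> schwartz \<Longrightarrow> (\<lambda>x. c * f x) \<in> schwartz"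
proof -
  assume f: "f \<in> schwartz"
  have "cmod (iter_deriv cs (\<lambda>x. c) t) \<le> cmod c * (1 + norm t) ^ 0" for cs :: "'a list" and t
    by (cases "cs = []") (auto simp: iter_deriv_const)
  then have "(\<lambda>x. f x * c) \<in> schwartz"
    by (intro schwartz_mult_moderate[OF f smooth_const]) blast
  then show ?thesis by (simp add: mult.commute)
qed

lemma seminorm_cmult:
  assumes "f \<in> schwartz"
  shows "schwartz_seminorm N (\<lambda>x. c * f x) \<le> cmod c * schwartz_seminorm N f"
proof (rule seminorm_le)
  fix bs :: "'a list" and x assume bs: "set bs \<subseteq> Basis" "length bs \<le> N"
  show "(1 + norm x) ^ N * cmod (iter_deriv bs (\<lambda>x. c * f x) x) \<le> cmod c * schwartz_seminorm N f"
    using mult_left_mono[OF seminorm_ge[OF assms bs, of x], of "cmod c"] assms bs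
    by (simp add: iter_deriv_cmult schwartz_smooth norm_mult mult_ac)
qed

lemma schwartz_diff: "f \<in> schwartz \<Longrightarrow> h \<in> schwartz \<Longrightarrow> (\<lambda>x. f x - h x) \<in> schwartz"
  using schwartz_add[OF _ schwartz_cmult[of h "-1"], of f] by simp

lemma schwartz_cnj: "f \<in> schwartz \<Longrightarrow> (\<lambda>x. cnj (f x)) \<in> schwartz"
  by (rule schwartzI) (auto simp: schwartz_smooth smooth_cnj iter_deriv_cnj dest: schwartzD)

lemma seminorm_cnj:
  assumes "f \<in> schwartz" shows "schwartz_seminorm N (\<lambda>x. cnj (f x)) \<le> schwartz_seminorm N f"
  by (rule seminorm_le) (use assms seminorm_ge in \<open>auto simp: iter_deriv_cnj schwartz_smooth\<close>)

lemma schwartz_iter_deriv: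
  assumes "f \<in> schwartz" "set bs \<subseteq> Basis" shows "iter_deriv bs f \<in> schwartz"
proof (rule schwartzI)
  show "smooth (iter_deriv bs f)" using assms by (simp add: schwartz_smooth smooth_iter_deriv)
  fix cs :: "'a list" and N assume "set cs \<subseteq> Basis"
  then show "\<exists>B. \<forall>x. (1 + norm x) ^ N * cmod (iter_deriv cs (iter_deriv bs f) x) \<le> B"
    using schwartzD[OF assms(1), of "cs @ bs" N] assms by (simp add: iter_deriv_append)
qed

lemma schwartz_partial: "f \<in> schwartz \<Longrightarrow> b \<in> Basis \<Longrightarrow> partial_deriv b f \<in> schwartz"
  using schwartz_iter_deriv[of f "[b]"] by simp

lemma seminorm_partial:
  assumes "f \<in> schwartz" "b \<in> Basis"
  shows "schwartz_seminorm N (partial_deriv b f) \<le> schwartz_seminorm (Suc N) f"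
proof (rule seminorm_le)
  fix bs :: "'a list" and x assume bs: "set bs \<subseteq> Basis" "length bs \<le> N"
  have "(1 + norm x) ^ N * cmod (iter_deriv bs (partial_deriv b f) x)
     \<le> (1 + norm x) ^ Suc N * cmod (iter_deriv (bs @ [b]) f x)"
    unfolding iter_deriv_append iter_deriv.simps by (intro mult_right_mono power_increasing) auto
  also have "\<dots> \<le> schwartz_seminorm (Suc N) f"
    using assms bs by (intro seminorm_ge) auto
  finally show "(1 + norm x) ^ N * cmod (iter_deriv bs (partial_deriv b f) x) \<le> schwartz_seminorm (Suc N) f" .
qed

lemma schwartz_modulation:
  assumes "f \<in> schwartz" shows "(\<lambda>t. f t * modulation \<omega> t) \<in> schwartz"
proof (rule schwartz_mult_moderate[OF assms smooth_modulation])
  fix N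
  have "\<forall>cs (t::'a). set cs \<subseteq> Basis \<longrightarrow> length cs \<le> N \<longrightarrow>
      cmod (iter_deriv cs (modulation \<omega>) t) \<le> (1 + 2 * pi * norm \<omega>) ^ N * (1 + norm t) ^ 0"
    by (simp add: iter_deriv_modulation_bound)
  then show "\<exists>B M. \<forall>cs (t::'a). set cs \<subseteq> Basis \<longrightarrow> length cs \<le> N \<longrightarrow>
      cmod (iter_deriv cs (modulation \<omega>) t) \<le> B * (1 + norm t) ^ M" by blast
qed

lemma seminorm_modulation:
  assumes "f \<in> schwartz"
  shows "schwartz_seminorm N (\<lambda>t. f t * modulation \<omega> t) \<le> 2 ^ N * (1 + 2 * pi * norm \<omega>) ^ N * schwartz_seminorm N f"
proof (rule seminorm_mult[OF assms smooth_modulation, where M=0, simplified])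
  show "cmod (iter_deriv cs (modulation \<omega>) t) \<le> (1 + 2 * pi * norm \<omega>) ^ N"
    if "set cs \<subseteq> Basis" "length cs \<le> N" for cs t
    using that by (rule iter_deriv_modulation_bound)
qed

lemma iter_deriv_linear_bound:
  assumes "a \<in> Basis" "set cs \<subseteq> Basis"
  shows "cmod (iter_deriv cs (\<lambda>x. complex_of_real (x \<bullet> a)) t) \<le> 1 * (1 + norm t) ^ 1"
proof (cases cs rule: rev_cases)
  case Nil
  then show ?thesis using Basis_le_norm[OF assms(1), of t] by simp
next
  case (snoc bs b)
  then have *: "iter_deriv cs (\<lambda>x. complex_of_real (x \<bullet> a)) = iter_deriv bs (\<lambda>x. of_real (b \<bullet> a))"
    using partial_deriv_linear[of b a 0] by (simp add: iter_deriv_append)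
  have "cmod (iter_deriv bs (\<lambda>x. complex_of_real (b \<bullet> a)) t) \<le> 1"
    using assms snoc by (cases "bs = []") (auto simp: iter_deriv_const inner_Basis)
  then show ?thesis by (simp add: *) (smt (verit) norm_ge_zero)
qed

lemma schwartz_coordinate: "f \<in> schwartz \<Longrightarrow> a \<in> Basis \<Longrightarrow> (\<lambda>t. f t * of_real (t \<bullet> a)) \<in> schwartz"
  by (rule schwartz_mult_moderate[OF _ smooth_linear], assumption)
    (rule exI, rule exI, intro allI impI, rule iter_deriv_linear_bound)

lemma seminorm_coordinate:
  assumes "f \<in> schwartz" "a \<in> Basis"
  shows "schwartz_seminorm N (\<lambda>t. f t * of_real (t \<bullet> a)) \<le> 2 ^ N * schwartz_seminorm (Suc N) f"
  using seminorm_mult[OF assms(1) smooth_linear, OF iter_deriv_linear_bound[OF assms(2)], of N] by simp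

text \<open>
  Peetre's inequality moves polynomial weights between \<open>t\<close> and its translate \<open>t - x\<close>.
\<close>

lemma peetre: "1 + norm x \<le> (1 + norm (t - x)) * (1 + norm t)" for x :: "'a::real_normed_vector"
proof -
  have "norm x \<le> norm (t - x) + norm t"
    using norm_triangle_ineq4[of t "t - x"] by simp
  moreover have "0 \<le> norm (t - x) * norm t" by simp
  moreover have "(1 + norm (t - x)) * (1 + norm t) = 1 + norm (t - x) + norm t + norm (t - x) * norm t"
    by (simp add: ring_distribs)
  ultimately show ?thesis by linarith
qed

lemma peetre': "1 + norm t \<le> (1 + norm (t - x)) * (1 + norm x)" for x :: "'a::real_normed_vector"
  using peetre[of t x] by (simp add: norm_minus_commute)

lemma translate_bound:
  assumes "g \<in> schwartz" "set cs \<subseteq> Basis" "length cs \<le> N"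
  shows "cmod (iter_deriv cs (\<lambda>t. g (t - x)) t) \<le> (schwartz_seminorm N g / (1 + norm x) ^ N) * (1 + norm t) ^ N"
proof -
  have "iter_deriv cs (\<lambda>t. g (t - x)) t = iter_deriv cs g (t - x)"
    using iter_deriv_affine[OF schwartz_smooth[OF assms(1)] assms(2), of 1 "-x"] by simp
  then have "cmod (iter_deriv cs (\<lambda>t. g (t - x)) t) * (1 + norm x) ^ N
      \<le> cmod (iter_deriv cs g (t - x)) * ((1 + norm (t - x)) * (1 + norm t)) ^ N"
    using power_mono[OF peetre, of x N t] by (intro mult_mono) auto
  also have "\<dots> \<le> schwartz_seminorm N g * (1 + norm t) ^ N"
    using mult_right_mono[OF seminorm_ge[OF assms, of "t - x"], of "(1 + norm t) ^ N"]
    by (simp add: power_mult_distrib mult_ac)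
  finally show ?thesis by (simp add: field_simps add_pos_nonneg)
qed

lemma smooth_translate: "smooth g \<Longrightarrow> smooth (\<lambda>t. g (t - x))"
  using smooth_affine[of g 1 "-x"] by simp

lemma schwartz_translate:
  assumes "g \<in> schwartz" shows "(\<lambda>t. g (t - x)) \<in> schwartz"
proof (rule schwartzI)
  show "smooth (\<lambda>t. g (t - x))" using assms by (simp add: schwartz_smooth smooth_translate)
  fix bs :: "'a list" and N assume bs: "set bs \<subseteq> Basis"
  obtain B where B: "\<forall>x. (1 + norm x) ^ N * cmod (iter_deriv bs g x) \<le> B"
    using schwartzD[OF assms bs] by blast
  have "(1 + norm t) ^ N * cmod (iter_deriv bs (\<lambda>t. g (t - x)) t) \<le> (1 + norm x) ^ N * B" for t
  proof -
    have "iter_deriv bs (\<lambda>t. g (t - x)) t = iter_deriv bs g (t - x)"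
      using iter_deriv_affine[OF schwartz_smooth[OF assms(1)] bs, of 1 "-x"] by simp
    moreover have "(1 + norm t) ^ N * cmod (iter_deriv bs g (t - x))
        \<le> ((1 + norm (t - x)) * (1 + norm x)) ^ N * cmod (iter_deriv bs g (t - x))"
      by (intro mult_right_mono power_mono peetre') auto
    moreover have "\<dots> = (1 + norm x) ^ N * ((1 + norm (t - x)) ^ N * cmod (iter_deriv bs g (t - x)))"
      by (simp add: power_mult_distrib mult_ac)
    moreover have "\<dots> \<le> (1 + norm x) ^ N * B" using B by (intro mult_left_mono) auto
    ultimately show ?thesis by simp
  qed
  then show "\<exists>B. \<forall>t. (1 + norm t) ^ N * cmod (iter_deriv bs (\<lambda>t. g (t - x)) t) \<le> B" by blast
qed

lemma seminorm_translate:
  assumes "g \<in> schwartz"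
  shows "schwartz_seminorm N (\<lambda>t. g (t - x)) \<le> (1 + norm x) ^ N * schwartz_seminorm N g"
proof (rule seminorm_le)
  fix bs :: "'a list" and t assume bs: "set bs \<subseteq> Basis" "length bs \<le> N"
  have "iter_deriv bs (\<lambda>t. g (t - x)) t = iter_deriv bs g (t - x)"
    using iter_deriv_affine[OF schwartz_smooth[OF assms(1)] bs(1), of 1 "-x"] by simp
  moreover have "(1 + norm t) ^ N * cmod (iter_deriv bs g (t - x))
      \<le> ((1 + norm (t - x)) * (1 + norm x)) ^ N * cmod (iter_deriv bs g (t - x))"
    by (intro mult_right_mono power_mono peetre') auto
  moreover have "\<dots> = (1 + norm x) ^ N * ((1 + norm (t - x)) ^ N * cmod (iter_deriv bs g (t - x)))"
    by (simp add: power_mult_distrib mult_ac)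
  moreover have "\<dots> \<le> (1 + norm x) ^ N * schwartz_seminorm N g"
    using seminorm_ge[OF assms bs] by (intro mult_left_mono) auto
  ultimately show "(1 + norm t) ^ N * cmod (iter_deriv bs (\<lambda>t. g (t - x)) t) \<le> (1 + norm x) ^ N * schwartz_seminorm N g"
    by simp
qed

lemma schwartz_mult:
  assumes "f \<in> schwartz" "h \<in> schwartz" shows "(\<lambda>t. f t * h t) \<in> schwartz"
proof (rule schwartz_mult_moderate[OF assms(1) schwartz_smooth[OF assms(2)]])
  fix N
  show "\<exists>B M. \<forall>cs t. set cs \<subseteq> Basis \<longrightarrow> length cs \<le> N \<longrightarrow> cmod (iter_deriv cs h t) \<le> B * (1 + norm t) ^ M"
    using translate_bound[OF assms(2), of _ N 0] by (intro exI[of _ "schwartz_seminorm N h"] exI[of _ N]) simp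
qed

text \<open>
  By Peetre's inequality, either the translated window or \<open>\<eta>\<close> is small at each point if \<open>x\<close> is large.
  This makes the coefficients of \<open>\<eta>\<close> decay in the position of the window.
\<close>

lemma seminorm_window_mult:
  assumes "\<eta> \<in> schwartz" "g \<in> schwartz" "N \<le> L"
  shows "schwartz_seminorm N (\<lambda>t. \<eta> t * g (t - x))
    \<le> 2 ^ N * (schwartz_seminorm L g / (1 + norm x) ^ L) * schwartz_seminorm (N + L) \<eta>"
  by (rule seminorm_mult[OF assms(1) smooth_translate[OF schwartz_smooth[OF assms(2)]]])
    (use translate_bound[OF assms(2)] assms(3) in auto)

lemma schwartz_reflect:
  assumes "f \<in> schwartz" shows "(\<lambda>x. f (- x)) \<in> schwartz"
proof (rule schwartzI)
  show "smooth (\<lambda>x. f (- x))" using smooth_affine[OF schwartz_smooth[OF assms], of "-1" 0] by simp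
  fix bs :: "'a list" and N assume bs: "set bs \<subseteq> Basis"
  have "iter_deriv bs (\<lambda>x. f (- x)) x = (-1) ^ length bs * iter_deriv bs f (- x)" for x
    using iter_deriv_affine[OF schwartz_smooth[OF assms] bs, of "-1" 0] by simp
  moreover obtain B where "\<forall>x. (1 + norm x) ^ N * cmod (iter_deriv bs f x) \<le> B"
    using schwartzD[OF assms bs] by blast
  ultimately have "(1 + norm x) ^ N * cmod (iter_deriv bs (\<lambda>x. f (- x)) x) \<le> B" for x
    by (simp add: norm_mult norm_power) (metis norm_minus_cancel)
  then show "\<exists>B. \<forall>x. (1 + norm x) ^ N * cmod (iter_deriv bs (\<lambda>x. f (- x)) x) \<le> B" by blast
qed

lemma seminorm_reflect:
  assumes "f \<in> schwartz" shows "schwartz_seminorm N (\<lambda>x. f (- x)) \<le> schwartz_seminorm N f"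
proof (rule seminorm_le)
  fix bs :: "'a list" and x assume bs: "set bs \<subseteq> Basis" "length bs \<le> N"
  have "iter_deriv bs (\<lambda>x. f (- x)) x = (-1) ^ length bs * iter_deriv bs f (- x)"
    using iter_deriv_affine[OF schwartz_smooth[OF assms] bs(1), of "-1" 0] by simp
  then show "(1 + norm x) ^ N * cmod (iter_deriv bs (\<lambda>x. f (- x)) x) \<le> schwartz_seminorm N f"
    using seminorm_ge[OF assms bs, of "-x"] by (simp add: norm_mult norm_power)
qed

section \<open>Integrals over Euclidean space\<close>

lemma nn_integral_affine:
  fixes f :: "'a::euclidean_space \<Rightarrow> ennreal"
  assumes [measurable]: "f \<in> borel_measurable borel" and c: "c \<noteq> 0"
  shows "(\<integral>\<^sup>+x. f x \<partial>lborel) = ennreal (\<bar>c\<bar> ^ DIM('a)) * (\<integral>\<^sup>+x. f (t + c *\<^sub>R x) \<partial>lborel)"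
  by (subst lborel_affine[OF c, of t])
    (simp add: nn_integral_density nn_integral_distr nn_integral_cmult ennreal_power)

lemma integrable_affine:
  fixes f :: "'a::euclidean_space \<Rightarrow> 'b::{banach, second_countable_topology}"
  assumes f: "integrable lborel f" and c: "c \<noteq> 0"
  shows "integrable lborel (\<lambda>x. f (t + c *\<^sub>R x))"
proof -
  have [measurable]: "f \<in> borel_measurable borel" using f by auto
  have "(\<integral>\<^sup>+x. norm (f x) \<partial>lborel) < \<infinity>" using f by (simp add: integrable_iff_bounded)
  then have "(\<integral>\<^sup>+x. norm (f (t + c *\<^sub>R x)) \<partial>lborel) < \<infinity>"
    using c nn_integral_affine[OF _ c, of "\<lambda>x. ennreal (norm (f x))" t]
    by (auto simp: ennreal_mult_less_top)
  then show ?thesis by (simp add: integrable_iff_bounded)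
qed

lemma integral_affine:
  fixes f :: "'a::euclidean_space \<Rightarrow> 'b::{banach, second_countable_topology}"
  assumes f: "integrable lborel f" and c: "c \<noteq> 0"
  shows "(LINT x|lborel. f x) = (\<bar>c\<bar> ^ DIM('a)) *\<^sub>R (LINT x|lborel. f (t + c *\<^sub>R x))"
proof -
  have [measurable]: "f \<in> borel_measurable borel" using f by auto
  show ?thesis
    by (subst lborel_affine[OF c, of t]) (simp add: integral_density integral_distr)
qed

lemma nn_integral_reflect:
  fixes f :: "'a::euclidean_space \<Rightarrow> ennreal"
  assumes "f \<in> borel_measurable borel"
  shows "(\<integral>\<^sup>+x. f (t - x) \<partial>lborel) = (\<integral>\<^sup>+x. f x \<partial>lborel)"
  using nn_integral_affine[OF assms, of "-1" t] by simp

lemma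
  fixes f :: "'a::euclidean_space \<Rightarrow> real \<Rightarrow> 'b::{real_normed_field, banach, second_countable_topology}"
  assumes f: "\<And>b. b \<in> Basis \<Longrightarrow> integrable lborel (f b)"
  shows integrable_prod_Basis: "integrable lborel (\<lambda>x::'a. \<Prod>b\<in>Basis. f b (x \<bullet> b))"
    and integral_prod_Basis:
      "(LINT x|lborel. (\<Prod>b\<in>Basis. f b ((x::'a) \<bullet> b))) = (\<Prod>b\<in>Basis. LINT y|lborel. f b y)"
proof -
  interpret product_sigma_finite "\<lambda>_::'a. lborel :: real measure" ..
  have eq: "(\<Prod>b\<in>Basis. f b ((\<Sum>c\<in>Basis. w c *\<^sub>R c) \<bullet> b)) = (\<Prod>b\<in>Basis. f b (w b))" for w :: "'a \<Rightarrow> real"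
    by (intro prod.cong refl) (simp add: inner_sum_left inner_Basis if_distrib cong: if_cong)
  have [measurable]: "(\<lambda>x. f b x) \<in> borel_measurable borel" if "b \<in> Basis" for b
    using f[OF that] by auto
  have m: "(\<lambda>x::'a. \<Prod>b\<in>Basis. f b (x \<bullet> b)) \<in> borel_measurable borel"
    by (intro borel_measurable_prod) measurable
  have m2: "(\<lambda>w. \<Sum>c\<in>Basis. w c *\<^sub>R c) \<in> measurable (Pi\<^sub>M Basis (\<lambda>_::'a. lborel :: real measure)) borel"
    by measurable
  show "integrable lborel (\<lambda>x::'a. \<Prod>b\<in>Basis. f b (x \<bullet> b))"
    using product_integrable_prod[OF finite_Basis f]
    by (subst lborel_eq, subst integrable_distr_eq[OF m2 m]) (simp add: eq)
  show "(LINT x|lborel. (\<Prod>b\<in>Basis. f b ((x::'a) \<bullet> b))) = (\<Prod>b\<in>Basis. LINT y|lborel. f b y)"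
    using product_integral_prod[OF finite_Basis f]
    by (subst lborel_eq, subst integral_distr[OF m2 m]) (simp add: eq)
qed

text \<open>
  A fixed integrable function of polynomial decay, to dominate with. The exponent is large
  enough for a comparison with the product of \<open>1 / (1 + y\<^sup>2)\<close> over the coordinates \<open>y\<close>.
\<close>

definition decay :: "'a::euclidean_space \<Rightarrow> real" where
  "decay t = 1 / (1 + norm t) ^ (2 * DIM('a))"

lemma decay_pos: "0 < decay t" by (simp add: decay_def add_pos_nonneg)
lemma decay_nonneg [simp]: "0 \<le> decay t" using decay_pos[of t] by simp

lemma borel_measurable_decay [measurable]: "decay \<in> borel_measurable borel"
  unfolding decay_def[abs_def] by measurable

lemma integrable_decay: "integrable lborel (decay :: 'a::euclidean_space \<Rightarrow> real)"
proof -
  have "set_integrable lborel UNIV (\<lambda>x::real. inverse (1 + x\<^sup>2))"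
    using integrable_inverse_1_plus_square by (simp add: einterval_def)
  then have 1: "integrable lborel (\<lambda>x::real. inverse (1 + x\<^sup>2))"
    by (simp add: set_integrable_def)
  have 2: "integrable lborel (\<lambda>x::'a. \<Prod>b\<in>Basis. inverse (1 + (x \<bullet> b)\<^sup>2))"
    by (rule integrable_prod_Basis) (rule 1)
  show ?thesis
  proof (rule Bochner_Integration.integrable_bound[OF 2])
    have "decay x \<le> (\<Prod>b\<in>Basis. inverse (1 + (x \<bullet> b)\<^sup>2))" for x :: 'a
    proof -
      have "(\<Prod>b\<in>(Basis::'a set). inverse ((1 + norm x)\<^sup>2)) \<le> (\<Prod>b\<in>Basis. inverse (1 + (x \<bullet> b)\<^sup>2))"
      proof (intro prod_mono conjI le_imp_inverse_le)
        fix b :: 'a assume "b \<in> Basis"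
        then have "(x \<bullet> b)\<^sup>2 \<le> (norm x)\<^sup>2"
          using Basis_le_norm[of b x] by (simp add: abs_le_square_iff[symmetric])
        then show "1 + (x \<bullet> b)\<^sup>2 \<le> (1 + norm x)\<^sup>2"
          using norm_ge_zero[of x] by (simp add: power2_sum add_increasing2)
      qed (auto intro: add_pos_nonneg)
      then show ?thesis by (simp add: decay_def power_mult power_inverse divide_inverse)
    qed
    then show "AE x in lborel. norm (decay (x::'a)) \<le> norm (\<Prod>b\<in>Basis. inverse (1 + (x \<bullet> b)\<^sup>2))"
      by (auto simp: abs_of_nonneg prod_nonneg)
  qed simp
qed

lemma integral_decay_nonneg: "0 \<le> (LINT t|lborel. decay t)"
  by (simp add: integral_nonneg)

lemma schwartz_decay_bound:
  fixes f :: "'a::euclidean_space \<Rightarrow> complex"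
  assumes "f \<in> schwartz"
  shows "(1 + norm t) ^ k * cmod (f t) \<le> schwartz_seminorm (2 * DIM('a) + k) f * decay t"
  using schwartz_decay[OF assms, of t "2 * DIM('a) + k"]
  by (simp add: decay_def power_add field_simps add_pos_nonneg)

lemma schwartz_integrable_moment:
  fixes f :: "'a::euclidean_space \<Rightarrow> complex"
  assumes "f \<in> schwartz"
  shows "integrable lborel (\<lambda>t. (1 + norm t) ^ k * cmod (f t))"
proof (rule Bochner_Integration.integrable_bound)
  show "integrable lborel (\<lambda>t::'a. schwartz_seminorm (2 * DIM('a) + k) f * decay t)"
    by (intro integrable_mult_right integrable_decay)
  show "AE t in lborel. norm ((1 + norm t) ^ k * cmod (f t)) \<le> norm (schwartz_seminorm (2 * DIM('a) + k) f * decay t)"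
    using schwartz_decay_bound[OF assms] seminorm_nonneg[OF assms] by (auto simp: abs_of_nonneg)
qed (use assms in measurable)

lemma schwartz_integrable: "f \<in> schwartz \<Longrightarrow> integrable lborel f"
  using schwartz_integrable_moment[of f 0] integrable_norm_cancel[of lborel f] schwartz_borel[of f] by simp

lemma schwartz_integral_bound:
  fixes f :: "'a::euclidean_space \<Rightarrow> complex"
  assumes "f \<in> schwartz"
  shows "(LINT t|lborel. cmod (f t)) \<le> schwartz_seminorm (2 * DIM('a)) f * (LINT t|lborel. decay (t::'a))"
proof -
  have "(LINT t|lborel. cmod (f t)) \<le> (LINT t|lborel. schwartz_seminorm (2 * DIM('a)) f * decay (t::'a))"
    using schwartz_decay_bound[OF assms, of _ 0]
    by (intro Bochner_Integration.integral_mono[OF integrable_norm[OF schwartz_integrable[OF assms]]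
          integrable_mult_right[OF integrable_decay]]) auto
  then show ?thesis by simp
qed

section \<open>The Fourier transform of Schwartz functions\<close>

lemma fourier_eq: "fourier f \<omega> = (LINT x|lborel. f x * modulation \<omega> x)"
  by (simp add: fourier_def modulation_def)

lemma modulation_measurable [measurable]:
  assumes [measurable]: "f \<in> borel_measurable M" "h \<in> borel_measurable M"
  shows "(\<lambda>z. modulation (f z) (h z)) \<in> borel_measurable M"
proof -
  have "continuous_on UNIV cis" by (rule continuous_on_cis) (rule continuous_on_id)
  then have [measurable]: "cis \<in> borel_measurable borel" by (rule borel_measurable_continuous_onI)
  show ?thesis unfolding modulation_def by measurable
qed

lemma modulation_commute: "modulation \<omega> t = modulation t \<omega>"
  by (simp add: modulation_def inner_commute)

lemma modulation_add: "modulation \<omega> (s + t) = modulation \<omega> s * modulation \<omega> t"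
  by (simp add: modulation_def cis_mult inner_left_distrib ring_distribs)

lemma modulation_add_left: "modulation (\<omega> + \<xi>) t = modulation \<omega> t * modulation \<xi> t"
  by (simp add: modulation_def cis_mult inner_right_distrib ring_distribs)

lemma modulation_minus: "modulation \<omega> (- t) = cnj (modulation \<omega> t)"
  by (simp add: modulation_def cis_cnj)

lemma modulation_minus_left: "modulation (- \<omega>) t = cnj (modulation \<omega> t)"
  by (simp add: modulation_def cis_cnj)

lemma modulation_cnj_mult [simp]: "modulation \<omega> t * cnj (modulation \<omega> t) = 1"
  by (simp add: modulation_def cis_cnj cis_mult)

lemma modulation_0 [simp]: "modulation 0 t = 1" "modulation \<omega> 0 = 1"
  by (simp_all add: modulation_def)

lemma integrable_modulation:
  assumes "integrable lborel f" shows "integrable lborel (\<lambda>x. f x * modulation \<omega> x)"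
  by (rule Bochner_Integration.integrable_bound[OF assms]) (use assms in \<open>auto simp: norm_mult\<close>)

lemma fourier_bound:
  assumes "integrable lborel f" shows "cmod (fourier f \<omega>) \<le> (LINT t|lborel. cmod (f t))"
proof -
  have "cmod (fourier f \<omega>) \<le> (LINT t|lborel. cmod (f t * modulation \<omega> t))"
    unfolding fourier_eq by (rule integral_norm_bound)
  then show ?thesis by (simp add: norm_mult)
qed

lemma fourier_borel [measurable]:
  assumes [measurable]: "f \<in> borel_measurable borel" shows "fourier f \<in> borel_measurable borel"
  unfolding fourier_eq[abs_def] by measurable

lemma cmod_cis_diff2: "cmod (cis x - 1 - \<i> * x) \<le> x\<^sup>2"
proof -
  have "cmod (cis x - (1 + \<i> * x)) \<le> \<bar>x\<bar>\<^sup>2 / 2"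
    using iexp_approx1[of x 1] by (simp add: cis_eq_exp numeral_2_eq_2)
  also have "\<dots> \<le> x\<^sup>2" by simp
  finally show ?thesis by (simp add: diff_diff_eq)
qed

text \<open>
  Differentiation under the integral: the second-order remainder of the character is at most
  quadratic, and the second moments of \<open>f\<close> are finite.
\<close>

lemma fourier_has_derivative:
  fixes f :: "'a::euclidean_space \<Rightarrow> complex"
  assumes f: "f \<in> schwartz"
  shows "(fourier f has_derivative (\<lambda>h. LINT t|lborel. f t * (- 2 * pi * \<i> * of_real (t \<bullet> h)) * modulation \<omega> t)) (at \<omega>)"
proof -
  note [measurable] = schwartz_borel[OF f]
  let ?D = "\<lambda>h. LINT t|lborel. f t * (- 2 * pi * \<i> * of_real (t \<bullet> h)) * modulation \<omega> t"
  define C where "C k = (LINT t|lborel. (1 + norm t) ^ k * cmod (f t))" for k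
  have le: "norm t \<le> 1 + norm t" for t :: 'a by simp
  have b1: "cmod (f t * (- 2 * pi * \<i> * of_real (t \<bullet> h)) * modulation \<omega> t)
      \<le> (2 * pi * norm h) * ((1 + norm t) ^ 1 * cmod (f t))" for t h
  proof -
    have "\<bar>t \<bullet> h\<bar> \<le> (1 + norm t) * norm h"
      by (rule order_trans[OF Cauchy_Schwarz_ineq2]) (simp add: mult_right_mono)
    then have "2 * pi * \<bar>t \<bullet> h\<bar> * cmod (f t) \<le> 2 * pi * ((1 + norm t) * norm h) * cmod (f t)"
      by (intro mult_right_mono mult_left_mono) auto
    then show ?thesis by (simp add: norm_mult mult_ac)
  qed
  have i1: "integrable lborel (\<lambda>t. f t * (- 2 * pi * \<i> * of_real (t \<bullet> h)) * modulation \<omega> t)" for h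
    by (rule Bochner_Integration.integrable_bound[OF integrable_mult_right[OF schwartz_integrable_moment[OF f, of 1], of "2 * pi * norm h"]])
      (use b1 in \<open>auto intro!: AE_I2 order_trans[OF b1] simp: abs_mult\<close>)
  have i0: "integrable lborel (\<lambda>t. f t * modulation \<omega> t)" for \<omega>
    by (rule integrable_modulation[OF schwartz_integrable[OF f]])
  have "bounded_linear ?D"
  proof (rule bounded_linear_intro[where K="2 * pi * C 1"])
    fix h k
    show "?D (h + k) = ?D h + ?D k"
      by (subst Bochner_Integration.integral_add[OF i1 i1, symmetric])
        (simp add: inner_right_distrib ring_distribs)
    show "?D (r *\<^sub>R h) = r *\<^sub>R ?D h" for r
      by (subst integral_scaleR_right[symmetric]) (simp add: scaleR_conv_of_real mult_ac)
    have "cmod (?D h) \<le> (LINT t|lborel. (2 * pi * norm h) * ((1 + norm t) ^ 1 * cmod (f t)))"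
      by (rule Bochner_Integration.integral_norm_bound_integral[OF i1 integrable_mult_right[OF schwartz_integrable_moment[OF f, of 1]] b1])
    then show "cmod (?D h) \<le> norm h * (2 * pi * C 1)"
      unfolding C_def integral_mult_right_zero by (simp only: mult_ac)
  qed
  moreover have "((\<lambda>h. cmod (fourier f (\<omega> + h) - fourier f \<omega> - ?D h) / norm h) \<longlongrightarrow> 0) (at 0)"
  proof (rule tendsto_sandwich[OF always_eventually always_eventually tendsto_const])
    show "((\<lambda>h::'a. norm h * ((2 * pi)\<^sup>2 * C 2)) \<longlongrightarrow> 0) (at 0)"
      by (auto intro!: tendsto_eq_intros)
    show "\<forall>h. cmod (fourier f (\<omega> + h) - fourier f \<omega> - ?D h) / norm h \<le> norm h * ((2 * pi)\<^sup>2 * C 2)"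
    proof
      fix h
      have "fourier f (\<omega> + h) - fourier f \<omega> - ?D h =
        (LINT t|lborel. f t * modulation (\<omega> + h) t - f t * modulation \<omega> t - f t * (- 2 * pi * \<i> * of_real (t \<bullet> h)) * modulation \<omega> t)"
        unfolding fourier_eq using i0 i1 by simp
      also have "cmod \<dots> \<le> (LINT t|lborel. ((2 * pi)\<^sup>2 * (norm h)\<^sup>2) * ((1 + norm t)\<^sup>2 * cmod (f t)))"
      proof (rule Bochner_Integration.integral_norm_bound_integral)
        fix t
        have "cmod (f t * modulation (\<omega> + h) t - f t * modulation \<omega> t - f t * (- 2 * pi * \<i> * of_real (t \<bullet> h)) * modulation \<omega> t)
          = cmod (f t * modulation \<omega> t * (modulation h t - 1 - \<i> * of_real (- 2 * pi * (t \<bullet> h))))"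
          by (simp add: modulation_add_left algebra_simps)
        also have "\<dots> \<le> cmod (f t) * (- 2 * pi * (t \<bullet> h))\<^sup>2"
          using cmod_cis_diff2[of "- 2 * pi * (t \<bullet> h)"]
          by (simp add: norm_mult mult_left_mono modulation_def)
        also have "\<dots> \<le> cmod (f t) * (2 * pi * ((1 + norm t) * norm h))\<^sup>2"
        proof -
          have "\<bar>t \<bullet> h\<bar> \<le> (1 + norm t) * norm h"
            by (rule order_trans[OF Cauchy_Schwarz_ineq2]) (simp add: mult_right_mono)
          then have "\<bar>- 2 * pi * (t \<bullet> h)\<bar> \<le> \<bar>2 * pi * ((1 + norm t) * norm h)\<bar>"
            by (simp add: abs_mult)
          then show ?thesis by (intro mult_left_mono) (simp_all only: abs_le_square_iff norm_ge_zero)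
        qed
        finally show "cmod (f t * modulation (\<omega> + h) t - f t * modulation \<omega> t - f t * (- 2 * pi * \<i> * of_real (t \<bullet> h)) * modulation \<omega> t)
          \<le> ((2 * pi)\<^sup>2 * (norm h)\<^sup>2) * ((1 + norm t)\<^sup>2 * cmod (f t))"
          by (simp only: power_mult_distrib mult_ac)
      qed (use i0 i1 schwartz_integrable_moment[OF f, of 2] in auto)
      finally have "cmod (fourier f (\<omega> + h) - fourier f \<omega> - ?D h) \<le> (norm h * ((2 * pi)\<^sup>2 * C 2)) * norm h"
        unfolding C_def integral_mult_right_zero by (simp only: power2_eq_square mult_ac)
      then show "cmod (fourier f (\<omega> + h) - fourier f \<omega> - ?D h) / norm h \<le> norm h * ((2 * pi)\<^sup>2 * C 2)"
        by (cases "h = 0") (simp_all add: divide_le_eq)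
    qed
  qed simp
  ultimately show ?thesis by (simp add: has_derivative_at)
qed

lemma fourier_differentiable: "f \<in> schwartz \<Longrightarrow> fourier f differentiable_on UNIV"
  by (intro differentiable_onI differentiableI[OF fourier_has_derivative])

lemma partial_deriv_fourier:
  assumes "f \<in> schwartz"
  shows "partial_deriv b (fourier f) = fourier (\<lambda>t. (- 2 * pi * \<i>) * (f t * of_real (t \<bullet> b)))"
  unfolding partial_deriv_eqI[OF fourier_has_derivative[OF assms]]
  by (simp add: fun_eq_iff fourier_eq mult_ac)

text \<open>The integral of a derivative vanishes because integrals are translation invariant.\<close>

lemma integral_partial_deriv:
  fixes f :: "'a::euclidean_space \<Rightarrow> complex"
  assumes f: "f \<in> schwartz" and b: "b \<in> Basis"
  shows "(LINT t|lborel. partial_deriv b f t) = 0"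
proof -
  note [measurable] = schwartz_borel[OF f]
  note fb = schwartz_partial[OF f b]
  note [measurable] = schwartz_borel[OF fb]
  define s where "s n = 1 / real (Suc n)" for n
  have s: "0 < s n" "s n \<le> 1" for n by (auto simp: s_def)
  have s0: "s \<longlonglongrightarrow> 0" unfolding s_def by (rule LIMSEQ_Suc[OF lim_1_over_n])
  define q where "q n t = (f (t + s n *\<^sub>R b) - f t) /\<^sub>R s n" for n t
  have line: "((\<lambda>u. f (t + u *\<^sub>R b)) has_derivative (\<lambda>h. h *\<^sub>R partial_deriv b f (t + u *\<^sub>R b))) (at u within X)" for t u X
  proof -
    note d = has_derivative_partial[OF smooth_differentiable[OF schwartz_smooth[OF f]], of "t + u *\<^sub>R b"]
    have "((\<lambda>u. f (t + u *\<^sub>R b)) has_derivative (\<lambda>h. frechet_derivative f (at (t + u *\<^sub>R b)) (h *\<^sub>R b))) (at u within X)"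
      by (rule has_derivative_compose[of "\<lambda>u. t + u *\<^sub>R b" "\<lambda>h. h *\<^sub>R b", OF _ d]) (auto intro!: derivative_eq_intros)
    moreover have "frechet_derivative f (at (t + u *\<^sub>R b)) (h *\<^sub>R b) = h *\<^sub>R partial_deriv b f (t + u *\<^sub>R b)" for h
      unfolding partial_deriv_def using linear_cmul[OF bounded_linear.linear[OF has_derivative_bounded_linear[OF d]]] .
    ultimately show ?thesis by simp
  qed
  let ?K = "2 * DIM('a)"
  \<comment> \<open>By the mean value theorem, \<open>?B\<close> dominates all difference quotients \<open>q n\<close>; the factor
    \<open>2 ^ ?K\<close> accounts for moving by at most a unit.\<close>
  let ?B = "\<lambda>t. schwartz_seminorm ?K (partial_deriv b f) * (2 ^ ?K * decay (t::'a))"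
  have bound: "cmod (q n t) \<le> ?B t" for n t
  proof -
    have "cmod (f (t + s n *\<^sub>R b) - f (t + 0 *\<^sub>R b)) \<le> ?B t * norm (s n - 0)"
    proof (rule differentiable_bound[of "{0..1}", OF _ line])
      fix u :: real assume u: "u \<in> {0..1}"
      have "1 + norm t \<le> (1 + norm (t + u *\<^sub>R b)) * (1 + norm (u *\<^sub>R b))"
        using peetre'[of t "t + u *\<^sub>R b"] by (simp add: mult.commute)
      also have "\<dots> \<le> (1 + norm (t + u *\<^sub>R b)) * 2"
        using u b by (intro mult_left_mono) auto
      finally have "(1 + norm t) ^ ?K \<le> (2 * (1 + norm (t + u *\<^sub>R b))) ^ ?K"
        by (intro power_mono) auto
      then have "decay (t + u *\<^sub>R b) \<le> 2 ^ ?K * decay t"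
        by (simp only: decay_def power_mult_distrib) (simp add: field_simps add_pos_nonneg)
      then have "schwartz_seminorm ?K (partial_deriv b f) * decay (t + u *\<^sub>R b) \<le> ?B t"
        by (intro mult_left_mono seminorm_nonneg[OF fb]) auto
      then have "cmod (partial_deriv b f (t + u *\<^sub>R b)) \<le> ?B t"
        using schwartz_decay_bound[OF fb, of "t + u *\<^sub>R b" 0] by simp
      then show "onorm (\<lambda>h. h *\<^sub>R partial_deriv b f (t + u *\<^sub>R b)) \<le> ?B t"
        by (intro onorm_bound) (auto intro: mult_left_mono simp: mult.commute[of "schwartz_seminorm _ _ * _"] order_trans[OF norm_ge_zero])
    qed (use s[of n] in auto)
    moreover have "cmod (q n t) = cmod (f (t + s n *\<^sub>R b) - f t) / s n"
      using s(1)[of n] by (simp add: q_def divide_inverse mult.commute)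
    ultimately show ?thesis using s(1)[of n] by (simp add: pos_divide_le_eq)
  qed
  have lim: "(\<lambda>n. q n t) \<longlonglongrightarrow> partial_deriv b f t" for t
  proof -
    have "((\<lambda>u. cmod ((1 / \<bar>u\<bar>) *\<^sub>R (f (t + u *\<^sub>R b) - (f t + u *\<^sub>R partial_deriv b f t)))) \<longlongrightarrow> 0) (at 0)"
      using line[of t 0 UNIV] by (intro tendsto_norm_zero) (simp add: has_derivative_at2)
    moreover have "cmod ((f (t + u *\<^sub>R b) - f t) /\<^sub>R u - partial_deriv b f t)
        = cmod ((1 / \<bar>u\<bar>) *\<^sub>R (f (t + u *\<^sub>R b) - (f t + u *\<^sub>R partial_deriv b f t)))" if "u \<noteq> 0" for u
    proof -
      have "(f (t + u *\<^sub>R b) - f t) /\<^sub>R u - partial_deriv b f t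
          = (1 / u) *\<^sub>R (f (t + u *\<^sub>R b) - (f t + u *\<^sub>R partial_deriv b f t))"
        using that by (simp add: algebra_simps divide_inverse)
      then show ?thesis by simp
    qed
    ultimately have "((\<lambda>u. cmod ((f (t + u *\<^sub>R b) - f t) /\<^sub>R u - partial_deriv b f t)) \<longlongrightarrow> 0) (at 0)"
      by (elim Lim_transform_eventually) (auto simp: eventually_at_filter)
    then have "((\<lambda>u. (f (t + u *\<^sub>R b) - f t) /\<^sub>R u) \<longlongrightarrow> partial_deriv b f t) (at 0)"
      using Lim_null tendsto_norm_zero_iff by blast
    then show ?thesis unfolding q_def
      by (rule filterlim_compose) (use s s0 in \<open>auto simp: filterlim_at intro!: always_eventually less_imp_neq[symmetric]\<close>)
  qed
  have "(\<lambda>n. LINT t|lborel. q n t) \<longlonglongrightarrow> (LINT t|lborel. partial_deriv b f t)"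
  proof (rule integral_dominated_convergence[where w="?B"])
    show "integrable lborel ?B" by (intro integrable_mult_right integrable_decay)
    show "q n \<in> borel_measurable lborel" for n unfolding q_def by measurable
  qed (auto intro: lim bound)
  moreover have "(LINT t|lborel. q n t) = 0" for n
  proof -
    have i: "integrable lborel (\<lambda>t. f (t + s n *\<^sub>R b))"
      using integrable_affine[OF schwartz_integrable[OF f], of 1 "s n *\<^sub>R b"] by (simp add: add.commute)
    have "(LINT t|lborel. f (t + s n *\<^sub>R b)) = (LINT t|lborel. f t)"
      using integral_affine[OF schwartz_integrable[OF f], of 1 "s n *\<^sub>R b"] by (simp add: add.commute)
    then show ?thesis unfolding q_def using i schwartz_integrable[OF f] by simp
  qed
  ultimately show ?thesis using LIMSEQ_unique[OF _ tendsto_const] by auto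
qed

lemma fourier_partial_deriv:
  assumes f: "f \<in> schwartz" and b: "b \<in> Basis"
  shows "fourier (partial_deriv b f) \<omega> = 2 * pi * \<i> * of_real (b \<bullet> \<omega>) * fourier f \<omega>"
proof -
  have "partial_deriv b (\<lambda>t. f t * modulation \<omega> t) =
     (\<lambda>t. partial_deriv b f t * modulation \<omega> t + (- 2 * pi * \<i> * of_real (b \<bullet> \<omega>)) * (f t * modulation \<omega> t))"
    using f by (simp add: partial_deriv_mult smooth_differentiable schwartz_smooth differentiable_modulation
        partial_deriv_modulation fun_eq_iff)
  then have "0 = (LINT t|lborel. partial_deriv b f t * modulation \<omega> t + (- 2 * pi * \<i> * of_real (b \<bullet> \<omega>)) * (f t * modulation \<omega> t))"
    using integral_partial_deriv[OF schwartz_modulation[OF f, of \<omega>] b] by simp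
  also have "\<dots> = fourier (partial_deriv b f) \<omega> + (- 2 * pi * \<i> * of_real (b \<bullet> \<omega>)) * fourier f \<omega>"
    unfolding fourier_eq
    by (subst Bochner_Integration.integral_add)
      (simp_all only: integral_mult_right_zero integrable_mult_right integrable_modulation schwartz_integrable schwartz_partial f b)
  finally show ?thesis by (simp add: algebra_simps eq_neg_iff_add_eq_0)
qed

text \<open>Each power of the frequency is paid for by one derivative of \<open>f\<close>.\<close>

lemma fourier_decay:
  "\<exists>C\<ge>0. \<exists>M. \<forall>f\<in>schwartz. \<forall>\<omega>::'a::euclidean_space. (1 + norm \<omega>) ^ N * cmod (fourier f \<omega>) \<le> C * schwartz_seminorm M f"
proof (induction N)
  case 0
  have "(1 + norm \<omega>) ^ 0 * cmod (fourier f \<omega>) \<le> (LINT t|lborel. decay (t::'a)) * schwartz_seminorm (2 * DIM('a)) f"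
    if "f \<in> schwartz" for f and \<omega> :: 'a
    using order_trans[OF fourier_bound[OF schwartz_integrable] schwartz_integral_bound] that by (simp add: mult.commute)
  then show ?case using integral_decay_nonneg by blast
next
  case (Suc N)
  then obtain C M where C: "0 \<le> C"
    and IH: "\<And>f (\<omega>::'a). f \<in> schwartz \<Longrightarrow> (1 + norm \<omega>) ^ N * cmod (fourier f \<omega>) \<le> C * schwartz_seminorm M f" by metis
  have "(1 + norm \<omega>) ^ Suc N * cmod (fourier f \<omega>) \<le> (C * (1 + DIM('a))) * schwartz_seminorm (Suc M) f"
    if f: "f \<in> schwartz" for f and \<omega> :: 'a
  proof -
    let ?P = "schwartz_seminorm (Suc M) f"
    have c: "(1 + norm \<omega>) ^ N * (\<bar>\<omega> \<bullet> b\<bar> * cmod (fourier f \<omega>)) \<le> C * ?P" if b: "b \<in> Basis" for b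
    proof -
      have "cmod (fourier (partial_deriv b f) \<omega>) = 2 * pi * (\<bar>\<omega> \<bullet> b\<bar> * cmod (fourier f \<omega>))"
        unfolding fourier_partial_deriv[OF f b] by (simp add: norm_mult inner_commute)
      moreover have "1 \<le> 2 * pi" using pi_gt3 by simp
      ultimately have "\<bar>\<omega> \<bullet> b\<bar> * cmod (fourier f \<omega>) \<le> cmod (fourier (partial_deriv b f) \<omega>)"
        using mult_right_mono[of 1 "2 * pi" "\<bar>\<omega> \<bullet> b\<bar> * cmod (fourier f \<omega>)"] by simp
      then have "(1 + norm \<omega>) ^ N * (\<bar>\<omega> \<bullet> b\<bar> * cmod (fourier f \<omega>)) \<le> (1 + norm \<omega>) ^ N * cmod (fourier (partial_deriv b f) \<omega>)"
        by (intro mult_left_mono) auto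
      also have "\<dots> \<le> C * schwartz_seminorm M (partial_deriv b f)" by (rule IH[OF schwartz_partial[OF f b]])
      also have "\<dots> \<le> C * ?P" by (intro mult_left_mono seminorm_partial f b C)
      finally show ?thesis .
    qed
    have "norm \<omega> \<le> (\<Sum>b\<in>Basis. \<bar>\<omega> \<bullet> b\<bar>)" by (rule norm_le_l1)
    then have "(1 + norm \<omega>) ^ Suc N * cmod (fourier f \<omega>)
       \<le> ((1 + norm \<omega>) ^ N * cmod (fourier f \<omega>)) * (1 + (\<Sum>b\<in>Basis. \<bar>\<omega> \<bullet> b\<bar>))"
      using mult_left_mono[of "1 + norm \<omega>" "1 + (\<Sum>b\<in>Basis. \<bar>\<omega> \<bullet> b\<bar>)" "(1 + norm \<omega>) ^ N * cmod (fourier f \<omega>)"]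
      by (simp add: mult_ac)
    also have "\<dots> = (1 + norm \<omega>) ^ N * cmod (fourier f \<omega>) + (\<Sum>b\<in>Basis. (1 + norm \<omega>) ^ N * (\<bar>\<omega> \<bullet> b\<bar> * cmod (fourier f \<omega>)))"
      by (simp add: distrib_left sum_distrib_left mult_ac)
    also have "\<dots> \<le> C * ?P + (\<Sum>b\<in>(Basis::'a set). C * ?P)"
      using order_trans[OF IH[OF f] mult_left_mono[OF seminorm_mono[OF f, of M "Suc M"] C]]
      by (intro add_mono sum_mono c) auto
    finally show ?thesis by (simp add: algebra_simps)
  qed
  then show ?case using C by (intro exI[of _ "C * (1 + DIM('a))"]) auto
qed

primrec coordinate_mult :: "'a::euclidean_space list \<Rightarrow> ('a \<Rightarrow> complex) \<Rightarrow> 'a \<Rightarrow> complex" where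
  "coordinate_mult [] f = f"
| "coordinate_mult (b # bs) f = (\<lambda>t. (- 2 * pi * \<i>) * (coordinate_mult bs f t * of_real (t \<bullet> b)))"

lemma schwartz_coordinate_mult:
  "f \<in> schwartz \<Longrightarrow> set bs \<subseteq> Basis \<Longrightarrow> coordinate_mult bs f \<in> schwartz"
  by (induction bs) (auto intro!: schwartz_cmult[of _ "- 2 * pi * \<i>"] schwartz_coordinate simp only: coordinate_mult.simps list.set insert_subset)

lemma iter_deriv_fourier:
  "f \<in> schwartz \<Longrightarrow> set bs \<subseteq> Basis \<Longrightarrow> iter_deriv bs (fourier f) = fourier (coordinate_mult bs f)"
  by (induction bs) (auto simp: partial_deriv_fourier schwartz_coordinate_mult)

lemma seminorm_coordinate_mult:
  "\<exists>C\<ge>0. \<forall>f\<in>schwartz. \<forall>bs::'a::euclidean_space list. set bs \<subseteq> Basis \<longrightarrow> length bs = n \<longrightarrow>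
    schwartz_seminorm M (coordinate_mult bs f) \<le> C * schwartz_seminorm (M + n) f"
proof (induction n arbitrary: M)
  case 0
  then show ?case by (auto intro!: exI[of _ 1])
next
  case (Suc n)
  obtain C where C: "0 \<le> C" and IH: "\<And>f (bs::'a list). f \<in> schwartz \<Longrightarrow> set bs \<subseteq> Basis \<Longrightarrow> length bs = n \<Longrightarrow>
    schwartz_seminorm (Suc M) (coordinate_mult bs f) \<le> C * schwartz_seminorm (Suc M + n) f"
    using Suc[of "Suc M"] by metis
  have "schwartz_seminorm M (coordinate_mult bs f) \<le> (2 * pi * 2 ^ M * C) * schwartz_seminorm (M + Suc n) f"
    if f: "f \<in> schwartz" and bs: "set bs \<subseteq> Basis" "length bs = Suc n" for f :: "'a \<Rightarrow> complex" and bs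
  proof -
    obtain b cs where [simp]: "bs = b # cs" using bs by (cases bs) auto
    have b: "b \<in> Basis" and cs: "set cs \<subseteq> Basis" "length cs = n" using bs by auto
    note h = schwartz_coordinate_mult[OF f cs(1)]
    have "schwartz_seminorm M (coordinate_mult bs f) \<le> 2 * pi * schwartz_seminorm M (\<lambda>t. coordinate_mult cs f t * of_real (t \<bullet> b))"
      using seminorm_cmult[OF schwartz_coordinate[OF h b], of M "- 2 * pi * \<i>"] by (simp add: norm_mult)
    also have "\<dots> \<le> 2 * pi * (2 ^ M * (C * schwartz_seminorm (Suc M + n) f))"
      using order_trans[OF seminorm_coordinate[OF h b, of M] mult_left_mono[OF IH[OF f cs], of "2 ^ M"]]
      by (intro mult_left_mono) auto
    finally show ?thesis by (simp add: mult_ac)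
  qed
  then show ?case using C by (intro exI[of _ "2 * pi * 2 ^ M * C"]) auto
qed

text \<open>
  Decay of the transform costs derivatives of the function, and derivatives of the transform cost
  powers of its argument; a seminorm of higher order pays for both.
\<close>

lemma
  shows schwartz_fourier: "\<And>f. f \<in> schwartz \<Longrightarrow> fourier f \<in> (schwartz :: ('a::euclidean_space \<Rightarrow> complex) set)"
    and seminorm_fourier: "\<exists>C\<ge>0. \<exists>M. \<forall>f\<in>(schwartz :: ('a \<Rightarrow> complex) set).
      schwartz_seminorm N (fourier f) \<le> C * schwartz_seminorm M f"
proof -
  have *: "\<exists>C\<ge>0. \<exists>M. \<forall>f\<in>schwartz. \<forall>\<omega>::'a. \<forall>bs. set bs \<subseteq> Basis \<longrightarrow> length bs \<le> n \<longrightarrow>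
      (1 + norm \<omega>) ^ N * cmod (iter_deriv bs (fourier f) \<omega>) \<le> C * schwartz_seminorm M f" for n N
  proof -
    obtain C M where C: "0 \<le> C" and CM: "\<And>f (\<omega>::'a). f \<in> schwartz \<Longrightarrow> (1 + norm \<omega>) ^ N * cmod (fourier f \<omega>) \<le> C * schwartz_seminorm M f"
      using fourier_decay[of N] by metis
    obtain D where D: "\<And>n. 0 \<le> D n" and DM: "\<And>n f (bs::'a list). f \<in> schwartz \<Longrightarrow> set bs \<subseteq> Basis \<Longrightarrow> length bs = n \<Longrightarrow>
        schwartz_seminorm M (coordinate_mult bs f) \<le> D n * schwartz_seminorm (M + n) f"
      using seminorm_coordinate_mult[of _ M] by metis
    have "(1 + norm \<omega>) ^ N * cmod (iter_deriv bs (fourier f) \<omega>) \<le> C * (\<Sum>k\<le>n. D k) * schwartz_seminorm (M + n) f"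
      if f: "f \<in> schwartz" and bs: "set bs \<subseteq> Basis" "length bs \<le> n" for f and \<omega> :: 'a and bs
    proof -
      have "(1 + norm \<omega>) ^ N * cmod (iter_deriv bs (fourier f) \<omega>) \<le> C * schwartz_seminorm M (coordinate_mult bs f)"
        unfolding iter_deriv_fourier[OF f bs(1)] by (rule CM[OF schwartz_coordinate_mult[OF f bs(1)]])
      also have "\<dots> \<le> C * (D (length bs) * schwartz_seminorm (M + length bs) f)"
        by (intro mult_left_mono DM f bs C) auto
      also have "\<dots> \<le> C * ((\<Sum>k\<le>n. D k) * schwartz_seminorm (M + n) f)"
        by (intro mult_left_mono mult_mono C seminorm_mono f member_le_sum D sum_nonneg seminorm_nonneg) (use bs in auto)
      finally show ?thesis by (simp add: mult.assoc)
    qed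
    moreover have "0 \<le> C * (\<Sum>k\<le>n. D k)" using C D by (simp add: sum_nonneg)
    ultimately show ?thesis by blast
  qed
  show S: "fourier f \<in> schwartz" if f: "f \<in> schwartz" for f :: "'a \<Rightarrow> complex"
  proof (rule schwartzI)
    show "smooth (fourier f)"
      by (rule smooth_coinduct[of _ "fourier ` schwartz"])
        (auto simp only: f fourier_differentiable partial_deriv_fourier
          intro!: imageI schwartz_cmult[of _ "- 2 * pi * \<i>"] schwartz_coordinate)
    fix bs :: "'a list" and N assume "set bs \<subseteq> Basis"
    then show "\<exists>B. \<forall>\<omega>. (1 + norm \<omega>) ^ N * cmod (iter_deriv bs (fourier f) \<omega>) \<le> B"
      using *[of "length bs" N] f by (metis order_refl)
  qed
  obtain C M where C: "0 \<le> C" and CM: "\<And>f (\<omega>::'a) bs. f \<in> schwartz \<Longrightarrow> set bs \<subseteq> Basis \<Longrightarrow> length bs \<le> N \<Longrightarrow>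
      (1 + norm \<omega>) ^ N * cmod (iter_deriv bs (fourier f) \<omega>) \<le> C * schwartz_seminorm M f"
    using *[of N N] by metis
  show "\<exists>C\<ge>0. \<exists>M. \<forall>f\<in>(schwartz :: ('a \<Rightarrow> complex) set). schwartz_seminorm N (fourier f) \<le> C * schwartz_seminorm M f"
    using C CM by (intro exI[of _ C] conjI exI[of _ M] ballI seminorm_le) auto
qed

section \<open>Fourier inversion and the Plancherel identity\<close>

lemma integrable_tensor:
  fixes f :: "'a::euclidean_space \<Rightarrow> complex" and h :: "'b::euclidean_space \<Rightarrow> complex"
  assumes f: "integrable lborel f" and h: "integrable lborel h"
  shows "integrable (lborel \<Otimes>\<^sub>M lborel) (\<lambda>(x, y). f x * h y)"
proof (rule lborel_pair.Fubini_integrable)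
  have [measurable]: "f \<in> borel_measurable borel" "h \<in> borel_measurable borel" using f h by auto
  show "(\<lambda>(x, y). f x * h y) \<in> borel_measurable (lborel \<Otimes>\<^sub>M lborel)" by measurable
  show "integrable lborel (\<lambda>x. LINT y|lborel. norm (case (x, y) of (x, y) \<Rightarrow> f x * h y))"
    using f by (simp add: norm_mult)
  show "AE x in lborel. integrable lborel (\<lambda>y. case (x, y) of (x, y) \<Rightarrow> f x * h y)"
    using h by simp
qed

lemma integrable_tensor_dominated:
  fixes f :: "'a::euclidean_space \<Rightarrow> complex" and h :: "'b::euclidean_space \<Rightarrow> complex"
  assumes f: "integrable lborel f" and h: "integrable lborel h"
    and "k \<in> borel_measurable (lborel \<Otimes>\<^sub>M lborel)"
    and "\<And>x y. cmod (k (x, y)) \<le> cmod (f x) * cmod (h y)"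
  shows "integrable (lborel \<Otimes>\<^sub>M lborel) k"
  by (rule Bochner_Integration.integrable_bound[OF integrable_tensor[OF f h] assms(3)])
    (use assms(4) in \<open>auto simp: norm_mult\<close>)

text \<open>
  Both sides are the double integral of \<open>f x\<close> and \<open>h y\<close> against the symmetric kernel
  \<open>modulation y x\<close>.
\<close>

lemma fourier_duality:
  fixes f h :: "'a::euclidean_space \<Rightarrow> complex"
  assumes f: "integrable lborel f" and h: "integrable lborel h"
  shows "(LINT y|lborel. fourier f y * h y) = (LINT x|lborel. f x * fourier h x)"
proof -
  have [measurable]: "f \<in> borel_measurable borel" "h \<in> borel_measurable borel" using f h by auto
  have "integrable (lborel \<Otimes>\<^sub>M lborel) (\<lambda>(x, y). f x * modulation y x * h y)"
    by (rule integrable_tensor_dominated[OF f h]) (auto simp: norm_mult split_beta')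
  from lborel_pair.Fubini_integral[OF this]
  have "(LINT y|lborel. (LINT x|lborel. f x * modulation y x * h y)) = (LINT x|lborel. (LINT y|lborel. f x * modulation y x * h y))"
    by simp
  then show ?thesis
    unfolding fourier_eq
    by (subst (asm) integral_mult_left_zero)
      (simp add: mult.assoc, simp only: integral_mult_right_zero[symmetric] modulation_commute mult.commute)
qed

lemma modulation_prod: "modulation s (\<omega>::'a::euclidean_space) = (\<Prod>b\<in>Basis. cis (- (2 * pi * (s \<bullet> b)) * (\<omega> \<bullet> b)))"
proof -
  have "(\<Prod>b\<in>Basis. cis (- (2 * pi * (s \<bullet> b)) * (\<omega> \<bullet> b))) = cis (\<Sum>b\<in>Basis. - (2 * pi * (s \<bullet> b)) * (\<omega> \<bullet> b))"
    by (simp add: cis_eq_exp exp_sum[symmetric] sum_distrib_left)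
  also have "(\<Sum>b\<in>Basis. - (2 * pi * (s \<bullet> b)) * (\<omega> \<bullet> b)) = - 2 * pi * (\<omega> \<bullet> s)"
    by (subst euclidean_inner) (simp add: sum_distrib_left sum_negf mult_ac)
  finally show ?thesis by (simp add: modulation_def)
qed

lemma
  fixes s \<epsilon> :: real
  assumes "0 < \<epsilon>"
  shows gaussian_integrable: "integrable lborel (\<lambda>u. complex_of_real (exp (- (\<epsilon> * u)\<^sup>2 / 2)) * cis (s * u))"
    and gaussian_integral: "(LINT u|lborel. complex_of_real (exp (- (\<epsilon> * u)\<^sup>2 / 2)) * cis (s * u)) =
      of_real (sqrt (2 * pi) / \<epsilon> * exp (- (s / \<epsilon>)\<^sup>2 / 2))"
proof -
  define F where "F s u = complex_of_real (exp (- u\<^sup>2 / 2)) * cis (s * u)" for s u :: real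
  have eq: "F s u = of_real (sqrt (2 * pi)) * (std_normal_density u *\<^sub>R iexp (s * u))" for s u
    by (simp add: F_def std_normal_density_def cis_eq_exp scaleR_conv_of_real)
  have [measurable]: "(\<lambda>u. cis (s * u)) \<in> borel_measurable borel" for s
    by (intro borel_measurable_continuous_onI continuous_on_cis continuous_intros)
  have "integrable lborel std_normal_density"
    using integrable_std_normal_moment[of 0] by (simp only: power_0 mult_1_right)
  then have int: "integrable lborel (\<lambda>u. std_normal_density u *\<^sub>R iexp (s * u))" for s
    by (rule Bochner_Integration.integrable_bound)
      (auto simp: abs_mult normal_density_nonneg cis_eq_exp[symmetric])
  have iF: "integrable lborel (F s)" for s unfolding eq by (intro integrable_mult_right int)
  \<comment> \<open>The integral is the characteristic function of the standard normal distribution, rescaled.\<close>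
  have "char std_normal_distribution s = (LINT u|lborel. std_normal_density u *\<^sub>R iexp (s * u))" for s
    unfolding char_def
    by (subst integral_density) (auto simp: normal_density_nonneg cis_eq_exp[symmetric])
  then have "(LINT u|lborel. F s u) = of_real (sqrt (2 * pi)) * char std_normal_distribution s" for s
    unfolding eq by (simp only: integral_mult_right_zero)
  then have vF: "(LINT u|lborel. F s u) = of_real (sqrt (2 * pi) * exp (- s\<^sup>2 / 2))" for s
    by (simp add: char_std_normal_distribution)
  have "integrable lborel (\<lambda>u. F (s / \<epsilon>) (0 + \<epsilon> * u))"
    using assms by (intro lborel_integrable_real_affine iF) simp
  then show "integrable lborel (\<lambda>u. complex_of_real (exp (- (\<epsilon> * u)\<^sup>2 / 2)) * cis (s * u))"
    using assms by (simp add: F_def)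
  have "(LINT u|lborel. F (s / \<epsilon>) u) = \<epsilon> *\<^sub>R (LINT u|lborel. F (s / \<epsilon>) (0 + \<epsilon> * u))"
    using lborel_integral_real_affine[of \<epsilon> "F (s / \<epsilon>)" 0] assms by simp
  then have "of_real (sqrt (2 * pi) * exp (- (s / \<epsilon>)\<^sup>2 / 2)) = of_real \<epsilon> * (LINT u|lborel. F (s / \<epsilon>) (\<epsilon> * u))"
    unfolding vF by (simp add: scaleR_conv_of_real)
  then have "(LINT u|lborel. F (s / \<epsilon>) (\<epsilon> * u)) = of_real (sqrt (2 * pi) * exp (- (s / \<epsilon>)\<^sup>2 / 2)) / of_real \<epsilon>"
    using assms by (simp add: field_simps)
  then show "(LINT u|lborel. complex_of_real (exp (- (\<epsilon> * u)\<^sup>2 / 2)) * cis (s * u)) =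
      of_real (sqrt (2 * pi) / \<epsilon> * exp (- (s / \<epsilon>)\<^sup>2 / 2))"
    using assms by (simp add: F_def)
qed

definition gaussian :: "real \<Rightarrow> 'a::euclidean_space \<Rightarrow> complex" where
  "gaussian \<epsilon> \<omega> = (\<Prod>b\<in>Basis. of_real (exp (- (\<epsilon> * (\<omega> \<bullet> b))\<^sup>2 / 2)))"

definition gaussian_kernel :: "real \<Rightarrow> 'a::euclidean_space \<Rightarrow> complex" where
  "gaussian_kernel \<epsilon> s = (\<Prod>b\<in>Basis. of_real (sqrt (2 * pi) / \<epsilon> * exp (- (2 * pi * (s \<bullet> b) / \<epsilon>)\<^sup>2 / 2)))"

text \<open>The integral factors over the coordinates.\<close>

lemma
  assumes "0 < \<epsilon>"
  shows integrable_gaussian: "integrable lborel (\<lambda>\<omega>. gaussian \<epsilon> \<omega> * modulation s \<omega>)"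
    and fourier_gaussian: "fourier (gaussian \<epsilon>) s = gaussian_kernel \<epsilon> s"
proof -
  have eq: "gaussian \<epsilon> \<omega> * modulation s \<omega> =
     (\<Prod>b\<in>Basis. of_real (exp (- (\<epsilon> * (\<omega> \<bullet> b))\<^sup>2 / 2)) * cis (- (2 * pi * (s \<bullet> b)) * (\<omega> \<bullet> b)))" for \<omega>
    by (simp add: gaussian_def modulation_prod prod.distrib)
  show "integrable lborel (\<lambda>\<omega>. gaussian \<epsilon> \<omega> * modulation s \<omega>)"
    unfolding eq by (rule integrable_prod_Basis[OF gaussian_integrable[OF assms]])
  show "fourier (gaussian \<epsilon>) s = gaussian_kernel \<epsilon> s"
    unfolding fourier_eq eq gaussian_kernel_def
    by (subst integral_prod_Basis[OF gaussian_integrable[OF assms]])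
      (simp only: gaussian_integral[OF assms], simp)
qed

lemma
  shows integrable_gaussian_kernel: "integrable lborel (gaussian_kernel 1)"
    and integral_gaussian_kernel: "(LINT s|lborel. gaussian_kernel 1 s) = 1"
proof -
  have i: "integrable lborel (\<lambda>y. complex_of_real (sqrt (2 * pi) / 1 * exp (- (2 * pi * y / 1)\<^sup>2 / 2)))"
    using integrable_mult_right[OF gaussian_integrable[of "2 * pi" 0], of "of_real (sqrt (2 * pi))"] by simp
  have "(LINT y|lborel. complex_of_real (exp (- (2 * pi * y)\<^sup>2 / 2))) = of_real (sqrt (2 * pi) / (2 * pi))"
    using gaussian_integral[of "2 * pi" 0] by simp
  then have "(LINT y|lborel. complex_of_real (sqrt (2 * pi) / 1 * exp (- (2 * pi * y / 1)\<^sup>2 / 2))) = of_real (sqrt (2 * pi) * (sqrt (2 * pi) / (2 * pi)))"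
    by (simp only: of_real_mult integral_mult_right_zero div_by_1)
  also have "sqrt (2 * pi) * (sqrt (2 * pi) / (2 * pi)) = 1"
    using real_sqrt_mult_self[of "2 * pi"] by (simp del: real_sqrt_mult_self)
  finally have v: "(LINT y|lborel. complex_of_real (sqrt (2 * pi) / 1 * exp (- (2 * pi * y / 1)\<^sup>2 / 2))) = 1" by simp
  show "integrable lborel (gaussian_kernel 1)"
    unfolding gaussian_kernel_def[abs_def] by (rule integrable_prod_Basis[OF i])
  show "(LINT s|lborel. gaussian_kernel 1 s) = 1"
    unfolding gaussian_kernel_def[abs_def] by (subst integral_prod_Basis[OF i]) (simp only: v, simp)
qed

lemma gaussian_le: "cmod (gaussian \<epsilon> \<omega>) \<le> 1"
  unfolding gaussian_def prod_norm[symmetric] by (rule prod_le_1) auto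

lemma gaussian_measurable [measurable]: "gaussian \<epsilon> \<in> borel_measurable borel"
  unfolding gaussian_def[abs_def] by (intro borel_measurable_prod) measurable

lemma gaussian_kernel_measurable [measurable]: "gaussian_kernel \<epsilon> \<in> borel_measurable borel"
  unfolding gaussian_kernel_def[abs_def] by (intro borel_measurable_prod) measurable

text \<open>
  Both sides are the limit for \<open>\<epsilon> \<rightarrow> 0\<close> of the integral of the transform against a wide Gaussian:
  by duality this is a mean of \<open>f\<close> near \<open>x\<close>.
\<close>

lemma fourier_inversion:
  fixes f :: "'a::euclidean_space \<Rightarrow> complex"
  assumes f: "f \<in> schwartz"
  shows "(LINT \<omega>|lborel. fourier f \<omega> * cnj (modulation x \<omega>)) = f x"
proof -
  define \<epsilon> where "\<epsilon> n = 1 / real (Suc n)" for n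
  have \<epsilon>: "0 < \<epsilon> n" for n by (simp add: \<epsilon>_def)
  have \<epsilon>0: "\<epsilon> \<longlonglongrightarrow> 0" unfolding \<epsilon>_def by (rule LIMSEQ_Suc[OF lim_1_over_n])
  note [measurable] = schwartz_borel[OF f]
  have fi: "integrable lborel (fourier f)" by (intro schwartz_integrable schwartz_fourier f)
  define h where "h n \<omega> = gaussian (\<epsilon> n) \<omega> * cnj (modulation x \<omega>)" for n \<omega>
  have hi: "integrable lborel (h n)" for n
    using integrable_gaussian[OF \<epsilon>, of n "- x"] by (simp add: h_def[abs_def] modulation_minus_left)
  have hf: "fourier (h n) t = gaussian_kernel (\<epsilon> n) (t - x)" for n t
  proof -
    have "h n \<omega> * modulation t \<omega> = gaussian (\<epsilon> n) \<omega> * modulation (t - x) \<omega>" for \<omega>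
      using modulation_add_left[of t "- x" \<omega>] by (simp add: h_def modulation_minus_left mult_ac)
    then show ?thesis using fourier_gaussian[OF \<epsilon>, of n "t - x"] by (simp add: fourier_eq)
  qed
  have scale: "(\<epsilon> n ^ DIM('a)) *\<^sub>R gaussian_kernel (\<epsilon> n) (\<epsilon> n *\<^sub>R s) = gaussian_kernel 1 s" for n and s :: 'a
  proof -
    have "complex_of_real (\<epsilon> n) ^ DIM('a) * gaussian_kernel (\<epsilon> n) (\<epsilon> n *\<^sub>R s) =
      (\<Prod>b\<in>(Basis::'a set). complex_of_real (\<epsilon> n)) * gaussian_kernel (\<epsilon> n) (\<epsilon> n *\<^sub>R s)" by simp
    also have "\<dots> = gaussian_kernel 1 s"
      unfolding gaussian_kernel_def prod.distrib[symmetric] using \<epsilon>[of n]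
      by (intro prod.cong refl) (simp add: field_simps)
    finally show ?thesis by (simp add: scaleR_conv_of_real)
  qed
  have eq: "(LINT \<omega>|lborel. fourier f \<omega> * h n \<omega>) = (LINT s|lborel. f (x + \<epsilon> n *\<^sub>R s) * gaussian_kernel 1 s)" for n
  proof -
    have "integrable lborel (\<lambda>t. f t * fourier (h n) t)"
    proof (rule Bochner_Integration.integrable_bound[OF integrable_mult_right[OF integrable_norm[OF schwartz_integrable[OF f]]]])
      show "(\<lambda>t. f t * fourier (h n) t) \<in> borel_measurable lborel"
        using hi[of n] by measurable
      show "AE t in lborel. cmod (f t * fourier (h n) t) \<le> norm ((LINT t|lborel. cmod (h n t)) * cmod (f t))"
        using fourier_bound[OF hi[of n]] by (auto simp: norm_mult mult.commute intro!: mult_left_mono order_trans[OF _ abs_ge_self])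
    qed
    from integral_affine[OF this, of "\<epsilon> n" x]
    have "(LINT t|lborel. f t * fourier (h n) t) = (\<bar>\<epsilon> n\<bar> ^ DIM('a)) *\<^sub>R (LINT s|lborel. f (x + \<epsilon> n *\<^sub>R s) * fourier (h n) (x + \<epsilon> n *\<^sub>R s))"
      using \<epsilon>[of n] by simp
    also have "\<dots> = (LINT s|lborel. f (x + \<epsilon> n *\<^sub>R s) * gaussian_kernel 1 s)"
      unfolding integral_scaleR_right[symmetric] hf scale[of n, symmetric] using \<epsilon>[of n] by simp
    finally show ?thesis unfolding fourier_duality[OF schwartz_integrable[OF f] hi] .
  qed
  have "(\<lambda>n. LINT \<omega>|lborel. fourier f \<omega> * h n \<omega>) \<longlonglongrightarrow> (LINT \<omega>|lborel. fourier f \<omega> * cnj (modulation x \<omega>))"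
  proof (rule integral_dominated_convergence[where w="\<lambda>\<omega>. cmod (fourier f \<omega>)"])
    show "AE \<omega> in lborel. (\<lambda>n. fourier f \<omega> * h n \<omega>) \<longlonglongrightarrow> fourier f \<omega> * cnj (modulation x \<omega>)"
    proof (rule AE_I2)
      fix \<omega>
      have "(\<lambda>n. gaussian (\<epsilon> n) \<omega>) \<longlonglongrightarrow> (\<Prod>b\<in>(Basis::'a set). complex_of_real (exp (- (0 * (\<omega> \<bullet> b))\<^sup>2 / 2)))"
        unfolding gaussian_def by (intro tendsto_intros \<epsilon>0) auto
      then show "(\<lambda>n. fourier f \<omega> * h n \<omega>) \<longlonglongrightarrow> fourier f \<omega> * cnj (modulation x \<omega>)"
        unfolding h_def by (auto intro!: tendsto_eq_intros)
    qed
    show "AE \<omega> in lborel. cmod (fourier f \<omega> * h n \<omega>) \<le> cmod (fourier f \<omega>)" for n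
      by (rule AE_I2) (simp add: h_def norm_mult mult_left_le gaussian_le)
    show "(\<lambda>\<omega>. fourier f \<omega> * h n \<omega>) \<in> borel_measurable lborel" for n
      using hi[of n] by measurable
    show "(\<lambda>\<omega>. fourier f \<omega> * cnj (modulation x \<omega>)) \<in> borel_measurable lborel"
      unfolding modulation_minus_left[symmetric] by measurable
  qed (use fi in auto)
  moreover have "(\<lambda>n. LINT s|lborel. f (x + \<epsilon> n *\<^sub>R s) * gaussian_kernel 1 s) \<longlonglongrightarrow> (LINT s|lborel. f x * gaussian_kernel 1 (s::'a))"
  proof (rule integral_dominated_convergence[where w="\<lambda>s. schwartz_seminorm 0 f * cmod (gaussian_kernel 1 s)"])
    show "AE s in lborel. (\<lambda>n. f (x + \<epsilon> n *\<^sub>R s) * gaussian_kernel 1 s) \<longlonglongrightarrow> f x * gaussian_kernel 1 s"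
    proof (rule AE_I2)
      fix s
      have "isCont f (x + 0 *\<^sub>R s)"
        using schwartz_continuous_on[OF f, of UNIV] by (simp add: continuous_on_eq_continuous_at)
      moreover have "(\<lambda>n. x + \<epsilon> n *\<^sub>R s) \<longlonglongrightarrow> x + 0 *\<^sub>R s" by (intro tendsto_intros \<epsilon>0)
      ultimately have "(\<lambda>n. f (x + \<epsilon> n *\<^sub>R s)) \<longlonglongrightarrow> f x"
        using isCont_tendsto_compose by fastforce
      then show "(\<lambda>n. f (x + \<epsilon> n *\<^sub>R s) * gaussian_kernel 1 s) \<longlonglongrightarrow> f x * gaussian_kernel 1 s"
        by (intro tendsto_intros)
    qed
    show "AE s in lborel. cmod (f (x + \<epsilon> n *\<^sub>R s) * gaussian_kernel 1 s) \<le> schwartz_seminorm 0 f * cmod (gaussian_kernel 1 s)" for n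
      using schwartz_decay[OF f, of _ 0] by (auto simp: norm_mult intro!: mult_right_mono)
  qed (use integrable_gaussian_kernel in auto)
  ultimately show ?thesis
    unfolding eq using LIMSEQ_unique integral_gaussian_kernel by fastforce
qed

lemma fourier_fourier:
  assumes f: "f \<in> schwartz" shows "fourier (fourier f) x = f (- x)"
  using fourier_inversion[OF f, of "- x"]
  by (simp add: fourier_eq[of "fourier f"] modulation_minus_left)

definition inverse_fourier :: "('a::euclidean_space \<Rightarrow> complex) \<Rightarrow> 'a \<Rightarrow> complex" where
  "inverse_fourier f = (\<lambda>x. fourier f (- x))"

lemma schwartz_inverse_fourier: "f \<in> schwartz \<Longrightarrow> inverse_fourier f \<in> schwartz"
  unfolding inverse_fourier_def by (intro schwartz_reflect schwartz_fourier)

lemma inverse_fourier_eq: "inverse_fourier f x = (LINT \<omega>|lborel. f \<omega> * cnj (modulation x \<omega>))"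
  by (simp add: inverse_fourier_def fourier_eq modulation_minus_left)

lemma inverse_fourier_fourier: "f \<in> schwartz \<Longrightarrow> inverse_fourier (fourier f) = f"
  by (simp add: inverse_fourier_eq fun_eq_iff fourier_inversion)

lemma fourier_reflect:
  assumes "integrable lborel f"
  shows "fourier (\<lambda>x. f (- x)) \<omega> = fourier f (- \<omega>)"
  using integral_affine[OF integrable_modulation[OF assms, of "- \<omega>"], of "-1" 0]
  by (simp add: fourier_eq modulation_minus modulation_minus_left)

lemma fourier_inverse_fourier: "f \<in> schwartz \<Longrightarrow> fourier (inverse_fourier f) = f"
  by (simp add: inverse_fourier_def fun_eq_iff fourier_reflect schwartz_integrable schwartz_fourier fourier_fourier)

lemma cnj_fourier: "cnj (fourier f x) = inverse_fourier (\<lambda>t. cnj (f t)) x"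
proof -
  have "cnj (fourier f x) = (LINT t|lborel. cnj (f t * modulation x t))"
    unfolding fourier_eq by (simp only: Bochner_Integration.integral_cnj)
  then show ?thesis by (simp add: inverse_fourier_eq modulation_commute[of x])
qed

lemma fourier_cnj_fourier:
  assumes "f \<in> schwartz" shows "fourier (\<lambda>x. cnj (fourier f x)) = (\<lambda>t. cnj (f t))"
  unfolding cnj_fourier using assms by (simp add: fourier_inverse_fourier schwartz_cnj)

lemma schwartz_square_integrable:
  assumes "f \<in> schwartz" shows "integrable lborel (\<lambda>t. (cmod (f t))\<^sup>2)"
proof -
  have "integrable lborel (\<lambda>t. f t * cnj (f t))"
    using assms by (intro schwartz_integrable schwartz_mult schwartz_cnj)
  then have "integrable lborel (\<lambda>t. complex_of_real ((cmod (f t))\<^sup>2))"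
    by (simp only: complex_norm_square)
  then show ?thesis by (simp only: complex_of_real_integrable_eq)
qed

lemma plancherel_schwartz:
  assumes f: "f \<in> schwartz"
  shows "(LINT \<omega>|lborel. (cmod (fourier f \<omega>))\<^sup>2) = (LINT t|lborel. (cmod (f t))\<^sup>2)"
proof -
  have "(LINT \<omega>|lborel. fourier f \<omega> * cnj (fourier f \<omega>)) = (LINT t|lborel. f t * cnj (f t))"
    using fourier_duality[OF schwartz_integrable[OF f], of "\<lambda>x. cnj (fourier f x)"]
      schwartz_integrable[OF schwartz_cnj[OF schwartz_fourier[OF f]]]
    by (simp add: fourier_cnj_fourier[OF f])
  then have "complex_of_real (LINT \<omega>|lborel. (cmod (fourier f \<omega>))\<^sup>2) = of_real (LINT t|lborel. (cmod (f t))\<^sup>2)"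
    by (simp only: complex_norm_square[symmetric] integral_complex_of_real)
  then show ?thesis by (simp only: of_real_eq_iff)
qed

section \<open>Test functions\<close>

definition test_functions :: "('a::euclidean_space \<Rightarrow> complex) set" where
  "test_functions = {\<eta>. smooth \<eta> \<and> compact (closure {x. \<eta> x \<noteq> 0})}"

lemma test_functionsI:
  assumes "smooth \<eta>" "\<And>x. r < norm x \<Longrightarrow> \<eta> x = 0"
  shows "\<eta> \<in> test_functions"
proof -
  have "{x. \<eta> x \<noteq> 0} \<subseteq> cball 0 r" using assms(2) by (force simp: not_less[symmetric])
  then have "bounded {x. \<eta> x \<noteq> 0}" using bounded_cball bounded_subset by blast
  then show ?thesis by (simp add: test_functions_def assms(1) compact_closure)
qed

lemma test_functions_support:
  assumes "\<eta> \<in> test_functions" shows "\<exists>r>0. \<forall>x. r < norm x \<longrightarrow> \<eta> x = 0"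
proof -
  have "bounded {x. \<eta> x \<noteq> 0}"
    using assms by (simp add: test_functions_def compact_closure)
  then obtain r where "r > 0" "\<forall>x\<in>{x. \<eta> x \<noteq> 0}. norm x \<le> r"
    using bounded_pos by blast
  then show ?thesis by (intro exI[of _ r]) force
qed

lemma partial_deriv_local:
  assumes "\<And>x. r < norm x \<Longrightarrow> f x = 0" "r < norm x"
  shows "partial_deriv b f x = 0"
proof -
  have "open {x::'a. r < norm x}" by (intro open_Collect_less continuous_intros)
  then have "(f has_derivative (\<lambda>h. 0)) (at x)"
    by (rule has_derivative_transform_within_open[OF has_derivative_const[of 0]]) (use assms in auto)
  from frechet_derivative_at[OF this] show ?thesis by (metis partial_deriv_def)
qed

lemma test_functions_schwartz:
  assumes "\<eta> \<in> test_functions" shows "\<eta> \<in> schwartz"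
proof (rule schwartzI)
  show s: "smooth \<eta>" using assms by (simp add: test_functions_def)
  obtain r where r: "\<forall>x. r < norm x \<longrightarrow> \<eta> x = 0" using test_functions_support[OF assms] by blast
  fix bs :: "'a list" and N assume bs: "set bs \<subseteq> Basis"
  have 0: "iter_deriv bs \<eta> x = 0" if "r < norm x" for x
    using that by (induction bs arbitrary: x) (auto simp: r intro: partial_deriv_local)
  have "continuous_on (cball 0 r) (\<lambda>x. (1 + norm x) ^ N * cmod (iter_deriv bs \<eta> x))"
    using smooth_continuous_on[OF smooth_iter_deriv[OF s bs]] by (intro continuous_intros)
  then have "bounded ((\<lambda>x. (1 + norm x) ^ N * cmod (iter_deriv bs \<eta> x)) ` cball 0 r)"
    by (intro compact_imp_bounded compact_continuous_image) auto
  then obtain B where "B > 0" "\<forall>x\<in>cball 0 r. \<bar>(1 + norm x) ^ N * cmod (iter_deriv bs \<eta> x)\<bar> \<le> B"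
    unfolding bounded_pos by auto
  then have "(1 + norm x) ^ N * cmod (iter_deriv bs \<eta> x) \<le> B" for x
    using 0[of x] by (cases "r < norm x") (auto simp: not_less)
  then show "\<exists>B. \<forall>x. (1 + norm x) ^ N * cmod (iter_deriv bs \<eta> x) \<le> B" by blast
qed

lemma test_functions_mult:
  assumes "\<eta> \<in> test_functions" "smooth h" shows "(\<lambda>x. h x * \<eta> x) \<in> test_functions"
proof -
  obtain r where "\<forall>x. r < norm x \<longrightarrow> \<eta> x = 0" using test_functions_support[OF assms(1)] by blast
  with assms show ?thesis
    by (intro test_functionsI[of _ r] smooth_mult) (auto simp: test_functions_def)
qed

text \<open>
  The functions \<open>exp (- 1 / x) / x\<^sup>k\<close>, extended by zero. This family is closed under derivatives
  up to linear combinations, which makes the bump smooth.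
\<close>

definition flat :: "nat \<Rightarrow> real \<Rightarrow> real" where
  "flat k x = (if x \<le> 0 then 0 else exp (- inverse x) * inverse x ^ k)"

lemma power_le_fact_exp: "0 \<le> x \<Longrightarrow> x ^ n \<le> fact n * exp (x::real)"
proof -
  assume x: "0 \<le> x"
  have "(\<Sum>k\<in>{n}. x ^ k /\<^sub>R fact k) \<le> (\<Sum>k. x ^ k /\<^sub>R fact k)"
    by (intro sum_le_suminf summable_exp_generic) (use x in auto)
  then show ?thesis by (simp add: exp_def field_simps)
qed

lemma flat_bound: "\<bar>flat k x\<bar> \<le> fact (k + 2) * x\<^sup>2"
proof (cases "0 < x")
  case True
  have "inverse x ^ (k + 2) * exp (- inverse x) \<le> fact (k + 2)"
    using power_le_fact_exp[of "inverse x" "k + 2"] True by (simp add: exp_minus field_simps)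
  then have "inverse x ^ (k + 2) * exp (- inverse x) * x\<^sup>2 \<le> fact (k + 2) * x\<^sup>2"
    by (intro mult_right_mono) auto
  moreover have "inverse x ^ (k + 2) * exp (- inverse x) * x\<^sup>2 = flat k x"
    using True by (simp add: flat_def power_add power2_eq_square field_simps)
  moreover have "0 \<le> flat k x" using True by (simp add: flat_def)
  ultimately show ?thesis by simp
qed (simp add: flat_def)

lemma flat_deriv: "(flat k has_real_derivative flat (k + 2) x - k * flat (k + 1) x) (at x)"
proof -
  consider "x < 0" | "x = 0" | "0 < x" by linarith
  then show ?thesis
  proof cases
    case 1
    have "((\<lambda>x. 0) has_real_derivative 0) (at x)" by simp
    then have "(flat k has_real_derivative 0) (at x)"
      by (rule DERIV_cong_ev[THEN iffD1, rotated 3])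
        (use 1 eventually_nhds_in_open[of "{..<0}" x] in \<open>auto simp: flat_def elim!: eventually_mono\<close>)
    then show ?thesis using 1 by (simp add: flat_def)
  next
    case 2
    have "((\<lambda>y. flat k y / y) \<longlongrightarrow> 0) (at 0)"
    proof (rule Lim_null_comparison)
      show "\<forall>\<^sub>F y in at 0. norm (flat k y / y) \<le> fact (k + 2) * \<bar>y\<bar>"
      proof (rule always_eventually, rule allI)
        fix y :: real
        show "norm (flat k y / y) \<le> fact (k + 2) * \<bar>y\<bar>"
          using flat_bound[of k y] by (cases "y = 0") (auto simp: abs_mult divide_le_eq power2_eq_square abs_mult_self_eq mult.assoc)
      qed
      show "((\<lambda>y. fact (k + 2) * \<bar>y\<bar>) \<longlongrightarrow> 0) (at (0::real))" by (auto intro!: tendsto_eq_intros)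
    qed
    then show ?thesis using 2 by (simp add: DERIV_def flat_def)
  next
    case 3
    have "((\<lambda>x. exp (- inverse x) * inverse x ^ k) has_real_derivative
        exp (- inverse x) * inverse x ^ (k + 2) - k * (exp (- inverse x) * inverse x ^ (k + 1))) (at x)"
      using 3 by (auto intro!: derivative_eq_intros simp: power_add power2_eq_square algebra_simps)
        (cases k; simp add: algebra_simps)
    then have "(flat k has_real_derivative
        exp (- inverse x) * inverse x ^ (k + 2) - k * (exp (- inverse x) * inverse x ^ (k + 1))) (at x)"
      by (rule DERIV_cong_ev[THEN iffD1, rotated 3])
        (use 3 eventually_nhds_in_open[of "{0<..}" x] in \<open>auto simp: flat_def elim!: eventually_mono\<close>)
    then show ?thesis using 3 by (simp add: flat_def)
  qed
qed

text \<open>The factor \<open>exp 1\<close> normalises the value at the origin to \<open>1\<close>.\<close>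

definition bump :: "'a::euclidean_space \<Rightarrow> real" where
  "bump t = exp 1 * flat 0 (1 - t \<bullet> t)"

lemma has_derivative_flat:
  "((\<lambda>t. complex_of_real (flat k (1 - t \<bullet> t))) has_derivative
    (\<lambda>h. of_real ((flat (k + 2) (1 - t \<bullet> t) - k * flat (k + 1) (1 - t \<bullet> t)) * (- 2 * (t \<bullet> h))))) (at t)"
proof -
  have "((\<lambda>t. 1 - t \<bullet> t) has_derivative (\<lambda>h. - 2 * (t \<bullet> h))) (at t)"
    by (auto intro!: derivative_eq_intros simp: inner_commute)
  from has_derivative_compose[OF this flat_deriv[unfolded has_field_derivative_def]]
  show ?thesis by (intro has_derivative_of_real) simp
qed

text \<open>
  The algebra generated by the smooth functions and all \<open>flat k (1 - |t|\<^sup>2)\<close> is closed under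
  partial derivatives.
\<close>

lemma smooth_bump: "smooth (\<lambda>t. complex_of_real (bump t))"
proof -
  let ?F = "\<lambda>k (t::'a). complex_of_real (flat k (1 - t \<bullet> t))"
  let ?B = "Collect smooth \<union> range ?F"
  have "?F 0 \<in> generated_algebra ?B" by (intro generated_algebra.base) auto
  then have "smooth (?F 0)"
  proof (rule smooth_generated_algebra[rotated 2])
    fix h assume h: "h \<in> ?B"
    then show "h differentiable_on UNIV"
      by (auto intro: smooth_differentiable differentiable_onI[OF differentiableI[OF has_derivative_flat]])
    fix b :: 'a assume b: "b \<in> Basis"
    from h consider "smooth h" | k where "h = ?F k" by auto
    then show "partial_deriv b h \<in> generated_algebra ?B"
    proof cases
      case 1
      then show ?thesis using smooth_partial[OF _ b] by (intro generated_algebra.base) auto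
    next
      case 2
      have "partial_deriv b h = (\<lambda>t. ?F (k + 2) t * ((- 2) * of_real (t \<bullet> b)) + ?F (k + 1) t * ((2 * of_nat k) * of_real (t \<bullet> b)))"
        unfolding 2 partial_deriv_eqI[OF has_derivative_flat] by (simp add: fun_eq_iff algebra_simps)
      moreover have "(\<lambda>t. c * complex_of_real (t \<bullet> b)) \<in> ?B" for c
        by (simp add: smooth_cmult smooth_linear)
      ultimately show ?thesis
        by (simp only:) (intro generated_algebra.add generated_algebra.mult generated_algebra.base; blast)
    qed
  qed
  then have "smooth (\<lambda>t. exp 1 * ?F 0 t)" by (rule smooth_cmult)
  moreover have "(\<lambda>t. exp 1 * ?F 0 t) = (\<lambda>t. complex_of_real (bump t))"
    by (simp add: bump_def exp_of_real[symmetric])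
  ultimately show ?thesis by simp
qed

lemma bump_eq: "bump t = (if norm t < 1 then exp (1 - inverse (1 - (norm t)\<^sup>2)) else 0)"
proof -
  have "t \<bullet> t = (norm t)\<^sup>2" by (simp add: power2_norm_eq_inner)
  moreover have "(norm t)\<^sup>2 < 1 \<longleftrightarrow> norm t < 1"
    using power2_less_imp_less[of "norm t" 1] by (auto simp: power_less_one_iff abs_square_less_1[symmetric])
  ultimately show ?thesis by (auto simp: bump_def flat_def exp_diff exp_minus field_simps not_le)
qed

lemma bump_nonneg: "0 \<le> bump t" by (simp add: bump_eq)
lemma bump_pos: "norm t < 1 \<Longrightarrow> 0 < bump t" by (simp add: bump_eq)
lemma bump_outside: "1 \<le> norm t \<Longrightarrow> bump t = 0" by (simp add: bump_eq)
lemma bump_le_1: "bump t \<le> 1"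
proof (cases "norm t < 1")
  case True
  then have "0 < 1 - (norm t)\<^sup>2" by (simp add: abs_square_less_1)
  moreover have "1 - (norm t)\<^sup>2 \<le> 1" by simp
  ultimately have "1 \<le> inverse (1 - (norm t)\<^sup>2)" by (simp add: one_le_inverse)
  then show ?thesis by (simp add: bump_eq)
qed (simp add: bump_eq)

lemma bump_near_1: "1 - bump t \<le> 2 * norm t"
proof (cases "norm t < 1 / 2")
  case True
  define q where "q = (norm t)\<^sup>2"
  have q: "0 \<le> q" "q \<le> norm t / 2" "q \<le> 1 / 4"
    using True mult_mono[of "norm t" "1/2" "norm t" "1/2"] mult_left_mono[of "norm t" "1/2" "norm t"]
    by (auto simp: q_def power2_eq_square)
  have "1 + (1 - inverse (1 - q)) \<le> bump t"
    using True exp_ge_add_one_self[of "1 - inverse (1 - q)"] by (simp add: bump_eq q_def)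
  moreover have "inverse (1 - q) \<le> 1 + 2 * q"
    using q mult_nonneg_nonneg[of q "1 - 2 * q"] by (simp add: field_simps power2_eq_square)
  ultimately show ?thesis using q by simp
next
  case False
  then show ?thesis using bump_nonneg[of t] by linarith
qed

lemma continuous_on_bump: "continuous_on S bump"
proof -
  have "continuous_on S (\<lambda>t. Re (complex_of_real (bump t)))"
    by (intro continuous_intros smooth_continuous_on smooth_bump)
  then show ?thesis by simp
qed

definition cutoff :: "nat \<Rightarrow> 'a::euclidean_space \<Rightarrow> complex" where
  "cutoff n t = complex_of_real (bump (t /\<^sub>R real (Suc n)))"

lemma smooth_cutoff: "smooth (cutoff n)"
  using smooth_affine[OF smooth_bump, of "inverse (real (Suc n))" 0] by (simp add: cutoff_def[abs_def])

lemma cutoff_le_1: "cmod (cutoff n t) \<le> 1"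
  by (simp add: cutoff_def bump_nonneg bump_le_1)

lemma cutoff_outside: "real (Suc n) < norm t \<Longrightarrow> cutoff n t = 0"
  by (simp add: cutoff_def bump_outside field_simps)

lemma cutoff_test_function: "cutoff n \<in> test_functions"
  by (rule test_functionsI[OF smooth_cutoff cutoff_outside])

lemma cutoff_measurable [measurable]: "cutoff n \<in> borel_measurable borel"
  by (rule smooth_borel[OF smooth_cutoff])

lemma cutoff_tendsto: "(\<lambda>n. cutoff n t) \<longlonglongrightarrow> 1"
proof -
  have "(\<lambda>n. t /\<^sub>R real (Suc n)) \<longlonglongrightarrow> 0 *\<^sub>R t"
    using LIMSEQ_Suc[OF lim_inverse_n] by (intro tendsto_intros) simp
  then have "(\<lambda>n. t /\<^sub>R real (Suc n)) \<longlonglongrightarrow> 0" by simp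
  moreover have "isCont bump (0::'a)" using continuous_on_bump[of "UNIV::'a set"] by (simp add: continuous_on_eq_continuous_at)
  ultimately have "(\<lambda>n. bump (t /\<^sub>R real (Suc n))) \<longlonglongrightarrow> bump (0::'a)"
    by (rule isCont_tendsto_compose[rotated])
  then show ?thesis unfolding cutoff_def by (auto intro!: tendsto_eq_intros simp: bump_eq)
qed

text \<open>
  Cutting off converges in every seminorm, at the price of one order: near the origin \<open>1 - bump\<close>
  is at most linear, and every derivative brings a factor \<open>1 / (n + 1)\<close>.
\<close>

lemma seminorm_cutoff:
  "\<exists>C\<ge>0. \<forall>\<eta>\<in>(schwartz :: ('a::euclidean_space \<Rightarrow> complex) set). \<forall>n.
     schwartz_seminorm N (\<lambda>t. \<eta> t * (1 - cutoff n t)) \<le> C / real (Suc n) * schwartz_seminorm (Suc N) \<eta>"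
proof -
  have bs: "(\<lambda>t::'a. complex_of_real (bump t)) \<in> schwartz"
    by (intro test_functions_schwartz test_functionsI[OF smooth_bump, of 1]) (simp add: bump_outside)
  define P where "P = schwartz_seminorm N (\<lambda>t::'a. complex_of_real (bump t))"
  have P: "0 \<le> P" unfolding P_def by (rule seminorm_nonneg[OF bs])
  have Pb: "cmod (iter_deriv cs (\<lambda>t::'a. complex_of_real (bump t)) t) \<le> P"
    if "set cs \<subseteq> Basis" "length cs \<le> N" for cs t
    using seminorm_ge[OF bs that, of t] unfolding P_def
    by (rule order_trans[rotated]) (simp add: mult_left_le_imp_le mult_le_cancel_right1)
  have b: "cmod (iter_deriv cs (\<lambda>t. 1 - cutoff n t) t) \<le> ((2 + P) / real (Suc n)) * (1 + norm t) ^ 1"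
    if cs: "set cs \<subseteq> Basis" "length cs \<le> N" for cs n and t :: 'a
  proof (cases "cs = []")
    case True
    have "1 - cutoff n t = of_real (1 - bump (t /\<^sub>R real (Suc n)))" by (simp add: cutoff_def)
    then have "cmod (1 - cutoff n t) = 1 - bump (t /\<^sub>R real (Suc n))"
      using bump_le_1[of "t /\<^sub>R real (Suc n)"] by (simp only: norm_of_real abs_of_nonneg diff_ge_0_iff_ge)
    also have "\<dots> \<le> 2 * norm t / real (Suc n)" using bump_near_1[of "t /\<^sub>R real (Suc n)"] by (simp add: field_simps)
    also have "\<dots> \<le> ((2 + P) / real (Suc n)) * (1 + norm t) ^ 1"
      using P by (auto intro!: divide_right_mono mult_mono simp: times_divide_eq_left)
    finally show ?thesis using True by simp
  next
    case False
    have "(\<lambda>t. 1 - cutoff n t) = (\<lambda>t. 1 + (-1) * cutoff n t)" by simp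
    then have "iter_deriv cs (\<lambda>t. 1 - cutoff n t) t = - iter_deriv cs (cutoff n) t"
      using cs False iter_deriv_add[OF smooth_const smooth_cmult[OF smooth_cutoff] cs(1), of 1 "-1" n]
        iter_deriv_cmult[OF smooth_cutoff cs(1), of "-1" n]
      by (simp add: iter_deriv_const)
    also have "\<dots> = - (of_real (inverse (real (Suc n))) ^ length cs * iter_deriv cs (\<lambda>t. complex_of_real (bump t)) (t /\<^sub>R real (Suc n)))"
      using iter_deriv_affine[OF smooth_bump cs(1), of "inverse (real (Suc n))" 0] by (simp add: cutoff_def[abs_def])
    finally have "cmod (iter_deriv cs (\<lambda>t. 1 - cutoff n t) t) = inverse (real (Suc n)) ^ length cs * cmod (iter_deriv cs (\<lambda>t. complex_of_real (bump t)) (t /\<^sub>R real (Suc n)))"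
      by (simp add: norm_mult norm_power norm_inverse del: of_nat_Suc)
    also have "\<dots> \<le> inverse (real (Suc n)) ^ 1 * P"
      using False by (intro mult_mono power_decreasing Pb cs) (auto simp: Suc_le_eq field_simps)
    also have "\<dots> \<le> ((2 + P) / real (Suc n)) * (1 + norm t) ^ 1"
      using P by (auto simp: divide_inverse mult.commute intro!: mult_mono) (simp add: algebra_simps add_increasing)
    finally show ?thesis .
  qed
  have "schwartz_seminorm N (\<lambda>t. \<eta> t * (1 - cutoff n t)) \<le> 2 ^ N * ((2 + P) / real (Suc n)) * schwartz_seminorm (N + 1) \<eta>"
    if "\<eta> \<in> schwartz" for \<eta> :: "'a \<Rightarrow> complex" and n
  proof (rule seminorm_mult[OF that _ b])
    have "smooth (\<lambda>t. 1 + (-1) * cutoff n (t::'a))" by (intro smooth_add smooth_cmult smooth_const smooth_cutoff)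
    then show "smooth (\<lambda>t. 1 - cutoff n (t::'a))" by simp
  qed
  then show ?thesis using P by (intro exI[of _ "2 ^ N * (2 + P)"]) auto
qed

lemma schwartz_cutoff: "\<eta> \<in> schwartz \<Longrightarrow> (\<lambda>t. \<eta> t * cutoff n t) \<in> schwartz"
  by (rule schwartz_mult[OF _ test_functions_schwartz[OF cutoff_test_function]])

lemma test_function_cutoff:
  assumes "\<eta> \<in> schwartz" shows "(\<lambda>t. \<eta> t * cutoff n t) \<in> test_functions"
  using test_functions_mult[of "cutoff n" \<eta>] cutoff_test_function schwartz_smooth[OF assms] by blast

section \<open>Density of test functions and the converse of Hoelder's inequality\<close>

lemma fatou_bound:
  fixes u :: "nat \<Rightarrow> 'a \<Rightarrow> ennreal"
  assumes [measurable]: "\<And>n. u n \<in> borel_measurable M"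
    and "AE x in M. (\<lambda>n. u n x) \<longlonglongrightarrow> v x"
    and "\<And>n. (\<integral>\<^sup>+x. u n x \<partial>M) \<le> b n" "b \<longlonglongrightarrow> B"
  shows "(\<integral>\<^sup>+x. v x \<partial>M) \<le> B"
proof -
  have "(\<integral>\<^sup>+x. v x \<partial>M) = (\<integral>\<^sup>+x. liminf (\<lambda>n. u n x) \<partial>M)"
    using assms(2) by (intro nn_integral_cong_AE) (auto simp: lim_imp_Liminf)
  also have "\<dots> \<le> liminf (\<lambda>n. \<integral>\<^sup>+x. u n x \<partial>M)" by (rule nn_integral_liminf) measurable
  also have "\<dots> \<le> liminf b" by (rule Liminf_mono) (simp add: assms(3))
  also have "\<dots> = B" using assms(4) by (simp add: lim_imp_Liminf)
  finally show ?thesis .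
qed

lemma smooth_real_polynomial: "real_polynomial_function p \<Longrightarrow> smooth (\<lambda>x. complex_of_real (p x))"
proof (induction rule: real_polynomial_function.induct)
  case (linear f)
  interpret bounded_linear f by fact
  define a where "a = (\<Sum>b\<in>Basis. f b *\<^sub>R b)"
  have "f x = x \<bullet> a" for x
  proof -
    have "f x = f (\<Sum>b\<in>Basis. (x \<bullet> b) *\<^sub>R b)" by (simp add: euclidean_representation)
    then show ?thesis by (simp add: a_def sum scaleR inner_sum_right mult.commute)
  qed
  then show ?case using smooth_linear[of a] by simp
qed (auto intro: smooth_const smooth_add smooth_mult)

text \<open>
  A measurable function is almost everywhere a limit of continuous ones, and a continuous function
  supported inside a ball is the bump times a continuous quotient, which polynomials approximate.
\<close>

lemma test_functions_dense:
  fixes q :: "'a::euclidean_space \<Rightarrow> complex"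
  assumes q: "q \<in> borel_measurable borel" and M: "0 < M" "\<And>t. cmod (q t) \<le> M"
    and r: "0 < r" "\<And>t. r < norm t \<Longrightarrow> q t = 0"
  obtains \<eta> where "\<And>n. \<eta> n \<in> test_functions" "\<And>n t. cmod (\<eta> n t) \<le> M + 1"
    "\<And>n t. 2 * r < norm t \<Longrightarrow> \<eta> n t = 0" "AE t in lborel. (\<lambda>n. \<eta> n t) \<longlonglongrightarrow> q t"
proof -
  have "q \<in> borel_measurable lebesgue" using q by (intro measurable_completion) simp
  then have "q measurable_on UNIV" by (simp add: measurable_on_iff_borel_measurable lebesgue_on_UNIV_eq)
  then obtain N G where N: "negligible N" and G: "\<And>n. continuous_on UNIV (G n)"
    and lim: "\<And>x. x \<notin> N \<Longrightarrow> (\<lambda>n. G n x) \<longlonglongrightarrow> q x"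
    unfolding measurable_on_def by auto
  have "N \<in> null_sets lebesgue" using N by (simp add: negligible_iff_null_sets)
  then have "AE x in lebesgue. x \<notin> N" by (rule AE_not_in)
  then have AEN: "AE x in lborel. x \<notin> N" by (simp add: AE_completion_iff)
  \<comment> \<open>A continuous cutoff that is \<open>1\<close> on the ball of radius \<open>r\<close> and vanishes beyond \<open>3 / 2 * r\<close>;
    it leaves room to divide by the bump of radius \<open>2 * r\<close>.\<close>
  define c where "c t = max 0 (min 1 (3 - 2 * norm t / r))" for t :: 'a
  \<comment> \<open>Truncation at \<open>M\<close> and the cutoff keep the limit \<open>q\<close>, as \<open>q\<close> is bounded by \<open>M\<close> and vanishes
    outside the ball.\<close>
  define G' where "G' n t = (c t * (M / max M (cmod (G n t)))) *\<^sub>R G n t" for n t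
  have c: "0 \<le> c t" "c t \<le> 1" "norm t \<le> r \<Longrightarrow> c t = 1" "3 / 2 * r \<le> norm t \<Longrightarrow> c t = 0" for t
    using r by (auto simp: c_def min_def max_def field_simps)
  have G'M: "cmod (G' n t) \<le> M" for n t
  proof -
    have "M / max M (cmod (G n t)) * cmod (G n t) \<le> M" using M by (simp add: field_simps max_def)
    then have "c t * (M / max M (cmod (G n t)) * cmod (G n t)) \<le> 1 * M"
      using c[of t] M by (intro mult_mono) (auto simp: max_def)
    then show ?thesis using c[of t] M by (simp add: G'_def mult.assoc abs_mult)
  qed
  have G'lim: "(\<lambda>n. G' n t) \<longlonglongrightarrow> q t" if "t \<notin> N" for t
  proof -
    have "(\<lambda>n. G' n t) \<longlonglongrightarrow> (c t * (M / max M (cmod (q t)))) *\<^sub>R q t"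
      unfolding G'_def using M lim[OF that] by (intro tendsto_intros) auto
    moreover have "(c t * (M / max M (cmod (q t)))) *\<^sub>R q t = q t"
      using M(1) M(2)[of t] c(3)[of t] r(2)[of t] by (cases "norm t \<le> r") (simp_all add: max.absorb1)
    ultimately show ?thesis by simp
  qed
  have G'cont: "continuous_on UNIV (G' n)" for n
    unfolding G'_def c_def using G[of n] M r by (intro continuous_intros) auto
  let ?b = "\<lambda>t. complex_of_real (bump (t /\<^sub>R (2 * r)))"
  have bsm: "smooth ?b" using smooth_affine[OF smooth_bump, of "inverse (2 * r)" 0] by simp
  have b0: "?b t = 0" if "2 * r \<le> norm t" for t
    using that r by (simp add: bump_outside field_simps)
  have bpos: "?b t \<noteq> 0" if "norm t < 2 * r" for t
    using bump_pos[of "t /\<^sub>R (2 * r)"] that r by (simp add: field_simps)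
  have ble: "cmod (?b t) \<le> 1" for t by (simp add: bump_nonneg bump_le_1)
  \<comment> \<open>The quotient is continuous everywhere, since \<open>G'\<close> vanishes before the bump does.\<close>
  define k where "k n t = G' n t / ?b t" for n t
  have kc: "continuous_on UNIV (k n)" for n
  proof -
    have "continuous_on {t. norm t < 2 * r} (k n)"
      unfolding k_def using bpos by (intro continuous_intros continuous_on_subset[OF G'cont] smooth_continuous_on[OF bsm]) auto
    moreover have "continuous_on {t. 3 / 2 * r < norm t} (k n)"
      by (rule continuous_on_eq[of _ "\<lambda>t. 0"]) (auto simp: k_def G'_def c)
    moreover have "open {t::'a. norm t < 2 * r}" "open {t::'a. 3 / 2 * r < norm t}"
      by (intro open_Collect_less continuous_intros)+
    ultimately have "continuous_on ({t. norm t < 2 * r} \<union> {t. 3 / 2 * r < norm t}) (k n)"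
      by (rule continuous_on_open_Un[rotated 2])
    moreover have "{t::'a. norm t < 2 * r} \<union> {t. 3 / 2 * r < norm t} = UNIV" using r by auto
    ultimately show ?thesis by simp
  qed
  have "\<exists>p1 p2. real_polynomial_function p1 \<and> real_polynomial_function p2 \<and>
      (\<forall>t\<in>cball 0 (2 * r). cmod (k n t - Complex (p1 t) (p2 t)) \<le> 1 / real (Suc n))" for n
  proof -
    have e: "0 < 1 / (2 * real (Suc n))" by simp
    obtain p1 where p1: "real_polynomial_function p1" "\<And>t. t \<in> cball 0 (2 * r) \<Longrightarrow> \<bar>Re (k n t) - p1 t\<bar> < 1 / (2 * real (Suc n))"
      using Stone_Weierstrass_real_polynomial_function[OF compact_cball _ e, of 0 "2 * r" "\<lambda>t. Re (k n t)"]
        continuous_on_Re[OF continuous_on_subset[OF kc[of n]], of "cball 0 (2 * r)"] by blast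
    obtain p2 where p2: "real_polynomial_function p2" "\<And>t. t \<in> cball 0 (2 * r) \<Longrightarrow> \<bar>Im (k n t) - p2 t\<bar> < 1 / (2 * real (Suc n))"
      using Stone_Weierstrass_real_polynomial_function[OF compact_cball _ e, of 0 "2 * r" "\<lambda>t. Im (k n t)"]
        continuous_on_Im[OF continuous_on_subset[OF kc[of n]], of "cball 0 (2 * r)"] by blast
    have "cmod (k n t - Complex (p1 t) (p2 t)) \<le> 1 / real (Suc n)" if "t \<in> cball 0 (2 * r)" for t
    proof -
      have "cmod (k n t - Complex (p1 t) (p2 t)) \<le> \<bar>Re (k n t) - p1 t\<bar> + \<bar>Im (k n t) - p2 t\<bar>"
        using cmod_le[of "k n t - Complex (p1 t) (p2 t)"] by simp
      also have "\<dots> \<le> 1 / (2 * real (Suc n)) + 1 / (2 * real (Suc n))"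
        using p1(2)[OF that] p2(2)[OF that] by linarith
      finally show ?thesis by (simp add: field_simps)
    qed
    then show ?thesis using p1(1) p2(1) by blast
  qed
  then obtain p1 p2 where p: "\<And>n. real_polynomial_function (p1 n)" "\<And>n. real_polynomial_function (p2 n)"
    and pk: "\<And>n t. t \<in> cball 0 (2 * r) \<Longrightarrow> cmod (k n t - Complex (p1 n t) (p2 n t)) \<le> 1 / real (Suc n)" by metis
  define \<eta> where "\<eta> n t = (complex_of_real (p1 n t) + \<i> * of_real (p2 n t)) * ?b t" for n t
  have \<eta>0: "\<eta> n t = 0" if "2 * r < norm t" for n t using b0[of t] that by (simp add: \<eta>_def)
  have \<eta>G: "cmod (\<eta> n t - G' n t) \<le> 1 / real (Suc n)" for n t
  proof (cases "norm t < 2 * r")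
    case True
    have "\<eta> n t - G' n t = - (k n t - Complex (p1 n t) (p2 n t)) * ?b t"
      using bpos[OF True] by (simp add: \<eta>_def k_def field_simps Complex_eq)
    then have "cmod (\<eta> n t - G' n t) = cmod (k n t - Complex (p1 n t) (p2 n t)) * cmod (?b t)"
      by (simp add: norm_mult norm_minus_commute)
    also have "\<dots> \<le> 1 / real (Suc n) * 1"
      using True by (intro mult_mono pk ble) auto
    finally show ?thesis by simp
  next
    case False
    then show ?thesis using b0[of t] c(4)[of t] r by (simp add: \<eta>_def G'_def)
  qed
  show ?thesis
  proof
    show "\<eta> n \<in> test_functions" for n
    proof (rule test_functionsI[OF _ \<eta>0])
      show "smooth (\<eta> n)" unfolding \<eta>_def
        by (intro smooth_mult smooth_add smooth_cmult smooth_real_polynomial p bsm)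
    qed
    show "cmod (\<eta> n t) \<le> M + 1" for n t
    proof -
      have "cmod (\<eta> n t) \<le> cmod (G' n t) + cmod (\<eta> n t - G' n t)"
        using norm_triangle_sub[of "\<eta> n t" "G' n t"] .
      also have "\<dots> \<le> M + 1 / real (Suc n)" by (intro add_mono G'M \<eta>G)
      also have "\<dots> \<le> M + 1" by (simp add: field_simps)
      finally show ?thesis .
    qed
    show "AE t in lborel. (\<lambda>n. \<eta> n t) \<longlonglongrightarrow> q t"
      using AEN
    proof eventually_elim
      case (elim t)
      have "(\<lambda>n. \<eta> n t - G' n t) \<longlonglongrightarrow> 0"
        by (rule Lim_null_comparison[OF always_eventually LIMSEQ_Suc[OF lim_1_over_n]]) (use \<eta>G in blast)
      from tendsto_add[OF this G'lim[OF elim]] show ?case by simp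
    qed
  qed (rule \<eta>0)
qed

text \<open>
  On a bounded set where \<open>F\<close> is bounded, let \<open>q\<close> be the conjugate of \<open>F\<close> divided by the weight.
  Testing with approximations of \<open>q\<close> gives \<open>I \<le> C \<surd>I\<close> for the weighted integral \<open>I\<close> over that
  set, hence \<open>I \<le> C\<^sup>2\<close>; the sets exhaust the space.
\<close>

lemma converse_hoelder:
  fixes F :: "'a::euclidean_space \<Rightarrow> complex"
  assumes F [measurable]: "F \<in> borel_measurable borel"
    and loc: "\<And>K. compact K \<Longrightarrow> set_integrable lborel K F"
    and C: "0 \<le> C"
    and test: "\<And>\<eta>. \<eta> \<in> test_functions \<Longrightarrow>
      cmod (LINT t|lborel. F t * \<eta> t) \<le> C * sqrt (LINT t|lborel. (cmod (\<eta> t))\<^sup>2 * (1 + norm t) ^ k)"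
  shows "(\<integral>\<^sup>+t. ennreal ((cmod (F t))\<^sup>2 / (1 + norm t) ^ k) \<partial>lborel) \<le> ennreal (C\<^sup>2)"
proof -
  have w: "0 < (1 + norm t) ^ k" "1 \<le> (1 + norm t) ^ k" for t :: 'a
    by (intro zero_less_power add_pos_nonneg) (auto intro: one_le_power)
  have nw: "cmod (1 + complex_of_real (norm t)) = 1 + norm t" for t :: 'a
    by (metis abs_of_nonneg add_nonneg_nonneg norm_ge_zero norm_of_real of_real_1 of_real_add zero_le_one)
  define A where "A n = {t. norm t \<le> real (Suc n) \<and> cmod (F t) \<le> real (Suc n)}" for n
  have [measurable]: "A n \<in> sets borel" for n unfolding A_def by measurable
  define I where "I n = (LINT t|lborel. indicator (A n) t * ((cmod (F t))\<^sup>2 / (1 + norm t) ^ k))" for n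
  have I0: "0 \<le> I n" for n unfolding I_def using w by (intro integral_nonneg_AE AE_I2) (simp add: less_imp_le)
  have int: "integrable lborel (\<lambda>t. indicator (A n) t * ((cmod (F t))\<^sup>2 / (1 + norm t) ^ k))" for n
  proof (rule Bochner_Integration.integrable_bound)
    show "integrable lborel (\<lambda>t::'a. indicator (cball 0 (real (Suc n))) t * (real (Suc n))\<^sup>2)"
      by (intro integrable_mult_left integrable_real_indicator) (auto simp: emeasure_bounded_finite[unfolded infinity_ennreal_def])
    show "AE t in lborel. norm (indicator (A n) t * ((cmod (F t))\<^sup>2 / (1 + norm t) ^ k))
        \<le> norm (indicator (cball 0 (real (Suc n))) t * (real (Suc n))\<^sup>2)"
    proof (rule AE_I2)
      fix t :: 'a
      have "(cmod (F t))\<^sup>2 / (1 + norm t) ^ k \<le> (real (Suc n))\<^sup>2" if "t \<in> A n"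
      proof -
        have "(cmod (F t))\<^sup>2 / (1 + norm t) ^ k \<le> (cmod (F t))\<^sup>2 / 1"
          using w by (intro divide_left_mono) auto
        also have "\<dots> \<le> (real (Suc n))\<^sup>2" using that by (simp add: A_def power_mono del: of_nat_Suc)
        finally show ?thesis .
      qed
      then show "norm (indicator (A n) t * ((cmod (F t))\<^sup>2 / (1 + norm t) ^ k))
        \<le> norm (indicator (cball 0 (real (Suc n))) t * (real (Suc n))\<^sup>2)"
        using w by (auto simp: indicator_def A_def less_imp_le simp del: of_nat_Suc)
    qed
  qed measurable
  have le: "I n \<le> C\<^sup>2" for n
  proof -
    define q where "q t = indicator (A n) t * (cnj (F t) / of_real ((1 + norm t) ^ k))" for t
    have cnjF [measurable]: "(\<lambda>t. cnj (F t)) \<in> borel_measurable borel"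
      by (rule measurable_compose[OF F]) (intro borel_measurable_continuous_onI continuous_intros)
    have qm [measurable]: "q \<in> borel_measurable borel" unfolding q_def by measurable
    have qle: "cmod (q t) \<le> real (Suc n)" for t
    proof (cases "t \<in> A n")
      case True
      then have "cmod (q t) = cmod (F t) / (1 + norm t) ^ k" by (simp add: q_def norm_divide norm_power nw)
      also have "\<dots> \<le> cmod (F t) / 1" using w by (intro divide_left_mono) auto
      finally show ?thesis using True by (simp add: A_def)
    qed (simp add: q_def)
    have q0: "q t = 0" if "real (Suc n) < norm t" for t using that by (simp add: q_def A_def)
    have n: "0 < real (Suc n)" by simp
    obtain \<eta> where \<eta>: "\<And>j. \<eta> j \<in> test_functions" "\<And>j t. cmod (\<eta> j t) \<le> real (Suc n) + 1"
      "\<And>j t. 2 * real (Suc n) < norm t \<Longrightarrow> \<eta> j t = 0" "AE t in lborel. (\<lambda>j. \<eta> j t) \<longlonglongrightarrow> q t"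
      by (rule test_functions_dense[OF qm n qle n q0]) (assumption, rule that)
    have [measurable]: "\<eta> j \<in> borel_measurable borel" for j
      using \<eta>(1) schwartz_borel test_functions_schwartz by blast
    let ?K = "cball (0::'a) (2 * real (Suc n))" and ?m = "real (Suc n) + 1"
    have ind: "cmod (\<eta> j t) \<le> indicator ?K t * ?m" for j t
      using \<eta>(2)[of j t] \<eta>(3)[of t j] by (auto simp: indicator_def)
    have "(\<lambda>j. LINT t|lborel. F t * \<eta> j t) \<longlonglongrightarrow> (LINT t|lborel. F t * q t)"
    proof (rule integral_dominated_convergence[where w="\<lambda>t. ?m * norm (indicator ?K t *\<^sub>R F t)"])
      show "integrable lborel (\<lambda>t. ?m * norm (indicator ?K t *\<^sub>R F t))"
        using loc[OF compact_cball, of 0 "2 * real (Suc n)"] unfolding set_integrable_def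
        by (intro integrable_mult_right integrable_norm)
      show "AE t in lborel. (\<lambda>j. F t * \<eta> j t) \<longlonglongrightarrow> F t * q t"
        using \<eta>(4) by eventually_elim (intro tendsto_intros)
      show "AE t in lborel. norm (F t * \<eta> j t) \<le> ?m * norm (indicator ?K t *\<^sub>R F t)" for j
        using mult_left_mono[OF ind norm_ge_zero] by (intro AE_I2) (simp add: norm_mult mult_ac)
    qed measurable
    moreover have "(LINT t|lborel. F t * q t) = of_real (I n)"
    proof -
      have "F t * q t = complex_of_real (indicator (A n) t * ((cmod (F t))\<^sup>2 / (1 + norm t) ^ k))" for t
        using complex_norm_square[of "F t"] by (simp add: q_def indicator_def)
      then show ?thesis unfolding I_def by (simp only: integral_complex_of_real)
    qed
    ultimately have l1: "(\<lambda>j. cmod (LINT t|lborel. F t * \<eta> j t)) \<longlonglongrightarrow> I n"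
      using tendsto_norm I0[of n] by fastforce
    have "(\<lambda>j. LINT t|lborel. (cmod (\<eta> j t))\<^sup>2 * (1 + norm t) ^ k) \<longlonglongrightarrow> (LINT t|lborel. (cmod (q t))\<^sup>2 * (1 + norm t) ^ k)"
    proof (rule integral_dominated_convergence[where w="\<lambda>t. indicator ?K t * (?m\<^sup>2 * (1 + 2 * real (Suc n)) ^ k)"])
      show "integrable lborel (\<lambda>t. indicator ?K t * (?m\<^sup>2 * (1 + 2 * real (Suc n)) ^ k))"
        by (intro integrable_mult_left integrable_real_indicator) (auto simp: emeasure_bounded_finite[unfolded infinity_ennreal_def])
      show "AE t in lborel. (\<lambda>j. (cmod (\<eta> j t))\<^sup>2 * (1 + norm t) ^ k) \<longlonglongrightarrow> (cmod (q t))\<^sup>2 * (1 + norm t) ^ k"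
        using \<eta>(4) by eventually_elim (intro tendsto_intros)
      show "AE t in lborel. norm ((cmod (\<eta> j t))\<^sup>2 * (1 + norm t) ^ k) \<le> indicator ?K t * (?m\<^sup>2 * (1 + 2 * real (Suc n)) ^ k)" for j
      proof (rule AE_I2)
        fix t
        show "norm ((cmod (\<eta> j t))\<^sup>2 * (1 + norm t) ^ k) \<le> indicator ?K t * (?m\<^sup>2 * (1 + 2 * real (Suc n)) ^ k)"
        proof (cases "t \<in> ?K")
          case True
          then show ?thesis using \<eta>(2)[of j t] w
            by (auto simp: abs_mult intro!: mult_mono power_mono simp del: of_nat_Suc)
        next
          case False
          then show ?thesis using \<eta>(3)[of t j] by simp
        qed
      qed
    qed measurable
    moreover have "(LINT t|lborel. (cmod (q t))\<^sup>2 * (1 + norm t) ^ k) = I n"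
    proof -
      have "(cmod (q t))\<^sup>2 * (1 + norm t) ^ k = indicator (A n) t * ((cmod (F t))\<^sup>2 / (1 + norm t) ^ k)" for t
        using w(1)[of t] by (simp add: q_def indicator_def norm_divide norm_power power2_eq_square nw)
      then show ?thesis unfolding I_def by simp
    qed
    ultimately have "(\<lambda>j. C * sqrt (LINT t|lborel. (cmod (\<eta> j t))\<^sup>2 * (1 + norm t) ^ k)) \<longlonglongrightarrow> C * sqrt (I n)"
      by (intro tendsto_intros) simp
    from LIMSEQ_le[OF l1 this] have "I n \<le> C * sqrt (I n)" using test[OF \<eta>(1)] by blast
    then have "sqrt (I n) * sqrt (I n) \<le> C * sqrt (I n)" using I0[of n] by simp
    then have "sqrt (I n) \<le> C" using C I0[of n]
      by (cases "sqrt (I n) = 0") (auto simp del: real_sqrt_mult_self)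
    then have "(sqrt (I n))\<^sup>2 \<le> C\<^sup>2" using I0[of n] by (intro power_mono) auto
    then show ?thesis using I0[of n] by simp
  qed
  show ?thesis
  proof (rule fatou_bound[where u="\<lambda>n t. ennreal (indicator (A n) t * ((cmod (F t))\<^sup>2 / (1 + norm t) ^ k))" and b="\<lambda>n. ennreal (C\<^sup>2)"])
    show "(\<integral>\<^sup>+t. ennreal (indicator (A n) t * ((cmod (F t))\<^sup>2 / (1 + norm t) ^ k)) \<partial>lborel) \<le> ennreal (C\<^sup>2)" for n
      using le[of n] w unfolding I_def
      by (subst nn_integral_eq_integral[OF int]) (auto simp: less_imp_le intro!: ennreal_leI)
    show "AE t in lborel. (\<lambda>n. ennreal (indicator (A n) t * ((cmod (F t))\<^sup>2 / (1 + norm t) ^ k)))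
        \<longlonglongrightarrow> ennreal ((cmod (F t))\<^sup>2 / (1 + norm t) ^ k)"
    proof (rule AE_I2)
      fix t :: 'a
      obtain m where m: "max (norm t) (cmod (F t)) \<le> real m" using real_arch_simple by blast
      have "\<forall>\<^sub>F n in sequentially. indicator (A n) t = (1::real)"
        using eventually_ge_at_top[of m] by eventually_elim (use m in \<open>auto simp: A_def\<close>)
      then have "\<forall>\<^sub>F n in sequentially. ennreal ((cmod (F t))\<^sup>2 / (1 + norm t) ^ k) = ennreal (indicator (A n) t * ((cmod (F t))\<^sup>2 / (1 + norm t) ^ k))"
        by eventually_elim simp
      then show "(\<lambda>n. ennreal (indicator (A n) t * ((cmod (F t))\<^sup>2 / (1 + norm t) ^ k)))
        \<longlonglongrightarrow> ennreal ((cmod (F t))\<^sup>2 / (1 + norm t) ^ k)"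
        by (rule Lim_transform_eventually[OF tendsto_const])
    qed
  qed auto
qed

lemma ennreal_square_le_cancel:
  fixes a b :: ennreal
  assumes "a\<^sup>2 \<le> b\<^sup>2" shows "a \<le> b"
proof (cases "b = \<top>")
  case False
  then obtain y where y: "0 \<le> y" "b = ennreal y" by (metis ennreal_cases)
  then have "a\<^sup>2 < \<top>" using assms by (auto simp: ennreal_power intro: le_less_trans)
  then obtain x where x: "0 \<le> x" "a = ennreal x" by (cases a) (auto simp: power2_eq_square)
  have "x\<^sup>2 \<le> y\<^sup>2" using assms x y by (simp add: ennreal_power)
  then have "x \<le> y" using y(1) by (rule power2_le_imp_le)
  then show ?thesis using x y by (simp add: ennreal_leI)
qed simp

lemma
  fixes f h :: "'a::euclidean_space \<Rightarrow> complex"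
  assumes [measurable]: "f \<in> borel_measurable borel" "h \<in> borel_measurable borel"
    and f: "integrable lborel (\<lambda>t. (cmod (f t))\<^sup>2)" and h: "integrable lborel (\<lambda>t. (cmod (h t))\<^sup>2)"
  shows integrable_cauchy_schwarz: "integrable lborel (\<lambda>t. f t * h t)"
    and integral_cauchy_schwarz: "cmod (LINT t|lborel. f t * h t) \<le>
      sqrt (LINT t|lborel. (cmod (f t))\<^sup>2) * sqrt (LINT t|lborel. (cmod (h t))\<^sup>2)"
proof -
  define A where "A = (LINT t|lborel. (cmod (f t))\<^sup>2)"
  define B where "B = (LINT t|lborel. (cmod (h t))\<^sup>2)"
  have AB: "0 \<le> A" "0 \<le> B" by (simp_all add: A_def B_def)
  have "(\<integral>\<^sup>+t. ennreal (cmod (f t)) * ennreal (cmod (h t)) \<partial>lborel)\<^sup>2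
     \<le> (\<integral>\<^sup>+t. (ennreal (cmod (f t)))\<^sup>2 \<partial>lborel) * (\<integral>\<^sup>+t. (ennreal (cmod (h t)))\<^sup>2 \<partial>lborel)"
    by (rule Cauchy_Schwarz_nn_integral) measurable
  also have "\<dots> = ennreal (A * B)"
    using AB by (simp add: ennreal_power A_def B_def nn_integral_eq_integral f h ennreal_mult)
  also have "\<dots> = (ennreal (sqrt A * sqrt B))\<^sup>2"
    using AB by (simp add: ennreal_power power_mult_distrib)
  finally have le: "(\<integral>\<^sup>+t. ennreal (cmod (f t * h t)) \<partial>lborel) \<le> ennreal (sqrt A * sqrt B)"
    unfolding norm_mult by (simp only: ennreal_mult norm_ge_zero ennreal_square_le_cancel)
  then show i: "integrable lborel (\<lambda>t. f t * h t)"
    by (auto simp: integrable_iff_bounded intro: le_less_trans)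
  have "ennreal (cmod (LINT t|lborel. f t * h t)) \<le> ennreal (sqrt A * sqrt B)"
    using integral_norm_bound_ennreal[OF i] le by (rule order_trans)
  then show "cmod (LINT t|lborel. f t * h t) \<le> sqrt A * sqrt B"
    using AB by (simp add: ennreal_le_iff)
qed

abbreviation L2_square :: "('a::euclidean_space \<Rightarrow> complex) \<Rightarrow> ennreal" where
  "L2_square F \<equiv> (\<integral>\<^sup>+t. ennreal ((cmod (F t))\<^sup>2) \<partial>lborel)"

text \<open>
  Both inequalities follow by duality from the Plancherel identity for Schwartz functions:
  pairing the transform of \<open>h\<close> with a test function is pairing \<open>h\<close> with its transform.
\<close>

lemma plancherel:
  fixes h :: "'a::euclidean_space \<Rightarrow> complex"
  assumes h: "integrable lborel h"
  shows "L2_square (fourier h) = L2_square h"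
proof (rule antisym)
  have hm [measurable]: "h \<in> borel_measurable borel" using h by auto
  show "L2_square (fourier h) \<le> L2_square h"
  proof (cases "L2_square h = \<infinity>")
    case False
    then have h2: "integrable lborel (\<lambda>t. (cmod (h t))\<^sup>2)"
      by (auto simp: integrable_iff_bounded less_top[symmetric])
    define C where "C = sqrt (LINT t|lborel. (cmod (h t))\<^sup>2)"
    have "(\<integral>\<^sup>+\<omega>. ennreal ((cmod (fourier h \<omega>))\<^sup>2 / (1 + norm \<omega>) ^ 0) \<partial>lborel) \<le> ennreal (C\<^sup>2)"
    proof (rule converse_hoelder)
      show "set_integrable lborel K (fourier h)" if "compact K" for K
        unfolding set_integrable_def
      proof (rule Bochner_Integration.integrable_bound)
        show "integrable lborel (\<lambda>t::'a. indicator K t * (LINT t|lborel. cmod (h t)))"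
          using that by (intro integrable_mult_left integrable_real_indicator)
            (auto simp: emeasure_bounded_finite[unfolded infinity_ennreal_def] compact_imp_bounded borel_compact)
        show "AE t in lborel. norm (indicator K t *\<^sub>R fourier h t) \<le> norm (indicator K t * (LINT t|lborel. cmod (h t)))"
          using fourier_bound[OF h] by (auto simp: indicator_def intro: order_trans[OF _ abs_ge_self])
        show "(\<lambda>t. indicator K t *\<^sub>R fourier h t) \<in> borel_measurable lborel"
          using borel_compact[OF that] by measurable
      qed
      fix \<eta> :: "'a \<Rightarrow> complex" assume "\<eta> \<in> test_functions"
      then have \<eta>: "\<eta> \<in> schwartz" by (rule test_functions_schwartz)
      have "cmod (LINT t|lborel. fourier h t * \<eta> t) = cmod (LINT t|lborel. h t * fourier \<eta> t)"
        using fourier_duality[OF h schwartz_integrable[OF \<eta>]] by simp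
      also have "\<dots> \<le> C * sqrt (LINT t|lborel. (cmod (fourier \<eta> t))\<^sup>2)"
        unfolding C_def using schwartz_fourier[OF \<eta>]
        by (intro integral_cauchy_schwarz[OF hm _ h2] schwartz_square_integrable schwartz_borel)
      finally show "cmod (LINT t|lborel. fourier h t * \<eta> t) \<le> C * sqrt (LINT t|lborel. (cmod (\<eta> t))\<^sup>2 * (1 + norm t) ^ 0)"
        by (simp add: plancherel_schwartz[OF \<eta>])
    qed (simp_all add: C_def)
    also have "ennreal (C\<^sup>2) = L2_square h"
      using nn_integral_eq_integral[OF h2] by (simp add: C_def)
    finally show ?thesis by simp
  qed simp
  show "L2_square h \<le> L2_square (fourier h)"
  proof (cases "L2_square (fourier h) = \<infinity>")
    case False
    then have h2: "integrable lborel (\<lambda>t. (cmod (fourier h t))\<^sup>2)"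
      by (auto simp: integrable_iff_bounded less_top[symmetric])
    define C where "C = sqrt (LINT t|lborel. (cmod (fourier h t))\<^sup>2)"
    have "(\<integral>\<^sup>+t. ennreal ((cmod (h t))\<^sup>2 / (1 + norm t) ^ 0) \<partial>lborel) \<le> ennreal (C\<^sup>2)"
    proof (rule converse_hoelder)
      show "set_integrable lborel K h" if "compact K" for K
        unfolding set_integrable_def using borel_compact[OF that]
        by (intro integrable_mult_indicator h) simp
      fix \<eta> :: "'a \<Rightarrow> complex" assume "\<eta> \<in> test_functions"
      then have \<eta>: "\<eta> \<in> schwartz" by (rule test_functions_schwartz)
      let ?z = "inverse_fourier \<eta>"
      note z = schwartz_inverse_fourier[OF \<eta>]
      have "cmod (LINT t|lborel. h t * \<eta> t) = cmod (LINT t|lborel. fourier h t * ?z t)"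
        using fourier_duality[OF h schwartz_integrable[OF z]] fourier_inverse_fourier[OF \<eta>] by simp
      also have "\<dots> \<le> C * sqrt (LINT t|lborel. (cmod (?z t))\<^sup>2)"
        unfolding C_def using z
        by (intro integral_cauchy_schwarz[OF fourier_borel[OF hm] _ h2] schwartz_square_integrable schwartz_borel)
      finally show "cmod (LINT t|lborel. h t * \<eta> t) \<le> C * sqrt (LINT t|lborel. (cmod (\<eta> t))\<^sup>2 * (1 + norm t) ^ 0)"
        using plancherel_schwartz[OF z] fourier_inverse_fourier[OF \<eta>] by simp
    qed (simp_all add: C_def)
    also have "ennreal (C\<^sup>2) = L2_square (fourier h)"
      using nn_integral_eq_integral[OF h2] by (simp add: C_def)
    finally show ?thesis by simp
  qed simp
qed

section \<open>Reconstruction from the short-time Fourier transform\<close>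

text \<open>
  The time-frequency shifts of the (conjugated) window: the transform of \<open>u\<close> at \<open>z\<close> is \<open>u\<close>
  applied to the atom.
\<close>

definition atom :: "('a::euclidean_space \<Rightarrow> complex) \<Rightarrow> 'a \<times> 'a \<Rightarrow> 'a \<Rightarrow> complex" where
  "atom g z t = cnj (g (t - fst z)) * modulation (snd z) t"

lemma stft_eq: "stft g u z = u (atom g z)"
  by (cases z) (simp add: stft_def atom_def[abs_def] modulation_def)

lemma schwartz_window: "g \<in> schwartz \<Longrightarrow> (\<lambda>t. cnj (g (t - x))) \<in> schwartz"
  using schwartz_translate[OF schwartz_cnj] by auto

lemma schwartz_atom: "g \<in> schwartz \<Longrightarrow> atom g z \<in> schwartz"
  unfolding atom_def by (intro schwartz_modulation schwartz_window)

lemma seminorm_atom: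
  assumes "g \<in> schwartz"
  shows "schwartz_seminorm N (atom g z) \<le> (2 ^ N * 7 ^ N * schwartz_seminorm N g) * ((1 + norm (fst z)) ^ N * (1 + norm (snd z)) ^ N)"
proof -
  have "schwartz_seminorm N (atom g z) \<le> 2 ^ N * (1 + 2 * pi * norm (snd z)) ^ N * schwartz_seminorm N (\<lambda>t. cnj (g (t - fst z)))"
    unfolding atom_def by (rule seminorm_modulation[OF schwartz_window[OF assms]])
  also have "\<dots> \<le> 2 ^ N * (7 * (1 + norm (snd z))) ^ N * ((1 + norm (fst z)) ^ N * schwartz_seminorm N g)"
  proof (intro mult_mono power_mono)
    \<comment> \<open>The constant \<open>7\<close> exceeds \<open>2 * pi\<close>.\<close>
    have "pi * norm (snd z) \<le> 3.5 * norm (snd z)"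
      using pi_less_4 pi_approx by (intro mult_right_mono) auto
    then show "1 + 2 * pi * norm (snd z) \<le> 7 * (1 + norm (snd z))" by (simp add: algebra_simps)
    have "schwartz_seminorm N (\<lambda>t. cnj (g (t - fst z))) \<le> schwartz_seminorm N (\<lambda>t. g (t - fst z))"
      by (rule seminorm_cnj[OF schwartz_translate[OF assms]])
    also have "\<dots> \<le> (1 + norm (fst z)) ^ N * schwartz_seminorm N g" by (rule seminorm_translate[OF assms])
    finally show "schwartz_seminorm N (\<lambda>t. cnj (g (t - fst z))) \<le> (1 + norm (fst z)) ^ N * schwartz_seminorm N g" .
  qed (auto intro!: seminorm_nonneg schwartz_window assms add_nonneg_nonneg)
  finally show ?thesis by (simp only: power_mult_distrib mult_ac)
qed

text \<open>The pairing of \<open>\<eta>\<close> with the complex conjugate of the atom at \<open>z\<close>.\<close>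

definition coefficient :: "('a::euclidean_space \<Rightarrow> complex) \<Rightarrow> ('a \<Rightarrow> complex) \<Rightarrow> 'a \<times> 'a \<Rightarrow> complex" where
  "coefficient g \<eta> z = inverse_fourier (\<lambda>t. \<eta> t * g (t - fst z)) (snd z)"

lemma coefficient_decay:
  assumes g: "g \<in> schwartz"
  shows "\<exists>C\<ge>0. \<exists>M. \<forall>\<eta>\<in>schwartz. \<forall>z::'a::euclidean_space \<times> 'a.
    cmod (coefficient g \<eta> z) * ((1 + norm (fst z)) ^ L * (1 + norm (snd z)) ^ L) \<le> C * schwartz_seminorm M \<eta>"
proof -
  obtain C M where C: "0 \<le> C" and CM: "\<And>f (\<omega>::'a). f \<in> schwartz \<Longrightarrow> (1 + norm \<omega>) ^ L * cmod (fourier f \<omega>) \<le> C * schwartz_seminorm M f"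
    using fourier_decay[of L] by metis
  define K where "K = max M L"
  define D where "D = C * (2 ^ M * schwartz_seminorm K g)"
  have D: "0 \<le> D" using C seminorm_nonneg[OF g] by (simp add: D_def)
  have "cmod (coefficient g \<eta> z) * ((1 + norm (fst z)) ^ L * (1 + norm (snd z)) ^ L) \<le> D * schwartz_seminorm (M + K) \<eta>"
    if \<eta>: "\<eta> \<in> schwartz" for \<eta> and z :: "'a \<times> 'a"
  proof -
    let ?h = "\<lambda>t. \<eta> t * g (t - fst z)"
    have h: "?h \<in> schwartz" by (intro schwartz_mult \<eta> schwartz_translate g)
    have pos: "0 < (1 + norm (fst z)) ^ K" by (intro zero_less_power add_pos_nonneg) auto
    have "(1 + norm (snd z)) ^ L * cmod (coefficient g \<eta> z) \<le> C * schwartz_seminorm M ?h"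
      using CM[OF h, of "- snd z"] by (simp add: coefficient_def inverse_fourier_def)
    also have "\<dots> \<le> C * (2 ^ M * (schwartz_seminorm K g / (1 + norm (fst z)) ^ K) * schwartz_seminorm (M + K) \<eta>)"
      by (intro mult_left_mono C seminorm_window_mult \<eta> g) (simp add: K_def)
    also have "\<dots> = D * schwartz_seminorm (M + K) \<eta> / (1 + norm (fst z)) ^ K" by (simp add: D_def)
    finally have "(1 + norm (snd z)) ^ L * cmod (coefficient g \<eta> z) * (1 + norm (fst z)) ^ K \<le> D * schwartz_seminorm (M + K) \<eta>"
      using pos by (simp add: field_simps)
    moreover have "(1 + norm (snd z)) ^ L * cmod (coefficient g \<eta> z) * (1 + norm (fst z)) ^ L
       \<le> (1 + norm (snd z)) ^ L * cmod (coefficient g \<eta> z) * (1 + norm (fst z)) ^ K"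
      by (intro mult_left_mono power_increasing) (auto simp: K_def)
    ultimately show ?thesis by (simp add: mult_ac)
  qed
  then show ?thesis using D by blast
qed

lemma borel_measurable_fst_snd [measurable]:
  "fst \<in> borel_measurable (borel :: ('a::euclidean_space \<times> 'b::euclidean_space) measure)"
  "snd \<in> borel_measurable (borel :: ('a::euclidean_space \<times> 'b::euclidean_space) measure)"
  by (intro borel_measurable_continuous_onI continuous_intros)+

lemma coefficient_measurable [measurable]:
  assumes [measurable]: "g \<in> borel_measurable borel" "\<eta> \<in> borel_measurable borel"
  shows "coefficient g \<eta> \<in> borel_measurable borel"
  unfolding coefficient_def[abs_def] inverse_fourier_def fourier_eq by measurable

lemma integrable_decay_prod:
  "integrable lborel (\<lambda>z::'a::euclidean_space \<times> 'a. decay (fst z) * decay (snd z))"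
proof -
  have "integrable (lborel \<Otimes>\<^sub>M lborel) (\<lambda>(x::'a, y::'a). complex_of_real (decay x) * complex_of_real (decay y))"
    by (intro integrable_tensor) (simp_all add: complex_of_real_integrable_eq integrable_decay)
  then have "integrable lborel (\<lambda>z::'a \<times> 'a. complex_of_real (decay (fst z) * decay (snd z)))"
    by (simp add: lborel_prod split_beta')
  then show ?thesis by (simp only: complex_of_real_integrable_eq)
qed

lemma coefficient_bound:
  assumes g: "g \<in> schwartz"
  shows "\<exists>C\<ge>0. \<exists>M. \<forall>\<eta>\<in>schwartz. \<forall>z::'a::euclidean_space \<times> 'a.
    cmod (coefficient g \<eta> z) * ((1 + norm (fst z)) ^ L * (1 + norm (snd z)) ^ L)
      \<le> C * schwartz_seminorm M \<eta> * (decay (fst z) * decay (snd z))"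
proof -
  obtain C M where C: "0 \<le> C" and CM: "\<And>\<eta> (z::'a\<times>'a). \<eta> \<in> schwartz \<Longrightarrow>
    cmod (coefficient g \<eta> z) * ((1 + norm (fst z)) ^ (L + 2 * DIM('a)) * (1 + norm (snd z)) ^ (L + 2 * DIM('a))) \<le> C * schwartz_seminorm M \<eta>"
    using coefficient_decay[OF g, of "L + 2 * DIM('a)"] by metis
  have "cmod (coefficient g \<eta> z) * ((1 + norm (fst z)) ^ L * (1 + norm (snd z)) ^ L)
      \<le> C * schwartz_seminorm M \<eta> * (decay (fst z) * decay (snd z))" if "\<eta> \<in> schwartz" for \<eta> and z :: "'a \<times> 'a"
    using CM[OF that, of z] by (simp add: decay_def power_add field_simps add_pos_nonneg)
  then show ?thesis using C by blast
qed

lemma coefficient_integrable: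
  fixes g \<eta> :: "'a::euclidean_space \<Rightarrow> complex"
  assumes g: "g \<in> schwartz" and \<eta>: "\<eta> \<in> schwartz"
  shows "integrable lborel (coefficient g \<eta>)"
proof -
  note [measurable] = schwartz_borel[OF g] schwartz_borel[OF \<eta>]
  obtain C M where C: "0 \<le> C" and CM: "\<And>z::'a\<times>'a. cmod (coefficient g \<eta> z)
      \<le> C * schwartz_seminorm M \<eta> * (decay (fst z) * decay (snd z))"
    using coefficient_bound[OF g, of 0] \<eta> by (metis mult_1_right power_0)
  show ?thesis
    by (rule Bochner_Integration.integrable_bound[OF integrable_mult_right[OF integrable_decay_prod, of "C * schwartz_seminorm M \<eta>"]])
      (use CM in \<open>auto intro!: AE_I2 intro: order_trans[OF _ abs_ge_self]\<close>)
qed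

lemma window_mult_bound:
  assumes "g \<in> schwartz"
  shows "cmod c * cmod (g t) \<le> schwartz_seminorm 0 g * cmod c"
  using mult_left_mono[OF schwartz_decay[OF assms, of t 0] norm_ge_zero[of c]]
  by (simp add: mult.commute)

text \<open>
  Fourier inversion in the frequency variable gives \<open>|g (t - x)|\<^sup>2 \<eta> t\<close> for every position \<open>x\<close> of the
  window; integration over \<open>x\<close> leaves the norm of the window.
\<close>

lemma coefficient_synthesis:
  fixes g \<eta> :: "'a::euclidean_space \<Rightarrow> complex"
  assumes g: "g \<in> schwartz" and \<eta>: "\<eta> \<in> schwartz"
  shows "(LINT z|lborel. coefficient g \<eta> z * atom g z t) = of_real (LINT s|lborel. (cmod (g s))\<^sup>2) * \<eta> t"
proof -
  note [measurable] = schwartz_borel[OF g] schwartz_borel[OF \<eta>]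
  have [measurable]: "(\<lambda>t. cnj (g t)) \<in> borel_measurable borel" by (rule schwartz_borel[OF schwartz_cnj[OF g]])
  have "integrable lborel (\<lambda>z. coefficient g \<eta> z * atom g z t)"
  proof (rule Bochner_Integration.integrable_bound[OF integrable_mult_right[OF integrable_norm[OF coefficient_integrable[OF g \<eta>]], of "schwartz_seminorm 0 g"]])
    show "(\<lambda>z. coefficient g \<eta> z * atom g z t) \<in> borel_measurable lborel" unfolding atom_def by measurable
    show "AE z in lborel. norm (coefficient g \<eta> z * atom g z t) \<le> norm (schwartz_seminorm 0 g * cmod (coefficient g \<eta> z))"
      using window_mult_bound[OF g] seminorm_nonneg[OF g]
      by (intro AE_I2) (simp add: atom_def norm_mult)
  qed
  then have i: "integrable (lborel \<Otimes>\<^sub>M lborel) (\<lambda>z. coefficient g \<eta> z * atom g z t)" by (simp add: lborel_prod)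
  have "(LINT z|lborel. coefficient g \<eta> z * atom g z t) = (LINT x|lborel. (LINT \<omega>|lborel. coefficient g \<eta> (x, \<omega>) * atom g (x, \<omega>) t))"
    using lborel_pair.integral_fst'[OF i] by (simp add: lborel_prod)
  also have "\<dots> = (LINT x|lborel. of_real ((cmod (g (t - x)))\<^sup>2) * \<eta> t)"
  proof (rule Bochner_Integration.integral_cong[OF refl])
    fix x
    let ?h = "\<lambda>t. \<eta> t * g (t - x)"
    have h: "?h \<in> schwartz" by (intro schwartz_mult \<eta> schwartz_translate g)
    have "(LINT \<omega>|lborel. coefficient g \<eta> (x, \<omega>) * atom g (x, \<omega>) t) = (LINT \<omega>|lborel. cnj (g (t - x)) * (inverse_fourier ?h \<omega> * modulation t \<omega>))"
      by (simp add: coefficient_def atom_def modulation_commute[of t] mult_ac)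
    also have "\<dots> = cnj (g (t - x)) * fourier (inverse_fourier ?h) t"
      by (simp add: fourier_eq)
    also have "\<dots> = of_real ((cmod (g (t - x)))\<^sup>2) * \<eta> t"
      unfolding fourier_inverse_fourier[OF h] complex_norm_square by (simp add: mult_ac)
    finally show "(LINT \<omega>|lborel. coefficient g \<eta> (x, \<omega>) * atom g (x, \<omega>) t) = of_real ((cmod (g (t - x)))\<^sup>2) * \<eta> t" .
  qed
  also have "\<dots> = of_real (LINT x|lborel. (cmod (g (t - x)))\<^sup>2) * \<eta> t"
    by (simp only: integral_mult_left_zero integral_complex_of_real)
  also have "(LINT x|lborel. (cmod (g (t - x)))\<^sup>2) = (LINT s|lborel. (cmod (g s))\<^sup>2)"
    using integral_affine[OF schwartz_square_integrable[OF g], of "-1" t] by simp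
  finally show ?thesis .
qed

lemma tempered_bound:
  assumes "u \<in> tempered" shows "\<exists>C\<ge>0. \<exists>N. \<forall>\<eta>\<in>schwartz. cmod (u \<eta>) \<le> C * schwartz_seminorm N \<eta>"
proof -
  obtain C N where CN: "\<forall>\<eta>\<in>schwartz. cmod (u \<eta>) \<le> C * schwartz_seminorm N \<eta>"
    using assms unfolding tempered_def by blast
  have "cmod (u \<eta>) \<le> \<bar>C\<bar> * schwartz_seminorm N \<eta>" if "\<eta> \<in> schwartz" for \<eta>
    using CN[rule_format, OF that] mult_right_mono[OF abs_ge_self seminorm_nonneg[OF that]] by (rule order_trans)
  then show ?thesis by (intro exI[of _ "\<bar>C\<bar>"]) auto
qed

lemma tempered_add: "u \<in> tempered \<Longrightarrow> \<eta> \<in> schwartz \<Longrightarrow> \<theta> \<in> schwartz \<Longrightarrow> u (\<lambda>x. \<eta> x + \<theta> x) = u \<eta> + u \<theta>"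
  by (simp add: tempered_def)

lemma tempered_cmult: "u \<in> tempered \<Longrightarrow> \<eta> \<in> schwartz \<Longrightarrow> u (\<lambda>x. c * \<eta> x) = c * u \<eta>"
  by (simp add: tempered_def)

lemma tempered_diff:
  assumes "u \<in> tempered" "\<eta> \<in> schwartz" "\<theta> \<in> schwartz" shows "u (\<lambda>x. \<eta> x - \<theta> x) = u \<eta> - u \<theta>"
  using tempered_add[OF assms(1,2) schwartz_cmult[OF assms(3), of "-1"]] tempered_cmult[OF assms(1,3), of "-1"] by simp

text \<open>
  Agreement with a function is only given on test functions; these facts carry it to Schwartz functions.
\<close>

lemma
  fixes u :: "('a::euclidean_space \<Rightarrow> complex) \<Rightarrow> complex"
  assumes u: "u \<in> tempered"
  shows tempered_cutoff_bound: "\<exists>C\<ge>0. \<exists>N. \<forall>\<eta>\<in>schwartz. \<forall>n. cmod (u (\<lambda>t. \<eta> t * cutoff n t)) \<le> C * schwartz_seminorm N \<eta>"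
    and tempered_cutoff_tendsto: "\<And>\<eta>. \<eta> \<in> schwartz \<Longrightarrow> (\<lambda>n. u (\<lambda>t. \<eta> t * cutoff n t)) \<longlonglongrightarrow> u \<eta>"
proof -
  obtain C N where C: "0 \<le> C" and CN: "\<And>\<eta>. \<eta> \<in> schwartz \<Longrightarrow> cmod (u \<eta>) \<le> C * schwartz_seminorm N \<eta>"
    using tempered_bound[OF u] by metis
  obtain D where D: "0 \<le> D" and DN: "\<And>(\<eta>::'a \<Rightarrow> complex) n. \<eta> \<in> schwartz \<Longrightarrow>
     schwartz_seminorm N (\<lambda>t. \<eta> t * (1 - cutoff n t)) \<le> D / real (Suc n) * schwartz_seminorm (Suc N) \<eta>"
    using seminorm_cutoff[of N] by metis
  have diff: "cmod (u \<eta> - u (\<lambda>t. \<eta> t * cutoff n t)) \<le> C * (D / real (Suc n) * schwartz_seminorm (Suc N) \<eta>)"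
    if \<eta>: "\<eta> \<in> schwartz" for \<eta> n
  proof -
    have e: "(\<lambda>t. \<eta> t - \<eta> t * cutoff n t) = (\<lambda>t. \<eta> t * (1 - cutoff n t))" by (simp add: algebra_simps)
    have "u \<eta> - u (\<lambda>t. \<eta> t * cutoff n t) = u (\<lambda>t. \<eta> t * (1 - cutoff n t))"
      using tempered_diff[OF u \<eta> schwartz_cutoff[OF \<eta>, of n]] unfolding e by simp
    moreover have "(\<lambda>t. \<eta> t * (1 - cutoff n t)) \<in> schwartz"
      using schwartz_diff[OF \<eta> schwartz_cutoff[OF \<eta>, of n]] unfolding e .
    ultimately show ?thesis
      using order_trans[OF CN mult_left_mono[OF DN[OF \<eta>] C]] by metis
  qed
  have "cmod (u (\<lambda>t. \<eta> t * cutoff n t)) \<le> (C + C * D) * schwartz_seminorm (Suc N) \<eta>"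
    if \<eta>: "\<eta> \<in> schwartz" for \<eta> n
  proof -
    let ?P = "schwartz_seminorm (Suc N) \<eta>"
    have P: "0 \<le> ?P" by (rule seminorm_nonneg[OF \<eta>])
    have "cmod (u (\<lambda>t. \<eta> t * cutoff n t)) \<le> cmod (u \<eta>) + cmod (u \<eta> - u (\<lambda>t. \<eta> t * cutoff n t))"
      using norm_triangle_sub[of "u (\<lambda>t. \<eta> t * cutoff n t)" "u \<eta>"] by (simp add: norm_minus_commute)
    also have "\<dots> \<le> C * ?P + C * (D / real (Suc n) * ?P)"
      by (intro add_mono diff \<eta> order_trans[OF CN[OF \<eta>]] mult_left_mono C seminorm_mono) simp
    also have "\<dots> \<le> C * ?P + C * (D * ?P)"
    proof -
      have "D / real (Suc n) \<le> D / 1" using D by (intro divide_left_mono) auto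
      then show ?thesis using C P by (intro add_left_mono mult_left_mono mult_right_mono) auto
    qed
    finally show ?thesis by (simp add: algebra_simps)
  qed
  then show "\<exists>C\<ge>0. \<exists>N. \<forall>\<eta>\<in>schwartz. \<forall>n. cmod (u (\<lambda>t. \<eta> t * cutoff n t)) \<le> C * schwartz_seminorm N \<eta>"
    using C D by (intro exI[of _ "C + C * D"]) auto
  show "(\<lambda>n. u (\<lambda>t. \<eta> t * cutoff n t)) \<longlonglongrightarrow> u \<eta>" if \<eta>: "\<eta> \<in> schwartz" for \<eta>
  proof -
    have "(\<lambda>n. C * (D * schwartz_seminorm (Suc N) \<eta>) * (1 / real (Suc n))) \<longlonglongrightarrow> C * (D * schwartz_seminorm (Suc N) \<eta>) * 0"
      by (intro tendsto_intros LIMSEQ_Suc[OF lim_1_over_n])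
    then have z: "(\<lambda>n. C * (D / real (Suc n) * schwartz_seminorm (Suc N) \<eta>)) \<longlonglongrightarrow> 0" by simp
    have "(\<lambda>n. u \<eta> - u (\<lambda>t. \<eta> t * cutoff n t)) \<longlonglongrightarrow> 0"
      by (rule Lim_null_comparison[OF always_eventually z]) (use diff[OF \<eta>] in blast)
    from tendsto_diff[OF tendsto_const[of "u \<eta>"] this] show ?thesis by simp
  qed
qed

lemma is_function_cutoff:
  assumes "is_function u F" "\<eta> \<in> schwartz"
  shows "u (\<lambda>t. \<eta> t * cutoff n t) = (LINT t|lborel. F t * (\<eta> t * cutoff n t))"
  using assms test_function_cutoff[OF assms(2), of n] by (auto simp: is_function_def test_functions_def)

lemma is_function_borel: "is_function u F \<Longrightarrow> F \<in> borel_measurable borel"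
  by (simp add: is_function_def)

lemma is_function_cutoff_integrable:
  assumes "is_function u F" shows "integrable lborel (\<lambda>t. F t * cutoff n t)"
proof -
  have "set_integrable lborel (cball 0 (real (Suc n))) F"
    using assms by (simp add: is_function_def)
  then have "integrable lborel (\<lambda>t. indicator (cball 0 (real (Suc n))) t *\<^sub>R F t)"
    by (simp add: set_integrable_def)
  then show ?thesis
  proof (rule Bochner_Integration.integrable_bound)
    show "(\<lambda>t. F t * cutoff n t) \<in> borel_measurable lborel"
      using is_function_borel[OF assms] by measurable
    show "AE t in lborel. norm (F t * cutoff n t) \<le> norm (indicator (cball 0 (real (Suc n))) t *\<^sub>R F t)"
      by (intro AE_I2) (auto simp: norm_mult indicator_def mult_left_le cutoff_le_1 cutoff_outside not_le simp del: of_nat_Suc)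
  qed
qed

text \<open>
  For the cut-off function, the reconstruction formula is Fubini's theorem and the expansion of \<open>\<eta>\<close> into
  atoms. The cutoffs are removed by dominated convergence: the pairings with all atoms have
  polynomial bounds that are uniform in the cutoff, and the coefficients decay rapidly.
\<close>

lemma
  fixes g \<eta> :: "'a::euclidean_space \<Rightarrow> complex"
  assumes u: "u \<in> tempered" and F: "is_function u F" and g: "g \<in> schwartz"
  shows stft_measurable: "stft g u \<in> borel_measurable borel"
    and stft_reconstruction: "\<eta> \<in> schwartz \<Longrightarrow>
      (LINT z|lborel. coefficient g \<eta> z * stft g u z) = of_real (LINT s|lborel. (cmod (g s))\<^sup>2) * u \<eta>"
proof -
  note [measurable] = schwartz_borel[OF g] is_function_borel[OF F]
  have [measurable]: "(\<lambda>t. cnj (g t)) \<in> borel_measurable borel" by (rule schwartz_borel[OF schwartz_cnj[OF g]])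
  define V where "V n z = (LINT t|lborel. F t * cutoff n t * atom g z t)" for n z
  have Vu: "V n z = u (\<lambda>t. atom g z t * cutoff n t)" for n z
    unfolding V_def is_function_cutoff[OF F schwartz_atom[OF g]] by (simp add: mult_ac)
  have lim: "(\<lambda>n. V n z) \<longlonglongrightarrow> stft g u z" for z
    unfolding Vu stft_eq by (rule tempered_cutoff_tendsto[OF u schwartz_atom[OF g]])
  have [measurable]: "V n \<in> borel_measurable borel" for n
    unfolding V_def[abs_def] atom_def by measurable
  show m: "stft g u \<in> borel_measurable borel"
    by (rule borel_measurable_LIMSEQ_metric[of V]) (auto intro: lim)
  assume \<eta>: "\<eta> \<in> schwartz"
  note [measurable] = schwartz_borel[OF \<eta>]
  obtain C N where C: "0 \<le> C" and CN: "\<And>\<eta> n. \<eta> \<in> schwartz \<Longrightarrow> cmod (u (\<lambda>t. \<eta> t * cutoff n t)) \<le> C * schwartz_seminorm N \<eta>"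
    using tempered_cutoff_bound[OF u] by metis
  obtain D where D: "0 \<le> D" and DN: "\<And>z::'a\<times>'a. schwartz_seminorm N (atom g z) \<le> D * ((1 + norm (fst z)) ^ N * (1 + norm (snd z)) ^ N)"
    using seminorm_atom[OF g, of N] seminorm_nonneg[OF g, of N]
    by (metis mult_nonneg_nonneg zero_le_numeral zero_le_power)
  obtain E M where E: "0 \<le> E" and EM: "\<And>z::'a\<times>'a. cmod (coefficient g \<eta> z) * ((1 + norm (fst z)) ^ N * (1 + norm (snd z)) ^ N)
      \<le> E * schwartz_seminorm M \<eta> * (decay (fst z) * decay (snd z))"
    using coefficient_bound[OF g, of N] \<eta> by metis
  have dom: "cmod (coefficient g \<eta> z * V n z) \<le> C * D * (E * schwartz_seminorm M \<eta>) * (decay (fst z) * decay (snd z))" for n z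
  proof -
    have "cmod (V n z) \<le> C * (D * ((1 + norm (fst z)) ^ N * (1 + norm (snd z)) ^ N))"
      unfolding Vu using order_trans[OF CN[OF schwartz_atom[OF g]] mult_left_mono[OF DN C]] .
    then have "cmod (coefficient g \<eta> z * V n z) \<le> cmod (coefficient g \<eta> z) * (C * (D * ((1 + norm (fst z)) ^ N * (1 + norm (snd z)) ^ N)))"
      by (simp add: norm_mult mult_left_mono)
    also have "\<dots> = (C * D) * (cmod (coefficient g \<eta> z) * ((1 + norm (fst z)) ^ N * (1 + norm (snd z)) ^ N))"
      by (simp add: mult_ac)
    also have "\<dots> \<le> (C * D) * (E * schwartz_seminorm M \<eta> * (decay (fst z) * decay (snd z)))"
      using C D by (intro mult_left_mono EM) auto
    finally show ?thesis by (simp add: mult_ac)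
  qed
  have "(\<lambda>n. LINT z|lborel. coefficient g \<eta> z * V n z) \<longlonglongrightarrow> (LINT z|lborel. coefficient g \<eta> z * stft g u z)"
  proof (rule integral_dominated_convergence[where w="\<lambda>z. C * D * (E * schwartz_seminorm M \<eta>) * (decay (fst z) * decay (snd z))"])
    show "integrable lborel (\<lambda>z::'a\<times>'a. C * D * (E * schwartz_seminorm M \<eta>) * (decay (fst z) * decay (snd z)))"
      by (intro integrable_mult_right integrable_decay_prod)
    show "(\<lambda>z. coefficient g \<eta> z * stft g u z) \<in> borel_measurable lborel" using m by measurable
  qed (auto intro!: tendsto_intros lim AE_I2 dom)
  moreover have "(LINT z|lborel. coefficient g \<eta> z * V n z) = of_real (LINT s|lborel. (cmod (g s))\<^sup>2) * u (\<lambda>t. \<eta> t * cutoff n t)" for n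
  proof -
    have Fn: "integrable lborel (\<lambda>t. of_real (schwartz_seminorm 0 g) * (F t * cutoff n t))"
      by (intro integrable_mult_right is_function_cutoff_integrable[OF F])
    have "integrable (lborel \<Otimes>\<^sub>M lborel) (\<lambda>(z, t). coefficient g \<eta> z * (F t * cutoff n t * atom g z t))"
    proof (rule integrable_tensor_dominated[OF coefficient_integrable[OF g \<eta>] Fn])
      show "(\<lambda>(z, t). coefficient g \<eta> z * (F t * cutoff n t * atom g z t)) \<in> borel_measurable (lborel \<Otimes>\<^sub>M lborel)"
        unfolding atom_def by measurable
      show "cmod (case (z, t) of (z, t) \<Rightarrow> coefficient g \<eta> z * (F t * cutoff n t * atom g z t))
         \<le> cmod (coefficient g \<eta> z) * cmod (of_real (schwartz_seminorm 0 g) * (F t * cutoff n t))" for z t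
        using window_mult_bound[OF g, of "coefficient g \<eta> z * (F t * cutoff n t)" "t - fst z"] seminorm_nonneg[OF g, of 0]
        by (simp add: atom_def norm_mult mult_ac)
    qed
    from lborel_pair.Fubini_integral[OF this]
    have "(LINT z|lborel. coefficient g \<eta> z * V n z) = (LINT t|lborel. LINT z|lborel. coefficient g \<eta> z * (F t * cutoff n t * atom g z t))"
      unfolding V_def by simp
    also have "\<dots> = (LINT t|lborel. F t * cutoff n t * (LINT z|lborel. coefficient g \<eta> z * atom g z t))"
      by (simp add: mult_ac flip: integral_mult_right_zero)
    also have "\<dots> = (LINT t|lborel. of_real (LINT s|lborel. (cmod (g s))\<^sup>2) * (F t * (\<eta> t * cutoff n t)))"
      unfolding coefficient_synthesis[OF g \<eta>] by (simp add: mult_ac)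
    also have "\<dots> = of_real (LINT s|lborel. (cmod (g s))\<^sup>2) * u (\<lambda>t. \<eta> t * cutoff n t)"
      unfolding is_function_cutoff[OF F \<eta>] by (rule integral_mult_right_zero)
    finally show ?thesis .
  qed
  moreover have "(\<lambda>n. of_real (LINT s|lborel. (cmod (g s))\<^sup>2) * u (\<lambda>t. \<eta> t * cutoff n t)) \<longlonglongrightarrow> of_real (LINT s|lborel. (cmod (g s))\<^sup>2) * u \<eta>"
    by (intro tendsto_intros tempered_cutoff_tendsto[OF u \<eta>])
  ultimately show "(LINT z|lborel. coefficient g \<eta> z * stft g u z) = of_real (LINT s|lborel. (cmod (g s))\<^sup>2) * u \<eta>"
    using LIMSEQ_unique by auto
qed

lemma AE_open_empty:
  fixes U :: "'a::euclidean_space set"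
  assumes "open U" "AE x in lborel. x \<notin> U" shows "U = {}"
proof (rule ccontr)
  assume "U \<noteq> {}"
  have "U \<in> sets lborel" using assms(1) by simp
  then have "U \<in> null_sets lborel" using assms(2) by (simp add: AE_iff_null_sets)
  then have "U \<in> null_sets lebesgue" by (rule null_sets_completionI)
  then have "negligible U" by (simp add: negligible_iff_null_sets)
  with open_not_negligible[OF assms(1) \<open>U \<noteq> {}\<close>] show False by simp
qed

lemma schwartz_norm_pos:
  assumes g: "g \<in> schwartz" and "g \<noteq> (\<lambda>_. 0)"
  shows "0 < (LINT s|lborel. (cmod (g s))\<^sup>2)"
proof -
  have "(LINT s|lborel. (cmod (g s))\<^sup>2) \<noteq> 0"
  proof
    assume "(LINT s|lborel. (cmod (g s))\<^sup>2) = 0"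
    then have "AE s in lborel. (cmod (g s))\<^sup>2 = 0"
      by (subst (asm) integral_nonneg_eq_0_iff_AE[OF schwartz_square_integrable[OF g]]) auto
    then have "AE s in lborel. s \<notin> {s. g s \<noteq> 0}" by simp
    moreover have "open {s. g s \<noteq> 0}"
      by (intro open_Collect_neq schwartz_continuous_on g continuous_on_const)
    ultimately have "{s. g s \<noteq> 0} = {}" by (intro AE_open_empty)
    then show False using assms(2) by auto
  qed
  moreover have "0 \<le> (LINT s|lborel. (cmod (g s))\<^sup>2)" by simp
  ultimately show ?thesis by linarith
qed

lemma nn_integral_fst_borel:
  fixes f :: "'a::euclidean_space \<times> 'b::euclidean_space \<Rightarrow> ennreal"
  assumes "f \<in> borel_measurable borel"
  shows "(\<integral>\<^sup>+z. f z \<partial>lborel) = (\<integral>\<^sup>+x. \<integral>\<^sup>+y. f (x, y) \<partial>lborel \<partial>lborel)"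
  using assms by (subst lborel_prod[symmetric], subst lborel.nn_integral_fst[symmetric]) (simp_all add: lborel_prod)

lemma nn_integral_snd_borel:
  fixes f :: "'a::euclidean_space \<times> 'b::euclidean_space \<Rightarrow> ennreal"
  assumes "f \<in> borel_measurable borel"
  shows "(\<integral>\<^sup>+z. f z \<partial>lborel) = (\<integral>\<^sup>+y. \<integral>\<^sup>+x. f (x, y) \<partial>lborel \<partial>lborel)"
  using assms by (subst lborel_prod[symmetric], subst lborel_pair.nn_integral_snd) (simp_all add: lborel_prod)

definition M2_integral :: "('a::euclidean_space \<Rightarrow> complex) \<Rightarrow> ('a \<times> 'a \<Rightarrow> real) \<Rightarrow> (('a \<Rightarrow> complex) \<Rightarrow> complex) \<Rightarrow> ennreal" where
  "M2_integral g \<mu> u = (\<integral>\<^sup>+z. ennreal ((\<mu> z * cmod (stft g u z))\<^sup>2) \<partial>lborel)"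

text \<open>
  In the reconstruction formula, the weight \<open>\<mu>\<close> is put on the transform and \<open>1 / \<mu>\<close> on the coefficients,
  before the Cauchy-Schwarz inequality is applied.
\<close>

lemma reconstruction_cauchy_schwarz:
  fixes g :: "'a::euclidean_space \<Rightarrow> complex"
  assumes u: "u \<in> tempered" and F: "is_function u F" and g: "g \<in> schwartz" and \<eta>: "\<eta> \<in> schwartz"
    and \<mu> [measurable]: "\<mu> \<in> borel_measurable borel" and pos: "\<And>z. 0 < \<mu> z"
    and B: "0 \<le> B" "M2_integral g \<mu> u \<le> ennreal (B\<^sup>2)"
    and D: "0 \<le> D" "(\<integral>\<^sup>+z. ennreal ((cmod (coefficient g \<eta> z) / \<mu> z)\<^sup>2) \<partial>lborel) \<le> ennreal (D\<^sup>2)"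
  shows "(LINT s|lborel. (cmod (g s))\<^sup>2) * cmod (u \<eta>) \<le> D * B"
proof -
  note [measurable] = stft_measurable[OF u F g] coefficient_measurable[OF schwartz_borel[OF g] schwartz_borel[OF \<eta>]]
  have "(\<integral>\<^sup>+z. ennreal (cmod (coefficient g \<eta> z) / \<mu> z) * ennreal (\<mu> z * cmod (stft g u z)) \<partial>lborel)\<^sup>2
     \<le> (\<integral>\<^sup>+z. (ennreal (cmod (coefficient g \<eta> z) / \<mu> z))\<^sup>2 \<partial>lborel) * (\<integral>\<^sup>+z. (ennreal (\<mu> z * cmod (stft g u z)))\<^sup>2 \<partial>lborel)"
    by (rule Cauchy_Schwarz_nn_integral) measurable
  also have "\<dots> = (\<integral>\<^sup>+z. ennreal ((cmod (coefficient g \<eta> z) / \<mu> z)\<^sup>2) \<partial>lborel) * M2_integral g \<mu> u"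
    using pos by (simp add: M2_integral_def ennreal_power less_imp_le)
  also have "\<dots> \<le> ennreal (D\<^sup>2) * ennreal (B\<^sup>2)" by (intro mult_mono D B) auto
  also have "\<dots> = (ennreal (D * B))\<^sup>2" using B D by (simp add: ennreal_power ennreal_mult power_mult_distrib)
  finally have "(\<integral>\<^sup>+z. ennreal (cmod (coefficient g \<eta> z) / \<mu> z) * ennreal (\<mu> z * cmod (stft g u z)) \<partial>lborel) \<le> ennreal (D * B)"
    by (rule ennreal_square_le_cancel)
  moreover have "ennreal (cmod (coefficient g \<eta> z) / \<mu> z) * ennreal (\<mu> z * cmod (stft g u z)) = ennreal (cmod (coefficient g \<eta> z * stft g u z))" for z
    using pos[of z] by (simp add: ennreal_mult[symmetric] norm_mult less_imp_le)
  ultimately have le: "(\<integral>\<^sup>+z. ennreal (cmod (coefficient g \<eta> z * stft g u z)) \<partial>lborel) \<le> ennreal (D * B)" by simp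
  then have "integrable lborel (\<lambda>z. coefficient g \<eta> z * stft g u z)"
    by (auto simp: integrable_iff_bounded intro: le_less_trans)
  from integral_norm_bound_ennreal[OF this] le
  have "ennreal (cmod (LINT z|lborel. coefficient g \<eta> z * stft g u z)) \<le> ennreal (D * B)" by (rule order_trans)
  moreover have "0 \<le> (LINT s|lborel. (cmod (g s))\<^sup>2)" by simp
  ultimately show ?thesis
    using B D unfolding stft_reconstruction[OF u F g \<eta>] by (simp add: norm_mult ennreal_le_iff)
qed

lemma decay_le_1: "decay t \<le> 1"
  unfolding decay_def by (simp add: divide_le_eq_1 add_pos_nonneg)

lemma nn_integral_decay_square:
  "\<exists>J\<ge>0. (\<integral>\<^sup>+z. ennreal ((decay (fst (z::'a::euclidean_space \<times> 'a)) * decay (snd z))\<^sup>2) \<partial>lborel) \<le> ennreal (J\<^sup>2)"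
proof -
  define J where "J = (LINT z|lborel. decay (fst (z::'a \<times> 'a)) * decay (snd z))"
  have J: "0 \<le> J" by (simp add: J_def)
  have "(\<integral>\<^sup>+z. ennreal ((decay (fst (z::'a::euclidean_space \<times> 'a)) * decay (snd z))\<^sup>2) \<partial>lborel) \<le> (\<integral>\<^sup>+z. ennreal (decay (fst (z::'a::euclidean_space \<times> 'a)) * decay (snd z)) \<partial>lborel)"
  proof (intro nn_integral_mono ennreal_leI)
    fix z :: "'a \<times> 'a"
    have "decay (fst z) * decay (snd z) \<le> 1" using decay_le_1 by (intro mult_le_one) auto
    then show "(decay (fst z) * decay (snd z))\<^sup>2 \<le> decay (fst z) * decay (snd z)"
      using mult_left_mono[of "decay (fst z) * decay (snd z)" 1 "decay (fst z) * decay (snd z)"] by (simp add: power2_eq_square)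
  qed
  also have "\<dots> = ennreal J"
    unfolding J_def by (rule nn_integral_eq_integral[OF integrable_decay_prod]) simp
  also have "\<dots> = ennreal ((sqrt J)\<^sup>2)" using J by simp
  finally show ?thesis using J by (intro exI[of _ "sqrt J"]) auto
qed

text \<open>
  The coefficients decay faster than \<open>1 / \<mu>\<close> can grow, so they are square integrable against it, with a
  bound by a seminorm.
\<close>

lemma stft_bound_function:
  fixes g :: "'a::euclidean_space \<Rightarrow> complex"
  assumes g: "g \<in> schwartz" "g \<noteq> (\<lambda>_. 0)" and \<mu>: "\<mu> \<in> borel_measurable borel"
    and c: "0 < c" "\<And>z. c \<le> \<mu> z * ((1 + norm (fst z)) ^ s * (1 + norm (snd z)) ^ s)"
  shows "\<exists>C\<ge>0. \<exists>N. \<forall>u F B \<eta>. u \<in> tempered \<longrightarrow> is_function u F \<longrightarrow> 0 \<le> B \<longrightarrow> M2_integral g \<mu> u \<le> ennreal (B\<^sup>2) \<longrightarrow>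
    \<eta> \<in> schwartz \<longrightarrow> cmod (u \<eta>) \<le> C * B * schwartz_seminorm N \<eta>"
proof -
  let ?G = "LINT s|lborel. (cmod (g s))\<^sup>2"
  have G: "0 < ?G" by (rule schwartz_norm_pos[OF g])
  have w: "0 < (1 + norm (fst z)) ^ s * (1 + norm (snd z)) ^ s" for z :: "'a \<times> 'a"
    by (intro mult_pos_pos zero_less_power add_pos_nonneg) auto
  have pos: "0 < \<mu> z" for z using c(1) c(2)[of z] w[of z] by (smt (verit) mult_nonpos_nonneg)
  obtain C M where C: "0 \<le> C" and CM: "\<And>\<eta> (z::'a \<times> 'a). \<eta> \<in> schwartz \<Longrightarrow>
      cmod (coefficient g \<eta> z) * ((1 + norm (fst z)) ^ s * (1 + norm (snd z)) ^ s) \<le> C * schwartz_seminorm M \<eta> * (decay (fst z) * decay (snd z))"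
    using coefficient_bound[OF g(1), of s] by metis
  obtain J where J: "0 \<le> J" "(\<integral>\<^sup>+z. ennreal ((decay (fst (z::'a::euclidean_space \<times> 'a)) * decay (snd z))\<^sup>2) \<partial>lborel) \<le> ennreal (J\<^sup>2)"
    using nn_integral_decay_square by metis
  have "cmod (u \<eta>) \<le> (C / c * J / ?G) * B * schwartz_seminorm M \<eta>"
    if u: "u \<in> tempered" and F: "is_function u F" and B: "0 \<le> B" "M2_integral g \<mu> u \<le> ennreal (B\<^sup>2)" and \<eta>: "\<eta> \<in> schwartz" for u F B \<eta>
  proof -
    let ?P = "schwartz_seminorm M \<eta>"
    have P: "0 \<le> ?P" by (rule seminorm_nonneg[OF \<eta>])
    define D where "D = C / c * ?P"
    have D: "0 \<le> D" using C c P by (simp add: D_def)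
    have le: "cmod (coefficient g \<eta> z) / \<mu> z \<le> D * (decay (fst z) * decay (snd z))" for z
    proof -
      let ?W = "(1 + norm (fst z)) ^ s * (1 + norm (snd z)) ^ s"
      have "c * cmod (coefficient g \<eta> z) \<le> (\<mu> z * ?W) * cmod (coefficient g \<eta> z)"
        by (intro mult_right_mono c) auto
      also have "\<dots> = \<mu> z * (cmod (coefficient g \<eta> z) * ?W)" by (simp add: mult_ac)
      also have "\<dots> \<le> \<mu> z * (C * ?P * (decay (fst z) * decay (snd z)))"
        using pos[of z] by (intro mult_left_mono CM \<eta>) auto
      finally show ?thesis using pos[of z] c(1) by (simp add: D_def field_simps)
    qed
    have "(\<integral>\<^sup>+z. ennreal ((cmod (coefficient g \<eta> z) / \<mu> z)\<^sup>2) \<partial>lborel) \<le> (\<integral>\<^sup>+z. ennreal (D\<^sup>2) * ennreal ((decay (fst (z::'a::euclidean_space \<times> 'a)) * decay (snd z))\<^sup>2) \<partial>lborel)"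
    proof (rule nn_integral_mono)
      fix z
      have "(cmod (coefficient g \<eta> z) / \<mu> z)\<^sup>2 \<le> (D * (decay (fst z) * decay (snd z)))\<^sup>2"
        using le[of z] pos[of z] by (intro power_mono) auto
      then show "ennreal ((cmod (coefficient g \<eta> z) / \<mu> z)\<^sup>2) \<le> ennreal (D\<^sup>2) * ennreal ((decay (fst z) * decay (snd z))\<^sup>2)"
        by (simp add: power_mult_distrib ennreal_mult[symmetric] ennreal_leI)
    qed
    also have "\<dots> = ennreal (D\<^sup>2) * (\<integral>\<^sup>+z. ennreal ((decay (fst (z::'a::euclidean_space \<times> 'a)) * decay (snd z))\<^sup>2) \<partial>lborel)"
      by (rule nn_integral_cmult) measurable
    also have "\<dots> \<le> ennreal (D\<^sup>2) * ennreal (J\<^sup>2)" by (intro mult_left_mono J) auto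
    also have "\<dots> = ennreal ((D * J)\<^sup>2)" by (simp add: ennreal_mult power_mult_distrib)
    finally have "?G * cmod (u \<eta>) \<le> D * J * B"
      using D J by (intro reconstruction_cauchy_schwarz[OF u F g(1) \<eta> \<mu> pos B]) auto
    then show ?thesis using G c(1) by (simp add: D_def field_simps)
  qed
  moreover have "0 \<le> C / c * J / ?G" using C c J G by simp
  ultimately show ?thesis by blast
qed

lemma nn_integral_coefficient:
  fixes g \<eta> :: "'a::euclidean_space \<Rightarrow> complex"
  assumes g: "g \<in> schwartz" and \<eta>: "\<eta> \<in> schwartz"
  shows "L2_square (\<lambda>\<omega>. coefficient g \<eta> (x, \<omega>)) = (\<integral>\<^sup>+t. ennreal ((cmod (\<eta> t))\<^sup>2 * (cmod (g (t - x)))\<^sup>2) \<partial>lborel)"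
proof -
  let ?h = "\<lambda>t. \<eta> t * g (t - x)"
  have h: "?h \<in> schwartz" by (intro schwartz_mult \<eta> schwartz_translate g)
  have [measurable]: "fourier ?h \<in> borel_measurable borel" by (rule schwartz_borel[OF schwartz_fourier[OF h]])
  have "L2_square (\<lambda>\<omega>. coefficient g \<eta> (x, \<omega>)) = L2_square (fourier ?h)"
    using nn_integral_reflect[of "\<lambda>\<omega>. ennreal ((cmod (fourier ?h \<omega>))\<^sup>2)" 0] by (simp add: coefficient_def inverse_fourier_def)
  also have "\<dots> = L2_square ?h" by (rule plancherel[OF schwartz_integrable[OF h]])
  finally show ?thesis by (simp add: norm_mult power_mult_distrib)
qed

lemma schwartz_weighted_square:
  assumes "g \<in> schwartz"
  shows "\<exists>K\<ge>0. (\<integral>\<^sup>+t. ennreal ((1 + norm t) ^ k * (cmod (g (t::'a::euclidean_space)))\<^sup>2) \<partial>lborel) \<le> ennreal K"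
proof -
  let ?S = "schwartz_seminorm 0 g"
  have le: "(1 + norm t) ^ k * (cmod (g t))\<^sup>2 \<le> ?S * ((1 + norm t) ^ k * cmod (g t))" for t
    using mult_left_mono[OF schwartz_decay[OF assms, of t 0], of "(1 + norm t) ^ k * cmod (g t)"]
    by (simp add: power2_eq_square mult_ac)
  have i: "integrable lborel (\<lambda>t. ?S * ((1 + norm t) ^ k * cmod (g t)))"
    by (intro integrable_mult_right schwartz_integrable_moment assms)
  have "(\<integral>\<^sup>+t. ennreal ((1 + norm t) ^ k * (cmod (g t))\<^sup>2) \<partial>lborel) \<le> (\<integral>\<^sup>+t. ennreal (?S * ((1 + norm t) ^ k * cmod (g t))) \<partial>lborel)"
    by (intro nn_integral_mono ennreal_leI le)
  also have "\<dots> = ennreal (LINT t|lborel. ?S * ((1 + norm t) ^ k * cmod (g t)))"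
    using seminorm_nonneg[OF assms] by (intro nn_integral_eq_integral[OF i] AE_I2) simp
  finally show ?thesis using seminorm_nonneg[OF assms, of 0]
    by (intro exI[of _ "LINT t|lborel. ?S * ((1 + norm t) ^ k * cmod (g t))"]) (auto intro!: integral_nonneg_AE)
qed

lemma weight_window_integral:
  fixes g :: "'a::euclidean_space \<Rightarrow> complex"
  assumes g [measurable]: "g \<in> borel_measurable borel"
    and K: "(\<integral>\<^sup>+t. ennreal ((1 + norm t) ^ k * (cmod (g t))\<^sup>2) \<partial>lborel) \<le> ennreal K"
  shows "(\<integral>\<^sup>+x. ennreal ((1 + norm (t - x)) ^ k * (cmod (g (t - x)))\<^sup>2) \<partial>lborel) \<le> ennreal K"
  using nn_integral_reflect[of "\<lambda>t. ennreal ((1 + norm t) ^ k * (cmod (g t))\<^sup>2)" t] K by simp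

abbreviation weighted_L2 :: "nat \<Rightarrow> ('a::euclidean_space \<Rightarrow> complex) \<Rightarrow> ennreal" where
  "weighted_L2 s F \<equiv> (\<integral>\<^sup>+t. ennreal ((cmod (F t))\<^sup>2 / (1 + norm t) ^ (2 * s)) \<partial>lborel)"

text \<open>
  The lower bound of \<open>\<mu>\<close> is uniform in frequency. So the frequency integral of the coefficients can be
  evaluated by the Plancherel identity, and \<open>u\<close> is bounded on test functions by a weighted \<open>L\<^sup>2\<close> norm;
  the converse of Hoelder's inequality turns this into a bound for \<open>F\<close>.
\<close>

lemma function_weighted_L2:
  fixes g :: "'a::euclidean_space \<Rightarrow> complex"
  assumes g: "g \<in> schwartz" "g \<noteq> (\<lambda>_. 0)" and \<mu> [measurable]: "\<mu> \<in> borel_measurable borel"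
    and c: "0 < c" "\<And>x \<omega>. c \<le> \<mu> (x, \<omega>) * (1 + norm x) ^ s"
  shows "\<exists>C\<ge>0. \<forall>u F B. u \<in> tempered \<longrightarrow> is_function u F \<longrightarrow> 0 \<le> B \<longrightarrow> M2_integral g \<mu> u \<le> ennreal (B\<^sup>2) \<longrightarrow>
    weighted_L2 s F \<le> ennreal ((C * B)\<^sup>2)"
proof -
  note [measurable] = schwartz_borel[OF g(1)]
  let ?G = "LINT s|lborel. (cmod (g s))\<^sup>2"
  have G: "0 < ?G" by (rule schwartz_norm_pos[OF g])
  have w: "0 < (1 + norm x) ^ s" for x :: 'a by (intro zero_less_power add_pos_nonneg) auto
  have pos: "0 < \<mu> z" for z
    using c(1) c(2)[of "fst z" "snd z"] w[of "fst z"] by (smt (verit) mult_nonpos_nonneg prod.collapse)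
  obtain K where K: "0 \<le> K" "(\<integral>\<^sup>+t. ennreal ((1 + norm t) ^ (2 * s) * (cmod (g t))\<^sup>2) \<partial>lborel) \<le> ennreal K"
    using schwartz_weighted_square[OF g(1)] by metis
  have "weighted_L2 s F \<le> ennreal ((sqrt K / c / ?G * B)\<^sup>2)"
    if u: "u \<in> tempered" and F: "is_function u F" and B: "0 \<le> B" "M2_integral g \<mu> u \<le> ennreal (B\<^sup>2)" for u F B
  proof (rule converse_hoelder)
    show "F \<in> borel_measurable borel" "\<And>K. compact K \<Longrightarrow> set_integrable lborel K F"
      using F by (auto simp: is_function_def)
    show "0 \<le> sqrt K / c / ?G * B" using K c G B by simp
    fix \<eta> :: "'a \<Rightarrow> complex" assume test: "\<eta> \<in> test_functions"
    then have \<eta>: "\<eta> \<in> schwartz" by (rule test_functions_schwartz)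
    note [measurable] = schwartz_borel[OF \<eta>]
    define E where "E = (LINT t|lborel. (cmod (\<eta> t))\<^sup>2 * (1 + norm t) ^ (2 * s))"
    have Ei: "integrable lborel (\<lambda>t. (cmod (\<eta> t))\<^sup>2 * (1 + norm t) ^ (2 * s))"
    proof -
      obtain L where "(\<integral>\<^sup>+t. ennreal ((1 + norm t) ^ (2 * s) * (cmod (\<eta> t))\<^sup>2) \<partial>lborel) \<le> ennreal L"
        using schwartz_weighted_square[OF \<eta>] by metis
      then show ?thesis by (auto simp: integrable_iff_bounded abs_mult mult.commute intro: le_less_trans)
    qed
    have E: "0 \<le> E" unfolding E_def by (intro integral_nonneg_AE AE_I2) simp
    have "(\<integral>\<^sup>+z. ennreal ((cmod (coefficient g \<eta> z) / \<mu> z)\<^sup>2) \<partial>lborel)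
       \<le> (\<integral>\<^sup>+z. ennreal (1 / c\<^sup>2 * (1 + norm (fst z)) ^ (2 * s)) * ennreal ((cmod (coefficient g \<eta> z))\<^sup>2) \<partial>lborel)"
    proof (rule nn_integral_mono)
      fix z
      have "c * cmod (coefficient g \<eta> z) \<le> (\<mu> z * (1 + norm (fst z)) ^ s) * cmod (coefficient g \<eta> z)"
        using c(2)[of "fst z" "snd z"] by (intro mult_right_mono) auto
      then have "cmod (coefficient g \<eta> z) / \<mu> z \<le> 1 / c * (1 + norm (fst z)) ^ s * cmod (coefficient g \<eta> z)"
        using pos[of z] c(1) by (simp add: field_simps)
      then have "(cmod (coefficient g \<eta> z) / \<mu> z)\<^sup>2 \<le> (1 / c * (1 + norm (fst z)) ^ s * cmod (coefficient g \<eta> z))\<^sup>2"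
        using pos[of z] by (intro power_mono) auto
      then show "ennreal ((cmod (coefficient g \<eta> z) / \<mu> z)\<^sup>2)
          \<le> ennreal (1 / c\<^sup>2 * (1 + norm (fst z)) ^ (2 * s)) * ennreal ((cmod (coefficient g \<eta> z))\<^sup>2)"
        by (subst ennreal_mult[symmetric]) (auto simp: power_mult_distrib power_divide power_mult[symmetric] mult.commute intro!: ennreal_leI)
    qed
    also have "\<dots> = (\<integral>\<^sup>+x. \<integral>\<^sup>+\<omega>. ennreal (1 / c\<^sup>2 * (1 + norm x) ^ (2 * s)) * ennreal ((cmod (coefficient g \<eta> (x, \<omega>)))\<^sup>2) \<partial>lborel \<partial>lborel)"
      by (subst nn_integral_fst_borel) (simp_all, measurable)
    also have "\<dots> = (\<integral>\<^sup>+x. \<integral>\<^sup>+t. ennreal (1 / c\<^sup>2 * (1 + norm x) ^ (2 * s)) * ennreal ((cmod (\<eta> t))\<^sup>2 * (cmod (g (t - x)))\<^sup>2) \<partial>lborel \<partial>lborel)"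
    proof (rule nn_integral_cong)
      fix x
      have [measurable]: "(\<lambda>\<omega>. coefficient g \<eta> (x, \<omega>)) \<in> borel_measurable borel"
        by measurable
      show "(\<integral>\<^sup>+\<omega>. ennreal (1 / c\<^sup>2 * (1 + norm x) ^ (2 * s)) * ennreal ((cmod (coefficient g \<eta> (x, \<omega>)))\<^sup>2) \<partial>lborel)
        = (\<integral>\<^sup>+t. ennreal (1 / c\<^sup>2 * (1 + norm x) ^ (2 * s)) * ennreal ((cmod (\<eta> t))\<^sup>2 * (cmod (g (t - x)))\<^sup>2) \<partial>lborel)"
        by (simp add: nn_integral_cmult nn_integral_coefficient[OF g(1) \<eta>])
    qed
    also have "\<dots> = (\<integral>\<^sup>+t. \<integral>\<^sup>+x. ennreal (1 / c\<^sup>2 * (1 + norm x) ^ (2 * s)) * ennreal ((cmod (\<eta> t))\<^sup>2 * (cmod (g (t - x)))\<^sup>2) \<partial>lborel \<partial>lborel)"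
      by (rule lborel_pair.Fubini') measurable
    also have "\<dots> \<le> (\<integral>\<^sup>+t. ennreal (K / c\<^sup>2) * ennreal ((cmod (\<eta> t))\<^sup>2 * (1 + norm t) ^ (2 * s)) \<partial>lborel)"
    proof (rule nn_integral_mono)
      fix t :: 'a
      have "(\<integral>\<^sup>+x. ennreal (1 / c\<^sup>2 * (1 + norm x) ^ (2 * s)) * ennreal ((cmod (\<eta> t))\<^sup>2 * (cmod (g (t - x)))\<^sup>2) \<partial>lborel)
        \<le> (\<integral>\<^sup>+x. ennreal (1 / c\<^sup>2 * ((cmod (\<eta> t))\<^sup>2 * (1 + norm t) ^ (2 * s))) * ennreal ((1 + norm (t - x)) ^ (2 * s) * (cmod (g (t - x)))\<^sup>2) \<partial>lborel)"
      proof (rule nn_integral_mono)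
        fix x
        have "(1 + norm x) ^ (2 * s) \<le> ((1 + norm (t - x)) * (1 + norm t)) ^ (2 * s)"
          by (intro power_mono peetre) simp
        then have "(1 / c\<^sup>2 * (cmod (\<eta> t))\<^sup>2 * (cmod (g (t - x)))\<^sup>2) * (1 + norm x) ^ (2 * s)
           \<le> (1 / c\<^sup>2 * (cmod (\<eta> t))\<^sup>2 * (cmod (g (t - x)))\<^sup>2) * ((1 + norm (t - x)) * (1 + norm t)) ^ (2 * s)"
          by (intro mult_left_mono) auto
        then show "ennreal (1 / c\<^sup>2 * (1 + norm x) ^ (2 * s)) * ennreal ((cmod (\<eta> t))\<^sup>2 * (cmod (g (t - x)))\<^sup>2)
          \<le> ennreal (1 / c\<^sup>2 * ((cmod (\<eta> t))\<^sup>2 * (1 + norm t) ^ (2 * s))) * ennreal ((1 + norm (t - x)) ^ (2 * s) * (cmod (g (t - x)))\<^sup>2)"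
          by (subst (1 2) ennreal_mult[symmetric]) (auto simp only: power_mult_distrib mult_ac intro!: ennreal_leI mult_nonneg_nonneg divide_nonneg_nonneg zero_le_power2 zero_le_power add_nonneg_nonneg norm_ge_zero zero_le_one)
      qed
      also have "\<dots> = ennreal (1 / c\<^sup>2 * ((cmod (\<eta> t))\<^sup>2 * (1 + norm t) ^ (2 * s))) * (\<integral>\<^sup>+x. ennreal ((1 + norm (t - x)) ^ (2 * s) * (cmod (g (t - x)))\<^sup>2) \<partial>lborel)"
        by (rule nn_integral_cmult) measurable
      also have "\<dots> \<le> ennreal (1 / c\<^sup>2 * ((cmod (\<eta> t))\<^sup>2 * (1 + norm t) ^ (2 * s))) * ennreal K"
        by (intro mult_left_mono weight_window_integral K) auto
      also have "\<dots> = ennreal (K / c\<^sup>2) * ennreal ((cmod (\<eta> t))\<^sup>2 * (1 + norm t) ^ (2 * s))"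
        using K by (simp add: ennreal_mult[symmetric] mult_ac)
      finally show "(\<integral>\<^sup>+x. ennreal (1 / c\<^sup>2 * (1 + norm x) ^ (2 * s)) * ennreal ((cmod (\<eta> t))\<^sup>2 * (cmod (g (t - x)))\<^sup>2) \<partial>lborel)
        \<le> ennreal (K / c\<^sup>2) * ennreal ((cmod (\<eta> t))\<^sup>2 * (1 + norm t) ^ (2 * s))" .
    qed
    also have "\<dots> = ennreal (K / c\<^sup>2) * (\<integral>\<^sup>+t. ennreal ((cmod (\<eta> t))\<^sup>2 * (1 + norm t) ^ (2 * s)) \<partial>lborel)"
      by (rule nn_integral_cmult) measurable
    also have "\<dots> = ennreal (K / c\<^sup>2) * ennreal E"
      unfolding E_def by (subst nn_integral_eq_integral[OF Ei]) auto
    also have "\<dots> = ennreal ((sqrt K / c * sqrt E)\<^sup>2)"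
      using K E by (simp add: ennreal_mult[symmetric] power_mult_distrib power_divide)
    finally have "?G * cmod (u \<eta>) \<le> sqrt K / c * sqrt E * B"
      using K E c by (intro reconstruction_cauchy_schwarz[OF u F g(1) \<eta> \<mu> pos B]) auto
    moreover have "u \<eta> = (LINT t|lborel. F t * \<eta> t)"
      using F test by (simp add: is_function_def test_functions_def)
    ultimately show "cmod (LINT t|lborel. F t * \<eta> t) \<le> sqrt K / c / ?G * B * sqrt (LINT t|lborel. (cmod (\<eta> t))\<^sup>2 * (1 + norm t) ^ (2 * s))"
      using G c(1) unfolding E_def by (simp add: field_simps)
  qed
  moreover have "0 \<le> sqrt K / c / ?G" using K c G by simp
  ultimately show ?thesis by blast
qed

lemma weighted_cauchy_schwarz:
  fixes F \<eta> :: "'a::euclidean_space \<Rightarrow> complex"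
  assumes [measurable]: "F \<in> borel_measurable borel" and \<eta>: "\<eta> \<in> schwartz" and D: "0 \<le> D"
    and F: "weighted_L2 s F \<le> ennreal (D\<^sup>2)"
  shows weighted_pairing_integrable: "integrable lborel (\<lambda>t. F t * \<eta> t)"
    and weighted_pairing_bound: "cmod (LINT t|lborel. F t * \<eta> t) \<le> D * sqrt (LINT t|lborel. (cmod (\<eta> t))\<^sup>2 * (1 + norm t) ^ (2 * s))"
proof -
  note [measurable] = schwartz_borel[OF \<eta>]
  have w: "0 < (1 + norm t) ^ s" for t :: 'a by (intro zero_less_power add_pos_nonneg) auto
  define f where "f t = F t / of_real ((1 + norm t) ^ s)" for t
  define h where "h t = \<eta> t * of_real ((1 + norm t) ^ s)" for t
  have [measurable]: "f \<in> borel_measurable borel" "h \<in> borel_measurable borel" unfolding f_def h_def by measurable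
  have f2: "(cmod (f t))\<^sup>2 = (cmod (F t))\<^sup>2 / (1 + norm t) ^ (2 * s)" for t
    using w[of t] by (simp add: f_def norm_divide power_divide power_mult[symmetric] mult.commute del: of_real_power of_real_add)
  have h2: "(cmod (h t))\<^sup>2 = (cmod (\<eta> t))\<^sup>2 * (1 + norm t) ^ (2 * s)" for t
    using w[of t] by (simp add: h_def norm_mult power_mult_distrib power_mult[symmetric] mult.commute[of s] del: of_real_power of_real_add)
  have fh: "f t * h t = F t * \<eta> t" for t
  proof -
    have "complex_of_real ((1 + norm t) ^ s) \<noteq> 0" using w[of t] by (metis less_irrefl of_real_eq_0_iff)
    then show ?thesis unfolding f_def h_def by (metis nonzero_eq_divide_eq times_divide_eq_right mult.assoc mult.commute)
  qed
  have fi: "integrable lborel (\<lambda>t. (cmod (f t))\<^sup>2)"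
    using F unfolding f2[symmetric] by (auto simp: integrable_iff_bounded intro: le_less_trans)
  obtain L where "(\<integral>\<^sup>+t. ennreal ((1 + norm t) ^ (2 * s) * (cmod (\<eta> t))\<^sup>2) \<partial>lborel) \<le> ennreal L"
    using schwartz_weighted_square[OF \<eta>, of "2 * s"] by blast
  then have hi: "integrable lborel (\<lambda>t. (cmod (h t))\<^sup>2)"
    unfolding h2 by (auto simp: integrable_iff_bounded abs_mult mult.commute intro: le_less_trans)
  show "integrable lborel (\<lambda>t. F t * \<eta> t)"
    using integrable_cauchy_schwarz[of f h] fi hi unfolding fh by simp
  have "ennreal (LINT t|lborel. (cmod (f t))\<^sup>2) \<le> ennreal (D\<^sup>2)"
    using F unfolding f2[symmetric] by (subst (asm) nn_integral_eq_integral[OF fi]) auto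
  then have "(LINT t|lborel. (cmod (f t))\<^sup>2) \<le> D\<^sup>2" by (simp add: ennreal_le_iff)
  then have "sqrt (LINT t|lborel. (cmod (f t))\<^sup>2) \<le> D" using D real_le_lsqrt by simp
  then have "sqrt (LINT t|lborel. (cmod (f t))\<^sup>2) * sqrt (LINT t|lborel. (cmod (h t))\<^sup>2) \<le> D * sqrt (LINT t|lborel. (cmod (h t))\<^sup>2)"
    by (intro mult_right_mono) (auto intro!: integral_nonneg_AE)
  then show "cmod (LINT t|lborel. F t * \<eta> t) \<le> D * sqrt (LINT t|lborel. (cmod (\<eta> t))\<^sup>2 * (1 + norm t) ^ (2 * s))"
    using integral_cauchy_schwarz[of f h] fi hi unfolding fh h2[symmetric] by (simp add: order_trans)
qed

text \<open>The cutoffs of \<open>\<eta>\<close> are test functions, and both sides are continuous along them.\<close>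

lemma function_pairing:
  assumes u: "u \<in> tempered" and F: "is_function u F" and \<eta>: "\<eta> \<in> schwartz" and D: "0 \<le> D"
    "weighted_L2 s F \<le> ennreal (D\<^sup>2)"
  shows "u \<eta> = (LINT t|lborel. F t * \<eta> t)"
proof -
  note [measurable] = is_function_borel[OF F] schwartz_borel[OF \<eta>]
  note i = weighted_pairing_integrable[OF is_function_borel[OF F] \<eta> D]
  have "(\<lambda>n. LINT t|lborel. F t * (\<eta> t * cutoff n t)) \<longlonglongrightarrow> (LINT t|lborel. F t * \<eta> t)"
  proof (rule integral_dominated_convergence[where w="\<lambda>t. cmod (F t * \<eta> t)"])
    show "AE t in lborel. (\<lambda>n. F t * (\<eta> t * cutoff n t)) \<longlonglongrightarrow> F t * \<eta> t"
      by (intro AE_I2) (auto intro!: tendsto_eq_intros cutoff_tendsto)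
    show "AE t in lborel. norm (F t * (\<eta> t * cutoff n t)) \<le> cmod (F t * \<eta> t)" for n
      by (intro AE_I2) (simp add: norm_mult mult.assoc[symmetric] mult_left_le cutoff_le_1)
  qed (use i in auto)
  moreover have "(\<lambda>n. LINT t|lborel. F t * (\<eta> t * cutoff n t)) \<longlonglongrightarrow> u \<eta>"
    using tempered_cutoff_tendsto[OF u \<eta>] unfolding is_function_cutoff[OF F \<eta>] .
  ultimately show ?thesis using LIMSEQ_unique by blast
qed

text \<open>For a fixed position \<open>x\<close> of the window, the transform is the Fourier transform of \<open>F t * cnj (g (t - x))\<close>.\<close>

lemma
  fixes g :: "'a::euclidean_space \<Rightarrow> complex"
  assumes u: "u \<in> tempered" and F: "is_function u F" and g: "g \<in> schwartz" and D: "0 \<le> D"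
    "weighted_L2 s F \<le> ennreal (D\<^sup>2)"
  shows stft_function: "stft g u z = (LINT t|lborel. F t * atom g z t)"
    and stft_plancherel: "L2_square (\<lambda>\<omega>. stft g u (x, \<omega>))
      = (\<integral>\<^sup>+t. ennreal ((cmod (F t))\<^sup>2) * ennreal ((cmod (g (t - x)))\<^sup>2) \<partial>lborel)"
proof -
  show eq: "stft g u z = (LINT t|lborel. F t * atom g z t)" for z
    unfolding stft_eq by (rule function_pairing[OF u F schwartz_atom[OF g] D])
  let ?h = "\<lambda>t. F t * cnj (g (t - x))"
  have i: "integrable lborel ?h"
    using weighted_pairing_integrable[OF is_function_borel[OF F] schwartz_window[OF g] D] .
  have "stft g u (x, \<omega>) = fourier ?h \<omega>" for \<omega>
    unfolding eq by (simp add: fourier_eq atom_def mult_ac)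
  then have "L2_square (\<lambda>\<omega>. stft g u (x, \<omega>)) = L2_square ?h"
    using plancherel[OF i] by simp
  then show "L2_square (\<lambda>\<omega>. stft g u (x, \<omega>))
      = (\<integral>\<^sup>+t. ennreal ((cmod (F t))\<^sup>2) * ennreal ((cmod (g (t - x)))\<^sup>2) \<partial>lborel)"
    by (simp add: norm_mult power_mult_distrib ennreal_mult)
qed

section \<open>The Fourier transform of distributions and the frequency side\<close>

lemma fourier_dist_apply: "\<eta> \<in> schwartz \<Longrightarrow> fourier_dist u \<eta> = u (fourier \<eta>)"
  by (simp add: fourier_dist_def)

lemma fourier_add:
  assumes "\<eta> \<in> schwartz" "\<theta> \<in> schwartz"
  shows "fourier (\<lambda>x. \<eta> x + \<theta> x) = (\<lambda>x. fourier \<eta> x + fourier \<theta> x)"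
  using integrable_modulation[OF schwartz_integrable[OF assms(1)]] integrable_modulation[OF schwartz_integrable[OF assms(2)]]
  by (simp add: fun_eq_iff fourier_eq distrib_right)

lemma fourier_cmult: "fourier (\<lambda>x. c * \<eta> x) = (\<lambda>x. c * fourier \<eta> x)"
  by (simp add: fun_eq_iff fourier_eq mult.assoc)

lemma fourier_dist_tempered:
  assumes u: "u \<in> tempered" shows "fourier_dist u \<in> tempered"
proof -
  obtain C N where C: "0 \<le> C" and CN: "\<And>\<eta>. \<eta> \<in> schwartz \<Longrightarrow> cmod (u \<eta>) \<le> C * schwartz_seminorm N \<eta>"
    using tempered_bound[OF u] by metis
  obtain D M where "0 \<le> D" and DM: "\<And>\<eta>. \<eta> \<in> schwartz \<Longrightarrow> schwartz_seminorm N (fourier \<eta>) \<le> D * schwartz_seminorm M (\<eta> :: 'a \<Rightarrow> complex)"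
    using seminorm_fourier[of N] by metis
  have "cmod (fourier_dist u \<eta>) \<le> (C * D) * schwartz_seminorm M \<eta>" if "\<eta> \<in> schwartz" for \<eta>
    using order_trans[OF CN[OF schwartz_fourier[OF that]] mult_left_mono[OF DM[OF that] C]] that
    by (simp add: fourier_dist_apply mult.assoc)
  moreover have "fourier_dist u (\<lambda>x. \<eta> x + \<theta> x) = fourier_dist u \<eta> + fourier_dist u \<theta>" if "\<eta> \<in> schwartz" "\<theta> \<in> schwartz" for \<eta> \<theta>
    using that tempered_add[OF u] by (simp add: fourier_dist_apply schwartz_add fourier_add schwartz_fourier)
  moreover have "fourier_dist u (\<lambda>x. c * \<eta> x) = c * fourier_dist u \<eta>" if "\<eta> \<in> schwartz" for c \<eta>
    using that tempered_cmult[OF u] by (simp add: fourier_dist_apply schwartz_cmult fourier_cmult schwartz_fourier)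
  moreover have "fourier_dist u \<in> extensional schwartz" by (simp add: fourier_dist_def)
  ultimately show ?thesis unfolding tempered_def by blast
qed

lemma fourier_translate:
  assumes "integrable lborel h"
  shows "fourier (\<lambda>\<xi>. h (\<xi> - \<omega>)) t = modulation \<omega> t * fourier h t"
proof -
  have "fourier h t = (LINT \<xi>|lborel. h (\<xi> - \<omega>) * modulation t (\<xi> - \<omega>))"
    using integral_affine[OF integrable_modulation[OF assms, of t], of 1 "- \<omega>"] by (simp add: fourier_eq)
  also have "\<dots> = (LINT \<xi>|lborel. cnj (modulation \<omega> t) * (h (\<xi> - \<omega>) * modulation t \<xi>))"
    using modulation_add[of t _ "- \<omega>"] by (simp add: modulation_minus modulation_commute[of t \<omega>] mult_ac)
  also have "\<dots> = cnj (modulation \<omega> t) * fourier (\<lambda>\<xi>. h (\<xi> - \<omega>)) t"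
    unfolding fourier_eq by (rule integral_mult_right_zero)
  finally show ?thesis by (simp add: mult.assoc[symmetric])
qed

text \<open>
  The Fourier transform turns translations into modulations and modulations into translations;
  the order of the two leaves a phase.
\<close>

lemma fourier_atom:
  assumes g: "g \<in> schwartz"
  shows "fourier (atom (fourier g) (\<omega>, - x)) = (\<lambda>t. cnj (modulation x \<omega>) * atom g (x, \<omega>) t)"
proof
  fix t
  let ?k = "\<lambda>\<xi>. cnj (fourier g \<xi>)"
  have "fourier (atom (fourier g) (\<omega>, - x)) t = fourier (\<lambda>\<xi>. ?k (\<xi> - \<omega>)) (t - x)"
    using modulation_add_left[of t "- x"] by (simp add: fourier_eq atom_def mult_ac)
  also have "\<dots> = modulation \<omega> (t - x) * fourier ?k (t - x)"
    using g by (intro fourier_translate schwartz_integrable schwartz_cnj schwartz_fourier)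
  also have "\<dots> = (modulation \<omega> t * cnj (modulation x \<omega>)) * cnj (g (t - x))"
    using modulation_add[of \<omega> t "- x"] by (simp add: modulation_minus modulation_commute[of \<omega> x] fourier_cnj_fourier[OF g])
  finally show "fourier (atom (fourier g) (\<omega>, - x)) t = cnj (modulation x \<omega>) * atom g (x, \<omega>) t"
    by (simp add: atom_def mult_ac)
qed

lemma stft_fourier_dist:
  assumes u: "u \<in> tempered" and g: "g \<in> schwartz"
  shows "stft (fourier g) (fourier_dist u) (\<omega>, - x) = cnj (modulation x \<omega>) * stft g u (x, \<omega>)"
  unfolding stft_eq fourier_dist_apply[OF schwartz_atom[OF schwartz_fourier[OF g]]] fourier_atom[OF g]
  by (rule tempered_cmult[OF u schwartz_atom[OF g]])

lemma stft_fourier_dist':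
  assumes u: "u \<in> tempered" and g: "g \<in> schwartz"
  shows "stft g u (x, \<omega>) = modulation x \<omega> * stft (fourier g) (fourier_dist u) (\<omega>, - x)"
  unfolding stft_fourier_dist[OF assms] by (simp add: mult.assoc[symmetric])

lemma nn_integral_rotate:
  fixes h :: "'a::euclidean_space \<times> 'a \<Rightarrow> ennreal"
  assumes [measurable]: "h \<in> borel_measurable borel"
  shows "(\<integral>\<^sup>+z. h z \<partial>lborel) = (\<integral>\<^sup>+z. h (snd z, - fst z) \<partial>lborel)"
proof -
  have "(\<integral>\<^sup>+z. h z \<partial>lborel) = (\<integral>\<^sup>+\<omega>. \<integral>\<^sup>+y. h (\<omega>, y) \<partial>lborel \<partial>lborel)"
    by (rule nn_integral_fst_borel) measurable
  also have "\<dots> = (\<integral>\<^sup>+\<omega>. \<integral>\<^sup>+x. h (\<omega>, 0 - x) \<partial>lborel \<partial>lborel)"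
    by (intro nn_integral_cong nn_integral_reflect[symmetric]) measurable
  also have "\<dots> = (\<integral>\<^sup>+z. h (snd z, - fst z) \<partial>lborel)"
    by (subst nn_integral_snd_borel) auto
  finally show ?thesis .
qed

lemma schwartz_fourier_nonzero:
  assumes "g \<in> schwartz" "g \<noteq> (\<lambda>_. 0)" shows "fourier g \<noteq> (\<lambda>_. 0)"
proof
  assume "fourier g = (\<lambda>_. 0)"
  then have "inverse_fourier (fourier g) = (\<lambda>_. 0)" by (simp add: inverse_fourier_eq fun_eq_iff)
  then show False using assms by (simp add: inverse_fourier_fourier)
qed

lemma stft_measurable_fourier:
  assumes u: "u \<in> tempered" and G: "is_function (fourier_dist u) G" and g: "g \<in> schwartz"
  shows "stft g u \<in> borel_measurable borel"
proof -
  note [measurable] = stft_measurable[OF fourier_dist_tempered[OF u] G schwartz_fourier[OF g]]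
  have "stft g u = (\<lambda>z. modulation (fst z) (snd z) * stft (fourier g) (fourier_dist u) (snd z, - fst z))"
    using stft_fourier_dist'[OF u g] by (auto simp: fun_eq_iff)
  also have "\<dots> \<in> borel_measurable borel" by measurable
  finally show ?thesis .
qed

text \<open>
  The rotation of the time-frequency plane preserves the measure, and the phase has modulus one.
\<close>

lemma M2_integral_fourier:
  assumes u: "u \<in> tempered" and G: "is_function (fourier_dist u) G" and g: "g \<in> schwartz"
    and [measurable]: "\<mu> \<in> borel_measurable borel"
  shows "M2_integral (fourier g) (\<lambda>z. \<mu> (- snd z, fst z)) (fourier_dist u) = M2_integral g \<mu> u"
proof -
  note [measurable] = stft_measurable[OF fourier_dist_tempered[OF u] G schwartz_fourier[OF g]]
  have "M2_integral (fourier g) (\<lambda>z. \<mu> (- snd z, fst z)) (fourier_dist u)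
     = (\<integral>\<^sup>+z. ennreal ((\<mu> z * cmod (stft (fourier g) (fourier_dist u) (snd z, - fst z)))\<^sup>2) \<partial>lborel)"
    unfolding M2_integral_def by (subst nn_integral_rotate) auto
  also have "\<dots> = M2_integral g \<mu> u"
    unfolding M2_integral_def
  proof (rule nn_integral_cong)
    fix z
    have "cmod (stft (fourier g) (fourier_dist u) (snd z, - fst z)) = cmod (stft g u z)"
      using stft_fourier_dist[OF u g, of "snd z" "fst z"] by (simp add: norm_mult)
    then show "ennreal ((\<mu> z * cmod (stft (fourier g) (fourier_dist u) (snd z, - fst z)))\<^sup>2) = ennreal ((\<mu> z * cmod (stft g u z))\<^sup>2)"
      by simp
  qed
  finally show ?thesis .
qed

lemma seminorm_inverse_fourier:
  "\<exists>C\<ge>0. \<exists>M. \<forall>\<eta>\<in>schwartz. schwartz_seminorm N (inverse_fourier (\<eta> :: 'a::euclidean_space \<Rightarrow> complex)) \<le> C * schwartz_seminorm M \<eta>"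
proof -
  obtain D M where D: "0 \<le> D" and DM: "\<And>\<eta>. \<eta> \<in> schwartz \<Longrightarrow> schwartz_seminorm N (fourier \<eta>) \<le> D * schwartz_seminorm M (\<eta> :: 'a \<Rightarrow> complex)"
    using seminorm_fourier[of N] by metis
  have "schwartz_seminorm N (inverse_fourier \<eta>) \<le> D * schwartz_seminorm M \<eta>" if "\<eta> \<in> schwartz" for \<eta> :: "'a \<Rightarrow> complex"
    unfolding inverse_fourier_def using seminorm_reflect[OF schwartz_fourier[OF that]] DM[OF that] by (rule order_trans)
  then show ?thesis using D by blast
qed

text \<open>
  If only the Fourier transform of \<open>u\<close> is a function, then the bound for it is transported by
  Fourier inversion.
\<close>

lemma stft_bound:
  fixes g :: "'a::euclidean_space \<Rightarrow> complex"
  assumes g: "g \<in> schwartz" "g \<noteq> (\<lambda>_. 0)" and \<mu> [measurable]: "\<mu> \<in> borel_measurable borel"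
    and c: "0 < c" "\<And>z. c \<le> \<mu> z * ((1 + norm (fst z)) ^ s * (1 + norm (snd z)) ^ s)"
  shows "\<exists>C\<ge>0. \<exists>N. \<forall>u B \<eta>. u \<in> tempered \<longrightarrow> (\<exists>F. is_function u F \<or> is_function (fourier_dist u) F) \<longrightarrow> 0 \<le> B \<longrightarrow>
    M2_integral g \<mu> u \<le> ennreal (B\<^sup>2) \<longrightarrow> \<eta> \<in> schwartz \<longrightarrow> cmod (u \<eta>) \<le> C * B * schwartz_seminorm N \<eta>"
proof -
  obtain C1 N1 where C1: "0 \<le> C1" "\<And>u F B \<eta>. u \<in> tempered \<Longrightarrow> is_function u F \<Longrightarrow> 0 \<le> B \<Longrightarrow> M2_integral g \<mu> u \<le> ennreal (B\<^sup>2) \<Longrightarrow>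
    \<eta> \<in> schwartz \<Longrightarrow> cmod (u \<eta>) \<le> C1 * B * schwartz_seminorm N1 \<eta>"
    using stft_bound_function[OF g \<mu> c] by metis
  have \<mu>': "(\<lambda>z. \<mu> (- snd z, fst z)) \<in> borel_measurable borel" by measurable
  have c': "c \<le> \<mu> (- snd z, fst z) * ((1 + norm (fst z)) ^ s * (1 + norm (snd z)) ^ s)" for z
    using c(2)[of "(- snd z, fst z)"] by (simp add: mult_ac)
  from stft_bound_function[OF schwartz_fourier[OF g(1)] schwartz_fourier_nonzero[OF g] \<mu>' c(1) c']
  obtain C2 N2 where C2: "0 \<le> C2" "\<forall>u F B \<eta>. u \<in> tempered \<longrightarrow> is_function u F \<longrightarrow> 0 \<le> B \<longrightarrow>
    M2_integral (fourier g) (\<lambda>z. \<mu> (- snd z, fst z)) u \<le> ennreal (B\<^sup>2) \<longrightarrow>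
    \<eta> \<in> schwartz \<longrightarrow> cmod (u \<eta>) \<le> C2 * B * schwartz_seminorm N2 \<eta>"
    by (elim exE conjE) (rule that)
  obtain D M where D: "0 \<le> D" and DM: "\<And>\<eta>. \<eta> \<in> schwartz \<Longrightarrow> schwartz_seminorm N2 (inverse_fourier \<eta>) \<le> D * schwartz_seminorm M (\<eta> :: 'a \<Rightarrow> complex)"
    using seminorm_inverse_fourier[of N2] by metis
  have "cmod (u \<eta>) \<le> (C1 + C2 * D) * B * schwartz_seminorm (max N1 M) \<eta>"
    if u: "u \<in> tempered" and F: "is_function u F \<or> is_function (fourier_dist u) F" and B: "0 \<le> B" "M2_integral g \<mu> u \<le> ennreal (B\<^sup>2)"
      and \<eta>: "\<eta> \<in> schwartz" for u F B \<eta>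
    using F
  proof
    assume "is_function u F"
    from C1(2)[OF u this B \<eta>] have "cmod (u \<eta>) \<le> C1 * B * schwartz_seminorm N1 \<eta>" .
    also have "\<dots> \<le> (C1 + C2 * D) * B * schwartz_seminorm (max N1 M) \<eta>"
      using C1(1) C2(1) D B(1) seminorm_nonneg[OF \<eta>] by (intro mult_mono seminorm_mono[OF \<eta>]) auto
    finally show ?thesis .
  next
    assume G: "is_function (fourier_dist u) F"
    have "cmod (fourier_dist u (inverse_fourier \<eta>)) \<le> C2 * B * schwartz_seminorm N2 (inverse_fourier \<eta>)"
      by (rule C2(2)[rule_format, OF fourier_dist_tempered[OF u] G B(1) _ schwartz_inverse_fourier[OF \<eta>]])
        (simp add: M2_integral_fourier[OF u G g(1)] B)
    then have "cmod (u \<eta>) \<le> C2 * B * schwartz_seminorm N2 (inverse_fourier \<eta>)"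
      by (simp add: fourier_dist_apply schwartz_inverse_fourier[OF \<eta>] fourier_inverse_fourier[OF \<eta>])
    also have "\<dots> \<le> C2 * B * (D * schwartz_seminorm M \<eta>)" using C2(1) B(1) by (intro mult_left_mono DM \<eta>) auto
    also have "\<dots> = (C2 * D) * B * schwartz_seminorm M \<eta>" by simp
    also have "\<dots> \<le> (C1 + C2 * D) * B * schwartz_seminorm (max N1 M) \<eta>"
      using C1(1) C2(1) D B(1) seminorm_nonneg[OF \<eta>] by (intro mult_mono seminorm_mono[OF \<eta>]) auto
    finally show ?thesis .
  qed
  moreover have "0 \<le> C1 + C2 * D" using C1(1) C2(1) D by simp
  ultimately show ?thesis by blast
qed

section \<open>Compactness of families of short-time Fourier transforms\<close>

lemma atom_dominated:
  fixes g :: "'a::euclidean_space \<Rightarrow> complex"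
  assumes g: "g \<in> schwartz"
  shows "(cmod (atom g z t))\<^sup>2 * (1 + norm t) ^ (2 * s)
    \<le> (schwartz_seminorm (s + DIM('a)) g)\<^sup>2 * (1 + norm (fst z)) ^ (2 * (s + DIM('a))) * decay t"
proof -
  let ?k = "s + DIM('a)" and ?y = "t - fst z"
  have pos: "0 < (1 + norm t) ^ (2 * DIM('a))" by (intro zero_less_power add_pos_nonneg) auto
  have "(cmod (atom g z t))\<^sup>2 * (1 + norm t) ^ (2 * ?k) = ((1 + norm t) ^ ?k * cmod (g ?y))\<^sup>2"
    by (simp only: atom_def norm_mult cmod_modulation complex_mod_cnj power_mult_distrib power_mult[symmetric] mult_1_left mult_1_right power_one mult.commute)
  also have "\<dots> \<le> (((1 + norm ?y) * (1 + norm (fst z))) ^ ?k * cmod (g ?y))\<^sup>2"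
    by (intro power_mono mult_right_mono peetre') auto
  also have "\<dots> = ((1 + norm (fst z)) ^ ?k * ((1 + norm ?y) ^ ?k * cmod (g ?y)))\<^sup>2"
    by (simp only: power_mult_distrib mult_ac)
  also have "\<dots> \<le> ((1 + norm (fst z)) ^ ?k * schwartz_seminorm ?k g)\<^sup>2"
    using seminorm_ge[OF g, of "[]" ?k ?y] by (intro power_mono mult_left_mono) auto
  also have "\<dots> = (schwartz_seminorm ?k g)\<^sup>2 * (1 + norm (fst z)) ^ (2 * ?k)"
    by (simp only: power_mult_distrib power_mult[symmetric] mult.commute)
  finally show ?thesis using pos by (simp add: decay_def power_add[symmetric] field_simps distrib_left)
qed

text \<open>
  Continuity of the atoms in weighted \<open>L\<^sup>2\<close>, from which transforms of weighted \<open>L\<^sup>2\<close> functions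
  inherit equicontinuity.
\<close>

lemma atom_continuous:
  fixes g :: "'a::euclidean_space \<Rightarrow> complex"
  assumes g: "g \<in> schwartz" and z: "\<zeta> \<longlonglongrightarrow> z"
  shows "(\<lambda>n. LINT t|lborel. (cmod (atom g (\<zeta> n) t - atom g z t))\<^sup>2 * (1 + norm t) ^ (2 * s)) \<longlonglongrightarrow> 0"
proof -
  let ?k = "s + DIM('a)"
  obtain b where b: "\<And>n. norm (\<zeta> n) \<le> b"
    using convergent_imp_bounded[OF z] by (auto simp: bounded_iff)
  define B where "B = max b (norm z)"
  have B: "norm (fst (\<zeta> n)) \<le> B" "norm (fst z) \<le> B" for n
    using b[of n] norm_fst_le[of "fst (\<zeta> n)" "snd (\<zeta> n)"] norm_fst_le[of "fst z" "snd z"]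
    by (simp_all add: B_def)
  define K where "K = (schwartz_seminorm ?k g)\<^sup>2 * (1 + B) ^ (2 * ?k)"
  have le: "(cmod (atom g y t))\<^sup>2 * (1 + norm t) ^ (2 * s) \<le> K * decay t" if "norm (fst y) \<le> B" for y t
    unfolding K_def using that
    by (intro order_trans[OF atom_dominated[OF g]] mult_right_mono mult_left_mono power_mono) auto
  have [measurable]: "atom g y \<in> borel_measurable borel" for y by (rule schwartz_borel[OF schwartz_atom[OF g]])
  have "(\<lambda>n. LINT t|lborel. (cmod (atom g (\<zeta> n) t - atom g z t))\<^sup>2 * (1 + norm t) ^ (2 * s)) \<longlonglongrightarrow> (LINT t|(lborel::'a measure). 0)"
  proof (rule integral_dominated_convergence[where w="\<lambda>t. 4 * (K * decay t)"])
    show "integrable lborel (\<lambda>t::'a. 4 * (K * decay t))" by (intro integrable_mult_right integrable_decay)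
    show "AE t in lborel. (\<lambda>n. (cmod (atom g (\<zeta> n) t - atom g z t))\<^sup>2 * (1 + norm t) ^ (2 * s)) \<longlonglongrightarrow> 0"
    proof (rule AE_I2)
      fix t
      have "continuous_on UNIV (\<lambda>y. atom g y t)"
        unfolding atom_def modulation_def
        by (intro continuous_intros continuous_on_cis continuous_on_compose2[OF schwartz_continuous_on[OF g, of UNIV]]) auto
      then have "(\<lambda>n. atom g (\<zeta> n) t) \<longlonglongrightarrow> atom g z t"
        using z by (rule continuous_on_tendsto_compose) auto
      then show "(\<lambda>n. (cmod (atom g (\<zeta> n) t - atom g z t))\<^sup>2 * (1 + norm t) ^ (2 * s)) \<longlonglongrightarrow> 0"
        by (auto intro!: tendsto_eq_intros)
    qed
    show "AE t in lborel. norm ((cmod (atom g (\<zeta> n) t - atom g z t))\<^sup>2 * (1 + norm t) ^ (2 * s)) \<le> 4 * (K * decay t)" for n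
    proof (rule AE_I2)
      fix t
      have sq: "(cmod (a - b))\<^sup>2 \<le> 2 * (cmod a)\<^sup>2 + 2 * (cmod b)\<^sup>2" for a b :: complex
      proof -
        have "(cmod (a - b))\<^sup>2 \<le> (cmod a + cmod b)\<^sup>2" by (intro power_mono norm_triangle_ineq4) simp
        also have "\<dots> \<le> 2 * (cmod a)\<^sup>2 + 2 * (cmod b)\<^sup>2"
          using zero_le_power2[of "cmod a - cmod b"] unfolding power2_sum power2_diff by linarith
        finally show ?thesis .
      qed
      have "(cmod (atom g (\<zeta> n) t - atom g z t))\<^sup>2 * (1 + norm t) ^ (2 * s)
        \<le> (2 * (cmod (atom g (\<zeta> n) t))\<^sup>2 + 2 * (cmod (atom g z t))\<^sup>2) * (1 + norm t) ^ (2 * s)"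
        by (intro mult_right_mono sq) simp
      also have "\<dots> \<le> 4 * (K * decay t)"
        using le[OF B(1), of n t] le[OF B(2), of t] by (simp add: distrib_right)
      finally show "norm ((cmod (atom g (\<zeta> n) t - atom g z t))\<^sup>2 * (1 + norm t) ^ (2 * s)) \<le> 4 * (K * decay t)" by simp
    qed
  qed measurable
  then show ?thesis by simp
qed

text \<open>
  Bounded sets of weighted \<open>L\<^sup>2\<close> functions have equicontinuous and pointwise bounded transforms, so
  a diagonal subsequence that converges on a dense set converges everywhere.
\<close>

lemma stft_pointwise_compact:
  fixes g :: "'a::euclidean_space \<Rightarrow> complex"
  assumes g: "g \<in> schwartz" and D: "0 \<le> D" and F: "\<And>n::nat. F n \<in> borel_measurable borel"
    and b: "\<And>n. weighted_L2 s (F n) \<le> ennreal (D\<^sup>2)"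
  shows "\<exists>r V. strict_mono (r :: nat \<Rightarrow> nat) \<and> (\<forall>z. (\<lambda>n. LINT t|lborel. F (r n) t * atom g z t) \<longlonglongrightarrow> V z)"
proof -
  define W where "W n z = (LINT t|lborel. F n t * atom g z t)" for n z
  define \<beta> where "\<beta> z = 1 + D * sqrt (LINT t|lborel. (cmod (atom g z t))\<^sup>2 * (1 + norm t) ^ (2 * s))" for z
  have \<beta>: "1 \<le> \<beta> z" for z
    unfolding \<beta>_def using D by (auto intro!: mult_nonneg_nonneg integral_nonneg_AE)
  have Wb: "cmod (W n z) \<le> \<beta> z" for n z
    unfolding W_def \<beta>_def using weighted_pairing_bound[OF F schwartz_atom[OF g] D b] by (rule order_trans) simp
  have Wd: "cmod (W n y - W n z) \<le> D * sqrt (LINT t|lborel. (cmod (atom g y t - atom g z t))\<^sup>2 * (1 + norm t) ^ (2 * s))" for n y z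
  proof -
    have "W n y - W n z = (LINT t|lborel. F n t * (atom g y t - atom g z t))"
      unfolding W_def using weighted_pairing_integrable[OF F schwartz_atom[OF g] D b]
      by (simp add: right_diff_distrib)
    then show ?thesis
      using weighted_pairing_bound[OF F schwartz_diff[OF schwartz_atom[OF g] schwartz_atom[OF g]] D b] by simp
  qed
  obtain X :: "('a \<times> 'a) set" where X: "countable X" "\<And>U. open U \<Longrightarrow> U \<noteq> {} \<Longrightarrow> \<exists>d\<in>X. d \<in> U"
    using countable_dense_setE by metis
  have nb: "norm (W n z / of_real (\<beta> z)) \<le> 1" for n z
    using Wb[of n z] \<beta>[of z] by (simp add: norm_divide divide_le_eq)
  obtain r where r: "strict_mono (r :: nat \<Rightarrow> nat)" "\<And>z. z \<in> X \<Longrightarrow> \<exists>l. (\<lambda>n. W (r n) z / of_real (\<beta> z)) \<longlonglongrightarrow> l"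
    using function_convergent_subsequence[OF X(1), of "\<lambda>n z. W n z / of_real (\<beta> z)" 1] nb by metis
  have "convergent (\<lambda>n. W (r n) z)" for z
  proof (rule Cauchy_convergent, rule CauchyI)
    fix e :: real assume e: "0 < e"
    have "\<exists>y\<in>X. D * sqrt (LINT t|lborel. (cmod (atom g y t - atom g z t))\<^sup>2 * (1 + norm t) ^ (2 * s)) < e / 3"
    proof -
      have "\<exists>y\<in>X. y \<in> ball z (1 / real (Suc n))" for n by (intro X(2)) auto
      then obtain \<zeta> where \<zeta>: "\<And>n. \<zeta> n \<in> X" "\<And>n. dist z (\<zeta> n) < 1 / real (Suc n)"
        by (metis mem_ball)
      have "(\<lambda>n. dist (\<zeta> n) z) \<longlonglongrightarrow> 0"
        by (rule Lim_null_comparison[OF always_eventually LIMSEQ_Suc[OF lim_1_over_n]])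
          (use \<zeta>(2) in \<open>simp add: dist_commute less_imp_le del: of_nat_Suc\<close>)
      then have "\<zeta> \<longlonglongrightarrow> z" by (rule tendsto_dist_iff[THEN iffD2])
      from atom_continuous[OF g this, of s]
      have "(\<lambda>n. D * sqrt (LINT t|lborel. (cmod (atom g (\<zeta> n) t - atom g z t))\<^sup>2 * (1 + norm t) ^ (2 * s))) \<longlonglongrightarrow> D * sqrt 0"
        by (intro tendsto_intros)
      then have "\<forall>\<^sub>F n in sequentially. D * sqrt (LINT t|lborel. (cmod (atom g (\<zeta> n) t - atom g z t))\<^sup>2 * (1 + norm t) ^ (2 * s)) < e / 3"
        using e by (intro order_tendstoD(2)) auto
      then show ?thesis using \<zeta>(1) eventually_happens' sequentially_bot by blast
    qed
    then obtain y where y: "y \<in> X" "\<And>n. cmod (W n y - W n z) < e / 3" using Wd le_less_trans by blast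
    obtain l where "(\<lambda>n. W (r n) y / of_real (\<beta> y)) \<longlonglongrightarrow> l" using r(2)[OF y(1)] by blast
    then have "(\<lambda>n. of_real (\<beta> y) * (W (r n) y / of_real (\<beta> y))) \<longlonglongrightarrow> of_real (\<beta> y) * l" by (intro tendsto_intros)
    then have "(\<lambda>n. W (r n) y) \<longlonglongrightarrow> of_real (\<beta> y) * l" using \<beta>[of y] by simp
    then have "Cauchy (\<lambda>n. W (r n) y)" by (rule LIMSEQ_imp_Cauchy)
    then obtain M where M: "\<And>m n. M \<le> m \<Longrightarrow> M \<le> n \<Longrightarrow> cmod (W (r m) y - W (r n) y) < e / 3"
      using e CauchyD[of _ "e / 3"] by (metis divide_pos_pos zero_less_numeral)
    have "cmod (W (r m) z - W (r n) z) < e" if "M \<le> m" "M \<le> n" for m n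
    proof -
      have "W (r m) z - W (r n) z = - (W (r m) y - W (r m) z) + (W (r m) y - W (r n) y) + (W (r n) y - W (r n) z)" by simp
      also have "cmod \<dots> \<le> cmod (W (r m) y - W (r m) z) + cmod (W (r m) y - W (r n) y) + cmod (W (r n) y - W (r n) z)"
        by (metis add_mono norm_minus_cancel norm_triangle_le norm_triangle_ineq order_refl)
      also have "\<dots> < e / 3 + e / 3 + e / 3" by (intro add_strict_mono y(2) M that)
      finally show ?thesis by simp
    qed
    then show "\<exists>M. \<forall>m\<ge>M. \<forall>n\<ge>M. cmod (W (r m) z - W (r n) z) < e" by blast
  qed
  then have "\<forall>z. \<exists>v. (\<lambda>n. W (r n) z) \<longlonglongrightarrow> v" by (simp add: convergent_def)
  then obtain V where "\<forall>z. (\<lambda>n. W (r n) z) \<longlonglongrightarrow> V z" by metis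
  then show ?thesis using r(1) unfolding W_def by blast
qed

section \<open>The norm estimate\<close>

lemma nn_integral_swap:
  fixes f :: "'a::euclidean_space \<times> 'b::euclidean_space \<Rightarrow> ennreal"
  assumes [measurable]: "f \<in> borel_measurable borel"
  shows "(\<integral>\<^sup>+z. f (snd z, fst z) \<partial>lborel) = (\<integral>\<^sup>+z. f z \<partial>lborel)"
  by (subst nn_integral_fst_borel, measurable, subst nn_integral_snd_borel[of f]) auto

lemma position_integral:
  fixes F g :: "'a::euclidean_space \<Rightarrow> complex"
  assumes [measurable]: "V \<in> borel_measurable borel" "F \<in> borel_measurable borel" "g \<in> borel_measurable borel" "h \<in> borel_measurable borel"
    and V: "\<And>x. L2_square (\<lambda>\<omega>. V (x, \<omega>)) = (\<integral>\<^sup>+t. ennreal ((cmod (F t))\<^sup>2) * ennreal ((cmod (g (t - x)))\<^sup>2) \<partial>lborel)"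
  shows "(\<integral>\<^sup>+z. h (fst z) * ennreal ((cmod (V z))\<^sup>2) \<partial>lborel)
    = (\<integral>\<^sup>+t. ennreal ((cmod (F t))\<^sup>2) * (\<integral>\<^sup>+x. h x * ennreal ((cmod (g (t - x)))\<^sup>2) \<partial>lborel) \<partial>lborel)"
proof -
  have "(\<integral>\<^sup>+z. h (fst z) * ennreal ((cmod (V z))\<^sup>2) \<partial>lborel) = (\<integral>\<^sup>+x. \<integral>\<^sup>+\<omega>. h x * ennreal ((cmod (V (x, \<omega>)))\<^sup>2) \<partial>lborel \<partial>lborel)"
    by (subst nn_integral_fst_borel) auto
  also have "\<dots> = (\<integral>\<^sup>+x. \<integral>\<^sup>+t. h x * (ennreal ((cmod (F t))\<^sup>2) * ennreal ((cmod (g (t - x)))\<^sup>2)) \<partial>lborel \<partial>lborel)"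
    by (rule nn_integral_cong) (simp add: nn_integral_cmult V)
  also have "\<dots> = (\<integral>\<^sup>+t. \<integral>\<^sup>+x. h x * (ennreal ((cmod (F t))\<^sup>2) * ennreal ((cmod (g (t - x)))\<^sup>2)) \<partial>lborel \<partial>lborel)"
    by (rule lborel_pair.Fubini') measurable
  also have "\<dots> = (\<integral>\<^sup>+t. \<integral>\<^sup>+x. ennreal ((cmod (F t))\<^sup>2) * (h x * ennreal ((cmod (g (t - x)))\<^sup>2)) \<partial>lborel \<partial>lborel)"
    by (simp add: mult_ac)
  also have "\<dots> = (\<integral>\<^sup>+t. ennreal ((cmod (F t))\<^sup>2) * (\<integral>\<^sup>+x. h x * ennreal ((cmod (g (t - x)))\<^sup>2) \<partial>lborel) \<partial>lborel)"
    by (rule nn_integral_cong, rule nn_integral_cmult) measurable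
  finally show ?thesis .
qed

lemma schwartz_tail:
  assumes "g \<in> schwartz" "0 < \<delta>"
  shows "\<exists>s>0. (\<integral>\<^sup>+y. indicator {y. s < norm y} y * ennreal ((cmod (g (y::'a::euclidean_space)))\<^sup>2) \<partial>lborel) \<le> ennreal \<delta>"
proof -
  note [measurable] = schwartz_borel[OF assms(1)]
  obtain K where K: "0 \<le> K" "(\<integral>\<^sup>+t. ennreal ((1 + norm t) ^ 1 * (cmod (g t))\<^sup>2) \<partial>lborel) \<le> ennreal K"
    using schwartz_weighted_square[OF assms(1), of 1] by blast
  define s where "s = K / \<delta> + 1"
  have s: "0 < s" "K \<le> s * \<delta>" using K assms(2) by (auto simp: s_def field_simps intro: add_nonneg_pos)
  have "(\<integral>\<^sup>+y. indicator {y. s < norm y} y * ennreal ((cmod (g y))\<^sup>2) \<partial>lborel)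
     \<le> (\<integral>\<^sup>+y. ennreal (1 / s) * ennreal ((1 + norm y) ^ 1 * (cmod (g y))\<^sup>2) \<partial>lborel)"
  proof (rule nn_integral_mono)
    fix y :: 'a
    show "indicator {y. s < norm y} y * ennreal ((cmod (g y))\<^sup>2) \<le> ennreal (1 / s) * ennreal ((1 + norm y) ^ 1 * (cmod (g y))\<^sup>2)"
    proof (cases "s < norm y")
      case True
      then have "s * (cmod (g y))\<^sup>2 \<le> (1 + norm y) * (cmod (g y))\<^sup>2" by (intro mult_right_mono) auto
      then have "(cmod (g y))\<^sup>2 \<le> 1 / s * ((1 + norm y) ^ 1 * (cmod (g y))\<^sup>2)" using s by (simp add: field_simps)
      then show ?thesis using True s by (simp add: ennreal_mult[symmetric] ennreal_leI del: power_one_right)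
    qed simp
  qed
  also have "\<dots> = ennreal (1 / s) * (\<integral>\<^sup>+y. ennreal ((1 + norm y) ^ 1 * (cmod (g y))\<^sup>2) \<partial>lborel)"
    by (rule nn_integral_cmult) measurable
  also have "\<dots> \<le> ennreal (1 / s) * ennreal K" by (intro mult_left_mono K) auto
  also have "\<dots> = ennreal (K / s)" using s K by (simp add: ennreal_mult[symmetric])
  also have "\<dots> \<le> ennreal \<delta>" using s by (intro ennreal_leI) (simp add: divide_le_eq mult.commute)
  finally show ?thesis using s(1) by blast
qed

abbreviation weighted_square :: "('a::euclidean_space \<Rightarrow> real) \<Rightarrow> ('a \<Rightarrow> complex) \<Rightarrow> ennreal" where
  "weighted_square w F \<equiv> (\<integral>\<^sup>+t. ennreal (w t * (cmod (F t))\<^sup>2) \<partial>lborel)"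

text \<open>Finiteness of \<open>Y\<close> is what allows subtracting half of it.\<close>

lemma ennreal_absorb:
  fixes Y Z :: ennreal
  assumes "Y < \<top>" "Y \<le> ennreal (1 / 2) * Y + Z" shows "Y \<le> 2 * Z"
proof (cases Z)
  case (real z)
  obtain y where y: "0 \<le> y" "Y = ennreal y" using assms(1) by (cases Y) auto
  have "ennreal (1 / 2) * Y + Z = ennreal (1 / 2 * y + z)"
    unfolding y(2) real(2) using y(1) real(1) by (simp only: ennreal_plus ennreal_mult mult_nonneg_nonneg zero_le_divide_1_iff zero_le_numeral)
  then have "ennreal y \<le> ennreal (1 / 2 * y + z)" using assms(2) y(2) by simp
  moreover have "0 \<le> 1 / 2 * y + z" using y(1) real(1) by simp
  ultimately have "y \<le> 1 / 2 * y + z" by (metis ennreal_le_iff)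
  then have "ennreal y \<le> ennreal (2 * z)" by (intro ennreal_leI) simp
  then show ?thesis using y real by (simp add: ennreal_mult)
qed (simp add: ennreal_mult_top)

text \<open>
  The weights of an admissible pair enter through the square of the associated weight and its two
  properties: it is moderate, and \<open>m\<^sub>0\<close> is small relative to it at infinity. The locale is symmetric
  under exchanging position and frequency.
\<close>

locale weights =
  fixes m0 :: "'a::euclidean_space \<times> 'a \<Rightarrow> real" and \<psi> \<phi> :: "'a \<Rightarrow> real" and C :: real and k :: nat
    and g \<gamma> :: "'a \<Rightarrow> complex"
  assumes m0_cont: "continuous_on UNIV m0" and m0_pos: "\<And>z. 0 < m0 z"
    and \<psi>_cont: "continuous_on UNIV \<psi>" and \<psi>_nonneg: "\<And>x. 0 \<le> \<psi> x"
    and \<phi>_cont: "continuous_on UNIV \<phi>" and \<phi>_nonneg: "\<And>x. 0 \<le> \<phi> x"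
    and C_pos: "0 < C"
    and moderate: "\<And>x \<omega> y \<eta>. (m0 (x, \<omega>))\<^sup>2 + (\<psi> x)\<^sup>2 + (\<phi> \<omega>)\<^sup>2 \<le>
      C * ((m0 (y, \<eta>))\<^sup>2 + (\<psi> y)\<^sup>2 + (\<phi> \<eta>)\<^sup>2) * ((1 + norm (x - y)) ^ k * (1 + norm (\<omega> - \<eta>)) ^ k)"
    and tail: "\<And>e. 0 < e \<Longrightarrow> \<exists>r>0. \<forall>x \<omega>. r \<le> norm (x, \<omega>) \<longrightarrow> (m0 (x, \<omega>))\<^sup>2 \<le> e * ((m0 (x, \<omega>))\<^sup>2 + (\<psi> x)\<^sup>2 + (\<phi> \<omega>)\<^sup>2)"
    and g: "g \<in> schwartz" "g \<noteq> (\<lambda>_. 0)" and \<gamma>: "\<gamma> \<in> schwartz" "\<gamma> \<noteq> (\<lambda>_. 0)"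
begin

definition M :: "'a \<times> 'a \<Rightarrow> real" where
  "M z = (m0 z)\<^sup>2 + (\<psi> (fst z))\<^sup>2 + (\<phi> (snd z))\<^sup>2"

lemma M_pos: "0 < M z"
  unfolding M_def using m0_pos[of z] by (intro add_pos_nonneg zero_less_power) auto

lemma M_moderate: "M (x, \<omega>) \<le> C * M (y, \<eta>) * ((1 + norm (x - y)) ^ k * (1 + norm (\<omega> - \<eta>)) ^ k)"
  using moderate by (simp add: M_def)

lemma \<psi>_le_M: "(\<psi> x)\<^sup>2 \<le> M (x, \<omega>)"
  by (simp add: M_def)

lemma M_cont: "continuous_on S M"
  unfolding M_def
  by (intro continuous_intros continuous_on_subset[OF m0_cont] continuous_on_compose2[OF \<psi>_cont] continuous_on_compose2[OF \<phi>_cont]) auto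

lemma measurable_weights [measurable]:
  "m0 \<in> borel_measurable borel" "\<psi> \<in> borel_measurable borel" "\<phi> \<in> borel_measurable borel" "M \<in> borel_measurable borel"
  using m0_cont \<psi>_cont \<phi>_cont M_cont by (auto intro: borel_measurable_continuous_onI)

lemma measurable_windows [measurable]:
  "g \<in> borel_measurable borel" "\<gamma> \<in> borel_measurable borel"
  using g \<gamma> by (auto intro: schwartz_borel)

lemma M_outside: "\<exists>r>0. \<forall>x \<omega>. r \<le> norm (x, \<omega>) \<longrightarrow> M (x, \<omega>) \<le> 2 * ((\<psi> x)\<^sup>2 + (\<phi> \<omega>)\<^sup>2)"
proof -
  obtain r where "r > 0" and r: "\<forall>x \<omega>. r \<le> norm (x, \<omega>) \<longrightarrow> (m0 (x, \<omega>))\<^sup>2 \<le> 1 / 2 * ((m0 (x, \<omega>))\<^sup>2 + (\<psi> x)\<^sup>2 + (\<phi> \<omega>)\<^sup>2)"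
    using tail[of "1 / 2"] by auto
  have "M (x, \<omega>) \<le> 2 * ((\<psi> x)\<^sup>2 + (\<phi> \<omega>)\<^sup>2)" if "r \<le> norm (x, \<omega>)" for x \<omega>
    using r[rule_format, OF that] by (simp add: M_def)
  then show ?thesis using \<open>r > 0\<close> by blast
qed

text \<open>
  Moderateness compares \<open>\<psi> x\<close> with \<open>M (t, 0)\<close>. For large \<open>t\<close>, the part \<open>m\<^sub>0\<close> of it can be
  absorbed, which leaves \<open>\<psi> t\<close> and the constant \<open>\<phi> 0\<close>; for small \<open>t\<close>, it is bounded.
\<close>

lemma \<psi>_crude: "\<exists>K\<ge>0. \<forall>x t. (\<psi> x)\<^sup>2 \<le> K * ((\<psi> t)\<^sup>2 + 1) * (1 + norm (x - t)) ^ k"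
proof -
  obtain r where r: "r > 0" "\<And>x \<omega>. r \<le> norm (x, \<omega>) \<Longrightarrow> M (x, \<omega>) \<le> 2 * ((\<psi> x)\<^sup>2 + (\<phi> \<omega>)\<^sup>2)"
    using M_outside by blast
  have "continuous_on (cball 0 r) (\<lambda>t. M (t, 0))"
    by (intro continuous_on_compose2[OF M_cont[of UNIV]] continuous_intros) auto
  then have "bounded ((\<lambda>t. M (t, 0)) ` cball 0 r)"
    by (intro compact_imp_bounded compact_continuous_image) auto
  then obtain B where B0: "B > 0" "\<forall>y\<in>(\<lambda>t. M (t, 0)) ` cball 0 r. norm y \<le> B"
    unfolding bounded_pos by blast
  then have B: "B > 0" "\<And>t. t \<in> cball 0 r \<Longrightarrow> M (t, 0) \<le> B" by (auto simp: abs_le_iff)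
  define L where "L = 2 * (1 + (\<phi> 0)\<^sup>2) + B"
  have L: "M (t, 0) \<le> L * ((\<psi> t)\<^sup>2 + 1)" for t
  proof (cases "r \<le> norm t")
    case True
    then have "M (t, 0) \<le> 2 * ((\<psi> t)\<^sup>2 + (\<phi> 0)\<^sup>2)" by (intro r(2)) simp
    also have "\<dots> \<le> 2 * (1 + (\<phi> 0)\<^sup>2) * ((\<psi> t)\<^sup>2 + 1)" by (simp add: algebra_simps)
    also have "\<dots> \<le> L * ((\<psi> t)\<^sup>2 + 1)" using B by (intro mult_right_mono) (auto simp: L_def)
    finally show ?thesis .
  next
    case False
    then have "M (t, 0) \<le> B * 1" using B(2) by simp
    also have "\<dots> \<le> L * ((\<psi> t)\<^sup>2 + 1)" using B by (intro mult_mono) (auto simp: L_def add_nonneg_nonneg)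
    finally show ?thesis .
  qed
  have "(\<psi> x)\<^sup>2 \<le> (C * L) * ((\<psi> t)\<^sup>2 + 1) * (1 + norm (x - t)) ^ k" for x t
  proof -
    have "(\<psi> x)\<^sup>2 \<le> C * M (t, 0) * (1 + norm (x - t)) ^ k"
      using order_trans[OF \<psi>_le_M M_moderate[of x 0 t 0]] by simp
    also have "\<dots> \<le> C * (L * ((\<psi> t)\<^sup>2 + 1)) * (1 + norm (x - t)) ^ k"
      using C_pos by (intro mult_right_mono mult_left_mono L) auto
    finally show ?thesis by (simp add: mult_ac)
  qed
  moreover have "0 \<le> C * L" using C_pos B by (simp add: L_def)
  ultimately show ?thesis by blast
qed

text \<open>
  Moderateness between \<open>x0\<close> and the zero \<open>t0\<close> of \<open>\<psi>\<close>, at the same frequency \<open>\<omega>\<close>, bounds \<open>\<psi> x0\<close>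
  by \<open>M (t0, \<omega>)\<close>; for large \<open>\<omega>\<close> the latter is essentially \<open>\<phi> \<omega>\<close>.
\<close>

lemma \<phi>_bounded_below_at_infinity:
  assumes "\<psi> t0 = 0" "\<psi> x0 \<noteq> 0"
  shows "\<exists>c>0. \<exists>r>0. \<forall>\<omega>. r \<le> norm \<omega> \<longrightarrow> c \<le> \<phi> \<omega>"
proof -
  obtain r where r: "r > 0" "\<And>x \<omega>. r \<le> norm (x, \<omega>) \<Longrightarrow> M (x, \<omega>) \<le> 2 * ((\<psi> x)\<^sup>2 + (\<phi> \<omega>)\<^sup>2)"
    using M_outside by blast
  define P where "P = C * 2 * (1 + norm (x0 - t0)) ^ k"
  have P: "0 < P" unfolding P_def using C_pos by (intro mult_pos_pos zero_less_power add_pos_nonneg) auto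
  have "\<psi> x0 / sqrt P \<le> \<phi> \<omega>" if "r \<le> norm \<omega>" for \<omega>
  proof -
    have "(\<psi> x0)\<^sup>2 \<le> C * M (t0, \<omega>) * (1 + norm (x0 - t0)) ^ k"
      using order_trans[OF \<psi>_le_M M_moderate[of x0 \<omega> t0 \<omega>]] by simp
    also have "\<dots> \<le> C * (2 * ((\<psi> t0)\<^sup>2 + (\<phi> \<omega>)\<^sup>2)) * (1 + norm (x0 - t0)) ^ k"
      using C_pos that norm_snd_le[of \<omega> t0] by (intro mult_right_mono mult_left_mono r(2)) (auto intro: order_trans)
    also have "\<dots> = P * (\<phi> \<omega>)\<^sup>2" using assms by (simp add: P_def)
    finally have "(\<psi> x0 / sqrt P)\<^sup>2 \<le> (\<phi> \<omega>)\<^sup>2" using P by (simp add: power_divide divide_le_eq mult.commute)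
    then show ?thesis by (rule power2_le_imp_le[OF _ \<phi>_nonneg])
  qed
  moreover have "0 < \<psi> x0 / sqrt P" using P assms \<psi>_nonneg[of x0] by simp
  ultimately show ?thesis using r(1) by blast
qed

text \<open>
  The properties of the short-time Fourier transform \<open>V\<close> of a distribution that the norm
  estimate depends on: the Plancherel identity in each variable, with \<open>F\<close> for the distribution
  and \<open>G\<close> for its Fourier transform. In this form, position and frequency can be exchanged. The
  identities are tied to the weights because a vanishing weight gives no reason for \<open>F\<close> or \<open>G\<close>
  to exist.
\<close>

definition transform_of :: "('a \<times> 'a \<Rightarrow> complex) \<Rightarrow> ('a \<Rightarrow> complex) \<Rightarrow> ('a \<Rightarrow> complex) \<Rightarrow> bool" where
  "transform_of V F G \<longleftrightarrow> V \<in> borel_measurable borel \<and> F \<in> borel_measurable borel \<and> G \<in> borel_measurable borel \<and>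
    ((\<exists>x. \<psi> x \<noteq> 0) \<longrightarrow> (\<forall>x. (L2_square (\<lambda>\<omega>. V (x, \<omega>)))
      = (\<integral>\<^sup>+t. ennreal ((cmod (F t))\<^sup>2) * ennreal ((cmod (g (t - x)))\<^sup>2) \<partial>lborel))) \<and>
    ((\<exists>\<omega>. \<phi> \<omega> \<noteq> 0) \<longrightarrow> (\<forall>\<omega>. (L2_square (\<lambda>x. V (x, \<omega>)))
      = (\<integral>\<^sup>+t. ennreal ((cmod (G t))\<^sup>2) * ennreal ((cmod (\<gamma> (t - \<omega>)))\<^sup>2) \<partial>lborel)))"

text \<open>The square of the norm built from \<open>m\<^sub>0\<close>, \<open>\<psi>\<close> and \<open>\<phi>\<close>.\<close>

definition total :: "('a \<times> 'a \<Rightarrow> complex) \<Rightarrow> ('a \<Rightarrow> complex) \<Rightarrow> ('a \<Rightarrow> complex) \<Rightarrow> ennreal" where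
  "total V F G = weighted_square (\<lambda>z. (m0 z)\<^sup>2) V
    + weighted_square (\<lambda>t. (\<psi> t)\<^sup>2) F + weighted_square (\<lambda>t. (\<phi> t)\<^sup>2) G"

lemma window_L2_square: "L2_square g = ennreal (LINT s|lborel. (cmod (g s))\<^sup>2)"
  by (rule nn_integral_eq_integral[OF schwartz_square_integrable[OF g(1)]]) simp

lemma position_integral':
  assumes "transform_of V F G" "\<psi> x0 \<noteq> 0" "h \<in> borel_measurable borel"
  shows "(\<integral>\<^sup>+z. h (fst z) * ennreal ((cmod (V z))\<^sup>2) \<partial>lborel)
    = (\<integral>\<^sup>+t. ennreal ((cmod (F t))\<^sup>2) * (\<integral>\<^sup>+x. h x * ennreal ((cmod (g (t - x)))\<^sup>2) \<partial>lborel) \<partial>lborel)"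
  using assms by (intro position_integral) (auto simp: transform_of_def)

lemma L2_square_transform:
  assumes "transform_of V F G" "\<psi> x0 \<noteq> 0"
  shows "L2_square V = L2_square F * L2_square g"
proof -
  have [measurable]: "F \<in> borel_measurable borel" using assms by (simp add: transform_of_def)
  have "L2_square (\<lambda>x. g (t - x)) = L2_square g" for t
    by (rule nn_integral_reflect) measurable
  then show ?thesis
    using position_integral'[OF assms, of "\<lambda>x. 1"] by (simp add: nn_integral_multc)
qed

abbreviation position_square :: "('a \<times> 'a \<Rightarrow> complex) \<Rightarrow> ennreal" where
  "position_square V \<equiv> (\<integral>\<^sup>+z. ennreal ((\<psi> (fst z))\<^sup>2) * ennreal ((cmod (V z))\<^sup>2) \<partial>lborel)"

text \<open>
  Integrating over positions first replaces \<open>\<psi>\<^sup>2\<close> by its average over the window, which \<open>K\<close>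
  compares with \<open>\<psi>\<^sup>2 + e\<close>.
\<close>

lemma position_weighted_bound:
  assumes V: "transform_of V F G" "\<psi> x0 \<noteq> 0" and K: "0 \<le> K" "0 \<le> e"
    "\<And>x t. (\<psi> x)\<^sup>2 \<le> K * ((\<psi> t)\<^sup>2 + e) * (1 + norm (x - t)) ^ k"
    and Kg: "(\<integral>\<^sup>+t. ennreal ((1 + norm t) ^ k * (cmod (g t))\<^sup>2) \<partial>lborel) \<le> ennreal Kg" "0 \<le> Kg"
  shows "position_square V
    \<le> ennreal (K * Kg) * (weighted_square (\<lambda>t. (\<psi> t)\<^sup>2) F + ennreal e * L2_square F)"
proof -
  have [measurable]: "F \<in> borel_measurable borel" using V by (simp add: transform_of_def)
  have "position_square V
    = (\<integral>\<^sup>+t. ennreal ((cmod (F t))\<^sup>2) * (\<integral>\<^sup>+x. ennreal ((\<psi> x)\<^sup>2) * ennreal ((cmod (g (t - x)))\<^sup>2) \<partial>lborel) \<partial>lborel)"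
    by (rule position_integral'[OF V]) measurable
  also have "\<dots> \<le> (\<integral>\<^sup>+t. ennreal (K * Kg) * (ennreal ((\<psi> t)\<^sup>2 * (cmod (F t))\<^sup>2) + ennreal e * ennreal ((cmod (F t))\<^sup>2)) \<partial>lborel)"
  proof (rule nn_integral_mono)
    fix t
    have "(\<integral>\<^sup>+x. ennreal ((\<psi> x)\<^sup>2) * ennreal ((cmod (g (t - x)))\<^sup>2) \<partial>lborel)
      \<le> (\<integral>\<^sup>+x. ennreal (K * ((\<psi> t)\<^sup>2 + e)) * ennreal ((1 + norm (t - x)) ^ k * (cmod (g (t - x)))\<^sup>2) \<partial>lborel)"
    proof (rule nn_integral_mono)
      fix x
      have "(\<psi> x)\<^sup>2 * (cmod (g (t - x)))\<^sup>2 \<le> (K * ((\<psi> t)\<^sup>2 + e) * (1 + norm (x - t)) ^ k) * (cmod (g (t - x)))\<^sup>2"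
        by (intro mult_right_mono K) simp
      then show "ennreal ((\<psi> x)\<^sup>2) * ennreal ((cmod (g (t - x)))\<^sup>2) \<le> ennreal (K * ((\<psi> t)\<^sup>2 + e)) * ennreal ((1 + norm (t - x)) ^ k * (cmod (g (t - x)))\<^sup>2)"
        using K by (subst (1 2) ennreal_mult[symmetric]) (auto simp: norm_minus_commute mult.assoc intro!: ennreal_leI)
    qed
    also have "\<dots> = ennreal (K * ((\<psi> t)\<^sup>2 + e)) * (\<integral>\<^sup>+x. ennreal ((1 + norm (t - x)) ^ k * (cmod (g (t - x)))\<^sup>2) \<partial>lborel)"
      by (rule nn_integral_cmult) measurable
    also have "\<dots> \<le> ennreal (K * ((\<psi> t)\<^sup>2 + e)) * ennreal Kg"
      by (intro mult_left_mono weight_window_integral Kg) measurable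
    finally have "ennreal ((cmod (F t))\<^sup>2) * (\<integral>\<^sup>+x. ennreal ((\<psi> x)\<^sup>2) * ennreal ((cmod (g (t - x)))\<^sup>2) \<partial>lborel)
      \<le> ennreal ((cmod (F t))\<^sup>2) * (ennreal (K * ((\<psi> t)\<^sup>2 + e)) * ennreal Kg)"
      by (rule mult_left_mono) simp
    also have "\<dots> = ennreal (K * Kg) * (ennreal ((\<psi> t)\<^sup>2 * (cmod (F t))\<^sup>2) + ennreal e * ennreal ((cmod (F t))\<^sup>2))"
      using K Kg by (simp add: ennreal_mult[symmetric] ennreal_plus[symmetric] algebra_simps del: ennreal_plus)
    finally show "ennreal ((cmod (F t))\<^sup>2) * (\<integral>\<^sup>+x. ennreal ((\<psi> x)\<^sup>2) * ennreal ((cmod (g (t - x)))\<^sup>2) \<partial>lborel)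
      \<le> ennreal (K * Kg) * (ennreal ((\<psi> t)\<^sup>2 * (cmod (F t))\<^sup>2) + ennreal e * ennreal ((cmod (F t))\<^sup>2))" .
  qed
  also have "\<dots> = ennreal (K * Kg) * (weighted_square (\<lambda>t. (\<psi> t)\<^sup>2) F + ennreal e * L2_square F)"
    by (simp add: nn_integral_cmult nn_integral_add)
  finally show ?thesis .
qed

text \<open>
  A window positioned far out sees \<open>F\<close> only far out, where \<open>\<psi>\<close> is bounded below, except through its tail,
  which has a small fraction of the mass of the window.
\<close>

lemma position_tail:
  assumes c: "0 < c" "0 < r" "\<And>t. r \<le> norm t \<Longrightarrow> c \<le> \<psi> t"
  shows "\<exists>\<rho>>0. \<forall>V F G. transform_of V F G \<longrightarrow>
    (\<integral>\<^sup>+z. indicator {x. \<rho> < norm x} (fst z) * ennreal ((cmod (V z))\<^sup>2) \<partial>lborel)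
      \<le> ennreal (1 / 4) * L2_square V + L2_square g * ennreal (1 / c\<^sup>2) * weighted_square (\<lambda>t. (\<psi> t)\<^sup>2) F"
proof -
  obtain b :: 'a where b: "b \<in> Basis" using nonempty_Basis by blast
  have "c \<le> \<psi> (r *\<^sub>R b)" using c(2) b by (intro c(3)) simp
  then have \<psi>0: "\<psi> (r *\<^sub>R b) \<noteq> 0" using c(1) by simp
  let ?G = "LINT s|lborel. (cmod (g s))\<^sup>2"
  have G: "0 < ?G" by (rule schwartz_norm_pos[OF g])
  then obtain s where s: "0 < s" "(\<integral>\<^sup>+y. indicator {y. s < norm y} y * ennreal ((cmod (g y))\<^sup>2) \<partial>lborel) \<le> ennreal (?G / 4)"
    using schwartz_tail[OF g(1), of "?G / 4"] by auto
  have "(\<integral>\<^sup>+z. indicator {x. r + s < norm x} (fst z) * ennreal ((cmod (V z))\<^sup>2) \<partial>lborel)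
      \<le> ennreal (1 / 4) * L2_square V + L2_square g * ennreal (1 / c\<^sup>2) * weighted_square (\<lambda>t. (\<psi> t)\<^sup>2) F"
    if V: "transform_of V F G" for V F G
  proof -
    have [measurable]: "F \<in> borel_measurable borel" using V by (simp add: transform_of_def)
    have "(\<integral>\<^sup>+z. indicator {x. r + s < norm x} (fst z) * ennreal ((cmod (V z))\<^sup>2) \<partial>lborel)
      = (\<integral>\<^sup>+t. ennreal ((cmod (F t))\<^sup>2) * (\<integral>\<^sup>+x. indicator {x. r + s < norm x} x * ennreal ((cmod (g (t - x)))\<^sup>2) \<partial>lborel) \<partial>lborel)"
      by (rule position_integral'[OF V \<psi>0]) measurable
    also have "\<dots> \<le> (\<integral>\<^sup>+t. ennreal (1 / 4) * L2_square g * ennreal ((cmod (F t))\<^sup>2) + L2_square g * ennreal (1 / c\<^sup>2) * ennreal ((\<psi> t)\<^sup>2 * (cmod (F t))\<^sup>2) \<partial>lborel)"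
    proof (rule nn_integral_mono)
      fix t :: 'a
      let ?w = "\<integral>\<^sup>+x. indicator {x. r + s < norm x} x * ennreal ((cmod (g (t - x)))\<^sup>2) \<partial>lborel"
      show "ennreal ((cmod (F t))\<^sup>2) * ?w \<le> ennreal (1 / 4) * L2_square g * ennreal ((cmod (F t))\<^sup>2) + L2_square g * ennreal (1 / c\<^sup>2) * ennreal ((\<psi> t)\<^sup>2 * (cmod (F t))\<^sup>2)"
      proof (cases "r \<le> norm t")
        case True
        have "?w \<le> L2_square (\<lambda>x. g (t - x))"
          by (rule nn_integral_mono) (simp add: indicator_def)
        also have "\<dots> = L2_square g" by (rule nn_integral_reflect) measurable
        finally have "ennreal ((cmod (F t))\<^sup>2) * ?w \<le> ennreal ((cmod (F t))\<^sup>2) * L2_square g" by (rule mult_left_mono) simp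
        also have "\<dots> \<le> (ennreal (1 / c\<^sup>2) * ennreal ((\<psi> t)\<^sup>2 * (cmod (F t))\<^sup>2)) * L2_square g"
        proof (rule mult_right_mono)
          have "c\<^sup>2 \<le> (\<psi> t)\<^sup>2" using c(3)[OF True] c(1) by (intro power_mono) auto
          then have "c\<^sup>2 * (cmod (F t))\<^sup>2 \<le> (\<psi> t)\<^sup>2 * (cmod (F t))\<^sup>2" by (intro mult_right_mono) auto
          then have "(cmod (F t))\<^sup>2 \<le> 1 / c\<^sup>2 * ((\<psi> t)\<^sup>2 * (cmod (F t))\<^sup>2)" using c(1) by (simp add: field_simps)
          then show "ennreal ((cmod (F t))\<^sup>2) \<le> ennreal (1 / c\<^sup>2) * ennreal ((\<psi> t)\<^sup>2 * (cmod (F t))\<^sup>2)"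
            by (simp add: ennreal_mult[symmetric] ennreal_leI)
        qed simp
        finally show ?thesis by (simp add: mult_ac add_increasing)
      next
        case False
        have "?w \<le> (\<integral>\<^sup>+x. indicator {y. s < norm y} (t - x) * ennreal ((cmod (g (t - x)))\<^sup>2) \<partial>lborel)"
        proof (rule nn_integral_mono)
          fix x
          have "s < norm (t - x)" if "r + s < norm x"
            using norm_triangle_sub[of x t] that False by (simp add: norm_minus_commute)
          then show "indicator {x. r + s < norm x} x * ennreal ((cmod (g (t - x)))\<^sup>2) \<le> indicator {y. s < norm y} (t - x) * ennreal ((cmod (g (t - x)))\<^sup>2)"
            by (auto simp: indicator_def)
        qed
        also have "\<dots> = (\<integral>\<^sup>+y. indicator {y. s < norm y} y * ennreal ((cmod (g y))\<^sup>2) \<partial>lborel)"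
          by (rule nn_integral_reflect) measurable
        also have "\<dots> \<le> ennreal (?G / 4)" by (rule s(2))
        also have "\<dots> = ennreal (1 / 4) * L2_square g" unfolding window_L2_square using G by (simp add: ennreal_mult[symmetric])
        finally have "ennreal ((cmod (F t))\<^sup>2) * ?w \<le> ennreal ((cmod (F t))\<^sup>2) * (ennreal (1 / 4) * L2_square g)" by (rule mult_left_mono) simp
        then show ?thesis by (simp add: mult_ac add_increasing2)
      qed
    qed
    also have "\<dots> = ennreal (1 / 4) * L2_square g * L2_square F + L2_square g * ennreal (1 / c\<^sup>2) * weighted_square (\<lambda>t. (\<psi> t)\<^sup>2) F"
      by (simp add: nn_integral_add nn_integral_cmult)
    also have "ennreal (1 / 4) * L2_square g * L2_square F = ennreal (1 / 4) * L2_square V"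
      unfolding L2_square_transform[OF V \<psi>0] by (simp add: mult_ac)
    finally show ?thesis .
  qed
  moreover have "0 < r + s" using c(2) s(1) by simp
  ultimately show ?thesis by blast
qed

end

lemma (in weights) swapped: "weights (\<lambda>z. m0 (snd z, fst z)) \<phi> \<psi> C k \<gamma> g"
proof
  show "continuous_on UNIV (\<lambda>z. m0 (snd z, fst z))"
    by (rule continuous_on_compose2[OF m0_cont]) (auto intro!: continuous_intros)
  fix x \<omega> y \<eta> :: 'a
  show "(m0 (snd (x, \<omega>), fst (x, \<omega>)))\<^sup>2 + (\<phi> x)\<^sup>2 + (\<psi> \<omega>)\<^sup>2 \<le>
      C * ((m0 (snd (y, \<eta>), fst (y, \<eta>)))\<^sup>2 + (\<phi> y)\<^sup>2 + (\<psi> \<eta>)\<^sup>2) * ((1 + norm (x - y)) ^ k * (1 + norm (\<omega> - \<eta>)) ^ k)"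
    using moderate[of \<omega> x \<eta> y] by (simp add: add_ac mult_ac)
next
  fix e :: real assume "0 < e"
  then obtain r where "r > 0" and r: "\<And>x \<omega>. r \<le> norm (x, \<omega>) \<Longrightarrow> (m0 (x, \<omega>))\<^sup>2 \<le> e * ((m0 (x, \<omega>))\<^sup>2 + (\<psi> x)\<^sup>2 + (\<phi> \<omega>)\<^sup>2)"
    using tail by metis
  have "(m0 (snd (x, \<omega>), fst (x, \<omega>)))\<^sup>2 \<le> e * ((m0 (snd (x, \<omega>), fst (x, \<omega>)))\<^sup>2 + (\<phi> x)\<^sup>2 + (\<psi> \<omega>)\<^sup>2)"
    if "r \<le> norm (x, \<omega>)" for x \<omega>
    using r[of \<omega> x] that by (simp add: norm_Pair add_ac)
  then show "\<exists>r>0. \<forall>x \<omega>. r \<le> norm (x, \<omega>) \<longrightarrow> (m0 (snd (x, \<omega>), fst (x, \<omega>)))\<^sup>2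
      \<le> e * ((m0 (snd (x, \<omega>), fst (x, \<omega>)))\<^sup>2 + (\<phi> x)\<^sup>2 + (\<psi> \<omega>)\<^sup>2)"
    using \<open>r > 0\<close> by blast
qed (use m0_pos \<psi>_cont \<phi>_cont \<psi>_nonneg \<phi>_nonneg C_pos g \<gamma> in auto)

context weights
begin

interpretation swapped: weights "\<lambda>z. m0 (snd z, fst z)" \<phi> \<psi> C k \<gamma> g
  by (rule swapped)

lemma swapped_M: "swapped.M z = M (snd z, fst z)"
  by (simp add: swapped.M_def M_def)

text \<open>
  Suppose that \<open>\<phi>\<close> is not bounded below. If \<open>\<psi>\<close> has no zero, then moderateness of \<open>M\<close> at frequencies
  where \<open>\<phi>\<close> is as small as desired becomes moderateness of \<open>\<psi>\<^sup>2\<close> away from the origin, and near the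
  origin \<open>\<psi>\<close> is bounded below. If \<open>\<psi>\<close> has a zero, then \<open>\<phi>\<close> is bounded
  below at infinity, so it has a zero too, and the same argument bounds \<open>\<psi>\<close> below at infinity.
\<close>

lemma \<psi>_trichotomy:
  assumes "\<psi> x0 \<noteq> 0"
  obtains (\<phi>_below) c where "0 < c" "\<And>\<omega>. c \<le> \<phi> \<omega>"
  | (\<psi>_moderate) K where "0 \<le> K" "\<And>x t. (\<psi> x)\<^sup>2 \<le> K * (\<psi> t)\<^sup>2 * (1 + norm (x - t)) ^ k"
  | (both_below) c r where "0 < c" "0 < r" "\<And>\<omega>. r \<le> norm \<omega> \<Longrightarrow> c \<le> \<phi> \<omega>" "\<And>t. r \<le> norm t \<Longrightarrow> c \<le> \<psi> t"
proof (cases "\<exists>c>0. \<forall>\<omega>. c \<le> \<phi> \<omega>")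
  case True
  then show ?thesis using that(1) by blast
next
  case False
  then have inf0: "\<exists>\<omega>. \<phi> \<omega> < c" if "0 < c" for c using that by (meson not_le)
  show ?thesis
  proof (cases "\<exists>t0. \<psi> t0 = 0")
    case True
    then obtain t0 where t0: "\<psi> t0 = 0" by blast
    obtain c r where c: "0 < c" "0 < r" "\<And>\<omega>. r \<le> norm \<omega> \<Longrightarrow> c \<le> \<phi> \<omega>"
      using \<phi>_bounded_below_at_infinity[OF t0 assms] by blast
    have "\<exists>\<omega>0. \<phi> \<omega>0 = 0"
    proof (rule ccontr)
      assume "\<nexists>\<omega>0. \<phi> \<omega>0 = 0"
      then have pos: "0 < \<phi> \<omega>" for \<omega> using \<phi>_nonneg[of \<omega>] by (metis less_eq_real_def)
      have "\<exists>x\<in>cball 0 r. \<forall>y\<in>cball 0 r. \<phi> x \<le> \<phi> y"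
        using c(2) by (intro continuous_attains_inf continuous_on_subset[OF \<phi>_cont]) auto
      then obtain x where x: "\<And>y. norm y \<le> r \<Longrightarrow> \<phi> x \<le> \<phi> y" by (metis mem_cball_0)
      have "min c (\<phi> x) \<le> \<phi> \<omega>" for \<omega>
        using x[of \<omega>] c(3)[of \<omega>] by (cases "norm \<omega> \<le> r") (auto simp: min_le_iff_disj)
      moreover have "0 < min c (\<phi> x)" using c(1) pos by simp
      ultimately show False using False by blast
    qed
    then obtain \<omega>0 where \<omega>0: "\<phi> \<omega>0 = 0" by blast
    obtain b :: 'a where b: "b \<in> Basis" using nonempty_Basis by blast
    have "c \<le> \<phi> (r *\<^sub>R b)" using c(2) b by (intro c(3)) simp
    then have "\<phi> (r *\<^sub>R b) \<noteq> 0" using c(1) by simp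
    then obtain c' r' where c': "0 < c'" "0 < r'" "\<And>t. r' \<le> norm t \<Longrightarrow> c' \<le> \<psi> t"
      using swapped.\<phi>_bounded_below_at_infinity[OF \<omega>0] by blast
    show ?thesis
      by (rule that(3)[of "min c c'" "max r r'"]) (use c c' in \<open>auto simp: min_le_iff_disj\<close>)
  next
    case False
    then have pos: "0 < \<psi> t" for t using \<psi>_nonneg[of t] by (metis less_eq_real_def)
    obtain r where r: "r > 0" "\<And>x \<omega>. r \<le> norm (x, \<omega>) \<Longrightarrow> M (x, \<omega>) \<le> 2 * ((\<psi> x)\<^sup>2 + (\<phi> \<omega>)\<^sup>2)"
      using M_outside by blast
    obtain K where K: "0 \<le> K" "\<And>x t. (\<psi> x)\<^sup>2 \<le> K * ((\<psi> t)\<^sup>2 + 1) * (1 + norm (x - t)) ^ k"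
      using \<psi>_crude by blast
    have "\<exists>x\<in>cball 0 r. \<forall>y\<in>cball 0 r. \<psi> x \<le> \<psi> y"
      using r(1) by (intro continuous_attains_inf continuous_on_subset[OF \<psi>_cont]) auto
    then obtain x1 where x1: "\<And>y. norm y \<le> r \<Longrightarrow> \<psi> x1 \<le> \<psi> y" by (metis mem_cball_0)
    define c where "c = \<psi> x1"
    have c: "0 < c" by (simp add: c_def pos)
    define L where "L = C * 2 + K * (1 + 1 / c\<^sup>2)"
    have "(\<psi> x)\<^sup>2 \<le> L * (\<psi> t)\<^sup>2 * (1 + norm (x - t)) ^ k" for x t
    proof (cases "r \<le> norm t")
      case True
      let ?P = "(1 + norm (x - t)) ^ k"
      have P: "0 < ?P" by (intro zero_less_power add_pos_nonneg) auto
      have "(\<psi> x)\<^sup>2 \<le> C * 2 * (\<psi> t)\<^sup>2 * ?P + e" if e: "0 < e" for e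
      proof -
        \<comment> \<open>The frequency is chosen such that the contribution of \<open>\<phi>\<close> is at most \<open>e\<close>.\<close>
        define d where "d = sqrt (e / (C * 2 * ?P))"
        have "1 + norm (x - t) \<noteq> 0" by (smt (verit) norm_ge_zero)
        then have d: "0 < d" "C * 2 * d\<^sup>2 * ?P = e" using e P C_pos by (auto simp: d_def)
        obtain \<omega> where \<omega>: "\<phi> \<omega> < d" using inf0[OF d(1)] by blast
        have "(\<psi> x)\<^sup>2 \<le> C * M (t, \<omega>) * ?P"
          using order_trans[OF \<psi>_le_M M_moderate[of x \<omega> t \<omega>]] by simp
        also have "\<dots> \<le> C * (2 * ((\<psi> t)\<^sup>2 + (\<phi> \<omega>)\<^sup>2)) * ?P"
          using C_pos True norm_fst_le[of t \<omega>] by (intro mult_right_mono mult_left_mono r(2)) (auto intro: order_trans)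
        also have "\<dots> \<le> C * (2 * ((\<psi> t)\<^sup>2 + d\<^sup>2)) * ?P"
          using C_pos \<omega> \<phi>_nonneg[of \<omega>] by (intro mult_right_mono mult_left_mono add_left_mono power_mono) auto
        also have "\<dots> = C * 2 * (\<psi> t)\<^sup>2 * ?P + C * 2 * d\<^sup>2 * ?P" by (simp add: algebra_simps)
        finally show ?thesis unfolding d(2) .
      qed
      then have "(\<psi> x)\<^sup>2 \<le> C * 2 * (\<psi> t)\<^sup>2 * ?P" by (rule field_le_epsilon)
      also have "\<dots> \<le> L * (\<psi> t)\<^sup>2 * ?P" using K by (intro mult_right_mono) (auto simp: L_def)
      finally show ?thesis .
    next
      case False
      then have "c\<^sup>2 \<le> (\<psi> t)\<^sup>2" using x1[of t] c by (intro power_mono) (auto simp: c_def)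
      then have "(\<psi> t)\<^sup>2 + 1 \<le> (1 + 1 / c\<^sup>2) * (\<psi> t)\<^sup>2" using c by (simp add: field_simps)
      then have "K * ((\<psi> t)\<^sup>2 + 1) * (1 + norm (x - t)) ^ k \<le> K * ((1 + 1 / c\<^sup>2) * (\<psi> t)\<^sup>2) * (1 + norm (x - t)) ^ k"
        using K(1) by (intro mult_right_mono mult_left_mono) auto
      also have "\<dots> \<le> L * (\<psi> t)\<^sup>2 * (1 + norm (x - t)) ^ k"
        using C_pos by (simp only: mult.assoc[symmetric]) (intro mult_right_mono, auto simp: L_def)
      finally show ?thesis using K(2)[of x t] by linarith
    qed
    moreover have "0 \<le> L" using C_pos K by (simp add: L_def)
    ultimately show ?thesis using that(2) by blast
  qed
qed

lemma transform_of_swap: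
  assumes "transform_of V F G" shows "swapped.transform_of (\<lambda>z. V (snd z, fst z)) G F"
proof -
  have [measurable]: "V \<in> borel_measurable borel" using assms by (simp add: transform_of_def)
  have "(\<lambda>z. V (snd z, fst z)) \<in> borel_measurable borel" by measurable
  then show ?thesis using assms unfolding transform_of_def swapped.transform_of_def by simp
qed

lemma total_swap:
  assumes [measurable]: "V \<in> borel_measurable borel"
  shows "swapped.total (\<lambda>z. V (snd z, fst z)) G F = total V F G"
  using nn_integral_swap[of "\<lambda>z. ennreal ((m0 z)\<^sup>2 * (cmod (V z))\<^sup>2)"]
  by (simp add: swapped.total_def total_def add_ac)

lemma components_le_total:
  "weighted_square (\<lambda>z. (m0 z)\<^sup>2) V \<le> total V F G"
  "weighted_square (\<lambda>t. (\<psi> t)\<^sup>2) F \<le> total V F G"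
  "weighted_square (\<lambda>t. (\<phi> t)\<^sup>2) G \<le> total V F G"
  unfolding total_def by (auto simp: add_increasing add_increasing2)

lemma L2_square_swap:
  assumes "V \<in> borel_measurable borel"
  shows "L2_square (\<lambda>z. V (snd z, fst z)) = L2_square (V :: 'a \<times> 'a \<Rightarrow> complex)"
  using nn_integral_swap[of "\<lambda>z. ennreal ((cmod (V z))\<^sup>2)"] assms by simp

text \<open>
  The Plancherel identity in the frequency variable turns the lower bound of \<open>\<phi>\<close> into a bound by
  the weighted norm of \<open>G\<close>.
\<close>

lemma L2_square_bound_below:
  assumes c: "0 < c" "\<And>\<omega>. c \<le> \<phi> \<omega>" and V: "transform_of V F G"
  shows "L2_square V \<le> ennreal ((LINT s|lborel. (cmod (\<gamma> s))\<^sup>2) / c\<^sup>2) * total V F G"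
proof -
  have [measurable]: "G \<in> borel_measurable borel" and V': "V \<in> borel_measurable borel" using V by (simp_all add: transform_of_def)
  have "\<phi> 0 \<noteq> 0" using c(1) c(2)[of 0] by simp
  from swapped.L2_square_transform[OF transform_of_swap[OF V] this]
  have "L2_square V = L2_square \<gamma> * L2_square G" by (simp add: L2_square_swap[OF V'] mult.commute)
  also have "L2_square G \<le> (\<integral>\<^sup>+t. ennreal (1 / c\<^sup>2) * ennreal ((\<phi> t)\<^sup>2 * (cmod (G t))\<^sup>2) \<partial>lborel)"
  proof (rule nn_integral_mono)
    fix t
    have "c\<^sup>2 * (cmod (G t))\<^sup>2 \<le> (\<phi> t)\<^sup>2 * (cmod (G t))\<^sup>2"
      using c(2)[of t] c(1) by (intro mult_right_mono power_mono) auto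
    then have "(cmod (G t))\<^sup>2 \<le> 1 / c\<^sup>2 * ((\<phi> t)\<^sup>2 * (cmod (G t))\<^sup>2)" using c(1) by (simp add: field_simps)
    then show "ennreal ((cmod (G t))\<^sup>2) \<le> ennreal (1 / c\<^sup>2) * ennreal ((\<phi> t)\<^sup>2 * (cmod (G t))\<^sup>2)"
      by (simp add: ennreal_mult[symmetric] ennreal_leI)
  qed
  also have "\<dots> = ennreal (1 / c\<^sup>2) * weighted_square (\<lambda>t. (\<phi> t)\<^sup>2) G"
    by (rule nn_integral_cmult) measurable
  also have "\<dots> \<le> ennreal (1 / c\<^sup>2) * total V F G" by (intro mult_left_mono components_le_total) simp
  finally have "L2_square V \<le> L2_square \<gamma> * (ennreal (1 / c\<^sup>2) * total V F G)" by (simp add: mult_left_mono)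
  also have "\<dots> = ennreal ((LINT s|lborel. (cmod (\<gamma> s))\<^sup>2) / c\<^sup>2) * total V F G"
    unfolding swapped.window_L2_square by (simp add: mult.assoc[symmetric] ennreal_mult[symmetric])
  finally show ?thesis .
qed

lemma m0_bounded_below:
  "\<exists>\<mu>>0. \<forall>x \<omega>. norm x \<le> a \<longrightarrow> norm \<omega> \<le> b \<longrightarrow> \<mu> \<le> (m0 (x, \<omega>))\<^sup>2"
proof (cases "0 \<le> a \<and> 0 \<le> b")
  case True
  have "\<exists>z\<in>cball 0 a \<times> cball 0 b. \<forall>y\<in>cball 0 a \<times> cball 0 b. m0 z \<le> m0 y"
    using True by (intro continuous_attains_inf compact_Times continuous_on_subset[OF m0_cont]) auto
  then obtain z where z: "\<forall>y\<in>cball 0 a \<times> cball 0 b. m0 z \<le> m0 y" by blast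
  have "(m0 z)\<^sup>2 \<le> (m0 (x, \<omega>))\<^sup>2" if "norm x \<le> a" "norm \<omega> \<le> b" for x \<omega>
    using z that m0_pos[of z] by (intro power_mono) auto
  then show ?thesis using m0_pos[of z] by (intro exI[of _ "(m0 z)\<^sup>2"]) auto
next
  case False
  then have "\<not> (norm x \<le> a \<and> norm \<omega> \<le> b)" for x \<omega> :: 'a
    using norm_ge_zero[of x] norm_ge_zero[of \<omega>] by linarith
  then show ?thesis by (intro exI[of _ 1]) auto
qed

text \<open>
  If both weights are bounded below at infinity, then the mass of the transform outside a product of
  balls is controlled by the two weighted norms and a fraction of the mass itself, which is finite
  and can be absorbed; on the balls, \<open>m\<^sub>0\<close> is bounded below.
\<close>

lemma L2_square_bound_both:
  assumes c: "0 < c" "0 < r" "\<And>\<omega>. r \<le> norm \<omega> \<Longrightarrow> c \<le> \<phi> \<omega>" "\<And>t. r \<le> norm t \<Longrightarrow> c \<le> \<psi> t"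
  shows "\<exists>K\<ge>0. \<forall>V F G. transform_of V F G \<longrightarrow> weighted_square M V < \<top> \<longrightarrow>
    L2_square V \<le> ennreal K * total V F G"
proof -
  obtain \<rho>1 where \<rho>1: "\<And>V F G. transform_of V F G \<Longrightarrow>
    (\<integral>\<^sup>+z. indicator {x. \<rho>1 < norm x} (fst z) * ennreal ((cmod (V z))\<^sup>2) \<partial>lborel)
      \<le> ennreal (1 / 4) * L2_square V + L2_square g * ennreal (1 / c\<^sup>2) * weighted_square (\<lambda>t. (\<psi> t)\<^sup>2) F"
    using position_tail[OF c(1,2,4)] by blast
  obtain \<rho>2 where \<rho>2: "\<And>V F G. swapped.transform_of V G F \<Longrightarrow>
    (\<integral>\<^sup>+z. indicator {x. \<rho>2 < norm x} (fst z) * ennreal ((cmod (V z))\<^sup>2) \<partial>lborel)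
      \<le> ennreal (1 / 4) * L2_square V + L2_square \<gamma> * ennreal (1 / c\<^sup>2) * weighted_square (\<lambda>t. (\<phi> t)\<^sup>2) G"
    using swapped.position_tail[OF c(1,2,3)] by blast
  obtain \<mu> where \<mu>: "0 < \<mu>" "\<And>x \<omega>. norm x \<le> \<rho>1 \<Longrightarrow> norm \<omega> \<le> \<rho>2 \<Longrightarrow> \<mu> \<le> (m0 (x, \<omega>))\<^sup>2"
    using m0_bounded_below[of \<rho>1 \<rho>2] by blast
  obtain \<nu> where \<nu>: "0 < \<nu>" "\<And>x \<omega>. norm x \<le> r \<Longrightarrow> norm \<omega> \<le> r \<Longrightarrow> \<nu> \<le> (m0 (x, \<omega>))\<^sup>2"
    using m0_bounded_below[of r r] by blast
  define c0 where "c0 = min (c\<^sup>2) \<nu>"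
  have c0: "0 < c0" using c(1) \<nu>(1) by (simp add: c0_def)
  have M_below: "c0 \<le> M (x, \<omega>)" for x \<omega>
  proof -
    consider "r \<le> norm x" | "r \<le> norm \<omega>" | "norm x \<le> r" "norm \<omega> \<le> r" by linarith
    then show ?thesis
    proof cases
      case 1
      then have "c\<^sup>2 \<le> (\<psi> x)\<^sup>2" using c(1) c(4)[of x] by (intro power_mono) auto
      then show ?thesis using \<psi>_le_M[of x \<omega>] by (simp add: c0_def)
    next
      case 2
      then have "c\<^sup>2 \<le> (\<phi> \<omega>)\<^sup>2" using c(1) c(3)[of \<omega>] by (intro power_mono) auto
      then show ?thesis by (simp add: c0_def M_def add_increasing min.coboundedI1)
    next
      case 3
      then show ?thesis using \<nu>(2)[of x \<omega>] by (simp add: c0_def M_def add_increasing2 min.coboundedI2)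
    qed
  qed
  define Gg G\<gamma> where "Gg = (LINT s|lborel. (cmod (g s))\<^sup>2)" and "G\<gamma> = (LINT s|lborel. (cmod (\<gamma> s))\<^sup>2)"
  have Gpos: "0 \<le> Gg" "0 \<le> G\<gamma>" by (simp_all add: Gg_def G\<gamma>_def)
  define K where "K = Gg / c\<^sup>2 + G\<gamma> / c\<^sup>2 + 1 / \<mu>"
  have K: "0 \<le> K" using Gpos \<mu>(1) by (simp add: K_def)
  have "L2_square V \<le> ennreal (2 * K) * total V F G"
    if V: "transform_of V F G" and fin: "weighted_square M V < \<top>" for V F G
  proof -
    have V' [measurable]: "V \<in> borel_measurable borel" using V by (simp add: transform_of_def)
    let ?T = "total V F G"
    have "L2_square V \<le> (\<integral>\<^sup>+z. ennreal (1 / c0) * ennreal (M z * (cmod (V z))\<^sup>2) \<partial>lborel)"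
    proof (rule nn_integral_mono)
      fix z
      have "c0 * (cmod (V z))\<^sup>2 \<le> M z * (cmod (V z))\<^sup>2" using M_below[of "fst z" "snd z"] by (intro mult_right_mono) auto
      then have "(cmod (V z))\<^sup>2 \<le> 1 / c0 * (M z * (cmod (V z))\<^sup>2)" using c0 by (simp add: field_simps)
      then show "ennreal ((cmod (V z))\<^sup>2) \<le> ennreal (1 / c0) * ennreal (M z * (cmod (V z))\<^sup>2)"
        using c0 M_pos[of z] by (simp add: ennreal_mult[symmetric] ennreal_leI less_imp_le)
    qed
    also have "\<dots> = ennreal (1 / c0) * weighted_square M V" by (rule nn_integral_cmult) measurable
    also have "\<dots> < \<top>" using fin by (simp add: ennreal_mult_less_top)
    finally have Yfin: "L2_square V < \<top>" .
    have "L2_square V \<le> (\<integral>\<^sup>+z. (indicator {x. \<rho>1 < norm x} (fst z) * ennreal ((cmod (V z))\<^sup>2)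
       + indicator {x. \<rho>2 < norm x} (snd z) * ennreal ((cmod (V z))\<^sup>2)) + ennreal (1 / \<mu>) * ennreal ((m0 z)\<^sup>2 * (cmod (V z))\<^sup>2) \<partial>lborel)"
    proof (rule nn_integral_mono)
      fix z
      let ?v = "ennreal ((cmod (V z))\<^sup>2)"
      consider "\<rho>1 < norm (fst z)" | "\<rho>2 < norm (snd z)" | "norm (fst z) \<le> \<rho>1" "norm (snd z) \<le> \<rho>2" by linarith
      then show "?v \<le> (indicator {x. \<rho>1 < norm x} (fst z) * ?v + indicator {x. \<rho>2 < norm x} (snd z) * ?v) + ennreal (1 / \<mu>) * ennreal ((m0 z)\<^sup>2 * (cmod (V z))\<^sup>2)"
      proof cases
        case 3
        then have "\<mu> * (cmod (V z))\<^sup>2 \<le> (m0 z)\<^sup>2 * (cmod (V z))\<^sup>2" using \<mu>(2)[of "fst z" "snd z"] by (intro mult_right_mono) auto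
        then have "(cmod (V z))\<^sup>2 \<le> 1 / \<mu> * ((m0 z)\<^sup>2 * (cmod (V z))\<^sup>2)" using \<mu>(1) by (simp add: field_simps)
        then have "?v \<le> ennreal (1 / \<mu>) * ennreal ((m0 z)\<^sup>2 * (cmod (V z))\<^sup>2)"
          using \<mu>(1) by (simp add: ennreal_mult[symmetric] ennreal_leI)
        then show ?thesis by (rule order_trans) (simp add: add_increasing)
      qed (simp_all add: add_increasing add_increasing2)
    qed
    also have "\<dots> = ((\<integral>\<^sup>+z. indicator {x. \<rho>1 < norm x} (fst z) * ennreal ((cmod (V z))\<^sup>2) \<partial>lborel)
       + (\<integral>\<^sup>+z. indicator {x. \<rho>2 < norm x} (snd z) * ennreal ((cmod (V z))\<^sup>2) \<partial>lborel)) + ennreal (1 / \<mu>) * weighted_square (\<lambda>z. (m0 z)\<^sup>2) V"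
      by (simp add: nn_integral_add nn_integral_cmult)
    also have "(\<integral>\<^sup>+z. indicator {x. \<rho>2 < norm x} (snd z) * ennreal ((cmod (V z))\<^sup>2) \<partial>lborel)
      = (\<integral>\<^sup>+z. indicator {x. \<rho>2 < norm x} (fst z) * ennreal ((cmod (V (snd z, fst z)))\<^sup>2) \<partial>lborel)"
      by (subst nn_integral_swap[symmetric]) auto
    also have "((\<integral>\<^sup>+z. indicator {x. \<rho>1 < norm x} (fst z) * ennreal ((cmod (V z))\<^sup>2) \<partial>lborel)
       + (\<integral>\<^sup>+z. indicator {x. \<rho>2 < norm x} (fst z) * ennreal ((cmod (V (snd z, fst z)))\<^sup>2) \<partial>lborel)) + ennreal (1 / \<mu>) * weighted_square (\<lambda>z. (m0 z)\<^sup>2) V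
      \<le> ((ennreal (1 / 4) * L2_square V + L2_square g * ennreal (1 / c\<^sup>2) * ?T) + (ennreal (1 / 4) * L2_square V + L2_square \<gamma> * ennreal (1 / c\<^sup>2) * ?T)) + ennreal (1 / \<mu>) * ?T"
    proof (intro add_mono)
      show "(\<integral>\<^sup>+z. indicator {x. \<rho>1 < norm x} (fst z) * ennreal ((cmod (V z))\<^sup>2) \<partial>lborel) \<le> ennreal (1 / 4) * L2_square V + L2_square g * ennreal (1 / c\<^sup>2) * ?T"
        by (rule order_trans[OF \<rho>1[OF V]]) (intro add_left_mono mult_left_mono components_le_total, simp)
      show "(\<integral>\<^sup>+z. indicator {x. \<rho>2 < norm x} (fst z) * ennreal ((cmod (V (snd z, fst z)))\<^sup>2) \<partial>lborel) \<le> ennreal (1 / 4) * L2_square V + L2_square \<gamma> * ennreal (1 / c\<^sup>2) * ?T"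
        using \<rho>2[OF transform_of_swap[OF V]] unfolding L2_square_swap[OF V']
        by (rule order_trans) (intro add_left_mono mult_left_mono components_le_total, simp)
      show "ennreal (1 / \<mu>) * weighted_square (\<lambda>z. (m0 z)\<^sup>2) V \<le> ennreal (1 / \<mu>) * ?T"
        by (intro mult_left_mono components_le_total) simp
    qed
    also have "\<dots> = ennreal (1 / 2) * L2_square V + ennreal K * ?T"
    proof -
      have "ennreal (1 / 4) + ennreal (1 / 4) = ennreal (1 / 2)" by (simp only: ennreal_plus[symmetric] zero_le_divide_1_iff zero_le_numeral) simp
      then have h: "ennreal (1 / 4) * L2_square V + ennreal (1 / 4) * L2_square V = ennreal (1 / 2) * L2_square V" by (metis distrib_right)
      have "L2_square g * ennreal (1 / c\<^sup>2) = ennreal (Gg / c\<^sup>2)" "L2_square \<gamma> * ennreal (1 / c\<^sup>2) = ennreal (G\<gamma> / c\<^sup>2)"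
        unfolding window_L2_square swapped.window_L2_square Gg_def G\<gamma>_def by (simp_all add: ennreal_mult[symmetric])
      moreover have "ennreal K = ennreal (Gg / c\<^sup>2) + ennreal (G\<gamma> / c\<^sup>2) + ennreal (1 / \<mu>)"
        unfolding K_def using Gpos \<mu>(1) by (simp add: ennreal_plus)
      ultimately show ?thesis unfolding h[symmetric] by (simp add: distrib_right add_ac)
    qed
    finally have "L2_square V \<le> 2 * (ennreal K * ?T)" by (rule ennreal_absorb[OF Yfin])
    also have "\<dots> = ennreal (2 * K) * ?T" using K by (simp add: ennreal_mult mult.assoc)
    finally show ?thesis .
  qed
  then show ?thesis using K by (intro exI[of _ "2 * K"]) auto
qed

text \<open>
  If \<open>\<psi>\<close> is moderate, then its average over the window is bounded by \<open>\<psi>\<close> itself. In the other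
  cases, the crude comparison with \<open>\<psi>\<^sup>2 + 1\<close> suffices, as the \<open>L\<^sup>2\<close> norm is controlled.
\<close>

lemma position_bound:
  assumes "\<psi> x0 \<noteq> 0"
  shows "\<exists>K\<ge>0. \<forall>V F G. transform_of V F G \<longrightarrow> weighted_square M V < \<top> \<longrightarrow>
    position_square V \<le> ennreal K * total V F G"
proof -
  obtain Kg where Kg: "0 \<le> Kg" "(\<integral>\<^sup>+t. ennreal ((1 + norm t) ^ k * (cmod (g t))\<^sup>2) \<partial>lborel) \<le> ennreal Kg"
    using schwartz_weighted_square[OF g(1), of k] by blast
  let ?G = "LINT s|lborel. (cmod (g s))\<^sup>2"
  have G: "0 < ?G" by (rule schwartz_norm_pos[OF g])
  obtain K1 where K1: "0 \<le> K1" "\<And>x t. (\<psi> x)\<^sup>2 \<le> K1 * ((\<psi> t)\<^sup>2 + 1) * (1 + norm (x - t)) ^ k"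
    using \<psi>_crude by blast
  have crude: ?thesis
    if L: "0 \<le> L" "\<And>V F G. transform_of V F G \<Longrightarrow> weighted_square M V < \<top> \<Longrightarrow> L2_square V \<le> ennreal L * total V F G" for L
  proof -
    have "position_square V \<le> ennreal (K1 * Kg * (1 + L / ?G)) * total V F G"
      if V: "transform_of V F G" and fin: "weighted_square M V < \<top>" for V F G
    proof -
      have "L2_square F = ennreal (1 / ?G) * L2_square V"
        unfolding L2_square_transform[OF V assms] window_L2_square using G
        by (simp add: mult.left_commute ennreal_mult[symmetric])
      also have "\<dots> \<le> ennreal (1 / ?G) * (ennreal L * total V F G)" by (intro mult_left_mono L(2)[OF V fin]) simp
      also have "\<dots> = ennreal (L / ?G) * total V F G" using G L(1) by (simp add: mult.assoc[symmetric] ennreal_mult[symmetric])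
      finally have nF: "L2_square F \<le> ennreal (L / ?G) * total V F G" .
      have "position_square V
        \<le> ennreal (K1 * Kg) * (weighted_square (\<lambda>t. (\<psi> t)\<^sup>2) F + ennreal 1 * L2_square F)"
        by (rule position_weighted_bound[OF V assms K1(1) _ K1(2) Kg(2,1)]) simp
      also have "\<dots> \<le> ennreal (K1 * Kg) * (total V F G + ennreal (L / ?G) * total V F G)"
        using nF by (intro mult_left_mono add_mono components_le_total) auto
      also have "\<dots> = ennreal (K1 * Kg * (1 + L / ?G)) * total V F G"
        using K1(1) Kg(1) L(1) G by (simp add: ennreal_mult ennreal_plus distrib_right mult.assoc)
      finally show ?thesis .
    qed
    moreover have "0 \<le> K1 * Kg * (1 + L / ?G)" using K1(1) Kg(1) L(1) G by simp
    ultimately show ?thesis by blast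
  qed
  from assms show ?thesis
  proof (cases rule: \<psi>_trichotomy)
    case (\<phi>_below c)
    show ?thesis
      by (rule crude[OF _ L2_square_bound_below[OF \<phi>_below]]) simp
  next
    case (\<psi>_moderate K)
    have "position_square V \<le> ennreal (K * Kg) * total V F G"
      if V: "transform_of V F G" for V F G
    proof -
      have "position_square V
        \<le> ennreal (K * Kg) * (weighted_square (\<lambda>t. (\<psi> t)\<^sup>2) F + ennreal 0 * L2_square F)"
        by (rule position_weighted_bound[OF V assms \<psi>_moderate(1) _ _ Kg(2,1)]) (simp_all add: \<psi>_moderate(2))
      also have "\<dots> \<le> ennreal (K * Kg) * total V F G"
        by (simp add: mult_left_mono components_le_total)
      finally show ?thesis .
    qed
    then show ?thesis using \<psi>_moderate(1) Kg(1) by (intro exI[of _ "K * Kg"]) auto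
  next
    case (both_below c r)
    from L2_square_bound_both[OF both_below]
    obtain L where "0 \<le> L" "\<And>V F G. transform_of V F G \<Longrightarrow> weighted_square M V < \<top> \<Longrightarrow> L2_square V \<le> ennreal L * total V F G"
      by blast
    then show ?thesis by (rule crude)
  qed
qed

lemma position_square_bound:
  "\<exists>K\<ge>0. \<forall>V F G. transform_of V F G \<longrightarrow> weighted_square M V < \<top> \<longrightarrow>
    position_square V \<le> ennreal K * total V F G"
proof (cases "\<exists>x0. \<psi> x0 \<noteq> 0")
  case False
  then show ?thesis by (intro exI[of _ 0]) simp
qed (use position_bound in blast)

end

text \<open>A second interpretation, after the estimate above, makes it available with position and frequency exchanged.\<close>

context weights
begin

interpretation swapped: weights "\<lambda>z. m0 (snd z, fst z)" \<phi> \<psi> C k \<gamma> g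
  by (rule swapped)

text \<open>
  The three parts of \<open>M\<close> are estimated separately; the part of \<open>\<phi>\<close> is that of \<open>\<psi>\<close> with position
  and frequency exchanged.
\<close>

lemma norm_estimate:
  "\<exists>K\<ge>0. \<forall>V F G. transform_of V F G \<longrightarrow> weighted_square M V < \<top> \<longrightarrow>
    weighted_square M V \<le> ennreal K * total V F G"
proof -
  obtain K1 where K1: "0 \<le> K1" "\<And>V F G. transform_of V F G \<Longrightarrow> weighted_square M V < \<top> \<Longrightarrow>
    position_square V \<le> ennreal K1 * total V F G"
    using position_square_bound by blast
  obtain K2 where K2: "0 \<le> K2" "\<And>V F G. swapped.transform_of V G F \<Longrightarrow> (\<integral>\<^sup>+z. ennreal (swapped.M z * (cmod (V z))\<^sup>2) \<partial>lborel) < \<top> \<Longrightarrow>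
    (\<integral>\<^sup>+z. ennreal ((\<phi> (fst z))\<^sup>2) * ennreal ((cmod (V z))\<^sup>2) \<partial>lborel) \<le> ennreal K2 * swapped.total V G F"
    using swapped.position_square_bound by blast
  have "weighted_square M V \<le> ennreal (1 + K1 + K2) * total V F G"
    if V: "transform_of V F G" and fin: "weighted_square M V < \<top>" for V F G
  proof -
    have V' [measurable]: "V \<in> borel_measurable borel" using V by (simp add: transform_of_def)
    have "(\<integral>\<^sup>+z. ennreal (swapped.M z * (cmod (V (snd z, fst z)))\<^sup>2) \<partial>lborel) = weighted_square M V"
      unfolding swapped_M by (rule nn_integral_swap[of "\<lambda>z. ennreal (M z * (cmod (V z))\<^sup>2)"]) measurable
    with K2(2)[OF transform_of_swap[OF V]] fin
    have "(\<integral>\<^sup>+z. ennreal ((\<phi> (fst z))\<^sup>2) * ennreal ((cmod (V (snd z, fst z)))\<^sup>2) \<partial>lborel) \<le> ennreal K2 * total V F G"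
      by (simp add: total_swap[OF V'])
    moreover have "(\<integral>\<^sup>+z. ennreal ((\<phi> (fst z))\<^sup>2) * ennreal ((cmod (V (snd z, fst z)))\<^sup>2) \<partial>lborel)
       = (\<integral>\<^sup>+z. ennreal ((\<phi> (snd z))\<^sup>2) * ennreal ((cmod (V z))\<^sup>2) \<partial>lborel)"
      by (subst nn_integral_swap[symmetric]) auto
    ultimately have B: "(\<integral>\<^sup>+z. ennreal ((\<phi> (snd z))\<^sup>2) * ennreal ((cmod (V z))\<^sup>2) \<partial>lborel) \<le> ennreal K2 * total V F G" by simp
    have "weighted_square M V = (\<integral>\<^sup>+z. (ennreal ((m0 z)\<^sup>2 * (cmod (V z))\<^sup>2)
        + ennreal ((\<psi> (fst z))\<^sup>2) * ennreal ((cmod (V z))\<^sup>2)) + ennreal ((\<phi> (snd z))\<^sup>2) * ennreal ((cmod (V z))\<^sup>2) \<partial>lborel)"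
      by (intro nn_integral_cong) (simp add: M_def distrib_right ennreal_plus ennreal_mult)
    also have "\<dots> = (weighted_square (\<lambda>z. (m0 z)\<^sup>2) V + position_square V)
       + (\<integral>\<^sup>+z. ennreal ((\<phi> (snd z))\<^sup>2) * ennreal ((cmod (V z))\<^sup>2) \<partial>lborel)"
      by (simp add: nn_integral_add)
    also have "\<dots> \<le> (total V F G + ennreal K1 * total V F G) + ennreal K2 * total V F G"
      by (intro add_mono components_le_total K1(2)[OF V fin] B)
    also have "\<dots> = ennreal (1 + K1 + K2) * total V F G"
      using K1(1) K2(1) by (simp add: ennreal_plus distrib_right)
    finally show ?thesis .
  qed
  then show ?thesis using K1(1) K2(1) by (intro exI[of _ "1 + K1 + K2"]) auto
qed

end

section \<open>Limits of functions in weighted \<open>L\<^sup>2\<close>\<close>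

lemma weighted_L1_bound:
  fixes F :: "'a::euclidean_space \<Rightarrow> complex"
  assumes [measurable]: "F \<in> borel_measurable borel" and D: "0 \<le> D"
    and F: "weighted_L2 s F \<le> ennreal (D\<^sup>2)"
  shows "integrable lborel (\<lambda>t. (decay t / (1 + norm t) ^ s) *\<^sub>R F t)"
    and "(LINT t|lborel. cmod ((decay t / (1 + norm t) ^ s) *\<^sub>R F t)) \<le> sqrt (LINT t|lborel. decay (t::'a)) * D"
proof -
  let ?J = "LINT t|lborel. decay (t::'a)"
  have J: "0 \<le> ?J" by simp
  have w: "0 < (1 + norm t) ^ s" for t :: 'a by (intro zero_less_power add_pos_nonneg) auto
  have eq: "cmod ((decay t / (1 + norm t) ^ s) *\<^sub>R F t) = decay t * (cmod (F t) / (1 + norm t) ^ s)" for t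
    using w[of t] by simp
  have "(\<integral>\<^sup>+t. ennreal (decay t) * ennreal (cmod (F t) / (1 + norm t) ^ s) \<partial>lborel)\<^sup>2
    \<le> (\<integral>\<^sup>+t. (ennreal (decay (t::'a)))\<^sup>2 \<partial>lborel) * (\<integral>\<^sup>+t. (ennreal (cmod (F t) / (1 + norm t) ^ s))\<^sup>2 \<partial>lborel)"
    by (rule Cauchy_Schwarz_nn_integral) measurable
  also have "\<dots> \<le> ennreal ?J * ennreal (D\<^sup>2)"
  proof (rule mult_mono)
    have "(\<integral>\<^sup>+t. (ennreal (decay (t::'a)))\<^sup>2 \<partial>lborel) \<le> (\<integral>\<^sup>+t. ennreal (decay (t::'a)) \<partial>lborel)"
    proof (rule nn_integral_mono)
      fix t :: 'a
      have "decay t * decay t \<le> decay t * 1" using decay_le_1[of t] by (intro mult_left_mono) auto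
      then show "(ennreal (decay t))\<^sup>2 \<le> ennreal (decay t)" by (simp add: power2_eq_square ennreal_mult[symmetric] ennreal_leI)
    qed
    also have "\<dots> = ennreal ?J" by (rule nn_integral_eq_integral[OF integrable_decay]) simp
    finally show "(\<integral>\<^sup>+t. (ennreal (decay (t::'a)))\<^sup>2 \<partial>lborel) \<le> ennreal ?J" .
    have "(ennreal (cmod (F t) / (1 + norm t) ^ s))\<^sup>2 = ennreal ((cmod (F t))\<^sup>2 / (1 + norm t) ^ (2 * s))" for t
      using w[of t] by (simp add: ennreal_power power_divide power_mult[symmetric] mult.commute)
    then show "(\<integral>\<^sup>+t. (ennreal (cmod (F t) / (1 + norm t) ^ s))\<^sup>2 \<partial>lborel) \<le> ennreal (D\<^sup>2)" using F by simp
  qed auto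
  also have "\<dots> = (ennreal (sqrt ?J * D))\<^sup>2"
    using J D by (simp add: ennreal_power ennreal_mult[symmetric] power_mult_distrib)
  finally have "(\<integral>\<^sup>+t. ennreal (decay t) * ennreal (cmod (F t) / (1 + norm t) ^ s) \<partial>lborel) \<le> ennreal (sqrt ?J * D)"
    by (rule ennreal_square_le_cancel)
  then have le: "(\<integral>\<^sup>+t. ennreal (cmod ((decay t / (1 + norm t) ^ s) *\<^sub>R F t)) \<partial>lborel) \<le> ennreal (sqrt ?J * D)"
  proof -
    have "ennreal (decay t * (cmod (F t) / (1 + norm t) ^ s)) = ennreal (decay t) * ennreal (cmod (F t) / (1 + norm t) ^ s)" for t
      using w[of t] by (intro ennreal_mult) auto
    then show ?thesis unfolding eq using \<open>_ \<le> ennreal (sqrt ?J * D)\<close> by (simp only:)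
  qed
  then show i: "integrable lborel (\<lambda>t. (decay t / (1 + norm t) ^ s) *\<^sub>R F t)"
    unfolding integrable_iff_bounded by (auto intro: le_less_trans)
  have "ennreal (LINT t|lborel. cmod ((decay t / (1 + norm t) ^ s) *\<^sub>R F t)) \<le> ennreal (sqrt ?J * D)"
    using le by (subst (asm) nn_integral_eq_integral[OF integrable_norm[OF i]]) auto
  then show "(LINT t|lborel. cmod ((decay t / (1 + norm t) ^ s) *\<^sub>R F t)) \<le> sqrt ?J * D"
    by (subst (asm) ennreal_le_iff) (use J D in auto)
qed

text \<open>
  By the Cauchy-Schwarz inequality, the sequence is a Cauchy sequence in \<open>L\<^sup>1\<close> with an
  integrable weight, so a subsequence converges almost everywhere. Fatou's lemma carries both
  bounds to the limit.
\<close>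

lemma weighted_L2_complete:
  fixes F :: "nat \<Rightarrow> 'a::euclidean_space \<Rightarrow> complex"
  assumes [measurable]: "\<And>n. F n \<in> borel_measurable borel" and D: "0 \<le> D"
    and F: "\<And>n. weighted_L2 s (F n) \<le> ennreal (D\<^sup>2)"
    and cauchy: "\<And>e. 0 < e \<Longrightarrow> \<exists>n0. \<forall>n\<ge>n0. \<forall>k\<ge>n0.
      weighted_L2 s (\<lambda>t. F n t - F k t) \<le> ennreal e"
  shows "\<exists>F0 r. F0 \<in> borel_measurable borel \<and> strict_mono (r :: nat \<Rightarrow> nat) \<and> (AE t in lborel. (\<lambda>n. F (r n) t) \<longlonglongrightarrow> F0 t) \<and>
    weighted_L2 s F0 \<le> ennreal (D\<^sup>2) \<and>
    (\<forall>e>0. \<exists>n0. \<forall>n\<ge>n0. weighted_L2 s (\<lambda>t. F n t - F0 t) \<le> ennreal e)"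
proof -
  define v where "v t = decay t / (1 + norm t) ^ s" for t :: 'a
  have v: "0 < v t" for t
    unfolding v_def by (intro divide_pos_pos decay_pos zero_less_power add_pos_nonneg) auto
  define J where "J = sqrt (LINT t|lborel. decay (t::'a)) + 1"
  have J: "0 < J" "sqrt (LINT t|lborel. decay (t::'a)) < J" by (auto simp: J_def add_nonneg_pos)
  have "\<exists>n0. \<forall>n\<ge>n0. \<forall>k\<ge>n0. (LINT t|lborel. cmod (v t *\<^sub>R F n t - v t *\<^sub>R F k t)) < e" if e: "0 < e" for e
  proof -
    have ee: "0 < (e / J)\<^sup>2" "0 \<le> e / J" using e J by auto
    obtain n0 where n0: "\<And>n k. n \<ge> n0 \<Longrightarrow> k \<ge> n0 \<Longrightarrow> weighted_L2 s (\<lambda>t. F n t - F k t) \<le> ennreal ((e / J)\<^sup>2)"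
      using cauchy[OF ee(1)] by blast
    have "(LINT t|lborel. cmod (v t *\<^sub>R F n t - v t *\<^sub>R F k t)) < e" if "n \<ge> n0" "k \<ge> n0" for n k
    proof -
      have "(LINT t|lborel. cmod (v t *\<^sub>R F n t - v t *\<^sub>R F k t)) \<le> sqrt (LINT t|lborel. decay (t::'a)) * (e / J)"
        using weighted_L1_bound(2)[OF _ ee(2) n0[OF that]] unfolding v_def by (simp add: scaleR_diff_right)
      also have "\<dots> < J * (e / J)" using J e by (intro mult_strict_right_mono) auto
      finally show ?thesis using J by simp
    qed
    then show ?thesis by blast
  qed
  moreover have "integrable lborel (\<lambda>t. v t *\<^sub>R F n t)" for n
    unfolding v_def by (rule weighted_L1_bound(1)[OF _ D F]) measurable
  ultimately obtain r where r: "strict_mono r" "AE t in lborel. Cauchy (\<lambda>n. v t *\<^sub>R F (r n) t)"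
    using cauchy_L1_AE_cauchy_subseq[of lborel "\<lambda>n t. v t *\<^sub>R F n t"] by blast
  define F0 where "F0 t = lim (\<lambda>n. F (r n) t)" for t
  have F0m [measurable]: "F0 \<in> borel_measurable borel" unfolding F0_def[abs_def] by measurable
  have lim: "AE t in lborel. (\<lambda>n. F (r n) t) \<longlonglongrightarrow> F0 t"
    using r(2)
  proof eventually_elim
    case (elim t)
    then obtain l where "(\<lambda>n. v t *\<^sub>R F (r n) t) \<longlonglongrightarrow> l" using Cauchy_convergent convergent_def by blast
    then have "(\<lambda>n. inverse (v t) *\<^sub>R (v t *\<^sub>R F (r n) t)) \<longlonglongrightarrow> inverse (v t) *\<^sub>R l" by (intro tendsto_intros)
    then have "(\<lambda>n. F (r n) t) \<longlonglongrightarrow> inverse (v t) *\<^sub>R l" using v[of t] by simp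
    then show ?case unfolding F0_def by (simp add: limI)
  qed
  have w0: "(1 + norm t) ^ (2 * s) \<noteq> 0" for t :: 'a by (smt (verit) norm_ge_zero zero_less_power)
  have "weighted_L2 s F0 \<le> ennreal (D\<^sup>2)"
  proof (rule fatou_bound[where u="\<lambda>n t. ennreal ((cmod (F (r n) t))\<^sup>2 / (1 + norm t) ^ (2 * s))", OF _ _ F tendsto_const])
    show "AE t in lborel. (\<lambda>n. ennreal ((cmod (F (r n) t))\<^sup>2 / (1 + norm t) ^ (2 * s))) \<longlonglongrightarrow> ennreal ((cmod (F0 t))\<^sup>2 / (1 + norm t) ^ (2 * s))"
      using lim by eventually_elim (intro tendsto_intros tendsto_ennrealI w0)
  qed measurable
  moreover have "\<exists>n0. \<forall>n\<ge>n0. weighted_L2 s (\<lambda>t. F n t - F0 t) \<le> ennreal e" if e: "0 < e" for e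
  proof -
    obtain n0 where n0: "\<And>n k. n \<ge> n0 \<Longrightarrow> k \<ge> n0 \<Longrightarrow> weighted_L2 s (\<lambda>t. F n t - F k t) \<le> ennreal e"
      using cauchy[OF e] by blast
    have "weighted_L2 s (\<lambda>t. F n t - F0 t) \<le> ennreal e" if n: "n \<ge> n0" for n
    proof (rule fatou_bound[where u="\<lambda>k t. ennreal ((cmod (F n t - F (r (k + n0)) t))\<^sup>2 / (1 + norm t) ^ (2 * s))", OF _ _ _ tendsto_const])
      show "AE t in lborel. (\<lambda>k. ennreal ((cmod (F n t - F (r (k + n0)) t))\<^sup>2 / (1 + norm t) ^ (2 * s))) \<longlonglongrightarrow> ennreal ((cmod (F n t - F0 t))\<^sup>2 / (1 + norm t) ^ (2 * s))"
        using lim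
      proof eventually_elim
        case (elim t)
        from LIMSEQ_ignore_initial_segment[OF elim, of n0] show ?case by (intro tendsto_intros tendsto_ennrealI w0)
      qed
      show "weighted_L2 s (\<lambda>t. F n t - F (r (k + n0)) t) \<le> ennreal e" for k
        using seq_suble[OF r(1), of "k + n0"] by (intro n0 n) simp
    qed measurable
    then show ?thesis by blast
  qed
  ultimately show ?thesis using F0m r(1) lim by blast
qed

lemma weighted_L2_locally_integrable:
  fixes F :: "'a::euclidean_space \<Rightarrow> complex"
  assumes [measurable]: "F \<in> borel_measurable borel"
    and F: "(\<integral>\<^sup>+t. ennreal ((cmod (F t))\<^sup>2 / (1 + norm t) ^ k) \<partial>lborel) < \<infinity>" and K: "compact K"
  shows "set_integrable lborel K F"
proof -
  have [measurable]: "K \<in> sets borel" by (rule borel_compact[OF K])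
  obtain b where b: "0 < b" "\<And>t. t \<in> K \<Longrightarrow> norm t \<le> b"
    using compact_imp_bounded[OF K] by (auto simp: bounded_pos)
  have i1: "integrable lborel (\<lambda>t. (cmod (F t))\<^sup>2 / (1 + norm t) ^ k)"
    using F by (simp add: integrable_iff_bounded)
  have i2: "integrable lborel (\<lambda>t::'a. indicator K t * (1 + b) ^ k)"
    by (intro integrable_mult_left integrable_real_indicator)
      (auto simp: emeasure_bounded_finite[OF compact_imp_bounded[OF K], unfolded infinity_ennreal_def])
  show ?thesis
    unfolding set_integrable_def
  proof (rule Bochner_Integration.integrable_bound[OF Bochner_Integration.integrable_add[OF i1 i2]])
    show "AE t in lborel. norm (indicator K t *\<^sub>R F t) \<le> norm ((cmod (F t))\<^sup>2 / (1 + norm t) ^ k + indicator K t * (1 + b) ^ k)"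
    proof (rule AE_I2)
      fix t :: 'a
      let ?w = "(1 + norm t) ^ k"
      have w: "0 < ?w" by (intro zero_less_power add_pos_nonneg) auto
      \<comment> \<open>Either \<open>F t\<close> is at most the weight, which is bounded on \<open>K\<close>, or it is at most its
        square divided by the weight.\<close>
      have "cmod (F t) \<le> (cmod (F t))\<^sup>2 / ?w + (1 + b) ^ k" if "t \<in> K"
      proof -
        have wb: "?w \<le> (1 + b) ^ k" using b(2)[OF that] by (intro power_mono) auto
        show ?thesis
        proof (cases "cmod (F t) \<le> ?w")
          case True
          then show ?thesis using wb w by (simp add: add_increasing)
        next
          case False
          then have "?w * cmod (F t) \<le> (cmod (F t))\<^sup>2" unfolding power2_eq_square by (intro mult_right_mono) auto
          then have "cmod (F t) \<le> (cmod (F t))\<^sup>2 / ?w" using w by (simp add: field_simps)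
          then show ?thesis using b(1) by (simp add: add_increasing2)
        qed
      qed
      moreover have "0 \<le> (cmod (F t))\<^sup>2 / ?w + indicator K t * (1 + b) ^ k" using w b(1) by (simp add: indicator_def)
      ultimately show "norm (indicator K t *\<^sub>R F t) \<le> norm ((cmod (F t))\<^sup>2 / ?w + indicator K t * (1 + b) ^ k)"
        by (cases "t \<in> K") auto
    qed
  qed measurable
qed

text \<open>Pairings with a test function are continuous in weighted \<open>L\<^sup>2\<close>, so the limit in weighted \<open>L\<^sup>2\<close> represents \<open>u0\<close>.\<close>

lemma limit_is_function:
  fixes F :: "nat \<Rightarrow> 'a::euclidean_space \<Rightarrow> complex"
  assumes Fm: "\<And>n. F n \<in> borel_measurable borel" and D: "0 \<le> D"
    and F: "\<And>n. weighted_L2 s (F n) \<le> ennreal (D\<^sup>2)"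
    and cauchy: "\<And>e. 0 < e \<Longrightarrow> \<exists>n0. \<forall>n\<ge>n0. \<forall>k\<ge>n0.
      weighted_L2 s (\<lambda>t. F n t - F k t) \<le> ennreal e"
    and u: "\<And>\<eta>. \<eta> \<in> schwartz \<Longrightarrow> (\<lambda>n. LINT t|lborel. F n t * \<eta> t) \<longlonglongrightarrow> u0 \<eta>"
  shows "\<exists>F0 r. is_function u0 F0 \<and> strict_mono (r :: nat \<Rightarrow> nat) \<and> (AE t in lborel. (\<lambda>n. F (r n) t) \<longlonglongrightarrow> F0 t)"
proof -
  obtain F0 r where F0 [measurable]: "F0 \<in> borel_measurable borel" and r: "strict_mono (r :: nat \<Rightarrow> nat)" "AE t in lborel. (\<lambda>n. F (r n) t) \<longlonglongrightarrow> F0 t"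
    and F0D: "weighted_L2 s F0 \<le> ennreal (D\<^sup>2)"
    and lim: "\<And>e. 0 < e \<Longrightarrow> \<exists>n0. \<forall>n\<ge>n0. weighted_L2 s (\<lambda>t. F n t - F0 t) \<le> ennreal e"
    using weighted_L2_complete[OF Fm D F cauchy] by blast
  have "is_function u0 F0"
    unfolding is_function_def
  proof (intro conjI F0 allI impI)
    show "set_integrable lborel K F0" if "compact K" for K
      by (rule weighted_L2_locally_integrable[OF F0 _ that]) (rule le_less_trans[OF F0D], simp)
    fix \<eta> :: "'a \<Rightarrow> complex" assume "smooth \<eta> \<and> compact (closure {x. \<eta> x \<noteq> 0})"
    then have \<eta>: "\<eta> \<in> schwartz" by (intro test_functions_schwartz) (simp add: test_functions_def)
    let ?A = "sqrt (LINT t|lborel. (cmod (\<eta> t))\<^sup>2 * (1 + norm t) ^ (2 * s))"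
    have A: "0 \<le> ?A" by (auto intro!: integral_nonneg_AE)
    have "(\<lambda>n. LINT t|lborel. F n t * \<eta> t) \<longlonglongrightarrow> (LINT t|lborel. F0 t * \<eta> t)"
    proof (rule LIMSEQ_I)
      fix e :: real assume e: "0 < e"
      have d: "0 < e / (?A + 1)" by (intro divide_pos_pos e) (use A in linarith)
      obtain n0 where n0: "\<And>n. n \<ge> n0 \<Longrightarrow> weighted_L2 s (\<lambda>t. F n t - F0 t) \<le> ennreal ((e / (?A + 1))\<^sup>2)"
        using lim[OF zero_less_power[OF d, of 2]] by blast
      have "cmod ((LINT t|lborel. F n t * \<eta> t) - (LINT t|lborel. F0 t * \<eta> t)) < e" if "n \<ge> n0" for n
      proof -
        have "(LINT t|lborel. F n t * \<eta> t) - (LINT t|lborel. F0 t * \<eta> t) = (LINT t|lborel. (F n t - F0 t) * \<eta> t)"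
          using weighted_pairing_integrable[OF Fm \<eta> D F] weighted_pairing_integrable[OF F0 \<eta> D F0D]
          by (simp add: left_diff_distrib)
        also have "cmod \<dots> \<le> e / (?A + 1) * ?A"
          using Fm d by (intro weighted_pairing_bound[OF _ \<eta> _ n0[OF that]]) auto
        also have "\<dots> < e / (?A + 1) * (?A + 1)" by (intro mult_strict_left_mono d) simp
        also have "\<dots> = e"
        proof -
          have "?A + 1 \<noteq> 0" using A by linarith
          then show ?thesis by simp
        qed
        finally show ?thesis .
      qed
      then show "\<exists>n0. \<forall>n\<ge>n0. cmod ((LINT t|lborel. F n t * \<eta> t) - (LINT t|lborel. F0 t * \<eta> t)) < e" by blast
    qed
    then show "u0 \<eta> = (LINT t|lborel. F0 t * \<eta> t)" using u[OF \<eta>] LIMSEQ_unique by blast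
  qed
  then show ?thesis using r by blast
qed

section \<open>The energy of a distribution\<close>

lemma is_function_test_integrable:
  assumes F: "is_function u F" and \<eta>: "\<eta> \<in> test_functions"
  shows "integrable lborel (\<lambda>t. F t * \<eta> t)"
proof -
  note [measurable] = is_function_borel[OF F] schwartz_borel[OF test_functions_schwartz[OF \<eta>]]
  obtain r where r: "\<forall>x. r < norm x \<longrightarrow> \<eta> x = 0" using test_functions_support[OF \<eta>] by blast
  let ?S = "schwartz_seminorm 0 \<eta>"
  have S: "cmod (\<eta> t) \<le> ?S" for t using schwartz_decay[OF test_functions_schwartz[OF \<eta>], of t 0] by simp
  have "integrable lborel (\<lambda>t. ?S * norm (indicator (cball 0 r) t *\<^sub>R F t))"
    using F by (intro integrable_mult_right integrable_norm) (simp add: is_function_def set_integrable_def)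
  then show ?thesis
  proof (rule Bochner_Integration.integrable_bound)
    show "AE t in lborel. norm (F t * \<eta> t) \<le> norm (?S * norm (indicator (cball 0 r) t *\<^sub>R F t))"
    proof (rule AE_I2)
      fix t
      show "norm (F t * \<eta> t) \<le> norm (?S * norm (indicator (cball 0 r) t *\<^sub>R F t))"
        using r window_mult_bound[OF test_functions_schwartz[OF \<eta>], of "F t" t] order_trans[OF norm_ge_zero S[of t]]
        by (cases "norm t \<le> r") (auto simp: norm_mult indicator_def abs_mult)
    qed
  qed measurable
qed

text \<open>The converse of Hoelder's inequality, with constant zero.\<close>

lemma is_function_unique:
  assumes F: "is_function u F" and F': "is_function u F'"
  shows "AE t in lborel. F t = F' t"
proof -
  note [measurable] = is_function_borel[OF F] is_function_borel[OF F']
  have "(\<integral>\<^sup>+t. ennreal ((cmod (F t - F' t))\<^sup>2 / (1 + norm t) ^ 0) \<partial>lborel) \<le> ennreal (0\<^sup>2)"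
  proof (rule converse_hoelder)
    show "set_integrable lborel K (\<lambda>t. F t - F' t)" if "compact K" for K
      using F F' that by (intro set_integral_diff) (auto simp: is_function_def)
    fix \<eta> :: "'a \<Rightarrow> complex" assume \<eta>: "\<eta> \<in> test_functions"
    have "(LINT t|lborel. (F t - F' t) * \<eta> t) = (LINT t|lborel. F t * \<eta> t) - (LINT t|lborel. F' t * \<eta> t)"
      using is_function_test_integrable[OF F \<eta>] is_function_test_integrable[OF F' \<eta>] by (simp add: left_diff_distrib)
    also have "\<dots> = u \<eta> - u \<eta>" using F F' \<eta> by (simp add: is_function_def test_functions_def)
    finally show "cmod (LINT t|lborel. (F t - F' t) * \<eta> t) \<le> 0 * sqrt (LINT t|lborel. (cmod (\<eta> t))\<^sup>2 * (1 + norm t) ^ 0)" by simp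
  qed auto
  then have "L2_square (\<lambda>t. F t - F' t) = 0" by simp
  then have "AE t in lborel. ennreal ((cmod (F t - F' t))\<^sup>2) = 0"
    by (subst (asm) nn_integral_0_iff_AE) auto
  then show ?thesis by eventually_elim simp
qed

lemma ennreal_sqrt_square: "(ennreal_sqrt a)\<^sup>2 = a"
  by (cases a) (auto simp: ennreal_sqrt_def ennreal_power)

lemma ennreal_sqrt_mono: "a \<le> b \<Longrightarrow> ennreal_sqrt a \<le> ennreal_sqrt b"
  by (rule ennreal_square_le_cancel) (simp add: ennreal_sqrt_square)

lemma L2_norm_square: "(L2_norm h)\<^sup>2 = L2_square h"
  by (simp add: L2_norm_def ennreal_sqrt_square)

text \<open>
  The representing function is unique almost everywhere, so the infimum ranges over a single
  value. If \<open>\<psi> = 0\<close>, then both sides vanish, for every \<open>F\<close>.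
\<close>

lemma L2_norm_product_square:
  assumes F: "(\<exists>x. \<psi> x \<noteq> 0) \<longrightarrow> is_function u F"
  shows "(L2_norm_product \<psi> u)\<^sup>2 = weighted_square (\<lambda>t. (cmod (\<psi> t))\<^sup>2) F"
proof (cases "\<psi> = (\<lambda>_. 0)")
  case True
  have "L2_norm_product \<psi> u \<le> L2_norm (\<lambda>_::'a. 0)"
    unfolding L2_norm_product_def by (rule INF_lower) (simp add: is_product_def True)
  also have "\<dots> = 0" by (simp add: L2_norm_def ennreal_sqrt_def)
  finally show ?thesis using True by simp
next
  case False
  then have Fu: "is_function u F" using F by auto
  have "L2_norm h = L2_norm (\<lambda>x. \<psi> x * F x)" if "is_product \<psi> u h" for h
  proof -
    obtain F' where F': "is_function u F'" "h = (\<lambda>x. \<psi> x * F' x)" using \<open>is_product \<psi> u h\<close> False by (auto simp: is_product_def)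
    have "L2_square h = L2_square (\<lambda>x. \<psi> x * F x)"
      by (rule nn_integral_cong_AE) (use is_function_unique[OF Fu F'(1)] in eventually_elim, simp add: F'(2))
    then show ?thesis by (simp add: L2_norm_def)
  qed
  note eq = this
  have p: "(\<lambda>x. \<psi> x * F x) \<in> {h. is_product \<psi> u h}" using Fu by (auto simp: is_product_def)
  have "L2_norm_product \<psi> u = L2_norm (\<lambda>x. \<psi> x * F x)"
  proof (rule antisym)
    show "L2_norm_product \<psi> u \<le> L2_norm (\<lambda>x. \<psi> x * F x)"
      unfolding L2_norm_product_def by (rule INF_lower[OF p])
    show "L2_norm (\<lambda>x. \<psi> x * F x) \<le> L2_norm_product \<psi> u"
      unfolding L2_norm_product_def
    proof (rule INF_greatest)
      fix h assume "h \<in> {h. is_product \<psi> u h}"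
      then have "L2_norm h = L2_norm (\<lambda>x. \<psi> x * F x)" by (intro eq) simp
      then show "L2_norm (\<lambda>x. \<psi> x * F x) \<le> L2_norm h" by (simp only: order_refl)
    qed
  qed
  then show ?thesis by (simp add: L2_norm_square norm_mult power_mult_distrib)
qed

lemma L2_norm_product_finite:
  assumes "L2_norm_product \<psi> u < \<top>" "\<psi> x \<noteq> 0"
  shows "\<exists>F. is_function u F"
proof (rule ccontr)
  assume "\<nexists>F. is_function u F"
  then have "{h. is_product \<psi> u h} = {}" using assms(2) by (auto simp: is_product_def)
  then show False using assms(1) by (simp add: L2_norm_product_def)
qed

lemma M2_norm_square: "(M2_norm g \<mu> f)\<^sup>2 = M2_integral g \<mu> f"
  by (simp add: M2_norm_def L2_norm_square M2_integral_def norm_mult power_mult_distrib)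

section \<open>Admissible weights\<close>

lemma moderate_weights_polynomial:
  assumes "m \<in> moderate_weights"
  shows "continuous_on UNIV m" "\<And>z. 0 < m z" "\<exists>C>0. \<exists>k. \<forall>x y. m (x + y) \<le> C * m x * (1 + norm y) ^ k"
proof -
  show "continuous_on UNIV m" and pos: "\<And>z. 0 < m z" using assms by (auto simp: moderate_weights_def weight_def)
  obtain s C where s: "0 \<le> s" and C: "0 < C" "\<And>x y. m (x + y) \<le> C * m x * poly_weight s y"
    using assms by (auto simp: moderate_weights_def moderate_def)
  have "poly_weight s y \<le> (1 + norm y) ^ nat \<lceil>s\<rceil>" for y :: 'a
  proof -
    have "poly_weight s y \<le> ((1 + norm y)\<^sup>2) powr (s / 2)"
      unfolding poly_weight_def using s norm_ge_zero[of y] by (intro powr_mono2) (auto simp: power2_sum)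
    also have "\<dots> = (1 + norm y) powr s"
      by (simp add: powr_powr add_pos_nonneg flip: powr_numeral)
    also have "\<dots> \<le> (1 + norm y) powr real (nat \<lceil>s\<rceil>)" by (intro powr_mono) (use s in linarith, simp)
    also have "\<dots> = (1 + norm y) ^ nat \<lceil>s\<rceil>" by (rule powr_realpow) (simp add: add_pos_nonneg)
    finally show ?thesis .
  qed
  then have "m (x + y) \<le> C * m x * (1 + norm y) ^ nat \<lceil>s\<rceil>" for x y
    using C(1) pos[of x] by (intro order_trans[OF C(2)] mult_left_mono) auto
  then show "\<exists>C>0. \<exists>k. \<forall>x y. m (x + y) \<le> C * m x * (1 + norm y) ^ k" using C(1) by blast
qed

lemma norm_Pair_product: "1 + norm (a, b) \<le> (1 + norm a) * (1 + norm b)"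
proof -
  have "norm (a, b) \<le> norm a + norm b" by (rule norm_Pair_le)
  moreover have "0 \<le> norm a * norm b" by simp
  moreover have "(1 + norm a) * (1 + norm b) = 1 + norm a + norm b + norm a * norm b" by (simp add: ring_distribs)
  ultimately show ?thesis by linarith
qed

lemma moderate_lower_bound:
  fixes m :: "'a::euclidean_space \<times> 'a \<Rightarrow> real"
  assumes "m \<in> moderate_weights"
  shows "\<exists>c>0. \<exists>s. \<forall>z. c \<le> m z * ((1 + norm (fst z)) ^ s * (1 + norm (snd z)) ^ s)"
proof -
  note m = moderate_weights_polynomial[OF assms]
  obtain C k where C: "0 < C" "\<And>x y. m (x + y) \<le> C * m x * (1 + norm y) ^ k" using m(3) by blast
  have "m 0 / C \<le> m z * ((1 + norm (fst z)) ^ k * (1 + norm (snd z)) ^ k)" for z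
  proof -
    have "m 0 \<le> C * m z * (1 + norm (- z)) ^ k" using C(2)[of z "- z"] by simp
    also have "\<dots> \<le> C * m z * ((1 + norm (fst z)) * (1 + norm (snd z))) ^ k"
      using C(1) m(2)[of z] norm_Pair_product[of "fst z" "snd z"] by (intro mult_left_mono power_mono) auto
    also have "\<dots> = C * (m z * ((1 + norm (fst z)) ^ k * (1 + norm (snd z)) ^ k))"
      by (simp only: power_mult_distrib mult.assoc)
    finally show ?thesis using C(1) by (simp add: pos_divide_le_eq mult.commute)
  qed
  moreover have "0 < m 0 / C" using C(1) m(2)[of 0] by simp
  ultimately show ?thesis by blast
qed

lemma assoc_weight_square:
  "(assoc_weight m0 \<psi> \<phi> (x, \<omega>))\<^sup>2 = (m0 (x, \<omega>))\<^sup>2 + (cmod (\<psi> x))\<^sup>2 + (cmod (\<phi> \<omega>))\<^sup>2"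
  by (simp add: assoc_weight_def)

text \<open>
  An essential bound of a continuous function on an open set holds pointwise, as nonempty open
  sets have positive measure.
\<close>

lemma Linf0_small:
  fixes h :: "'a::euclidean_space \<Rightarrow> real"
  assumes h: "h \<in> Linf0" and cont: "continuous_on UNIV h" and e: "0 < e"
  shows "\<exists>r>0. \<forall>z. r \<le> norm z \<longrightarrow> \<bar>h z\<bar> \<le> e"
proof -
  have "((\<lambda>R::real. esssup (restrict_space lborel {z. R \<le> norm z}) (\<lambda>z. ereal \<bar>h z\<bar>)) \<longlongrightarrow> 0) at_top"
    using h by (simp add: Linf0_def)
  then have "\<forall>\<^sub>F R in at_top. esssup (restrict_space lborel {z. R \<le> norm z}) (\<lambda>z. ereal \<bar>h z\<bar>) < ereal e"
    by (rule order_tendstoD) (use e in simp)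
  then obtain R where R: "esssup (restrict_space lborel {z. R \<le> norm z}) (\<lambda>z. ereal \<bar>h z\<bar>) < ereal e"
    by (auto simp: eventually_at_top_linorder)
  have [measurable]: "h \<in> borel_measurable borel" using h by (simp add: Linf0_def Linf_def)
  have "AE z in restrict_space lborel {z. R \<le> norm z}. ereal \<bar>h z\<bar> \<le> esssup (restrict_space lborel {z. R \<le> norm z}) (\<lambda>z. ereal \<bar>h z\<bar>)"
    by (rule esssup_AE)
  then have "AE z in lborel. R \<le> norm z \<longrightarrow> ereal \<bar>h z\<bar> \<le> esssup (restrict_space lborel {z. R \<le> norm z}) (\<lambda>z. ereal \<bar>h z\<bar>)"
    by (subst (asm) AE_restrict_space_iff) auto
  then have "AE z in lborel. z \<notin> {z. R < norm z \<and> e < \<bar>h z\<bar>}"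
  proof eventually_elim
    case (elim z)
    then show ?case using le_less_trans[OF _ R] by fastforce
  qed
  moreover have "open {z. R < norm z \<and> e < \<bar>h z\<bar>}"
    by (intro open_Collect_conj open_Collect_less continuous_intros cont)
  ultimately have "{z. R < norm z \<and> e < \<bar>h z\<bar>} = {}" by (intro AE_open_empty)
  then have "\<bar>h z\<bar> \<le> e" if "max (R + 1) 1 \<le> norm z" for z using that by (force simp: not_less)
  then show ?thesis by (intro exI[of _ "max (R + 1) 1"]) auto
qed

lemma weights_admissible:
  assumes m0: "m0 \<in> moderate_weights" and adm: "admissible_weights m0 \<psi> \<phi>" and g: "g \<in> schwartz" "g \<noteq> (\<lambda>_. 0)"
  shows "\<exists>C k. weights m0 (\<lambda>x. cmod (\<psi> x)) (\<lambda>x. cmod (\<phi> x)) C k g (fourier g)"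
proof -
  let ?m = "assoc_weight m0 \<psi> \<phi>"
  have am: "?m \<in> moderate_weights" and L: "(\<lambda>z. m0 z / ?m z) \<in> Linf0" and cont: "continuous_on UNIV \<psi>" "continuous_on UNIV \<phi>"
    using adm by (auto simp: admissible_weights_def)
  note a = moderate_weights_polynomial[OF am] and b = moderate_weights_polynomial[OF m0]
  obtain C k where C: "0 < C" "\<And>x y. ?m (x + y) \<le> C * ?m x * (1 + norm y) ^ k" using a(3) by blast
  have "weights m0 (\<lambda>x. cmod (\<psi> x)) (\<lambda>x. cmod (\<phi> x)) (C\<^sup>2) (2 * k) g (fourier g)"
  proof
    show "continuous_on UNIV m0" "\<And>z. 0 < m0 z" by (rule b)+
    fix x \<omega> y \<eta> :: 'a
    have "?m (x, \<omega>) \<le> C * ?m (y, \<eta>) * (1 + norm (x - y, \<omega> - \<eta>)) ^ k"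
      using C(2)[of "(y, \<eta>)" "(x - y, \<omega> - \<eta>)"] by simp
    also have "\<dots> \<le> C * ?m (y, \<eta>) * ((1 + norm (x - y)) * (1 + norm (\<omega> - \<eta>))) ^ k"
      using C(1) a(2)[of "(y, \<eta>)"] by (intro mult_left_mono power_mono norm_Pair_product) auto
    finally have "(?m (x, \<omega>))\<^sup>2 \<le> (C * ?m (y, \<eta>) * ((1 + norm (x - y)) * (1 + norm (\<omega> - \<eta>))) ^ k)\<^sup>2"
      using a(2)[of "(x, \<omega>)"] by (intro power_mono) auto
    also have "\<dots> = C\<^sup>2 * (?m (y, \<eta>))\<^sup>2 * ((1 + norm (x - y)) ^ (2 * k) * (1 + norm (\<omega> - \<eta>)) ^ (2 * k))"
      by (simp only: power_mult_distrib power_mult[symmetric] mult.commute[of k 2])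
    finally show "(m0 (x, \<omega>))\<^sup>2 + (cmod (\<psi> x))\<^sup>2 + (cmod (\<phi> \<omega>))\<^sup>2 \<le>
      C\<^sup>2 * ((m0 (y, \<eta>))\<^sup>2 + (cmod (\<psi> y))\<^sup>2 + (cmod (\<phi> \<eta>))\<^sup>2) * ((1 + norm (x - y)) ^ (2 * k) * (1 + norm (\<omega> - \<eta>)) ^ (2 * k))"
      unfolding assoc_weight_square .
  next
    fix e :: real assume e: "0 < e"
    have "continuous_on UNIV (\<lambda>z. m0 z / ?m z)"
      using a(2) by (intro continuous_intros a(1) b(1)) (metis less_irrefl)
    from Linf0_small[OF L this, of "sqrt e"] e
    obtain r where r: "r > 0" "\<And>z. r \<le> norm z \<Longrightarrow> \<bar>m0 z / ?m z\<bar> \<le> sqrt e" by auto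
    have "(m0 (x, \<omega>))\<^sup>2 \<le> e * ((m0 (x, \<omega>))\<^sup>2 + (cmod (\<psi> x))\<^sup>2 + (cmod (\<phi> \<omega>))\<^sup>2)" if "r \<le> norm (x, \<omega>)" for x \<omega>
    proof -
      have "m0 (x, \<omega>) / ?m (x, \<omega>) \<le> sqrt e" using r(2)[OF that] by linarith
      then have "m0 (x, \<omega>) \<le> sqrt e * ?m (x, \<omega>)" using a(2)[of "(x, \<omega>)"] by (simp add: divide_le_eq)
      then have "(m0 (x, \<omega>))\<^sup>2 \<le> (sqrt e * ?m (x, \<omega>))\<^sup>2" using b(2)[of "(x, \<omega>)"] by (intro power_mono) auto
      then show ?thesis using e by (simp add: power_mult_distrib assoc_weight_square)
    qed
    then show "\<exists>r>0. \<forall>x \<omega>. r \<le> norm (x, \<omega>) \<longrightarrow> (m0 (x, \<omega>))\<^sup>2 \<le> e * ((m0 (x, \<omega>))\<^sup>2 + (cmod (\<psi> x))\<^sup>2 + (cmod (\<phi> \<omega>))\<^sup>2)"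
      using r(1) by blast
  qed (use C(1) g cont in \<open>auto intro!: continuous_intros schwartz_fourier dest: schwartz_fourier_nonzero\<close>)
  then show ?thesis by blast
qed

text \<open>
  Moderateness between \<open>x\<close> and the point \<open>x0\<close> where \<open>\<psi>\<close> does not vanish. The bound is uniform in
  frequency, so elements of \<open>M\<^sup>2\<^sub>m\<close> that are functions lie in a weighted \<open>L\<^sup>2\<close> space.
\<close>

lemma (in weights) position_lower_bound:
  assumes "\<psi> x0 \<noteq> 0"
  shows "\<exists>c>0. \<forall>x \<omega>. c \<le> sqrt (M (x, \<omega>)) * (1 + norm x) ^ k"
proof -
  define c where "c = (\<psi> x0)\<^sup>2 / (C * (1 + norm x0) ^ k)"
  have p: "0 < (1 + norm x) ^ k" "1 \<le> (1 + norm x) ^ k" for x :: 'a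
    by (intro zero_less_power add_pos_nonneg) (auto intro: one_le_power)
  have c: "0 < c" unfolding c_def using assms C_pos p(1)[of x0] by (intro divide_pos_pos mult_pos_pos) auto
  have "sqrt c \<le> sqrt (M (x, \<omega>)) * (1 + norm x) ^ k" for x \<omega>
  proof -
    have "(\<psi> x0)\<^sup>2 \<le> C * M (x, \<omega>) * (1 + norm (x0 - x)) ^ k"
      using order_trans[OF \<psi>_le_M M_moderate[of x0 \<omega> x \<omega>]] by simp
    also have "\<dots> \<le> C * M (x, \<omega>) * ((1 + norm x0) * (1 + norm x)) ^ k"
    proof (intro mult_left_mono power_mono)
      have "(1 + norm x0) * (1 + norm x) = 1 + norm x0 + norm x + norm x0 * norm x" by (simp add: ring_distribs)
      moreover have "0 \<le> norm x0 * norm x" by simp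
      ultimately show "1 + norm (x0 - x) \<le> (1 + norm x0) * (1 + norm x)"
        using norm_triangle_ineq4[of x0 x] by linarith
    qed (use C_pos M_pos[of "(x, \<omega>)"] in auto)
    also have "\<dots> = (C * (1 + norm x0) ^ k) * (M (x, \<omega>) * (1 + norm x) ^ k)" by (simp only: power_mult_distrib mult_ac)
    finally have "c \<le> M (x, \<omega>) * (1 + norm x) ^ k"
      using C_pos p(1)[of x0] by (simp add: c_def pos_divide_le_eq mult.commute)
    also have "\<dots> \<le> M (x, \<omega>) * ((1 + norm x) ^ k)\<^sup>2"
      using M_pos[of "(x, \<omega>)"] mult_left_mono[OF p(2)[of x], of "(1 + norm x) ^ k"] p(1)[of x]
      by (intro mult_left_mono) (simp_all add: power2_eq_square less_imp_le)
    finally have "(sqrt c)\<^sup>2 \<le> (sqrt (M (x, \<omega>)) * (1 + norm x) ^ k)\<^sup>2"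
      using c M_pos[of "(x, \<omega>)"] by (simp add: power_mult_distrib less_imp_le)
    then show ?thesis by (rule power2_le_imp_le) (use M_pos[of "(x, \<omega>)"] p(1)[of x] in \<open>simp add: less_imp_le\<close>)
  qed
  then show ?thesis using c by (intro exI[of _ "sqrt c"]) auto
qed

text \<open>A sequence has the Cauchy property iff the squared norms of its differences form such a double sequence.\<close>

definition vanishing :: "(nat \<Rightarrow> nat \<Rightarrow> ennreal) \<Rightarrow> bool" where
  "vanishing A \<longleftrightarrow> (\<forall>e>0. \<exists>n0. \<forall>n\<ge>n0. \<forall>k\<ge>n0. A n k \<le> ennreal e)"

lemma vanishingD: "vanishing A \<Longrightarrow> 0 < e \<Longrightarrow> \<exists>n0. \<forall>n\<ge>n0. \<forall>k\<ge>n0. A n k \<le> ennreal e"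
  by (simp add: vanishing_def)

lemma vanishing_mono: "vanishing B \<Longrightarrow> (\<And>n k. A n k \<le> B n k) \<Longrightarrow> vanishing A"
  unfolding vanishing_def by (meson order_trans)

lemma vanishing_add:
  assumes "vanishing A" "vanishing B" shows "vanishing (\<lambda>n k. A n k + B n k)"
  unfolding vanishing_def
proof (intro allI impI)
  fix e :: real assume "0 < e"
  then have e: "0 < e / 2" by simp
  obtain a where a: "\<And>n k. n \<ge> a \<Longrightarrow> k \<ge> a \<Longrightarrow> A n k \<le> ennreal (e / 2)" using vanishingD[OF assms(1) e] by blast
  obtain b where b: "\<And>n k. n \<ge> b \<Longrightarrow> k \<ge> b \<Longrightarrow> B n k \<le> ennreal (e / 2)" using vanishingD[OF assms(2) e] by blast
  have "A n k + B n k \<le> ennreal e" if "n \<ge> max a b" "k \<ge> max a b" for n k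
  proof -
    have "A n k + B n k \<le> ennreal (e / 2) + ennreal (e / 2)" using that by (intro add_mono a b) auto
    also have "\<dots> = ennreal (e / 2 + e / 2)" using e by (intro ennreal_plus[symmetric]) auto
    finally show ?thesis by simp
  qed
  then show "\<exists>n0. \<forall>n\<ge>n0. \<forall>k\<ge>n0. A n k + B n k \<le> ennreal e" by blast
qed

lemma vanishing_cmult:
  assumes "vanishing A" "c < \<top>" shows "vanishing (\<lambda>n k. c * A n k)"
  unfolding vanishing_def
proof (intro allI impI)
  fix e :: real assume e: "0 < e"
  obtain r where r: "0 \<le> r" "c = ennreal r" using assms(2) by (cases c) auto
  have d: "0 < e / (r + 1)" using e r by simp
  obtain a where a: "\<And>n k. n \<ge> a \<Longrightarrow> k \<ge> a \<Longrightarrow> A n k \<le> ennreal (e / (r + 1))" using vanishingD[OF assms(1) d] by blast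
  have "c * A n k \<le> ennreal e" if "n \<ge> a" "k \<ge> a" for n k
  proof -
    have "c * A n k \<le> ennreal r * ennreal (e / (r + 1))" unfolding r(2) using that by (intro mult_left_mono a) auto
    also have "\<dots> = ennreal (r * (e / (r + 1)))" using r d by (intro ennreal_mult[symmetric]) auto
    also have "\<dots> \<le> ennreal e" using r e by (intro ennreal_leI) (simp add: field_simps)
    finally show ?thesis .
  qed
  then show "\<exists>n0. \<forall>n\<ge>n0. \<forall>k\<ge>n0. c * A n k \<le> ennreal e" by blast
qed

lemma vanishing_swap: "vanishing A \<Longrightarrow> vanishing (\<lambda>n k. A k n)"
  unfolding vanishing_def by meson

lemma vanishing_subseq:
  assumes A: "vanishing A" and r: "strict_mono (r :: nat \<Rightarrow> nat)"
  shows "vanishing (\<lambda>n k. A (r n) (r k))"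
  unfolding vanishing_def
proof (intro allI impI)
  fix e :: real assume "0 < e"
  then obtain n0 where n0: "\<forall>n\<ge>n0. \<forall>k\<ge>n0. A n k \<le> ennreal e" using vanishingD[OF A] by blast
  have "n0 \<le> r n" if "n0 \<le> n" for n using that seq_suble[OF r, of n] by linarith
  then show "\<exists>n0. \<forall>n\<ge>n0. \<forall>k\<ge>n0. A (r n) (r k) \<le> ennreal e" using n0 by blast
qed

lemma vanishing_harmonic: "vanishing (\<lambda>n k. ennreal (1 / real (Suc n)))"
  unfolding vanishing_def
proof (intro allI impI)
  fix e :: real assume "0 < e"
  then obtain m where m: "1 / real (Suc m) < e" using reals_Archimedean by (auto simp: inverse_eq_divide)
  have "ennreal (1 / real (Suc n)) \<le> ennreal e" if "n \<ge> m" for n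
  proof (rule ennreal_leI)
    have "1 / real (Suc n) \<le> 1 / real (Suc m)" using that by (intro divide_left_mono) auto
    then show "1 / real (Suc n) \<le> e" using m by linarith
  qed
  then show "\<exists>n0. \<forall>n\<ge>n0. \<forall>k\<ge>n0. ennreal (1 / real (Suc n)) \<le> ennreal e" by blast
qed

section \<open>Linear combinations of distributions\<close>

definition combination :: "complex \<Rightarrow> complex \<Rightarrow> (('a::euclidean_space \<Rightarrow> complex) \<Rightarrow> complex) \<Rightarrow> (('a \<Rightarrow> complex) \<Rightarrow> complex) \<Rightarrow> ('a \<Rightarrow> complex) \<Rightarrow> complex" where
  "combination a b u v = restrict (\<lambda>\<eta>. a * u \<eta> + b * v \<eta>) schwartz"

lemma combination_apply: "\<eta> \<in> schwartz \<Longrightarrow> combination a b u v \<eta> = a * u \<eta> + b * v \<eta>"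
  by (simp add: combination_def)

lemma combination_tempered:
  assumes u: "u \<in> tempered" and v: "v \<in> tempered"
  shows "combination a b u v \<in> tempered"
proof -
  obtain C1 N1 where C1: "0 \<le> C1" "\<And>\<eta>. \<eta> \<in> schwartz \<Longrightarrow> cmod (u \<eta>) \<le> C1 * schwartz_seminorm N1 \<eta>"
    using tempered_bound[OF u] by blast
  obtain C2 N2 where C2: "0 \<le> C2" "\<And>\<eta>. \<eta> \<in> schwartz \<Longrightarrow> cmod (v \<eta>) \<le> C2 * schwartz_seminorm N2 \<eta>"
    using tempered_bound[OF v] by blast
  have "cmod (combination a b u v \<eta>) \<le> (cmod a * C1 + cmod b * C2) * schwartz_seminorm (max N1 N2) \<eta>" if \<eta>: "\<eta> \<in> schwartz" for \<eta>
  proof -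
    let ?P = "schwartz_seminorm (max N1 N2) \<eta>"
    have "cmod (combination a b u v \<eta>) \<le> cmod a * cmod (u \<eta>) + cmod b * cmod (v \<eta>)"
      unfolding combination_apply[OF \<eta>] norm_mult[symmetric] by (rule norm_triangle_ineq)
    also have "\<dots> \<le> cmod a * (C1 * ?P) + cmod b * (C2 * ?P)"
      by (intro add_mono mult_left_mono order_trans[OF C1(2)[OF \<eta>]] order_trans[OF C2(2)[OF \<eta>]] C1(1) C2(1) seminorm_mono \<eta>) auto
    finally show ?thesis by (simp add: algebra_simps)
  qed
  moreover have "combination a b u v (\<lambda>x. \<eta> x + \<theta> x) = combination a b u v \<eta> + combination a b u v \<theta>"
    if "\<eta> \<in> schwartz" "\<theta> \<in> schwartz" for \<eta> \<theta>
    using that by (simp add: combination_apply schwartz_add tempered_add[OF u] tempered_add[OF v] algebra_simps)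
  moreover have "combination a b u v (\<lambda>x. c * \<eta> x) = c * combination a b u v \<eta>" if "\<eta> \<in> schwartz" for c \<eta>
    using that by (simp add: combination_apply schwartz_cmult tempered_cmult[OF u] tempered_cmult[OF v] algebra_simps)
  moreover have "combination a b u v \<in> extensional schwartz" by (simp add: combination_def)
  ultimately show ?thesis unfolding tempered_def by blast
qed

lemma fourier_dist_combination: "fourier_dist (combination a b u v) = combination a b (fourier_dist u) (fourier_dist v)"
  by (auto simp: fun_eq_iff fourier_dist_def combination_def schwartz_fourier)

lemma stft_combination: "g \<in> schwartz \<Longrightarrow> stft g (combination a b u v) z = a * stft g u z + b * stft g v z"
  by (simp add: stft_eq combination_apply schwartz_atom)

lemma is_function_combination:
  assumes F: "is_function u F" and G: "is_function v G"
  shows "is_function (combination a b u v) (\<lambda>t. a * F t + b * G t)"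
proof -
  note [measurable] = is_function_borel[OF F] is_function_borel[OF G]
  have "set_integrable lborel K (\<lambda>t. a * F t + b * G t)" if "compact K" for K
    using F G that by (intro set_integral_add set_integrable_mult_right) (auto simp: is_function_def)
  moreover have "combination a b u v \<eta> = (LINT t|lborel. (a * F t + b * G t) * \<eta> t)"
    if \<eta>: "smooth \<eta> \<and> compact (closure {x. \<eta> x \<noteq> 0})" for \<eta>
  proof -
    have t: "\<eta> \<in> test_functions" using \<eta> by (simp add: test_functions_def)
    have "(LINT t|lborel. (a * F t + b * G t) * \<eta> t) = (LINT t|lborel. a * (F t * \<eta> t) + b * (G t * \<eta> t))"
      by (simp add: algebra_simps)
    also have "\<dots> = a * (LINT t|lborel. F t * \<eta> t) + b * (LINT t|lborel. G t * \<eta> t)"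
      using is_function_test_integrable[OF F t] is_function_test_integrable[OF G t] by simp
    also have "\<dots> = a * u \<eta> + b * v \<eta>" using F G \<eta> by (simp add: is_function_def)
    finally show ?thesis using test_functions_schwartz[OF t] by (simp add: combination_apply)
  qed
  ultimately show ?thesis unfolding is_function_def by auto
qed

lemma parallelogram_complex: "(cmod (a + b))\<^sup>2 + (cmod (a - b))\<^sup>2 = 2 * (cmod a)\<^sup>2 + 2 * (cmod b)\<^sup>2"
  unfolding cmod_power2 by (simp add: power2_eq_square algebra_simps)

lemma cmod_add_square_le: "(cmod (a + b))\<^sup>2 \<le> 2 * (cmod a)\<^sup>2 + 2 * (cmod b)\<^sup>2"
  using parallelogram_complex[of a b] zero_le_power2[of "cmod (a - b)"] by linarith

lemma cmod_square_perturbation: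
  assumes "0 < \<epsilon>" shows "(cmod a)\<^sup>2 \<le> (1 + \<epsilon>) * (cmod b)\<^sup>2 + (1 + 1 / \<epsilon>) * (cmod (a - b))\<^sup>2"
proof -
  have "(cmod a)\<^sup>2 \<le> (cmod b + cmod (a - b))\<^sup>2"
    using norm_triangle_sub[of a b] by (intro power_mono) auto
  also have "\<dots> = (cmod b)\<^sup>2 + (cmod (a - b))\<^sup>2 + 2 * (cmod b * cmod (a - b))" by (simp add: power2_sum)
  also have "2 * (cmod b * cmod (a - b)) \<le> \<epsilon> * (cmod b)\<^sup>2 + 1 / \<epsilon> * (cmod (a - b))\<^sup>2"
  proof -
    have "0 \<le> (\<epsilon> * cmod b - cmod (a - b))\<^sup>2 / \<epsilon>" using assms by simp
    also have "\<dots> = \<epsilon> * (cmod b)\<^sup>2 + 1 / \<epsilon> * (cmod (a - b))\<^sup>2 - 2 * (cmod b * cmod (a - b))"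
      using assms by (simp add: power2_eq_square field_simps)
    finally show ?thesis by simp
  qed
  finally show ?thesis by (simp add: algebra_simps)
qed

section \<open>The variational problem\<close>

text \<open>
  The window on the frequency side is the Fourier transform of \<open>g\<close>, as the short-time Fourier
  transform of \<open>f\<close> is, up to a phase and a rotation, that of its Fourier transform.
\<close>

locale admissible_pair = weights m0 "\<lambda>x. cmod (\<psi> x)" "\<lambda>x. cmod (\<phi> x)" C k g "fourier g"
  for m0 :: "'a::euclidean_space \<times> 'a \<Rightarrow> real" and \<psi> \<phi> :: "'a \<Rightarrow> complex" and C :: real and k :: nat and g :: "'a \<Rightarrow> complex" +
  assumes m0_moderate: "m0 \<in> moderate_weights"
    and \<psi>_continuous: "continuous_on UNIV \<psi>" and \<phi>_continuous: "continuous_on UNIV \<phi>"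
begin

interpretation swapped: weights "\<lambda>z. m0 (snd z, fst z)" "\<lambda>x. cmod (\<phi> x)" "\<lambda>x. cmod (\<psi> x)" C k "fourier g" g
  by (rule swapped)

abbreviation m :: "'a \<times> 'a \<Rightarrow> real" where "m \<equiv> assoc_weight m0 \<psi> \<phi>"

lemma m_eq: "m z = sqrt (M z)"
  by (cases z) (simp add: assoc_weight_def M_def)

lemma m_square: "(m z)\<^sup>2 = M z"
  using M_pos[of z] by (simp add: m_eq less_imp_le)

lemma weights_measurable [measurable]:
  "\<psi> \<in> borel_measurable borel" "\<phi> \<in> borel_measurable borel" "m \<in> borel_measurable borel"
proof -
  show "\<psi> \<in> borel_measurable borel" "\<phi> \<in> borel_measurable borel"
    using \<psi>_continuous \<phi>_continuous by (auto intro: borel_measurable_continuous_onI)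
  show "m \<in> borel_measurable borel" unfolding m_eq[abs_def] by measurable
qed

lemma M2_integral_m: "M2_integral g m u = weighted_square M (stft g u)"
  by (simp add: M2_integral_def power_mult_distrib m_square)

lemma M2_integral_m0: "M2_integral g m0 u = weighted_square (\<lambda>z. (m0 z)\<^sup>2) (stft g u)"
  by (simp add: M2_integral_def power_mult_distrib)

lemma M2_integral_m0_le: "M2_integral g m0 u \<le> M2_integral g m u"
  unfolding M2_integral_m M2_integral_m0
  by (intro nn_integral_mono ennreal_leI mult_right_mono) (simp_all add: M_def)

text \<open>Otherwise \<open>m = m\<^sub>0\<close>, and \<open>m\<^sub>0 / m\<close> does not tend to zero.\<close>

lemma nontrivial: "(\<exists>x. \<psi> x \<noteq> 0) \<or> (\<exists>x. \<phi> x \<noteq> 0)"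
proof (rule ccontr)
  assume "\<not> ?thesis"
  then have 0: "\<psi> x = 0" "\<phi> x = 0" for x by auto
  obtain r where r: "r > 0" "\<And>x \<omega>. r \<le> norm (x, \<omega>) \<Longrightarrow> (m0 (x, \<omega>))\<^sup>2 \<le> 1 / 2 * (m0 (x, \<omega>))\<^sup>2"
    using tail[of "1 / 2"] by (auto simp: 0)
  obtain b :: 'a where b: "b \<in> Basis" using nonempty_Basis by blast
  have "(m0 (r *\<^sub>R b, 0))\<^sup>2 \<le> 1 / 2 * (m0 (r *\<^sub>R b, 0))\<^sup>2" using r(1) b by (intro r(2)) simp
  moreover have "0 < (m0 (r *\<^sub>R b, 0))\<^sup>2" using m0_pos[of "(r *\<^sub>R b, 0)"] by simp
  ultimately show False by linarith
qed

text \<open>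
  An element \<open>u\<close> of \<open>M\<^sup>2\<^sub>m\<close> with functions \<open>F\<close> and \<open>G\<close> that represent it and its Fourier
  transform. If a weight vanishes identically, then there need not be such a function, and an
  arbitrary one is allowed, which the energy does not see.
\<close>

definition state :: "(('a \<Rightarrow> complex) \<Rightarrow> complex) \<Rightarrow> ('a \<Rightarrow> complex) \<Rightarrow> ('a \<Rightarrow> complex) \<Rightarrow> bool" where
  "state u F G \<longleftrightarrow> u \<in> tempered \<and> M2_integral g m u < \<top> \<and> F \<in> borel_measurable borel \<and> G \<in> borel_measurable borel \<and>
    ((\<exists>x. \<psi> x \<noteq> 0) \<longrightarrow> is_function u F) \<and> ((\<exists>x. \<phi> x \<noteq> 0) \<longrightarrow> is_function (fourier_dist u) G)"

text \<open>
  The energy in terms of representing functions, as one integral, so that Fatou's lemma applies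
  to the sum.
\<close>

definition Q :: "('a \<Rightarrow> complex) \<Rightarrow> ('a \<Rightarrow> complex) \<Rightarrow> ennreal" where
  "Q F G = (\<integral>\<^sup>+t. ennreal ((cmod (\<psi> t))\<^sup>2 * (cmod (F t))\<^sup>2 + (cmod (\<phi> t))\<^sup>2 * (cmod (G t))\<^sup>2) \<partial>lborel)"

lemma state_measurable:
  assumes "state u F G"
  shows "F \<in> borel_measurable borel" "G \<in> borel_measurable borel" "stft g u \<in> borel_measurable borel"
  using assms nontrivial stft_measurable[of u F g] stft_measurable_fourier[of u G g] g(1) by (auto simp: state_def)

lemma state_tempered: "state u F G \<Longrightarrow> u \<in> tempered"
  by (simp add: state_def)

lemma Q_eq:
  assumes [measurable]: "F \<in> borel_measurable borel" "G \<in> borel_measurable borel"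
  shows "Q F G = weighted_square (\<lambda>t. (cmod (\<psi> t))\<^sup>2) F + weighted_square (\<lambda>t. (cmod (\<phi> t))\<^sup>2) G"
  unfolding Q_def by (simp add: ennreal_plus nn_integral_add)

lemma state_energy: "state u F G \<Longrightarrow> energy \<psi> \<phi> u = Q F G"
proof -
  assume s: "state u F G"
  have "(L2_norm_product \<psi> u)\<^sup>2 = weighted_square (\<lambda>t. (cmod (\<psi> t))\<^sup>2) F"
    by (rule L2_norm_product_square) (use s in \<open>unfold state_def, blast\<close>)
  moreover have "(L2_norm_product \<phi> (fourier_dist u))\<^sup>2 = weighted_square (\<lambda>t. (cmod (\<phi> t))\<^sup>2) G"
    by (rule L2_norm_product_square) (use s in \<open>unfold state_def, blast\<close>)
  ultimately show ?thesis unfolding energy_def by (simp only: Q_eq[OF state_measurable(1,2)[OF s]])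
qed

text \<open>
  A product with no function to represent the distribution has infinite norm, unless the weight
  vanishes.
\<close>

lemma finite_energy_state:
  assumes u: "u \<in> M2 g m" and e: "energy \<psi> \<phi> u < \<top>"
  shows "\<exists>F G. state u F G"
proof -
  have t: "u \<in> tempered" and n: "M2_norm g m u < \<top>" using u by (auto simp: M2_def)
  have fin: "M2_integral g m u < \<top>"
    using n unfolding M2_norm_square[symmetric] by (simp add: power2_eq_square ennreal_mult_less_top)
  have "(L2_norm_product \<psi> u)\<^sup>2 < \<top>" "(L2_norm_product \<phi> (fourier_dist u))\<^sup>2 < \<top>"
    using e by (auto simp: energy_def)
  then have p: "L2_norm_product \<psi> u < \<top>" "L2_norm_product \<phi> (fourier_dist u) < \<top>"
    by (auto simp: power2_eq_square less_top[symmetric] ennreal_mult_eq_top_iff)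
  have "\<exists>F. F \<in> borel_measurable borel \<and> ((\<exists>x. \<psi> x \<noteq> 0) \<longrightarrow> is_function u F)"
    using L2_norm_product_finite[OF p(1)] is_function_borel by (metis borel_measurable_const)
  moreover have "\<exists>G. G \<in> borel_measurable borel \<and> ((\<exists>x. \<phi> x \<noteq> 0) \<longrightarrow> is_function (fourier_dist u) G)"
    using L2_norm_product_finite[OF p(2)] is_function_borel by (metis borel_measurable_const)
  ultimately show ?thesis using t fin unfolding state_def by blast
qed

lemma state_function_bound:
  assumes "\<psi> x0 \<noteq> 0"
  shows "\<exists>D\<ge>0. \<forall>u F G B. state u F G \<longrightarrow> 0 \<le> B \<longrightarrow> M2_integral g m u \<le> ennreal (B\<^sup>2) \<longrightarrow>
    weighted_L2 k F \<le> ennreal ((D * B)\<^sup>2)"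
proof -
  have "cmod (\<psi> x0) \<noteq> 0" using assms by simp
  from position_lower_bound[OF this]
  obtain c where "0 < c" "\<And>x \<omega>. c \<le> m (x, \<omega>) * (1 + norm x) ^ k" by (auto simp: m_eq)
  from function_weighted_L2[OF g weights_measurable(3) this]
  show ?thesis using assms unfolding state_def by blast
qed

lemma state_fourier_bound:
  assumes "\<phi> x0 \<noteq> 0"
  shows "\<exists>D\<ge>0. \<forall>u F G B. state u F G \<longrightarrow> 0 \<le> B \<longrightarrow> M2_integral g m u \<le> ennreal (B\<^sup>2) \<longrightarrow>
    weighted_L2 k G \<le> ennreal ((D * B)\<^sup>2)"
proof -
  have "cmod (\<phi> x0) \<noteq> 0" using assms by simp
  from swapped.position_lower_bound[OF this]
  obtain c where c: "0 < c" "\<And>x \<omega>. c \<le> m (\<omega>, x) * (1 + norm x) ^ k" by (auto simp: m_eq swapped_M)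
  have \<mu>: "(\<lambda>z. m (- snd z, fst z)) \<in> borel_measurable borel" by measurable
  have "c \<le> m (- snd (x, \<omega>), fst (x, \<omega>)) * (1 + norm x) ^ k" for x \<omega> using c(2)[of "- \<omega>" x] by simp
  from function_weighted_L2[OF \<gamma> \<mu> c(1) this]
  obtain D where D: "0 \<le> D" "\<And>u F B. u \<in> tempered \<Longrightarrow> is_function u F \<Longrightarrow> 0 \<le> B \<Longrightarrow>
    M2_integral (fourier g) (\<lambda>z. m (- snd z, fst z)) u \<le> ennreal (B\<^sup>2) \<Longrightarrow>
    weighted_L2 k F \<le> ennreal ((D * B)\<^sup>2)" by blast
  have "weighted_L2 k G \<le> ennreal ((D * B)\<^sup>2)"
    if s: "state u F G" and B: "0 \<le> B" "M2_integral g m u \<le> ennreal (B\<^sup>2)" for u F G B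
  proof -
    have u: "u \<in> tempered" and G: "is_function (fourier_dist u) G" using s assms by (auto simp: state_def)
    show ?thesis
      using B(2) by (intro D(2)[OF fourier_dist_tempered[OF u] G B(1)]) (simp add: M2_integral_fourier[OF u G g(1)])
  qed
  then show ?thesis using D(1) by blast
qed

lemma finite_square_bound:
  fixes a :: ennreal assumes "a < \<top>" shows "\<exists>B\<ge>0. a \<le> ennreal (B\<^sup>2)"
proof -
  obtain r where "0 \<le> r" "a = ennreal r" using assms by (cases a) auto
  then show ?thesis by (intro exI[of _ "sqrt r"]) simp
qed

lemma state_transform:
  assumes s: "state u F G" shows "transform_of (stft g u) F G"
proof -
  note [measurable] = state_measurable[OF s]
  have u: "u \<in> tempered" and fin: "M2_integral g m u < \<top>" using s by (auto simp: state_def)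
  obtain B where B: "0 \<le> B" "M2_integral g m u \<le> ennreal (B\<^sup>2)" using finite_square_bound[OF fin] by blast
  have position: "L2_square (\<lambda>\<omega>. stft g u (x, \<omega>))
      = (\<integral>\<^sup>+t. ennreal ((cmod (F t))\<^sup>2) * ennreal ((cmod (g (t - x)))\<^sup>2) \<partial>lborel)" if \<psi>: "\<psi> x0 \<noteq> 0" for x x0
  proof -
    obtain D where D: "0 \<le> D" "weighted_L2 k F \<le> ennreal ((D * B)\<^sup>2)"
      using state_function_bound[OF \<psi>] s B by blast
    have F: "is_function u F" using s \<psi> by (auto simp: state_def)
    show ?thesis by (rule stft_plancherel[OF u F g(1) _ D(2)]) (use D(1) B(1) in simp)
  qed
  have frequency: "L2_square (\<lambda>x. stft g u (x, \<omega>))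
      = (\<integral>\<^sup>+t. ennreal ((cmod (G t))\<^sup>2) * ennreal ((cmod (fourier g (t - \<omega>)))\<^sup>2) \<partial>lborel)" if \<phi>: "\<phi> x0 \<noteq> 0" for \<omega> x0
  proof -
    obtain D where D: "0 \<le> D" "weighted_L2 k G \<le> ennreal ((D * B)\<^sup>2)"
      using state_fourier_bound[OF \<phi>] s B by blast
    have G: "is_function (fourier_dist u) G" using s \<phi> by (auto simp: state_def)
    note [measurable] = stft_measurable[OF fourier_dist_tempered[OF u] G \<gamma>(1)]
    have "L2_square (\<lambda>x. stft g u (x, \<omega>)) = L2_square (\<lambda>x. stft (fourier g) (fourier_dist u) (\<omega>, 0 - x))"
      by (simp add: stft_fourier_dist[OF u g(1)] norm_mult)
    also have "\<dots> = L2_square (\<lambda>y. stft (fourier g) (fourier_dist u) (\<omega>, y))"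
      by (rule nn_integral_reflect) measurable
    also have "\<dots> = (\<integral>\<^sup>+t. ennreal ((cmod (G t))\<^sup>2) * ennreal ((cmod (fourier g (t - \<omega>)))\<^sup>2) \<partial>lborel)"
      by (rule stft_plancherel[OF fourier_dist_tempered[OF u] G \<gamma>(1) _ D(2)]) (use D(1) B(1) in simp)
    finally show ?thesis .
  qed
  show ?thesis unfolding transform_of_def
  proof (intro conjI impI allI state_measurable[OF s])
    fix x assume "\<exists>x. cmod (\<psi> x) \<noteq> 0"
    then show "L2_square (\<lambda>\<omega>. stft g u (x, \<omega>))
      = (\<integral>\<^sup>+t. ennreal ((cmod (F t))\<^sup>2) * ennreal ((cmod (g (t - x)))\<^sup>2) \<partial>lborel)" using position by (elim exE) simp
  next
    fix \<omega> assume "\<exists>\<omega>. cmod (\<phi> \<omega>) \<noteq> 0"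
    then show "L2_square (\<lambda>x. stft g u (x, \<omega>))
      = (\<integral>\<^sup>+t. ennreal ((cmod (G t))\<^sup>2) * ennreal ((cmod (fourier g (t - \<omega>)))\<^sup>2) \<partial>lborel)" using frequency by (elim exE) simp
  qed
qed

text \<open>The substantial half of the equivalence of the two norms on \<open>M\<^sup>2\<^sub>m\<close>.\<close>

lemma state_norm_estimate:
  "\<exists>K\<ge>0. \<forall>u F G. state u F G \<longrightarrow> M2_integral g m u \<le> ennreal K * (M2_integral g m0 u + Q F G)"
proof -
  obtain K where K: "0 \<le> K" "\<And>V F G. transform_of V F G \<Longrightarrow> weighted_square M V < \<top> \<Longrightarrow>
    weighted_square M V \<le> ennreal K * total V F G"
    using norm_estimate by blast
  have "M2_integral g m u \<le> ennreal K * (M2_integral g m0 u + Q F G)" if s: "state u F G" for u F G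
  proof -
    have "M2_integral g m u \<le> ennreal K * total (stft g u) F G"
      using K(2)[OF state_transform[OF s]] s unfolding M2_integral_m[symmetric] by (simp add: state_def)
    then show ?thesis
      unfolding total_def M2_integral_m0 using state_measurable[OF s] by (simp add: Q_eq add.assoc)
  qed
  then show ?thesis using K(1) by blast
qed

lemma state_schwartz_bound:
  "\<exists>D\<ge>0. \<exists>N. \<forall>u F G B \<eta>. state u F G \<longrightarrow> 0 \<le> B \<longrightarrow> M2_integral g m0 u \<le> ennreal (B\<^sup>2) \<longrightarrow>
    \<eta> \<in> schwartz \<longrightarrow> cmod (u \<eta>) \<le> D * B * schwartz_seminorm N \<eta>"
proof -
  obtain c s where c: "0 < c" "\<And>z. c \<le> m0 z * ((1 + norm (fst z)) ^ s * (1 + norm (snd z)) ^ s)"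
    using moderate_lower_bound[OF m0_moderate] by blast
  have f: "\<exists>F. is_function u F \<or> is_function (fourier_dist u) F" if "state u F G" for u F G
    using that nontrivial by (auto simp: state_def)
  from stft_bound[OF g measurable_weights(1) c] show ?thesis
    using f state_tempered by meson
qed

lemma state_combination:
  assumes s: "state u F G" and s': "state v F' G'"
  shows "state (combination a b u v) (\<lambda>t. a * F t + b * F' t) (\<lambda>t. a * G t + b * G' t)"
proof -
  note [measurable] = state_measurable[OF s] state_measurable[OF s']
  have "M2_integral g m (combination a b u v) \<le> (\<integral>\<^sup>+z. ennreal (2 * (cmod a)\<^sup>2) * ennreal (M z * (cmod (stft g u z))\<^sup>2)
     + ennreal (2 * (cmod b)\<^sup>2) * ennreal (M z * (cmod (stft g v z))\<^sup>2) \<partial>lborel)"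
    unfolding M2_integral_m
  proof (rule nn_integral_mono)
    fix z
    have "M z * (cmod (stft g (combination a b u v) z))\<^sup>2 \<le> M z * (2 * (cmod (a * stft g u z))\<^sup>2 + 2 * (cmod (b * stft g v z))\<^sup>2)"
      unfolding stft_combination[OF g(1)] using M_pos[of z] by (intro mult_left_mono cmod_add_square_le) auto
    also have "\<dots> = 2 * (cmod a)\<^sup>2 * (M z * (cmod (stft g u z))\<^sup>2) + 2 * (cmod b)\<^sup>2 * (M z * (cmod (stft g v z))\<^sup>2)"
      by (simp add: norm_mult power_mult_distrib algebra_simps)
    finally show "ennreal (M z * (cmod (stft g (combination a b u v) z))\<^sup>2) \<le> ennreal (2 * (cmod a)\<^sup>2) * ennreal (M z * (cmod (stft g u z))\<^sup>2)
     + ennreal (2 * (cmod b)\<^sup>2) * ennreal (M z * (cmod (stft g v z))\<^sup>2)"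
      using M_pos[of z] by (simp add: ennreal_mult[symmetric] ennreal_plus[symmetric] ennreal_leI less_imp_le del: ennreal_plus)
  qed
  also have "\<dots> = ennreal (2 * (cmod a)\<^sup>2) * M2_integral g m u + ennreal (2 * (cmod b)\<^sup>2) * M2_integral g m v"
    unfolding M2_integral_m by (simp add: nn_integral_add nn_integral_cmult)
  also have "\<dots> < \<top>" using s s' by (simp add: state_def ennreal_mult_less_top)
  finally show ?thesis
    using s s' unfolding state_def fourier_dist_combination
    by (auto intro: combination_tempered is_function_combination)
qed

lemma state_parallelogram:
  assumes s: "state u F G" and s': "state v F' G'"
  shows "M2_integral g m0 (combination 1 1 u v) + M2_integral g m0 (combination 1 (-1) u v) = 2 * M2_integral g m0 u + 2 * M2_integral g m0 v"
    and "Q (\<lambda>t. 1 * F t + 1 * F' t) (\<lambda>t. 1 * G t + 1 * G' t) + Q (\<lambda>t. 1 * F t + (-1) * F' t) (\<lambda>t. 1 * G t + (-1) * G' t) = 2 * Q F G + 2 * Q F' G'"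
proof -
  note [measurable] = state_measurable[OF s] state_measurable[OF s']
  have two: "2 * ennreal x = ennreal (2 * x)" if "0 \<le> x" for x using that by (simp add: ennreal_mult)
  have "ennreal ((m0 z)\<^sup>2 * (cmod (stft g u z + stft g v z))\<^sup>2) + ennreal ((m0 z)\<^sup>2 * (cmod (stft g u z - stft g v z))\<^sup>2)
     = 2 * ennreal ((m0 z)\<^sup>2 * (cmod (stft g u z))\<^sup>2) + 2 * ennreal ((m0 z)\<^sup>2 * (cmod (stft g v z))\<^sup>2)" for z
    using arg_cong[OF parallelogram_complex[of "stft g u z" "stft g v z"], of "\<lambda>x. (m0 z)\<^sup>2 * x"]
    by (simp add: two ennreal_plus[symmetric] algebra_simps del: ennreal_plus)
  then have "(\<integral>\<^sup>+z. ennreal ((m0 z)\<^sup>2 * (cmod (stft g u z + stft g v z))\<^sup>2) + ennreal ((m0 z)\<^sup>2 * (cmod (stft g u z - stft g v z))\<^sup>2) \<partial>lborel)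
     = (\<integral>\<^sup>+z. 2 * ennreal ((m0 z)\<^sup>2 * (cmod (stft g u z))\<^sup>2) + 2 * ennreal ((m0 z)\<^sup>2 * (cmod (stft g v z))\<^sup>2) \<partial>lborel)"
    by simp
  then show "M2_integral g m0 (combination 1 1 u v) + M2_integral g m0 (combination 1 (-1) u v) = 2 * M2_integral g m0 u + 2 * M2_integral g m0 v"
    unfolding M2_integral_m0 by (simp add: stft_combination[OF g(1)] nn_integral_add nn_integral_cmult)
  have "ennreal ((cmod (\<psi> t))\<^sup>2 * (cmod (F t + F' t))\<^sup>2 + (cmod (\<phi> t))\<^sup>2 * (cmod (G t + G' t))\<^sup>2)
      + ennreal ((cmod (\<psi> t))\<^sup>2 * (cmod (F t - F' t))\<^sup>2 + (cmod (\<phi> t))\<^sup>2 * (cmod (G t - G' t))\<^sup>2)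
     = 2 * ennreal ((cmod (\<psi> t))\<^sup>2 * (cmod (F t))\<^sup>2 + (cmod (\<phi> t))\<^sup>2 * (cmod (G t))\<^sup>2)
      + 2 * ennreal ((cmod (\<psi> t))\<^sup>2 * (cmod (F' t))\<^sup>2 + (cmod (\<phi> t))\<^sup>2 * (cmod (G' t))\<^sup>2)" for t
    using arg_cong[OF parallelogram_complex[of "F t" "F' t"], of "\<lambda>x. (cmod (\<psi> t))\<^sup>2 * x"]
      arg_cong[OF parallelogram_complex[of "G t" "G' t"], of "\<lambda>x. (cmod (\<phi> t))\<^sup>2 * x"]
    by (simp add: two ennreal_plus[symmetric] algebra_simps del: ennreal_plus)
  then have *: "(\<integral>\<^sup>+t. ennreal ((cmod (\<psi> t))\<^sup>2 * (cmod (F t + F' t))\<^sup>2 + (cmod (\<phi> t))\<^sup>2 * (cmod (G t + G' t))\<^sup>2)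
      + ennreal ((cmod (\<psi> t))\<^sup>2 * (cmod (F t - F' t))\<^sup>2 + (cmod (\<phi> t))\<^sup>2 * (cmod (G t - G' t))\<^sup>2) \<partial>lborel)
     = (\<integral>\<^sup>+t. 2 * ennreal ((cmod (\<psi> t))\<^sup>2 * (cmod (F t))\<^sup>2 + (cmod (\<phi> t))\<^sup>2 * (cmod (G t))\<^sup>2)
      + 2 * ennreal ((cmod (\<psi> t))\<^sup>2 * (cmod (F' t))\<^sup>2 + (cmod (\<phi> t))\<^sup>2 * (cmod (G' t))\<^sup>2) \<partial>lborel)" by simp
  show "Q (\<lambda>t. 1 * F t + 1 * F' t) (\<lambda>t. 1 * G t + 1 * G' t) + Q (\<lambda>t. 1 * F t + (-1) * F' t) (\<lambda>t. 1 * G t + (-1) * G' t) = 2 * Q F G + 2 * Q F' G'"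
  proof -
    let ?f = "\<lambda>F G t. ennreal ((cmod (\<psi> t))\<^sup>2 * (cmod (F t))\<^sup>2 + (cmod (\<phi> t))\<^sup>2 * (cmod (G t))\<^sup>2)"
    have m: "?f A B \<in> borel_measurable lborel" if [measurable]: "A \<in> borel_measurable borel" "B \<in> borel_measurable borel" for A B
      by measurable
    have "Q (\<lambda>t. 1 * F t + 1 * F' t) (\<lambda>t. 1 * G t + 1 * G' t) + Q (\<lambda>t. 1 * F t + (-1) * F' t) (\<lambda>t. 1 * G t + (-1) * G' t)
      = (\<integral>\<^sup>+t. ?f (\<lambda>t. F t + F' t) (\<lambda>t. G t + G' t) t + ?f (\<lambda>t. F t - F' t) (\<lambda>t. G t - G' t) t \<partial>lborel)"
      unfolding Q_def by (subst nn_integral_add) (auto intro!: m simp del: ennreal_plus)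
    also have "\<dots> = (\<integral>\<^sup>+t. 2 * ?f F G t + 2 * ?f F' G' t \<partial>lborel)" by (rule *)
    also have "\<dots> = 2 * Q F G + 2 * Q F' G'"
      unfolding Q_def by (subst nn_integral_add) (auto intro!: m simp: nn_integral_cmult[OF m] simp del: ennreal_plus)
    finally show ?thesis .
  qed
qed

text \<open>The infimum of the energy over the sphere; infinite energies do not affect it.\<close>

definition ground_energy :: ennreal where
  "ground_energy = Inf {Q F G | u F G. state u F G \<and> M2_integral g m0 u = 1}"

lemma ground_energy_le: "state u F G \<Longrightarrow> M2_integral g m0 u = 1 \<Longrightarrow> ground_energy \<le> Q F G"
  unfolding ground_energy_def by (rule Inf_lower) auto

text \<open>By homogeneity, the infimum over the sphere bounds the energy by the norm on all states.\<close>

lemma ground_energy_mult_le: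
  assumes s: "state u F G" shows "ground_energy * M2_integral g m0 u \<le> Q F G"
proof (cases "M2_integral g m0 u = 0")
  case False
  note [measurable] = state_measurable[OF s]
  have "M2_integral g m0 u < \<top>" using s M2_integral_m0_le[of u] by (auto simp: state_def intro: le_less_trans)
  with False obtain \<nu> where \<nu>: "0 < \<nu>" "M2_integral g m0 u = ennreal \<nu>" by (cases "M2_integral g m0 u") (auto simp: less_le)
  define a where "a = complex_of_real (1 / sqrt \<nu>)"
  have a: "(cmod a)\<^sup>2 = 1 / \<nu>" using \<nu>(1) by (simp add: a_def power_divide norm_divide)
  have s': "state (combination a 0 u u) (\<lambda>t. a * F t + 0 * F t) (\<lambda>t. a * G t + 0 * G t)" by (rule state_combination[OF s s])
  have "M2_integral g m0 (combination a 0 u u) = (\<integral>\<^sup>+z. ennreal (1 / \<nu>) * ennreal ((m0 z)\<^sup>2 * (cmod (stft g u z))\<^sup>2) \<partial>lborel)"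
    unfolding M2_integral_m0 using \<nu>(1)
    by (intro nn_integral_cong) (simp add: stft_combination[OF g(1)] norm_mult power_mult_distrib a ennreal_mult[symmetric] mult_ac)
  also have "\<dots> = ennreal (1 / \<nu>) * M2_integral g m0 u" unfolding M2_integral_m0 by (rule nn_integral_cmult) measurable
  also have "\<dots> = 1" unfolding \<nu>(2) using \<nu>(1) by (simp add: ennreal_mult[symmetric])
  finally have "ground_energy \<le> Q (\<lambda>t. a * F t + 0 * F t) (\<lambda>t. a * G t + 0 * G t)" by (rule ground_energy_le[OF s'])
  also have "\<dots> = (\<integral>\<^sup>+t. ennreal (1 / \<nu>) * ennreal ((cmod (\<psi> t))\<^sup>2 * (cmod (F t))\<^sup>2 + (cmod (\<phi> t))\<^sup>2 * (cmod (G t))\<^sup>2) \<partial>lborel)"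
    unfolding Q_def using \<nu>(1)
    by (intro nn_integral_cong)
      (simp add: norm_mult power_mult_distrib a ennreal_mult[symmetric] add_divide_distrib mult_ac del: ennreal_plus)
  also have "\<dots> = ennreal (1 / \<nu>) * Q F G" unfolding Q_def by (rule nn_integral_cmult) measurable
  finally have "ground_energy * ennreal \<nu> \<le> ennreal (1 / \<nu>) * Q F G * ennreal \<nu>" by (rule mult_right_mono) simp
  also have "\<dots> = (ennreal (1 / \<nu>) * ennreal \<nu>) * Q F G" by (simp add: mult_ac)
  also have "\<dots> = Q F G" using \<nu>(1) by (simp add: ennreal_mult[symmetric])
  finally show ?thesis unfolding \<nu>(2) .
qed simp

text \<open>
  The quadratic form \<open>Q - ground_energy \<cdot> N\<close> is nonnegative and nearly vanishes at near minimisers,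
  so by the parallelogram law it nearly vanishes at their differences.
\<close>

lemma near_minimisers_close:
  assumes s: "state u F G" "M2_integral g m0 u = 1" "Q F G \<le> ground_energy + d"
    and s': "state v F' G'" "M2_integral g m0 v = 1" "Q F' G' \<le> ground_energy + d'"
    and fin: "ground_energy < \<top>"
  shows "Q (\<lambda>t. 1 * F t + (-1) * F' t) (\<lambda>t. 1 * G t + (-1) * G' t)
    \<le> 2 * d + 2 * d' + ground_energy * M2_integral g m0 (combination 1 (-1) u v)"
proof -
  let ?l = ground_energy and ?N = "\<lambda>b. M2_integral g m0 (combination 1 b u v)"
  let ?D = "Q (\<lambda>t. 1 * F t + (-1) * F' t) (\<lambda>t. 1 * G t + (-1) * G' t)"
  have "?D + ?l * ?N 1 \<le> ?D + Q (\<lambda>t. 1 * F t + 1 * F' t) (\<lambda>t. 1 * G t + 1 * G' t)"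
    by (intro add_left_mono ground_energy_mult_le state_combination s s')
  also have "\<dots> = 2 * Q F G + 2 * Q F' G'"
    using state_parallelogram(2)[OF s(1) s'(1)] by (simp only: add.commute)
  also have "\<dots> \<le> 2 * (?l + d) + 2 * (?l + d')" by (intro add_mono mult_left_mono s s') auto
  finally have "?D + ?l * ?N 1 + ?l * ?N (-1) \<le> 2 * (?l + d) + 2 * (?l + d') + ?l * ?N (-1)" by (rule add_right_mono)
  moreover have "?D + ?l * ?N 1 + ?l * ?N (-1) = 4 * ?l + ?D"
  proof -
    have "?N 1 + ?N (-1) = 4" using state_parallelogram(1)[OF s(1) s'(1)] s(2) s'(2) by simp
    then have "?l * ?N 1 + ?l * ?N (-1) = 4 * ?l" by (metis distrib_left mult.commute)
    then show ?thesis by (simp add: add_ac)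
  qed
  moreover have "2 * (?l + d) + 2 * (?l + d') + ?l * ?N (-1) = 4 * ?l + (2 * d + 2 * d' + ?l * ?N (-1))"
  proof -
    have "(4::ennreal) = 2 + 2" by simp
    then have "4 * ?l = 2 * ?l + 2 * ?l" by (simp only: distrib_right)
    then show ?thesis by (simp only: distrib_left add_ac)
  qed
  ultimately have "4 * ?l + ?D \<le> 4 * ?l + (2 * d + 2 * d' + ?l * ?N (-1))" by (simp only:)
  moreover have "4 * ?l \<noteq> \<top>" using fin by (simp add: ennreal_mult_eq_top_iff)
  ultimately show ?thesis by (simp only: ennreal_add_left_cancel_le infinity_ennreal_def simp_thms)
qed

lemma minimising_sequence:
  assumes "ground_energy < \<top>"
  shows "\<exists>f F G. \<forall>n. state (f n) (F n) (G n) \<and> M2_integral g m0 (f n) = 1 \<and>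
    Q (F n) (G n) \<le> ground_energy + ennreal (1 / real (Suc n))"
proof -
  have "\<exists>u F G. state u F G \<and> M2_integral g m0 u = 1 \<and> Q F G \<le> ground_energy + ennreal (1 / real (Suc n))" for n
  proof -
    obtain l where l: "0 \<le> l" "ground_energy = ennreal l" using assms by (cases ground_energy) auto
    have "ground_energy < ground_energy + ennreal (1 / real (Suc n))"
      using l(1) by (simp add: l(2) ennreal_plus[symmetric] ennreal_less_iff del: ennreal_plus of_nat_Suc)
    then obtain q where "q \<in> {Q F G | u F G. state u F G \<and> M2_integral g m0 u = 1}" "q < ground_energy + ennreal (1 / real (Suc n))"
      unfolding ground_energy_def Inf_less_iff by blast
    then show ?thesis by (auto intro: less_imp_le)
  qed
  then show ?thesis by metis
qed

lemma state_stft_bound: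
  "\<exists>D\<ge>0. \<exists>N. \<forall>u F G B z. state u F G \<longrightarrow> 0 \<le> B \<longrightarrow> M2_integral g m0 u \<le> ennreal (B\<^sup>2) \<longrightarrow>
    cmod (stft g u z) \<le> D * B * ((1 + norm (fst z)) ^ N * (1 + norm (snd z)) ^ N)"
proof -
  obtain D N where D: "0 \<le> D" "\<And>u F G B \<eta>. state u F G \<Longrightarrow> 0 \<le> B \<Longrightarrow> M2_integral g m0 u \<le> ennreal (B\<^sup>2) \<Longrightarrow>
    \<eta> \<in> schwartz \<Longrightarrow> cmod (u \<eta>) \<le> D * B * schwartz_seminorm N \<eta>" using state_schwartz_bound by blast
  define c where "c = 2 ^ N * 7 ^ N * schwartz_seminorm N g"
  have c: "0 \<le> c" unfolding c_def using seminorm_nonneg[OF g(1)] by simp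
  have "cmod (stft g u z) \<le> (D * c) * B * ((1 + norm (fst z)) ^ N * (1 + norm (snd z)) ^ N)"
    if "state u F G" "0 \<le> B" "M2_integral g m0 u \<le> ennreal (B\<^sup>2)" for u F G B z
  proof -
    have "cmod (stft g u z) \<le> D * B * schwartz_seminorm N (atom g z)"
      unfolding stft_eq by (rule D(2)[OF that schwartz_atom[OF g(1)]])
    also have "\<dots> \<le> D * B * (c * ((1 + norm (fst z)) ^ N * (1 + norm (snd z)) ^ N))"
      unfolding c_def using D(1) that(2) by (intro mult_left_mono seminorm_atom[OF g(1)]) auto
    finally show ?thesis by (simp only: mult_ac)
  qed
  moreover have "0 \<le> D * c" using D(1) c by simp
  ultimately show ?thesis by blast
qed

text \<open>
  By \<open>nontrivial\<close>, the transform is that of a function on at least one of the two sides, with a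
  uniform weighted \<open>L\<^sup>2\<close> bound.
\<close>

lemma state_pointwise_compact:
  assumes s: "\<And>n::nat. state (f n) (F n) (G n)" and B: "0 \<le> B" "\<And>n. M2_integral g m (f n) \<le> ennreal (B\<^sup>2)"
  shows "\<exists>r V. strict_mono (r :: nat \<Rightarrow> nat) \<and> (\<forall>z. (\<lambda>n. stft g (f (r n)) z) \<longlonglongrightarrow> V z)"
proof (cases "\<exists>x. \<psi> x \<noteq> 0")
  case True
  then obtain x0 where x0: "\<psi> x0 \<noteq> 0" by blast
  obtain D where D: "0 \<le> D" "\<And>n. weighted_L2 k (F n) \<le> ennreal ((D * B)\<^sup>2)"
    using state_function_bound[OF x0] s B by blast
  have DB: "0 \<le> D * B" using D(1) B(1) by simp
  have "stft g (f n) z = (LINT t|lborel. F n t * atom g z t)" for n z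
    by (rule stft_function[OF state_tempered[OF s] _ g(1) DB D(2)]) (use s True in \<open>auto simp: state_def\<close>)
  then show ?thesis using stft_pointwise_compact[OF g(1) DB state_measurable(1)[OF s] D(2)] by simp
next
  case False
  then obtain x0 where x0: "\<phi> x0 \<noteq> 0" using nontrivial by blast
  obtain D where D: "0 \<le> D" "\<And>n. weighted_L2 k (G n) \<le> ennreal ((D * B)\<^sup>2)"
    using state_fourier_bound[OF x0] s B by blast
  have DB: "0 \<le> D * B" using D(1) B(1) by simp
  have e: "stft (fourier g) (fourier_dist (f n)) z = (LINT t|lborel. G n t * atom (fourier g) z t)" for n z
    by (rule stft_function[OF fourier_dist_tempered[OF state_tempered[OF s]] _ \<gamma>(1) DB D(2)]) (use s x0 in \<open>auto simp: state_def\<close>)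
  obtain r V where r: "strict_mono r" "\<And>z. (\<lambda>n. stft (fourier g) (fourier_dist (f (r n))) z) \<longlonglongrightarrow> V z"
    using stft_pointwise_compact[where F=G, OF \<gamma>(1) DB state_measurable(2)[OF s] D(2)] unfolding e by blast
  have "(\<lambda>n. stft g (f (r n)) z) \<longlonglongrightarrow> modulation (fst z) (snd z) * V (snd z, - fst z)" for z
    using tendsto_mult_left[OF r(2)[of "(snd z, - fst z)"], of "modulation (fst z) (snd z)"]
      stft_fourier_dist'[OF state_tempered[OF s] g(1), of _ "fst z" "snd z"] by simp
  then show ?thesis using r(1) by (intro exI[of _ r] exI[of _ "\<lambda>z. modulation (fst z) (snd z) * V (snd z, - fst z)"]) blast
qed

lemma weighted_fatou:
  assumes s: "\<And>n::nat. state (f n) (F n) (G n)" and V: "\<And>z. (\<lambda>n. stft g (f n) z) \<longlonglongrightarrow> V z"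
    and [measurable]: "\<mu> \<in> borel_measurable borel" and b: "\<And>n. weighted_square \<mu> (stft g (f n)) \<le> b"
  shows "weighted_square \<mu> V \<le> b"
proof -
  note [measurable] = state_measurable(3)[OF s]
  show ?thesis
    by (rule fatou_bound[where u="\<lambda>n z. ennreal (\<mu> z * (cmod (stft g (f n) z))\<^sup>2)" and b="\<lambda>n. b"])
      (auto intro!: b AE_I2 tendsto_intros V)
qed

text \<open>
  On a ball this is dominated convergence, by the uniform pointwise bound of the transforms. Outside
  a large ball, \<open>m\<^sub>0\<^sup>2 \<le> \<delta> m\<^sup>2\<close>, and the integrals with weight \<open>m\<^sup>2\<close> are bounded.
\<close>

lemma strong_convergence:
  assumes s: "\<And>n::nat. state (f n) (F n) (G n)" and B: "0 \<le> B" "\<And>n. M2_integral g m (f n) \<le> ennreal (B\<^sup>2)"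
    and V: "\<And>z. (\<lambda>n. stft g (f n) z) \<longlonglongrightarrow> V z"
  shows "vanishing (\<lambda>n k. \<integral>\<^sup>+z. ennreal ((m0 z)\<^sup>2 * (cmod (stft g (f n) z - V z))\<^sup>2) \<partial>lborel)"
  unfolding vanishing_def
proof (intro allI impI)
  fix e :: real assume e: "0 < e"
  note [measurable] = state_measurable(3)[OF s]
  have V_measurable [measurable]: "V \<in> borel_measurable borel"
    by (rule borel_measurable_LIMSEQ_metric[OF state_measurable(3)[OF s] V])
  have VM: "weighted_square M V \<le> ennreal (B\<^sup>2)"
    by (rule weighted_fatou[OF s V]) (use B(2) in \<open>simp_all add: M2_integral_m\<close>)
  have far: "weighted_square M (\<lambda>z. stft g (f n) z - V z) \<le> ennreal (4 * B\<^sup>2)" for n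
  proof -
    have "weighted_square M (\<lambda>z. stft g (f n) z - V z)
      \<le> (\<integral>\<^sup>+z. 2 * ennreal (M z * (cmod (stft g (f n) z))\<^sup>2) + 2 * ennreal (M z * (cmod (V z))\<^sup>2) \<partial>lborel)"
    proof (rule nn_integral_mono)
      fix z
      have "M z * (cmod (stft g (f n) z - V z))\<^sup>2 \<le> M z * (2 * (cmod (stft g (f n) z))\<^sup>2 + 2 * (cmod (V z))\<^sup>2)"
        using cmod_add_square_le[of "stft g (f n) z" "- V z"] M_pos[of z] by (intro mult_left_mono) auto
      also have "\<dots> = 2 * (M z * (cmod (stft g (f n) z))\<^sup>2) + 2 * (M z * (cmod (V z))\<^sup>2)" by (simp add: algebra_simps)
      finally have "ennreal (M z * (cmod (stft g (f n) z - V z))\<^sup>2) \<le> ennreal (2 * (M z * (cmod (stft g (f n) z))\<^sup>2) + 2 * (M z * (cmod (V z))\<^sup>2))"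
        by (rule ennreal_leI)
      also have "\<dots> = 2 * ennreal (M z * (cmod (stft g (f n) z))\<^sup>2) + 2 * ennreal (M z * (cmod (V z))\<^sup>2)"
        using M_pos[of z] by (simp add: ennreal_mult ennreal_plus less_imp_le)
      finally show "ennreal (M z * (cmod (stft g (f n) z - V z))\<^sup>2) \<le> 2 * ennreal (M z * (cmod (stft g (f n) z))\<^sup>2) + 2 * ennreal (M z * (cmod (V z))\<^sup>2)" .
    qed
    also have "\<dots> = 2 * M2_integral g m (f n) + 2 * weighted_square M V"
      unfolding M2_integral_m by (simp add: nn_integral_add nn_integral_cmult)
    also have "\<dots> \<le> 2 * ennreal (B\<^sup>2) + 2 * ennreal (B\<^sup>2)" by (intro add_mono mult_left_mono B VM) auto
    also have "\<dots> = ennreal (2 * B\<^sup>2) + ennreal (2 * B\<^sup>2)" by (simp add: ennreal_mult)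
    also have "\<dots> = ennreal (2 * B\<^sup>2 + 2 * B\<^sup>2)" by (rule ennreal_plus[symmetric]) auto
    finally show ?thesis by simp
  qed
  \<comment> \<open>The exterior of the ball contributes at most \<open>\<delta> * (4 * B\<^sup>2)\<close>, that is, half of \<open>e\<close>; adding
    \<open>1\<close> avoids division by zero.\<close>
  define \<delta> where "\<delta> = e / (2 * (4 * B\<^sup>2 + 1))"
  have p: "0 < 4 * B\<^sup>2 + 1" by (intro add_nonneg_pos) auto
  have \<delta>: "0 < \<delta>" "\<delta> * (4 * B\<^sup>2) \<le> e / 2"
  proof -
    show "0 < \<delta>" using e p by (simp add: \<delta>_def)
    then have "\<delta> * (4 * B\<^sup>2) \<le> \<delta> * (4 * B\<^sup>2 + 1)" by simp
    also have "\<dots> = e / 2"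
    proof -
      have "e / (2 * q) * q = e / 2" if "0 < q" for q :: real using that by simp
      from this[OF p] show ?thesis by (simp only: \<delta>_def)
    qed
    finally show "\<delta> * (4 * B\<^sup>2) \<le> e / 2" .
  qed
  obtain \<rho> where \<rho>: "0 < \<rho>" "\<And>x \<omega>. \<rho> \<le> norm (x, \<omega>) \<Longrightarrow> (m0 (x, \<omega>))\<^sup>2 \<le> \<delta> * ((m0 (x, \<omega>))\<^sup>2 + (cmod (\<psi> x))\<^sup>2 + (cmod (\<phi> \<omega>))\<^sup>2)"
    using tail[OF \<delta>(1)] by blast
  have out: "(m0 z)\<^sup>2 \<le> \<delta> * M z" if "z \<notin> cball 0 \<rho>" for z
    using \<rho>(2)[of "fst z" "snd z"] that by (simp add: M_def)
  have [measurable]: "(indicator (cball 0 \<rho>) :: 'a \<times> 'a \<Rightarrow> ennreal) \<in> borel_measurable borel"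
    by (rule borel_measurable_indicator) simp
  define b where "b n = (\<integral>\<^sup>+z. indicator (cball 0 \<rho>) z * ennreal ((m0 z)\<^sup>2 * (cmod (stft g (f n) z - V z))\<^sup>2) \<partial>lborel)" for n
  have near: "b \<longlonglongrightarrow> 0"
  proof -
    obtain D N where D: "0 \<le> D" "\<And>u F G B z. state u F G \<Longrightarrow> 0 \<le> B \<Longrightarrow> M2_integral g m0 u \<le> ennreal (B\<^sup>2) \<Longrightarrow>
      cmod (stft g u z) \<le> D * B * ((1 + norm (fst z)) ^ N * (1 + norm (snd z)) ^ N)"
      using state_stft_bound by blast
    define L where "L = D * B * ((1 + \<rho>) ^ N * (1 + \<rho>) ^ N)"
    have L: "cmod (stft g (f n) z) \<le> L" if z: "z \<in> cball 0 \<rho>" for n z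
    proof -
      have zn: "norm (fst z) \<le> \<rho>" "norm (snd z) \<le> \<rho>"
        using z norm_fst_le[of "fst z" "snd z"] norm_snd_le[of "snd z" "fst z"] by auto
      have "cmod (stft g (f n) z) \<le> D * B * ((1 + norm (fst z)) ^ N * (1 + norm (snd z)) ^ N)"
        by (rule D(2)[OF s B(1) order_trans[OF M2_integral_m0_le B(2)]])
      also have "\<dots> \<le> L" unfolding L_def using D(1) B(1) zn \<rho>(1)
        by (intro mult_left_mono mult_mono power_mono) auto
      finally show ?thesis .
    qed
    have LV: "cmod (V z) \<le> L" if z: "z \<in> cball 0 \<rho>" for z
      by (rule LIMSEQ_le_const2[OF tendsto_norm[OF V]]) (use L[OF z] in blast)
    have "compact (m0 ` cball 0 \<rho>)"
      by (intro compact_continuous_image continuous_on_subset[OF m0_cont]) auto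
    then obtain P0 where "\<forall>y\<in>m0 ` cball 0 \<rho>. norm y \<le> P0"
      using compact_imp_bounded bounded_iff by metis
    then have P0: "m0 z \<le> P0" if "z \<in> cball 0 \<rho>" for z using that by force
    have dom: "indicator (cball 0 \<rho>) z * ennreal ((m0 z)\<^sup>2 * (cmod (stft g (f n) z - V z))\<^sup>2)
      \<le> ennreal (P0\<^sup>2 * (2 * L)\<^sup>2) * indicator (cball 0 \<rho>) z" for n z
    proof (cases "z \<in> cball 0 \<rho>")
      case True
      have "cmod (stft g (f n) z - V z) \<le> 2 * L"
        using norm_triangle_ineq4[of "stft g (f n) z" "V z"] L[OF True, of n] LV[OF True] by linarith
      then have "(cmod (stft g (f n) z - V z))\<^sup>2 \<le> (2 * L)\<^sup>2" by (rule power_mono) simp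
      moreover have "(m0 z)\<^sup>2 \<le> P0\<^sup>2" using P0[OF True] m0_pos[of z] by (intro power_mono) (auto intro: less_imp_le)
      ultimately have "(m0 z)\<^sup>2 * (cmod (stft g (f n) z - V z))\<^sup>2 \<le> P0\<^sup>2 * (2 * L)\<^sup>2" by (intro mult_mono) auto
      from ennreal_leI[OF this] show ?thesis using True by (simp only: indicator_simps mult_1 mult_1_right)
    qed simp
    have fin: "(\<integral>\<^sup>+z. ennreal (P0\<^sup>2 * (2 * L)\<^sup>2) * indicator (cball (0 :: 'a \<times> 'a) \<rho>) z \<partial>lborel) < \<infinity>"
      using emeasure_bounded_finite[of "cball (0 :: 'a \<times> 'a) \<rho>"]
      by (simp add: nn_integral_cmult_indicator ennreal_mult_less_top)
    have lim: "(\<lambda>n. indicator (cball 0 \<rho>) z * ennreal ((m0 z)\<^sup>2 * (cmod (stft g (f n) z - V z))\<^sup>2)) \<longlonglongrightarrow> 0" for z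
    proof -
      have "(\<lambda>n. ennreal ((m0 z)\<^sup>2 * (cmod (stft g (f n) z - V z))\<^sup>2)) \<longlonglongrightarrow> ennreal ((m0 z)\<^sup>2 * (cmod (V z - V z))\<^sup>2)"
        by (intro tendsto_intros V)
      then show ?thesis by (cases "z \<in> cball 0 \<rho>") auto
    qed
    have "b \<longlonglongrightarrow> (\<integral>\<^sup>+z. 0 \<partial>(lborel :: ('a \<times> 'a) measure))"
      unfolding b_def
      by (rule nn_integral_dominated_convergence[OF _ _ _ _ fin AE_I2[OF lim]]) (measurable, rule AE_I2[OF dom])
    then show ?thesis by simp
  qed
  have "eventually (\<lambda>n. b n < ennreal (e / 2)) sequentially"
    using near e by (intro order_tendstoD(2)) auto
  then obtain n0 where n0: "\<And>n. n \<ge> n0 \<Longrightarrow> b n \<le> ennreal (e / 2)"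
    unfolding eventually_sequentially by (auto intro: less_imp_le)
  have "weighted_square (\<lambda>z. (m0 z)\<^sup>2) (\<lambda>z. stft g (f n) z - V z) \<le> ennreal e" if n: "n \<ge> n0" for n
  proof -
    have "weighted_square (\<lambda>z. (m0 z)\<^sup>2) (\<lambda>z. stft g (f n) z - V z)
      \<le> (\<integral>\<^sup>+z. indicator (cball 0 \<rho>) z * ennreal ((m0 z)\<^sup>2 * (cmod (stft g (f n) z - V z))\<^sup>2)
          + ennreal \<delta> * ennreal (M z * (cmod (stft g (f n) z - V z))\<^sup>2) \<partial>lborel)"
    proof (rule nn_integral_mono)
      fix z :: "'a \<times> 'a"
      show "ennreal ((m0 z)\<^sup>2 * (cmod (stft g (f n) z - V z))\<^sup>2) \<le> indicator (cball 0 \<rho>) z * ennreal ((m0 z)\<^sup>2 * (cmod (stft g (f n) z - V z))\<^sup>2)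
          + ennreal \<delta> * ennreal (M z * (cmod (stft g (f n) z - V z))\<^sup>2)"
      proof (cases "z \<in> cball 0 \<rho>")
        case False
        have "(m0 z)\<^sup>2 * (cmod (stft g (f n) z - V z))\<^sup>2 \<le> \<delta> * M z * (cmod (stft g (f n) z - V z))\<^sup>2"
          by (intro mult_right_mono out False) simp
        then show ?thesis using False \<delta>(1) by (simp add: ennreal_mult'[symmetric] ennreal_leI mult.assoc)
      qed simp
    qed
    also have "\<dots> = b n + ennreal \<delta> * weighted_square M (\<lambda>z. stft g (f n) z - V z)"
      unfolding b_def by (subst nn_integral_cmult[symmetric], measurable, rule nn_integral_add) measurable
    also have "\<dots> \<le> ennreal (e / 2) + ennreal \<delta> * ennreal (4 * B\<^sup>2)" by (intro add_mono mult_left_mono far n0 n) auto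
    also have "\<dots> = ennreal (e / 2 + \<delta> * (4 * B\<^sup>2))" using e \<delta>(1) by (simp add: ennreal_mult ennreal_plus)
    also have "\<dots> \<le> ennreal e" using \<delta>(2) by (intro ennreal_leI) simp
    finally show ?thesis .
  qed
  then show "\<exists>n0. \<forall>n\<ge>n0. \<forall>k\<ge>n0. weighted_square (\<lambda>z. (m0 z)\<^sup>2) (\<lambda>z. stft g (f n) z - V z) \<le> ennreal e" by blast
qed

lemma difference_le:
  assumes s: "state u F G" "state v F' G'" and [measurable]: "V \<in> borel_measurable borel"
  shows "M2_integral g m0 (combination 1 (-1) u v) \<le> 2 * weighted_square (\<lambda>z. (m0 z)\<^sup>2) (\<lambda>z. stft g u z - V z)
    + 2 * weighted_square (\<lambda>z. (m0 z)\<^sup>2) (\<lambda>z. stft g v z - V z)"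
proof -
  note [measurable] = state_measurable[OF s(1)] state_measurable[OF s(2)]
  have "M2_integral g m0 (combination 1 (-1) u v) \<le> (\<integral>\<^sup>+z. 2 * ennreal ((m0 z)\<^sup>2 * (cmod (stft g u z - V z))\<^sup>2)
      + 2 * ennreal ((m0 z)\<^sup>2 * (cmod (stft g v z - V z))\<^sup>2) \<partial>lborel)"
    unfolding M2_integral_m0
  proof (rule nn_integral_mono)
    fix z
    have "(cmod (stft g u z - stft g v z))\<^sup>2 \<le> 2 * (cmod (stft g u z - V z))\<^sup>2 + 2 * (cmod (stft g v z - V z))\<^sup>2"
      using cmod_add_square_le[of "stft g u z - V z" "V z - stft g v z"] by (simp add: norm_minus_commute)
    then have "(m0 z)\<^sup>2 * (cmod (stft g u z - stft g v z))\<^sup>2 \<le> (m0 z)\<^sup>2 * (2 * (cmod (stft g u z - V z))\<^sup>2 + 2 * (cmod (stft g v z - V z))\<^sup>2)"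
      by (rule mult_left_mono) simp
    also have "\<dots> = 2 * ((m0 z)\<^sup>2 * (cmod (stft g u z - V z))\<^sup>2) + 2 * ((m0 z)\<^sup>2 * (cmod (stft g v z - V z))\<^sup>2)" by (simp add: algebra_simps)
    finally have "ennreal ((m0 z)\<^sup>2 * (cmod (stft g u z - stft g v z))\<^sup>2)
      \<le> ennreal (2 * ((m0 z)\<^sup>2 * (cmod (stft g u z - V z))\<^sup>2) + 2 * ((m0 z)\<^sup>2 * (cmod (stft g v z - V z))\<^sup>2))" by (rule ennreal_leI)
    also have "\<dots> = 2 * ennreal ((m0 z)\<^sup>2 * (cmod (stft g u z - V z))\<^sup>2) + 2 * ennreal ((m0 z)\<^sup>2 * (cmod (stft g v z - V z))\<^sup>2)"
      by (simp add: ennreal_mult ennreal_plus)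
    finally show "ennreal ((m0 z)\<^sup>2 * (cmod (stft g (combination 1 (-1) u v) z))\<^sup>2)
      \<le> 2 * ennreal ((m0 z)\<^sup>2 * (cmod (stft g u z - V z))\<^sup>2) + 2 * ennreal ((m0 z)\<^sup>2 * (cmod (stft g v z - V z))\<^sup>2)"
      by (simp add: stft_combination[OF g(1)])
  qed
  also have "\<dots> = 2 * weighted_square (\<lambda>z. (m0 z)\<^sup>2) (\<lambda>z. stft g u z - V z)
    + 2 * weighted_square (\<lambda>z. (m0 z)\<^sup>2) (\<lambda>z. stft g v z - V z)"
    by (simp add: nn_integral_add nn_integral_cmult)
  finally show ?thesis .
qed

text \<open>
  Bounds of the form \<open>(D * B)\<^sup>2\<close> for every \<open>B\<close> with \<open>A \<le> B\<^sup>2\<close> carry over the Cauchy property.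
\<close>

lemma vanishing_square:
  assumes A: "vanishing A" and b: "\<And>n k B. 0 \<le> B \<Longrightarrow> A n k \<le> ennreal (B\<^sup>2) \<Longrightarrow> a n k \<le> ennreal ((D * B)\<^sup>2)"
    and D: "0 \<le> D" and e: "0 < e"
  shows "\<exists>n0. \<forall>n\<ge>n0. \<forall>k\<ge>n0. a n k \<le> ennreal e"
proof -
  have D1: "0 < D + 1" using D by simp
  define B where "B = sqrt e / (D + 1)"
  have B: "0 < B" "D * B \<le> sqrt e" using D1 D e by (auto simp: B_def field_simps)
  then have "0 < B\<^sup>2" by simp
  then obtain n0 where n0: "\<And>n k. n \<ge> n0 \<Longrightarrow> k \<ge> n0 \<Longrightarrow> A n k \<le> ennreal (B\<^sup>2)" using vanishingD[OF A] by blast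
  have "(D * B)\<^sup>2 \<le> (sqrt e)\<^sup>2" using B D by (intro power_mono) auto
  then have "a n k \<le> ennreal e" if "n \<ge> n0" "k \<ge> n0" for n k
    using order_trans[OF b[OF _ n0[OF that]] ennreal_leI] B(1) e by simp
  then show ?thesis by blast
qed

lemma states_function_limit:
  assumes s: "\<And>n::nat. state (f n) (F n) (G n)" and B: "0 \<le> B" "\<And>n. M2_integral g m (f n) \<le> ennreal (B\<^sup>2)"
    and cauchy: "vanishing (\<lambda>n k. M2_integral g m (combination 1 (-1) (f n) (f k)))"
    and u: "\<And>\<eta>. \<eta> \<in> schwartz \<Longrightarrow> (\<lambda>n. f n \<eta>) \<longlonglongrightarrow> u \<eta>" and x0: "\<psi> x0 \<noteq> 0"
  shows "\<exists>F0 r. is_function u F0 \<and> strict_mono (r :: nat \<Rightarrow> nat) \<and> (AE t in lborel. (\<lambda>n. F (r n) t) \<longlonglongrightarrow> F0 t)"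
proof -
  obtain D where D: "0 \<le> D" "\<And>u F G B. state u F G \<Longrightarrow> 0 \<le> B \<Longrightarrow> M2_integral g m u \<le> ennreal (B\<^sup>2) \<Longrightarrow>
    weighted_L2 k F \<le> ennreal ((D * B)\<^sup>2)"
    using state_function_bound[OF x0] by blast
  have DB: "0 \<le> D * B" using D(1) B(1) by simp
  have F: "is_function (f n) (F n)" for n using s[of n] x0 unfolding state_def by blast
  have d: "weighted_L2 k (\<lambda>t. F n t - F l t) \<le> ennreal ((D * b)\<^sup>2)"
    if "0 \<le> b" "M2_integral g m (combination 1 (-1) (f n) (f l)) \<le> ennreal (b\<^sup>2)" for n l b
    using D(2)[OF state_combination[OF s[of n] s[of l], of 1 "-1"] that] by simp
  show ?thesis
  proof (rule limit_is_function[OF state_measurable(1)[OF s] DB D(2)[OF s B]])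
    show "\<exists>n0. \<forall>n\<ge>n0. \<forall>l\<ge>n0. weighted_L2 k (\<lambda>t. F n t - F l t) \<le> ennreal e"
      if "0 < e" for e
      by (rule vanishing_square[OF cauchy d D(1) that])
    show "(\<lambda>n. LINT t|lborel. F n t * \<eta> t) \<longlonglongrightarrow> u \<eta>" if \<eta>: "\<eta> \<in> schwartz" for \<eta>
      using u[OF \<eta>] by (simp add: function_pairing[OF state_tempered[OF s] F \<eta> DB D(2)[OF s B]])
  qed
qed

lemma states_fourier_limit:
  assumes s: "\<And>n::nat. state (f n) (F n) (G n)" and B: "0 \<le> B" "\<And>n. M2_integral g m (f n) \<le> ennreal (B\<^sup>2)"
    and cauchy: "vanishing (\<lambda>n k. M2_integral g m (combination 1 (-1) (f n) (f k)))"
    and u: "\<And>\<eta>. \<eta> \<in> schwartz \<Longrightarrow> (\<lambda>n. f n \<eta>) \<longlonglongrightarrow> u \<eta>" and x0: "\<phi> x0 \<noteq> 0"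
  shows "\<exists>G0 r. is_function (fourier_dist u) G0 \<and> strict_mono (r :: nat \<Rightarrow> nat) \<and> (AE t in lborel. (\<lambda>n. G (r n) t) \<longlonglongrightarrow> G0 t)"
proof -
  obtain D where D: "0 \<le> D" "\<And>u F G B. state u F G \<Longrightarrow> 0 \<le> B \<Longrightarrow> M2_integral g m u \<le> ennreal (B\<^sup>2) \<Longrightarrow>
    weighted_L2 k G \<le> ennreal ((D * B)\<^sup>2)"
    using state_fourier_bound[OF x0] by blast
  have DB: "0 \<le> D * B" using D(1) B(1) by simp
  have G: "is_function (fourier_dist (f n)) (G n)" for n using s[of n] x0 unfolding state_def by blast
  have d: "weighted_L2 k (\<lambda>t. G n t - G l t) \<le> ennreal ((D * b)\<^sup>2)"
    if "0 \<le> b" "M2_integral g m (combination 1 (-1) (f n) (f l)) \<le> ennreal (b\<^sup>2)" for n l b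
    using D(2)[OF state_combination[OF s[of n] s[of l], of 1 "-1"] that] by simp
  show ?thesis
  proof (rule limit_is_function[OF state_measurable(2)[OF s] DB D(2)[OF s B]])
    show "\<exists>n0. \<forall>n\<ge>n0. \<forall>l\<ge>n0. weighted_L2 k (\<lambda>t. G n t - G l t) \<le> ennreal e"
      if "0 < e" for e
      by (rule vanishing_square[OF cauchy d D(1) that])
    show "(\<lambda>n. LINT t|lborel. G n t * \<eta> t) \<longlonglongrightarrow> fourier_dist u \<eta>" if \<eta>: "\<eta> \<in> schwartz" for \<eta>
    proof -
      have "(\<lambda>n. fourier_dist (f n) \<eta>) \<longlonglongrightarrow> fourier_dist u \<eta>"
        using u[OF schwartz_fourier[OF \<eta>]] by (simp add: fourier_dist_apply[OF \<eta>])
      then show ?thesis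
        by (simp add: function_pairing[OF fourier_dist_tempered[OF state_tempered[OF s]] G \<eta> DB D(2)[OF s B]])
    qed
  qed
qed

text \<open>
  The norm controls the value on each Schwartz function, so these values converge, with a bound
  by one seminorm.
\<close>

lemma states_distribution_limit:
  assumes s: "\<And>n::nat. state (f n) (F n) (G n)" and B: "0 \<le> B" "\<And>n. M2_integral g m (f n) \<le> ennreal (B\<^sup>2)"
    and cauchy: "vanishing (\<lambda>n k. M2_integral g m (combination 1 (-1) (f n) (f k)))"
  shows "\<exists>u\<in>tempered. \<forall>\<eta>\<in>schwartz. (\<lambda>n. f n \<eta>) \<longlonglongrightarrow> u \<eta>"
proof -
  obtain D N where D: "0 \<le> D" "\<And>u F G B \<eta>. state u F G \<Longrightarrow> 0 \<le> B \<Longrightarrow> M2_integral g m0 u \<le> ennreal (B\<^sup>2) \<Longrightarrow>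
    \<eta> \<in> schwartz \<Longrightarrow> cmod (u \<eta>) \<le> D * B * schwartz_seminorm N \<eta>" using state_schwartz_bound by blast
  have conv: "convergent (\<lambda>n. f n \<eta>)" if \<eta>: "\<eta> \<in> schwartz" for \<eta>
  proof (rule Cauchy_convergent, rule CauchyI)
    fix e :: real assume e: "0 < e"
    let ?p = "schwartz_seminorm N \<eta>"
    define b where "b = e / (D * ?p + 1)"
    have P: "0 < D * ?p + 1" using D(1) seminorm_nonneg[OF \<eta>, of N] by (simp add: add_nonneg_pos)
    have b: "0 < b" "D * b * ?p < e"
    proof -
      show "0 < b" using e P by (simp add: b_def)
      then have "D * b * ?p < b * (D * ?p + 1)" by (simp add: algebra_simps)
      also have "\<dots> = e" using P by (simp add: b_def)
      finally show "D * b * ?p < e" .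
    qed
    then have "0 < b\<^sup>2" by simp
    then obtain n0 where n0: "\<And>n k. n \<ge> n0 \<Longrightarrow> k \<ge> n0 \<Longrightarrow> M2_integral g m (combination 1 (-1) (f n) (f k)) \<le> ennreal (b\<^sup>2)"
      using vanishingD[OF cauchy] by blast
    have "norm (f n \<eta> - f k \<eta>) < e" if "n \<ge> n0" "k \<ge> n0" for n k
    proof -
      have "cmod (combination 1 (-1) (f n) (f k) \<eta>) \<le> D * b * ?p"
        by (rule D(2)[OF state_combination[OF s s] _ order_trans[OF M2_integral_m0_le n0[OF that]] \<eta>]) (use b(1) in simp)
      then show ?thesis using b(2) by (simp add: combination_apply[OF \<eta>])
    qed
    then show "\<exists>n0. \<forall>n\<ge>n0. \<forall>k\<ge>n0. norm (f n \<eta> - f k \<eta>) < e" by blast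
  qed
  define u where "u = restrict (\<lambda>\<eta>. lim (\<lambda>n. f n \<eta>)) schwartz"
  have u: "(\<lambda>n. f n \<eta>) \<longlonglongrightarrow> u \<eta>" if "\<eta> \<in> schwartz" for \<eta>
    using conv[OF that] that by (simp add: u_def convergent_LIMSEQ_iff)
  note t = state_tempered[OF s]
  have "u (\<lambda>x. \<eta> x + \<theta> x) = u \<eta> + u \<theta>" if \<eta>: "\<eta> \<in> schwartz" "\<theta> \<in> schwartz" for \<eta> \<theta>
    using LIMSEQ_unique[OF u[OF schwartz_add[OF \<eta>]]] tendsto_add[OF u[OF \<eta>(1)] u[OF \<eta>(2)]] by (simp add: tempered_add[OF t \<eta>])
  moreover have "u (\<lambda>x. c * \<eta> x) = c * u \<eta>" if \<eta>: "\<eta> \<in> schwartz" for c \<eta>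
    using LIMSEQ_unique[OF u[OF schwartz_cmult[OF \<eta>]]] tendsto_mult_left[OF u[OF \<eta>], of c] by (simp add: tempered_cmult[OF t \<eta>])
  moreover have "cmod (u \<eta>) \<le> D * B * schwartz_seminorm N \<eta>" if \<eta>: "\<eta> \<in> schwartz" for \<eta>
    by (rule LIMSEQ_le_const2[OF tendsto_norm[OF u[OF \<eta>]]])
      (use D(2)[OF s B(1) order_trans[OF M2_integral_m0_le B(2)] \<eta>] in blast)
  moreover have "u \<in> extensional schwartz" by (simp add: u_def)
  ultimately have "u \<in> tempered" unfolding tempered_def by blast
  then show ?thesis using u by blast
qed

text \<open>
  The limit exists as a distribution. Its representing functions are the limits of \<open>F n\<close> and
  \<open>G n\<close> in weighted \<open>L\<^sup>2\<close>, along a subsequence also almost everywhere; if a weight vanishes,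
  then the function is arbitrary, and its product with the weight converges trivially.
\<close>

lemma states_complete:
  assumes s: "\<And>n::nat. state (f n) (F n) (G n)" and B: "0 \<le> B" "\<And>n. M2_integral g m (f n) \<le> ennreal (B\<^sup>2)"
    and cauchy: "vanishing (\<lambda>n k. M2_integral g m (combination 1 (-1) (f n) (f k)))"
  shows "\<exists>u F0 G0 r. state u F0 G0 \<and> strict_mono (r :: nat \<Rightarrow> nat) \<and> (\<forall>z. (\<lambda>n. stft g (f n) z) \<longlonglongrightarrow> stft g u z) \<and>
    (AE t in lborel. (\<lambda>n. \<psi> t * F (r n) t) \<longlonglongrightarrow> \<psi> t * F0 t) \<and> (AE t in lborel. (\<lambda>n. \<phi> t * G (r n) t) \<longlonglongrightarrow> \<phi> t * G0 t)"
proof -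
  obtain u where t: "u \<in> tempered" and u: "\<And>\<eta>. \<eta> \<in> schwartz \<Longrightarrow> (\<lambda>n. f n \<eta>) \<longlonglongrightarrow> u \<eta>"
    using states_distribution_limit[OF s B cauchy] by blast
  have V: "(\<lambda>n. stft g (f n) z) \<longlonglongrightarrow> stft g u z" for z unfolding stft_eq by (rule u[OF schwartz_atom[OF g(1)]])
  have "M2_integral g m u \<le> ennreal (B\<^sup>2)"
    unfolding M2_integral_m by (rule weighted_fatou[OF s V]) (use B(2) in \<open>simp_all add: M2_integral_m\<close>)
  then have fin: "M2_integral g m u < \<top>" by (rule le_less_trans) simp
  have "\<exists>F0 r. F0 \<in> borel_measurable borel \<and> strict_mono (r :: nat \<Rightarrow> nat) \<and> ((\<exists>x. \<psi> x \<noteq> 0) \<longrightarrow> is_function u F0) \<and>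
    (AE t in lborel. (\<lambda>n. \<psi> t * F (r n) t) \<longlonglongrightarrow> \<psi> t * F0 t)"
  proof (cases "\<exists>x. \<psi> x \<noteq> 0")
    case True
    then obtain x0 where x0: "\<psi> x0 \<noteq> 0" by blast
    obtain F0 r where F0: "is_function u F0" "strict_mono (r :: nat \<Rightarrow> nat)" "AE t in lborel. (\<lambda>n. F (r n) t) \<longlonglongrightarrow> F0 t"
      using states_function_limit[OF s B cauchy u x0] by blast
    have "AE t in lborel. (\<lambda>n. \<psi> t * F (r n) t) \<longlonglongrightarrow> \<psi> t * F0 t" using F0(3) by (rule AE_mp) (intro AE_I2 impI tendsto_mult_left)
    then show ?thesis using F0(1,2) is_function_borel[OF F0(1)] by blast
  next
    case False
    then show ?thesis by (intro exI[of _ "\<lambda>_. 0"] exI[of _ id]) (auto simp: strict_mono_def)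
  qed
  then obtain F0 r where F0: "F0 \<in> borel_measurable borel" "strict_mono (r :: nat \<Rightarrow> nat)" "(\<exists>x. \<psi> x \<noteq> 0) \<longrightarrow> is_function u F0"
    "AE t in lborel. (\<lambda>n. \<psi> t * F (r n) t) \<longlonglongrightarrow> \<psi> t * F0 t" by blast
  have "\<exists>G0 r'. G0 \<in> borel_measurable borel \<and> strict_mono (r' :: nat \<Rightarrow> nat) \<and> ((\<exists>x. \<phi> x \<noteq> 0) \<longrightarrow> is_function (fourier_dist u) G0) \<and>
    (AE t in lborel. (\<lambda>n. \<phi> t * G (r (r' n)) t) \<longlonglongrightarrow> \<phi> t * G0 t)"
  proof (cases "\<exists>x. \<phi> x \<noteq> 0")
    case True
    then obtain x0 where x0: "\<phi> x0 \<noteq> 0" by blast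
    have ur: "(\<lambda>n. f (r n) \<eta>) \<longlonglongrightarrow> u \<eta>" if "\<eta> \<in> schwartz" for \<eta>
      using LIMSEQ_subseq_LIMSEQ[OF u[OF that] F0(2)] by (simp add: o_def)
    obtain G0 r' where G0: "is_function (fourier_dist u) G0" "strict_mono (r' :: nat \<Rightarrow> nat)" "AE t in lborel. (\<lambda>n. G (r (r' n)) t) \<longlonglongrightarrow> G0 t"
      using states_fourier_limit[of "\<lambda>n. f (r n)" "\<lambda>n. F (r n)" "\<lambda>n. G (r n)", OF s B vanishing_subseq[OF cauchy F0(2)] ur x0] by blast
    have "AE t in lborel. (\<lambda>n. \<phi> t * G (r (r' n)) t) \<longlonglongrightarrow> \<phi> t * G0 t" using G0(3) by (rule AE_mp) (intro AE_I2 impI tendsto_mult_left)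
    then show ?thesis using G0(1,2) is_function_borel[OF G0(1)] by blast
  next
    case False
    then show ?thesis by (intro exI[of _ "\<lambda>_. 0"] exI[of _ id]) (auto simp: strict_mono_def)
  qed
  then obtain G0 r' where G0: "G0 \<in> borel_measurable borel" "strict_mono (r' :: nat \<Rightarrow> nat)" "(\<exists>x. \<phi> x \<noteq> 0) \<longrightarrow> is_function (fourier_dist u) G0"
    "AE t in lborel. (\<lambda>n. \<phi> t * G (r (r' n)) t) \<longlonglongrightarrow> \<phi> t * G0 t" by blast
  have "AE t in lborel. (\<lambda>n. \<psi> t * F (r (r' n)) t) \<longlonglongrightarrow> \<psi> t * F0 t"
    using F0(4) by (rule AE_mp) (intro AE_I2 impI LIMSEQ_subseq_LIMSEQ[OF _ G0(2), unfolded o_def])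
  moreover have "state u F0 G0" unfolding state_def using t fin F0 G0 by blast
  moreover have "strict_mono (\<lambda>n. r (r' n))" using F0(2) G0(2) by (auto simp: strict_mono_def)
  ultimately show ?thesis using V G0(4)
    by (intro exI[of _ u] exI[of _ F0] exI[of _ G0] exI[of _ "\<lambda>n. r (r' n)"]) auto
qed

text \<open>
  A minimising sequence has a subsequence that converges in \<open>M\<^sup>2\<^sub>m\<^sub>0\<close>, hence stays on the sphere in the
  limit; along it the energies of the differences tend to zero, hence it converges in \<open>M\<^sup>2\<^sub>m\<close>.
\<close>

lemma minimiser_exists:
  assumes fin: "ground_energy < \<top>"
  shows "\<exists>u F G. state u F G \<and> M2_integral g m0 u = 1 \<and> Q F G \<le> ground_energy"
proof -
  obtain f' F' G' where s': "\<And>n. state (f' n) (F' n) (G' n)" and N': "\<And>n. M2_integral g m0 (f' n) = 1"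
    and Q': "\<And>n. Q (F' n) (G' n) \<le> ground_energy + ennreal (1 / real (Suc n))"
    using minimising_sequence[OF fin] by metis
  obtain K where K: "0 \<le> K" "\<And>u F G. state u F G \<Longrightarrow> M2_integral g m u \<le> ennreal K * (M2_integral g m0 u + Q F G)"
    using state_norm_estimate by blast
  have "ennreal K * (1 + (ground_energy + 1)) < \<top>" using fin by (simp add: ennreal_mult_less_top)
  then obtain B where B: "0 \<le> B" "ennreal K * (1 + (ground_energy + 1)) \<le> ennreal (B\<^sup>2)" using finite_square_bound by blast
  have X': "M2_integral g m (f' n) \<le> ennreal (B\<^sup>2)" for n
  proof -
    have "ennreal (1 / real (Suc n)) \<le> ennreal 1" by (intro ennreal_leI) simp
    then have "Q (F' n) (G' n) \<le> ground_energy + 1" using order_trans[OF Q'[of n] add_left_mono] by simp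
    then have "ennreal K * (M2_integral g m0 (f' n) + Q (F' n) (G' n)) \<le> ennreal K * (1 + (ground_energy + 1))"
      unfolding N' by (intro mult_left_mono add_left_mono) auto
    then show ?thesis using K(2)[OF s'[of n]] B(2) by (meson order_trans)
  qed
  obtain r V where r: "strict_mono r" and V: "\<And>z. (\<lambda>n. stft g (f' (r n)) z) \<longlonglongrightarrow> V z"
    using state_pointwise_compact[where f=f', OF s' B(1) X'] by blast
  \<comment> \<open>Passing to a subsequence keeps the bounds, as \<open>r n \<ge> n\<close>.\<close>
  define f F G where "f n = f' (r n)" and "F n = F' (r n)" and "G n = G' (r n)" for n
  define d where "d n = ennreal (1 / real (Suc n))" for n
  have s: "state (f n) (F n) (G n)" and N: "M2_integral g m0 (f n) = 1" and X: "M2_integral g m (f n) \<le> ennreal (B\<^sup>2)" for n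
    unfolding f_def F_def G_def by (rule s' N' X')+
  have V: "(\<lambda>n. stft g (f n) z) \<longlonglongrightarrow> V z" for z unfolding f_def by (rule V)
  have Q: "Q (F n) (G n) \<le> ground_energy + d n" for n
  proof -
    have "1 / real (Suc (r n)) \<le> 1 / real (Suc n)" using seq_suble[OF r, of n] by (intro divide_left_mono) auto
    then have "ground_energy + ennreal (1 / real (Suc (r n))) \<le> ground_energy + d n" unfolding d_def by (intro add_left_mono ennreal_leI)
    then show ?thesis unfolding F_def G_def using Q' by (rule order_trans[rotated])
  qed
  note [measurable] = state_measurable[OF s]
  have V_measurable [measurable]: "V \<in> borel_measurable borel"
    by (rule borel_measurable_LIMSEQ_metric[OF state_measurable(3)[OF s] V])
  define a where "a n = weighted_square (\<lambda>z. (m0 z)\<^sup>2) (\<lambda>z. stft g (f n) z - V z)" for n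
  have a: "vanishing (\<lambda>n k. a n)" unfolding a_def by (rule strong_convergence[OF s B(1) X V])
  have Nd: "vanishing (\<lambda>n k. M2_integral g m0 (combination 1 (-1) (f n) (f k)))"
  proof (rule vanishing_mono)
    show "vanishing (\<lambda>n k. 2 * a n + 2 * a k)"
      using vanishing_add[OF vanishing_cmult[OF a, of 2] vanishing_cmult[OF vanishing_swap[OF a], of 2]] by simp
    show "M2_integral g m0 (combination 1 (-1) (f n) (f k)) \<le> 2 * a n + 2 * a k" for n k
      unfolding a_def by (rule difference_le[OF s s V_measurable])
  qed
  have Qd: "vanishing (\<lambda>n k. Q (\<lambda>t. 1 * F n t + (-1) * F k t) (\<lambda>t. 1 * G n t + (-1) * G k t))"
  proof (rule vanishing_mono)
    have d: "vanishing (\<lambda>n k. d n)" unfolding d_def by (rule vanishing_harmonic)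
    show "vanishing (\<lambda>n k. 2 * d n + 2 * d k + ground_energy * M2_integral g m0 (combination 1 (-1) (f n) (f k)))"
      by (intro vanishing_add vanishing_cmult d vanishing_swap[OF d] Nd fin) auto
    show "Q (\<lambda>t. 1 * F n t + (-1) * F k t) (\<lambda>t. 1 * G n t + (-1) * G k t)
      \<le> 2 * d n + 2 * d k + ground_energy * M2_integral g m0 (combination 1 (-1) (f n) (f k))" for n k
      by (rule near_minimisers_close[OF s N Q s N Q fin])
  qed
  have Xd: "vanishing (\<lambda>n k. M2_integral g m (combination 1 (-1) (f n) (f k)))"
    by (rule vanishing_mono[OF vanishing_cmult[OF vanishing_add[OF Nd Qd]]], rule ennreal_less_top, rule K(2)[OF state_combination[OF s s]])
  obtain u F0 G0 q where u: "state u F0 G0" and q: "strict_mono (q :: nat \<Rightarrow> nat)" and Vu: "\<And>z. (\<lambda>n. stft g (f n) z) \<longlonglongrightarrow> stft g u z"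
    and F0: "AE t in lborel. (\<lambda>n. \<psi> t * F (q n) t) \<longlonglongrightarrow> \<psi> t * F0 t" and G0: "AE t in lborel. (\<lambda>n. \<phi> t * G (q n) t) \<longlonglongrightarrow> \<phi> t * G0 t"
    using states_complete[OF s B(1) X Xd] by blast
  note [measurable] = state_measurable[OF u]
  have VV: "V z = stft g u z" for z by (rule LIMSEQ_unique[OF V Vu])
  have le: "M2_integral g m0 u \<le> 1"
    unfolding M2_integral_m0 by (rule weighted_fatou[OF s Vu]) (use N in \<open>simp_all add: M2_integral_m0\<close>)
  then obtain \<nu> where \<nu>: "0 \<le> \<nu>" "M2_integral g m0 u = ennreal \<nu>" "\<nu> \<le> 1"
    by (cases "M2_integral g m0 u") (auto simp: top_unique ennreal_1[symmetric] simp del: ennreal_1)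
  \<comment> \<open>Fatou's lemma gives only \<open>\<nu> \<le> 1\<close>; no mass is lost because the convergence is strong.\<close>
  have "1 \<le> \<nu>"
  proof (rule field_le_epsilon)
    fix e :: real assume e: "0 < e"
    define \<epsilon> where "\<epsilon> = e / 2"
    \<comment> \<open>The perturbation costs \<open>1 + 1 / \<epsilon>\<close> times the distance, so the distance is made \<open>\<beta>\<close> for a
      total error of \<open>\<epsilon>\<close>.\<close>
    define \<beta> where "\<beta> = \<epsilon> / (1 + 1 / \<epsilon>)"
    have \<epsilon>: "0 < \<epsilon>" "0 < 1 + 1 / \<epsilon>" using e by (auto simp: \<epsilon>_def intro: add_pos_pos)
    have \<beta>: "0 < \<beta>" "(1 + 1 / \<epsilon>) * \<beta> = \<epsilon>" unfolding \<beta>_def using \<epsilon> by auto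
    obtain n where n: "a n \<le> ennreal \<beta>" using vanishingD[OF a \<beta>(1)] by blast
    have "M2_integral g m0 (f n) \<le> (\<integral>\<^sup>+z. ennreal (1 + \<epsilon>) * ennreal ((m0 z)\<^sup>2 * (cmod (stft g u z))\<^sup>2)
      + ennreal (1 + 1 / \<epsilon>) * ennreal ((m0 z)\<^sup>2 * (cmod (stft g (f n) z - stft g u z))\<^sup>2) \<partial>lborel)"
      unfolding M2_integral_m0
    proof (rule nn_integral_mono)
      fix z
      have "(m0 z)\<^sup>2 * (cmod (stft g (f n) z))\<^sup>2 \<le> (m0 z)\<^sup>2 * ((1 + \<epsilon>) * (cmod (stft g u z))\<^sup>2 + (1 + 1 / \<epsilon>) * (cmod (stft g (f n) z - stft g u z))\<^sup>2)"
        by (intro mult_left_mono cmod_square_perturbation \<epsilon>) simp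
      also have "\<dots> = (1 + \<epsilon>) * ((m0 z)\<^sup>2 * (cmod (stft g u z))\<^sup>2) + (1 + 1 / \<epsilon>) * ((m0 z)\<^sup>2 * (cmod (stft g (f n) z - stft g u z))\<^sup>2)"
        by (simp only: distrib_left mult_ac)
      finally show "ennreal ((m0 z)\<^sup>2 * (cmod (stft g (f n) z))\<^sup>2) \<le> ennreal (1 + \<epsilon>) * ennreal ((m0 z)\<^sup>2 * (cmod (stft g u z))\<^sup>2)
        + ennreal (1 + 1 / \<epsilon>) * ennreal ((m0 z)\<^sup>2 * (cmod (stft g (f n) z - stft g u z))\<^sup>2)"
        using \<epsilon> by (simp add: ennreal_mult[symmetric] ennreal_plus[symmetric] ennreal_leI less_imp_le del: ennreal_plus)
    qed
    also have "\<dots> = ennreal (1 + \<epsilon>) * M2_integral g m0 u + ennreal (1 + 1 / \<epsilon>) * a n"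
      unfolding M2_integral_m0 a_def VV by (subst nn_integral_add, measurable, subst (1 2) nn_integral_cmult, measurable)
    also have "\<dots> \<le> ennreal (1 + \<epsilon>) * ennreal \<nu> + ennreal (1 + 1 / \<epsilon>) * ennreal \<beta>"
      unfolding \<nu>(2) by (intro add_left_mono mult_left_mono n) auto
    also have "\<dots> = ennreal ((1 + \<epsilon>) * \<nu> + (1 + 1 / \<epsilon>) * \<beta>)"
      using \<epsilon> \<nu>(1) \<beta>(1) by (subst ennreal_plus) (auto simp: ennreal_mult[symmetric] simp del: ennreal_plus)
    finally have "ennreal 1 \<le> ennreal ((1 + \<epsilon>) * \<nu> + \<epsilon>)" unfolding N \<beta>(2) by simp
    then have "1 \<le> (1 + \<epsilon>) * \<nu> + \<epsilon>" using \<epsilon> \<nu>(1) by (subst (asm) ennreal_le_iff) auto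
    also have "(1 + \<epsilon>) * \<nu> = \<nu> + \<epsilon> * \<nu>" by (simp only: distrib_right mult_1_left)
    also have "\<nu> + \<epsilon> * \<nu> + \<epsilon> \<le> \<nu> + (\<epsilon> + \<epsilon>)" using mult_left_le[of \<nu> \<epsilon>] \<nu>(3) \<epsilon>(1) by simp
    also have "\<dots> = \<nu> + e" by (simp add: \<epsilon>_def)
    finally show "1 \<le> \<nu> + e" .
  qed
  then have N0: "M2_integral g m0 u = 1" using \<nu>(2,3) by simp
  have "Q F0 G0 \<le> ground_energy"
    unfolding Q_def
  proof (rule fatou_bound[where u="\<lambda>n t. ennreal ((cmod (\<psi> t))\<^sup>2 * (cmod (F (q n) t))\<^sup>2 + (cmod (\<phi> t))\<^sup>2 * (cmod (G (q n) t))\<^sup>2)"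
        and b="\<lambda>n. ground_energy + d (q n)"])
    show "AE t in lborel. (\<lambda>n. ennreal ((cmod (\<psi> t))\<^sup>2 * (cmod (F (q n) t))\<^sup>2 + (cmod (\<phi> t))\<^sup>2 * (cmod (G (q n) t))\<^sup>2))
      \<longlonglongrightarrow> ennreal ((cmod (\<psi> t))\<^sup>2 * (cmod (F0 t))\<^sup>2 + (cmod (\<phi> t))\<^sup>2 * (cmod (G0 t))\<^sup>2)"
      using F0 G0
    proof eventually_elim
      case (elim t)
      have "(\<lambda>n. ennreal ((cmod (\<psi> t * F (q n) t))\<^sup>2 + (cmod (\<phi> t * G (q n) t))\<^sup>2))
        \<longlonglongrightarrow> ennreal ((cmod (\<psi> t * F0 t))\<^sup>2 + (cmod (\<phi> t * G0 t))\<^sup>2)"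
        by (intro tendsto_intros elim)
      then show ?case by (simp only: norm_mult power_mult_distrib)
    qed
    show "(\<integral>\<^sup>+t. ennreal ((cmod (\<psi> t))\<^sup>2 * (cmod (F (q n) t))\<^sup>2 + (cmod (\<phi> t))\<^sup>2 * (cmod (G (q n) t))\<^sup>2) \<partial>lborel) \<le> ground_energy + d (q n)" for n
      using Q[of "q n"] unfolding Q_def .
    have "d \<longlonglongrightarrow> ennreal 0"
      unfolding d_def[abs_def] by (intro tendsto_ennrealI LIMSEQ_Suc[OF lim_1_over_n])
    then have "(\<lambda>n. ground_energy + d (q n)) \<longlonglongrightarrow> ground_energy + ennreal 0"
      by (intro tendsto_add tendsto_const LIMSEQ_subseq_LIMSEQ[OF _ q, unfolded o_def])
    then show "(\<lambda>n. ground_energy + d (q n)) \<longlonglongrightarrow> ground_energy" by simp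
  qed measurable
  then show ?thesis using u N0 by blast
qed

text \<open>
  On the sphere, the norm is a monotone function of the energy. So a minimiser has at most the
  norm of \<open>f1\<close>, hence at most \<open>R\<close>; and elements of infinite energy are no competitors.
\<close>

lemma energy_minimiser_exists:
  assumes f1: "f1 \<in> bounded_sphere g R \<psi> \<phi> m0"
  shows "\<exists>f0 \<in> bounded_sphere g R \<psi> \<phi> m0. \<forall>f \<in> unit_sphere g \<psi> \<phi> m0. energy \<psi> \<phi> f0 \<le> energy \<psi> \<phi> f"
proof -
  have norm1: "M2_integral g m0 f = 1 \<longleftrightarrow> M2_norm g m0 f = 1" for f
  proof
    assume "M2_integral g m0 f = 1"
    then have "(M2_norm g m0 f)\<^sup>2 = 1\<^sup>2" by (simp add: M2_norm_square)
    then show "M2_norm g m0 f = 1"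
      using ennreal_square_le_cancel[of "M2_norm g m0 f" 1] ennreal_square_le_cancel[of 1 "M2_norm g m0 f"] by (intro antisym) simp_all
  qed (simp add: M2_norm_square[symmetric])
  have norm_energy: "weighted_norm g \<psi> \<phi> m0 f = ennreal_sqrt (1 + energy \<psi> \<phi> f)" if "M2_norm g m0 f = 1" for f
    by (simp add: weighted_norm_def energy_def that add.assoc)
  have lower: "ground_energy \<le> energy \<psi> \<phi> f" if f: "f \<in> unit_sphere g \<psi> \<phi> m0" for f
  proof (cases "energy \<psi> \<phi> f < \<top>")
    case True
    obtain F G where s: "state f F G" using finite_energy_state[OF _ True] f by (auto simp: unit_sphere_def)
    have "M2_integral g m0 f = 1" using f by (simp add: norm1 unit_sphere_def)
    from ground_energy_le[OF s this] show ?thesis by (simp add: state_energy[OF s])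
  qed (simp add: less_top[symmetric])
  have f1u: "f1 \<in> unit_sphere g \<psi> \<phi> m0" and f1R: "weighted_norm g \<psi> \<phi> m0 f1 \<le> ennreal R"
    using f1 by (auto simp: bounded_sphere_def unit_sphere_def)
  have "1 + energy \<psi> \<phi> f1 = (weighted_norm g \<psi> \<phi> m0 f1)\<^sup>2"
    using f1u by (simp add: norm_energy unit_sphere_def ennreal_sqrt_square)
  also have "\<dots> \<le> (ennreal R)\<^sup>2" using f1R by (intro power_mono) auto
  also have "\<dots> < \<top>" by (simp add: power2_eq_square ennreal_mult_less_top)
  finally have "energy \<psi> \<phi> f1 < \<top>" by simp
  then have "ground_energy < \<top>" using lower[OF f1u] by (rule le_less_trans[rotated])
  then obtain f0 F G where s: "state f0 F G" and N: "M2_integral g m0 f0 = 1" and Q: "Q F G \<le> ground_energy"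
    using minimiser_exists by blast
  have min: "energy \<psi> \<phi> f0 \<le> energy \<psi> \<phi> f" if "f \<in> unit_sphere g \<psi> \<phi> m0" for f
    using order_trans[OF Q lower[OF that]] by (simp add: state_energy[OF s])
  have "(M2_norm g m f0)\<^sup>2 < \<top>" using s by (simp add: M2_norm_square state_def)
  then have "M2_norm g m f0 < \<top>" by (auto simp: power2_eq_square less_top[symmetric] ennreal_mult_eq_top_iff)
  then have "f0 \<in> M2 g m" using state_tempered[OF s] by (simp add: M2_def)
  moreover have "weighted_norm g \<psi> \<phi> m0 f0 \<le> weighted_norm g \<psi> \<phi> m0 f1"
    using min[OF f1u] N f1u by (simp add: norm_energy norm1 unit_sphere_def ennreal_sqrt_mono add_left_mono)
  then have "weighted_norm g \<psi> \<phi> m0 f0 \<le> ennreal R" using f1R by (rule order_trans)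
  ultimately have "f0 \<in> bounded_sphere g R \<psi> \<phi> m0" using N by (simp add: bounded_sphere_def norm1)
  then show ?thesis using min by blast
qed

end

theorem theorem12:
  fixes g \<psi> \<phi> :: "real ^ 'd \<Rightarrow> complex"
    and m0 :: "(real ^ 'd) \<times> (real ^ 'd) \<Rightarrow> real"
    and R :: real
  assumes "g \<in> schwartz" and "g \<noteq> (\<lambda>_. 0)"
    and "m0 \<in> moderate_weights"
    and "admissible_weights m0 \<psi> \<phi>"
    and "R > 1"
    and "bounded_sphere g R \<psi> \<phi> m0 \<noteq> {}"
  shows "\<exists>f0 \<in> bounded_sphere g R \<psi> \<phi> m0.
           \<forall>f \<in> unit_sphere g \<psi> \<phi> m0. energy \<psi> \<phi> f0 \<le> energy \<psi> \<phi> f"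
proof -
  obtain C k where w: "weights m0 (\<lambda>x. cmod (\<psi> x)) (\<lambda>x. cmod (\<phi> x)) C k g (fourier g)"
    using weights_admissible[OF assms(3,4,1,2)] by blast
  have "admissible_pair m0 \<psi> \<phi> C k g"
    using w assms(3,4) by (simp add: admissible_pair_def admissible_pair_axioms_def admissible_weights_def)
  then show ?thesis using assms(6) admissible_pair.energy_minimiser_exists by blast
qed

end
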